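(* Let $\mathcal{X}=\mathbb{R}^d$, let $k,h$ be positive integers, let $\alpha,\beta\in(0,1]$, and let $0<\epsilon<\min\big(\frac{1}{k+1},\frac{\alpha}{5},\frac{\beta}{12.5}\big)$. There is a deterministic $(\alpha,\beta)$-feasible fully dynamic decision tree algorithm with pruning thresholds $k,h$ that has query time $O(h^* )$, uses space $O(nd)$, and has amortized running time per update $$O\Big(\frac{d\,h^{*}\log^2 n}{\epsilon}\Big)=O\Big(\frac{d\log^3 n}{\epsilon^2}\Big),$$ where $h^*\le h$ and $n$ are respectively the maximum height of the tree and the maximum size of the active set at any time.
   Context: **Examples and Gini gain.** The feature domain is $\mathcal{X}=\mathbb{R}^d$ and the label domain is $\mathcal{Y}=\{0,1\}$. $S$ denotes a finite multiset of labeled examples $(x,y)\in\mathcal{X}\times\mathcal{Y}$; $x_j$ is the $j$-th feature of $x$; $[d]=\{1,\dots,d\}$. It is assumed that an example can be stored in $O(d)$ bits and that each $x_j$ can be accessed in time $O(1)$. $S[x_j\le t]=\{(x,y)\in S: x_j\le t\}$ (as a sub-multiset), and similarly for $S[x_j>t]$. A split is a pair $(j,t)\in[d]\times\mathbb{R}$. The Gini index of $S$ is $g(S)=2p_S(1-p_S)$ with $p_S=\frac1{|S|}\sum_{(x,y)\in S}y$. The Gini gain of $(j,t)$ on $S$ is $G(S,j,t)=g(S)-\big(\frac{|S_-|}{|S|}g(S_-)+\frac{|S_+|}{|S|}g(S_+)\big)$ where $S_-=S[x_j\le t]$, $S_+=S[x_j>t]$. If $|S|=0$ then $g(S)=0$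 and $G(S,j,t)=0$. **Decision trees.** A decision tree is a triple $(T,\Sigma,L)$ where $T$ is a rooted directed binary tree with vertex set $V(T)$, $\Sigma$ assigns a split $\sigma_v=(j_v,t_v)$ to each internal node $v$, and $L$ assigns a label $L_v\in\{0,1\}$ to each leaf. An $x\in\mathcal{X}$ arriving at internal node $v$ goes to the left child if $x_{j_v}\le t_v$ and to the right child otherwise. $S_v$ denotes the sub-multiset of $S$ of those examples whose root-to-leaf route passes through $v$. $T(x)$ is the label of the leaf reached by $x$. The root has depth $0$. **Feasibility.** Let $k,h\in\mathbb{N}$. $(T,\Sigma,L)$ is $(\alpha,\beta)$-feasible with pruning thresholds $(k,h)$ w.r.t. $S$ if for every $v\in V(T)$: (1) if $|S_v|\le k$ or $g(S_v)=0$ or $\mathrm{depth}_T(v)=h$ then $v$ is a leaf, else if $g(S_v)\ge\alpha$ then $v$ is an internal node; (2) if $\sigma_v=(j,a)$ then $G(S_v,j,a)\ge G(S_v,j',a')-\beta$ for all $(j',a')\in[d]\times\mathbb{R}$; (3) if $v$ is a leaf then $L_v$ is a majority label of $S_v$. **Fully dynamic algorithms.** A fully dynamic decision tree algorithm $\mathcal{A}$ receives an arbitrary sequence of requests of three types: insertion $\mathrm{ins}(x,y)$, deletion $\mathrm{del}(x,y)$, labeling $\mathrm{lab}(x)$. The sequence induces an active multiset $S$, obtained by performing the insertions and deletions in order. After processing a sequence, $\mathcal{A}$ is coherent with a decision tree $T$ if for every $x\in\mathcal{X}$ a further request $\mathrm{lab}(x)$ makes $\mathcal{A}$ output $T(x)$.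 $\mathcal{A}$ is $(\alpha,\beta)$-feasible (for pruning thresholds $k,h$) if at any point in time it is coherent with a decision tree that is $(\alpha,\beta)$-feasible with pruning thresholds $(k,h)$ w.r.t. the current active multiset ("the tree" in the claim). Query time is the worst-case time to answer a request $\mathrm{lab}(x)$. An update is an insertion or a deletion; amortized running time per update $O(f)$ means that any sequence of $\mathcal{T}$ updates is processed in total time $O(\mathcal{T}f)$.
   Formalization: O(d h* log²n/ε)=O(d log³n/ε²) fails literally: two examples at one point with opposite labels can force h*=h while n=2; instead the update time is stated to satisfy both bounds (with d≥1, and h*, n replaced by at least 1, or 2 inside the logarithm). *)

theory Defs
  imports Complex_Main "HOL-Library.Multiset"
begin

section \<open>Examples and Gini gain\<close>

text \<open>
  A point of \<open>\<real>^d\<close> is a list of length \<open>d\<close>, with features numbered \<open>0, \<dots>, d - 1\<close>;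
  the dimension is quantified inside the final statement, so it cannot be a type.
  The labels 0 and 1 are \<open>False\<close> and \<open>True\<close>.
\<close>

type_synonym point = "real list"
type_synonym example = "point \<times> bool"

definition pos_fraction :: "example multiset \<Rightarrow> real" where
  "pos_fraction S = (\<Sum>(x, y)\<in>#S. of_bool y) / real (size S)"

text \<open>Since \<open>a / 0 = 0\<close>, the two definitions below give 0 for empty \<open>S\<close>, as they should.\<close>

definition gini :: "example multiset \<Rightarrow> real" where
  "gini S = 2 * pos_fraction S * (1 - pos_fraction S)"

definition below :: "example multiset \<Rightarrow> nat \<Rightarrow> real \<Rightarrow> example multiset" where
  "below S j t = {#(x, y) \<in># S. x ! j \<le> t#}"

definition above :: "example multiset \<Rightarrow> nat \<Rightarrow> real \<Rightarrow> example multiset" where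
  "above S j t = {#(x, y) \<in># S. x ! j > t#}"

definition gini_gain :: "example multiset \<Rightarrow> nat \<Rightarrow> real \<Rightarrow> real" where
  "gini_gain S j t = gini S -
     (real (size (below S j t)) / real (size S) * gini (below S j t) +
      real (size (above S j t)) / real (size S) * gini (above S j t))"


section \<open>Decision trees and feasibility\<close>

datatype dtree = is_Leaf: Leaf bool | Split nat real dtree dtree

primrec classify :: "dtree \<Rightarrow> point \<Rightarrow> bool" where
  "classify (Leaf b) x = b"
| "classify (Split j t l r) x = (if x ! j \<le> t then classify l x else classify r x)"

primrec height :: "dtree \<Rightarrow> nat" where
  "height (Leaf b) = 0"
| "height (Split j t l r) = Suc (max (height l) (height r))"

text \<open>
  \<open>nodes T e S\<close> lists the vertices \<open>v\<close> of \<open>T\<close> as triples (depth of \<open>v\<close>, \<open>S\<^sub>v\<close>, subtree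
  rooted at \<open>v\<close>), where the root of \<open>T\<close> has depth \<open>e\<close> and receives the examples \<open>S\<close>.
\<close>

primrec nodes :: "dtree \<Rightarrow> nat \<Rightarrow> example multiset \<Rightarrow> (nat \<times> example multiset \<times> dtree) set" where
  "nodes (Leaf b) e S = {(e, S, Leaf b)}"
| "nodes (Split j t l r) e S =
     insert (e, S, Split j t l r)
       (nodes l (Suc e) (below S j t) \<union> nodes r (Suc e) (above S j t))"

definition majority_label :: "example multiset \<Rightarrow> bool \<Rightarrow> bool" where
  "majority_label S b \<longleftrightarrow>
     size {#(x, y) \<in># S. y \<noteq> b#} \<le> size {#(x, y) \<in># S. y = b#}"

definition feasible ::
  "nat \<Rightarrow> real \<Rightarrow> real \<Rightarrow> nat \<Rightarrow> nat \<Rightarrow> example multiset \<Rightarrow> dtree \<Rightarrow> bool" where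
  "feasible d \<alpha> \<beta> k h S T \<longleftrightarrow>
     (\<forall>(e, S\<^sub>v, v) \<in> nodes T 0 S.
        (if size S\<^sub>v \<le> k \<or> gini S\<^sub>v = 0 \<or> e = h then is_Leaf v
         else gini S\<^sub>v \<ge> \<alpha> \<longrightarrow> \<not> is_Leaf v) \<and>
        (\<forall>j a l r. v = Split j a l r \<longrightarrow>
           j < d \<and> (\<forall>j' < d. \<forall>a'. gini_gain S\<^sub>v j a \<ge> gini_gain S\<^sub>v j' a' - \<beta>)) \<and>
        (\<forall>b. v = Leaf b \<longrightarrow> majority_label S\<^sub>v b))"


section \<open>Requests\<close>

datatype request = Ins point bool | Del point bool | Lab point

fun req_point :: "request \<Rightarrow> point" where
  "req_point (Ins x y) = x"
| "req_point (Del x y) = x"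
| "req_point (Lab x) = x"

fun is_update :: "request \<Rightarrow> bool" where
  "is_update (Lab x) = False"
| "is_update r = True"

text \<open>Deleting an example that is not active has no effect, because \<open>M - {#a#} = M\<close> if \<open>a \<notin># M\<close>.\<close>

fun apply_request :: "request \<Rightarrow> example multiset \<Rightarrow> example multiset" where
  "apply_request (Ins x y) S = add_mset (x, y) S"
| "apply_request (Del x y) S = S - {#(x, y)#}"
| "apply_request (Lab x) S = S"

definition active :: "request list \<Rightarrow> example multiset" where
  "active rs = fold apply_request rs {#}"

definition peak_size :: "request list \<Rightarrow> nat" where
  "peak_size rs = Max {size (active (take i rs)) | i. i \<le> length rs}"

text \<open>\<open>tree rs\<close> is the tree with which an algorithm is coherent after processing \<open>rs\<close>.\<close>

definition peak_height :: "(request list \<Rightarrow> dtree) \<Rightarrow> request list \<Rightarrow> nat" where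
  "peak_height tree rs = Max {height (tree (take i rs)) | i. i \<le> length rs}"


section \<open>The machine\<close>

text \<open>
  Algorithms are programs of a deterministic unit-cost real RAM, written in a structured
  language. The memory consists of an array of words (natural numbers) and an array of reals.
  A request is supplied in a read-only buffer: its features are read one at a time,
  its label as a word. There is no conversion from reals to words (such as the floor function),
  and real numbers can otherwise only be compared; the only literals are words.

  Executing a program yields a trace of unit-cost events. Its length is the running time, and
  the space consumption and the word length used can be read off it too.
\<close>

datatype wexp =
    Lit nat
  | W wexp      \<comment> \<open>the word stored at an address\<close>
  | Label
  | WAdd wexp wexp
  | WSub wexp wexp
  | WMul wexp wexp
  | WDiv wexp wexp
  | WMod wexp wexp

datatype rexp =
    R wexp      \<comment> \<open>the real stored at an address\<close>
  | Feature wexp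
  | OfWord wexp
  | RAdd rexp rexp
  | RSub rexp rexp
  | RMul rexp rexp
  | RDiv rexp rexp

datatype test =
    WLess wexp wexp
  | RLess rexp rexp
  | Not test
  | And test test

datatype com =
    Skip
  | SetW wexp wexp   \<comment> \<open>address and new content\<close>
  | SetR wexp rexp
  | Seq com com
  | Cond test com com
  | While test com

record state =
  words :: "nat \<Rightarrow> nat"
  reals :: "nat \<Rightarrow> real"

datatype event =
    Word nat    \<comment> \<open>a word was computed or fetched\<close>
  | CellW nat   \<comment> \<open>a word cell was accessed\<close>
  | CellR nat   \<comment> \<open>a real cell was accessed\<close>
  | Step        \<comment> \<open>any other elementary operation\<close>

primrec wval :: "example \<Rightarrow> state \<Rightarrow> wexp \<Rightarrow> nat" where
  "wval z s (Lit c) = c"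
| "wval z s (W e) = words s (wval z s e)"
| "wval z s Label = of_bool (snd z)"
| "wval z s (WAdd e f) = wval z s e + wval z s f"
| "wval z s (WSub e f) = wval z s e - wval z s f"
| "wval z s (WMul e f) = wval z s e * wval z s f"
| "wval z s (WDiv e f) = wval z s e div wval z s f"
| "wval z s (WMod e f) = wval z s e mod wval z s f"

primrec wtrace :: "example \<Rightarrow> state \<Rightarrow> wexp \<Rightarrow> event list" where
  "wtrace z s (Lit c) = [Word c]"
| "wtrace z s (W e) = wtrace z s e @ [CellW (wval z s e), Word (wval z s (W e))]"
| "wtrace z s Label = [Word (wval z s Label)]"
| "wtrace z s (WAdd e f) = wtrace z s e @ wtrace z s f @ [Word (wval z s (WAdd e f))]"
| "wtrace z s (WSub e f) = wtrace z s e @ wtrace z s f @ [Word (wval z s (WSub e f))]"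
| "wtrace z s (WMul e f) = wtrace z s e @ wtrace z s f @ [Word (wval z s (WMul e f))]"
| "wtrace z s (WDiv e f) = wtrace z s e @ wtrace z s f @ [Word (wval z s (WDiv e f))]"
| "wtrace z s (WMod e f) = wtrace z s e @ wtrace z s f @ [Word (wval z s (WMod e f))]"

primrec rval :: "example \<Rightarrow> state \<Rightarrow> rexp \<Rightarrow> real" where
  "rval z s (R e) = reals s (wval z s e)"
| "rval z s (Feature e) =
     (if wval z s e < length (fst z) then fst z ! wval z s e else 0)"
| "rval z s (OfWord e) = real (wval z s e)"
| "rval z s (RAdd e f) = rval z s e + rval z s f"
| "rval z s (RSub e f) = rval z s e - rval z s f"
| "rval z s (RMul e f) = rval z s e * rval z s f"
| "rval z s (RDiv e f) = rval z s e / rval z s f"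

primrec rtrace :: "example \<Rightarrow> state \<Rightarrow> rexp \<Rightarrow> event list" where
  "rtrace z s (R e) = wtrace z s e @ [CellR (wval z s e)]"
| "rtrace z s (Feature e) = wtrace z s e @ [Step]"
| "rtrace z s (OfWord e) = wtrace z s e @ [Step]"
| "rtrace z s (RAdd e f) = rtrace z s e @ rtrace z s f @ [Step]"
| "rtrace z s (RSub e f) = rtrace z s e @ rtrace z s f @ [Step]"
| "rtrace z s (RMul e f) = rtrace z s e @ rtrace z s f @ [Step]"
| "rtrace z s (RDiv e f) = rtrace z s e @ rtrace z s f @ [Step]"

primrec tval :: "example \<Rightarrow> state \<Rightarrow> test \<Rightarrow> bool" where
  "tval z s (WLess e f) \<longleftrightarrow> wval z s e < wval z s f"
| "tval z s (RLess e f) \<longleftrightarrow> rval z s e < rval z s f"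
| "tval z s (Not b) \<longleftrightarrow> \<not> tval z s b"
| "tval z s (And b c) \<longleftrightarrow> tval z s b \<and> tval z s c"

primrec ttrace :: "example \<Rightarrow> state \<Rightarrow> test \<Rightarrow> event list" where
  "ttrace z s (WLess e f) = wtrace z s e @ wtrace z s f @ [Step]"
| "ttrace z s (RLess e f) = rtrace z s e @ rtrace z s f @ [Step]"
| "ttrace z s (Not b) = ttrace z s b @ [Step]"
| "ttrace z s (And b c) = ttrace z s b @ ttrace z s c @ [Step]"

inductive exec :: "example \<Rightarrow> com \<Rightarrow> state \<Rightarrow> event list \<Rightarrow> state \<Rightarrow> bool" for z where
  Skip: "exec z Skip s [Step] s"
| SetW: "exec z (SetW e f) s (wtrace z s e @ wtrace z s f @ [CellW (wval z s e)])
           (s\<lparr>words := (words s)(wval z s e := wval z s f)\<rparr>)"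
| SetR: "exec z (SetR e f) s (wtrace z s e @ rtrace z s f @ [CellR (wval z s e)])
           (s\<lparr>reals := (reals s)(wval z s e := rval z s f)\<rparr>)"
| Seq: "exec z c s\<^sub>1 tr s\<^sub>2 \<Longrightarrow> exec z c' s\<^sub>2 tr' s\<^sub>3 \<Longrightarrow> exec z (Seq c c') s\<^sub>1 (tr @ tr') s\<^sub>3"
| CondTrue: "tval z s b \<Longrightarrow> exec z c s tr s' \<Longrightarrow>
    exec z (Cond b c c') s (ttrace z s b @ tr) s'"
| CondFalse: "\<not> tval z s b \<Longrightarrow> exec z c' s tr s' \<Longrightarrow>
    exec z (Cond b c c') s (ttrace z s b @ tr) s'"
| WhileFalse: "\<not> tval z s b \<Longrightarrow> exec z (While b c) s (ttrace z s b) s"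
| WhileTrue: "tval z s\<^sub>1 b \<Longrightarrow> exec z c s\<^sub>1 tr s\<^sub>2 \<Longrightarrow> exec z (While b c) s\<^sub>2 tr' s\<^sub>3 \<Longrightarrow>
    exec z (While b c) s\<^sub>1 (ttrace z s\<^sub>1 b @ tr @ tr') s\<^sub>3"

inductive_cases exec_SkipE: "exec z Skip s tr s'"
inductive_cases exec_SetWE: "exec z (SetW e f) s tr s'"
inductive_cases exec_SetRE: "exec z (SetR e f) s tr s'"
inductive_cases exec_SeqE: "exec z (Seq c c') s tr s'"
inductive_cases exec_CondE: "exec z (Cond b c c') s tr s'"
inductive_cases exec_WhileE: "exec z (While b c) s tr s'"

lemma exec_deterministic:
  "exec z c s tr s' \<Longrightarrow> exec z c s tr' s'' \<Longrightarrow> tr' = tr \<and> s'' = s'"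
proof (induction arbitrary: tr' s'' rule: exec.induct)
  case Skip then show ?case by (auto elim: exec_SkipE)
next
  case SetW then show ?case by (auto elim: exec_SetWE)
next
  case SetR then show ?case by (auto elim: exec_SetRE)
next
  case Seq then show ?case by (blast elim: exec_SeqE)
next
  case CondTrue then show ?case by (blast elim: exec_CondE)
next
  case CondFalse then show ?case by (blast elim: exec_CondE)
next
  case WhileFalse then show ?case by (blast elim: exec_WhileE)
next
  case WhileTrue then show ?case by (blast elim: exec_WhileE)
qed

text \<open>The number of cells of both arrays up to the last ones accessed.\<close>

definition space_used :: "event list \<Rightarrow> nat" where
  "space_used tr = Max (insert 0 (Suc ` {a. CellW a \<in> set tr})) +
                   Max (insert 0 (Suc ` {a. CellR a \<in> set tr}))"

text \<open>
  Unit cost is only justified for words of logarithmic length, so all words that occur,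
  intermediate results included, have to be accounted for.
\<close>

definition words_bounded :: "nat \<Rightarrow> event list \<Rightarrow> bool" where
  "words_bounded m tr \<longleftrightarrow> (\<forall>w. Word w \<in> set tr \<longrightarrow> w \<le> m)"


section \<open>Fully dynamic decision tree algorithms\<close>

record algorithm =
  ins_code :: com
  del_code :: com
  lab_code :: com

fun exec_request :: "algorithm \<Rightarrow> request \<Rightarrow> state \<Rightarrow> event list \<Rightarrow> state \<Rightarrow> bool" where
  "exec_request A (Ins x y) = exec (x, y) (ins_code A)"
| "exec_request A (Del x y) = exec (x, y) (del_code A)"
| "exec_request A (Lab x) = exec (x, False) (lab_code A)"

text \<open>\<open>run A s rs trs s'\<close>: from \<open>s\<close>, the \<open>i\<close>-th request of \<open>rs\<close> is processed with trace \<open>trs ! i\<close>.\<close>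

inductive run ::
  "algorithm \<Rightarrow> state \<Rightarrow> request list \<Rightarrow> event list list \<Rightarrow> state \<Rightarrow> bool" for A where
  Nil: "run A s [] [] s"
| Cons: "exec_request A r s\<^sub>1 tr s\<^sub>2 \<Longrightarrow> run A s\<^sub>2 rs trs s\<^sub>3 \<Longrightarrow>
    run A s\<^sub>1 (r # rs) (tr # trs) s\<^sub>3"

text \<open>The memory is initially zero, except that it provides the parameters to the algorithm.\<close>

definition start :: "nat \<Rightarrow> nat \<Rightarrow> nat \<Rightarrow> real \<Rightarrow> real \<Rightarrow> real \<Rightarrow> state" where
  "start d k h \<alpha> \<beta> \<epsilon> =
     \<lparr>words = (\<lambda>_. 0)(1 := d, 2 := k, 3 := h), reals = (\<lambda>_. 0)(0 := \<alpha>, 1 := \<beta>, 2 := \<epsilon>)\<rparr>"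

text \<open>The answer to a labeling request is left in word cell 0.\<close>

definition coherent :: "nat \<Rightarrow> algorithm \<Rightarrow> state \<Rightarrow> dtree \<Rightarrow> bool" where
  "coherent d A s T \<longleftrightarrow>
     (\<forall>x. length x = d \<longrightarrow>
        (\<exists>tr s'. exec_request A (Lab x) s tr s' \<and> words s' 0 = of_bool (classify T x)))"

definition valid_requests :: "nat \<Rightarrow> request list \<Rightarrow> bool" where
  "valid_requests d rs \<longleftrightarrow> (\<forall>r \<in> set rs. length (req_point r) = d)"

text \<open>The trees witnessing feasibility at the various points in time are given by \<open>tree\<close>.\<close>

definition feasible_algorithm ::
  "nat \<Rightarrow> real \<Rightarrow> real \<Rightarrow> nat \<Rightarrow> nat \<Rightarrow> state \<Rightarrow> algorithm \<Rightarrow> (request list \<Rightarrow> dtree) \<Rightarrow> bool" where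
  "feasible_algorithm d \<alpha> \<beta> k h s\<^sub>0 A tree \<longleftrightarrow>
     (\<forall>rs. valid_requests d rs \<longrightarrow>
        (\<exists>trs s. run A s\<^sub>0 rs trs s \<and> coherent d A s (tree rs) \<and>
           feasible d \<alpha> \<beta> k h (active rs) (tree rs)))"

definition num_updates :: "request list \<Rightarrow> nat" where
  "num_updates rs = length (filter is_update rs)"

definition update_time :: "request list \<Rightarrow> event list list \<Rightarrow> nat" where
  "update_time rs trs = (\<Sum>i | i < length rs \<and> is_update (rs ! i). length (trs ! i))"

end

theory Submission
  imports Defs "HOL-Library.List_Lexorder"
begin

text \<open>The algorithm maintains an approximately greedy tree and repairs it lazily. All Gini
  quantities are scaled by the size of the set: for a examples labelled 0 and b labelled 1 the
  weighted index is \<open>wf a b\<close> = 2ab/(a+b), which is 2-Lipschitz in each count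
  (\<open>wf_step\<close>). Hence the weighted gain \<open>sco\<close> of a fixed split is
  4-Lipschitz in the symmetric difference of the sets (\<open>sco_lipschitz\<close>), and a decision
  taken at a node for a set \<open>X0\<close> stays nearly optimal for every \<open>X\<close> that
  differs from \<open>X0\<close> in at most \<epsilon>|X0|/4 examples. A node under construction is
  split, by its best split, if it has more than k examples, depth below h and a split of gain above
  4\<epsilon>; otherwise it becomes a leaf. \<open>dt_feasible\<close> adds up the errors, and
  \<open>near_card\<close> uses \<epsilon>(k+1) < 1 to show that the drift never moves a set across
  the threshold k. Feasibility asks for internal nodes wherever the Gini index is at least \<alpha>,
  even if no split has a notable gain; there the witnessing tree continues the stored leaf by a
  chain of trivial splits, which are within \<beta> of the best and change no answer.

  Height: a gain above 4\<epsilon> forces a fraction 2\<epsilon> of the examples to each side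
  (\<open>sco_le_sides\<close>), so even after the drift sizes shrink by the factor 1-\<epsilon> per
  level, and the stored tree has height O(log n / \<epsilon>) (\<open>sh_bound\<close>).

  Time: the drift is controlled by update counters. A counter at every node would make each update
  pay once per level. Instead a node gets its own counter only if its size is at most half the
  reference size of the closest ancestor with a counter, and otherwise shares that ancestor's
  counter. So a path carries O(log n) counters (\<open>tp_bound\<close>), each raised by one per
  update through its node. When a counter passes \<epsilon>/8 of its reference size, the subtree is
  rebuilt from its live examples in time O(d h* log n) per example, which is O(d h* log n /
  \<epsilon>) per unit of the counter. With O(log n) units per update this is the first bound, and
  the height bound turns it into the second.

  Storage: examples are rows of a table. To find a row to delete by comparisons alone, the rows are
  kept in sorted blocks that follow the binary digits of their number (the logarithmic method);
  deletion only sets a flag. Dead rows and discarded nodes are reclaimed by compaction as soon as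
  the memory in use is a constant multiple of the size of the tree's root. Counters, memory and
  block merging are paid for by the three terms of the potential \<open>pot\<close>
  (\<open>amortized\<close>), and \<open>run_exists\<close> sums over the requests.

  The programs are verified in a weakest precondition calculus that carries the time along. Space
  and word length are split off: \<open>sx\<close> checks the words that are stored,
  \<open>csafe\<close> checks addresses and intermediate results from the syntax, and
  \<open>sx_exec\<close> joins the two.\<close>

section \<open>Memory layout and macros of the machine language\<close>

definition adr :: "nat \<Rightarrow> nat \<Rightarrow> nat" where "adr k i = 40 + 16 * i + k"

lemma adr_eq [simp]: "k < 16 \<Longrightarrow> k' < 16 \<Longrightarrow> adr k i = adr k' i' \<longleftrightarrow> k = k' \<and> i = i'"
proof
  assume *: "k < 16" "k' < 16" and "adr k i = adr k' i'"
  then have e: "16 * i + k = 16 * i' + k'" by (simp add: adr_def)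
  have "i = (16 * i + k) div 16" "i' = (16 * i' + k') div 16" using * by simp_all
  with e have "i = i'" by metis
  with e show "k = k' \<and> i = i'" by simp
qed auto

lemma adr_neq [simp]: "x < 40 \<Longrightarrow> adr k i \<noteq> x" "x < 40 \<Longrightarrow> x \<noteq> adr k i"
  unfolding adr_def by auto

lemma adr_class [simp]: "\<not> adr k i < 40" "k < 16 \<Longrightarrow> (adr k i - 40) mod 16 = k"
  unfolding adr_def by auto

text \<open>Word cells below 40 are scalars; from there on sixteen arrays are interleaved. Array 0
  holds segments of row numbers, 1 the dictionary of rows, 2 is scratch space of merging. For a tree
  node with address \<open>v\<close>: array 3 links to its children from the slots
  \<open>2 * v\<close> and \<open>2 * v + 1\<close> (slot 1 links to the root of the tree), 4 is the
  split feature plus one or 0 at a leaf, 5 and 6 are the label counts of a leaf, 7 is 0 iff the node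
  has its own counter, 8 is the reference size, 9 the counter, 10 the head of the list of later
  insertions, 11 and 12 delimit the segment, 13 is the depth. Arrays 14 and 15 are list cells: row
  number and next cell. Scalar 4 is the last address given to a segment entry, node or list cell;
  scalar 5 is the number of rows.\<close>

definition sc :: "state \<Rightarrow> nat \<Rightarrow> nat" where "sc s x = words s x"
definition ar :: "state \<Rightarrow> nat \<Rightarrow> nat \<Rightarrow> nat" where "ar s k i = words s (adr k i)"
definition rv :: "state \<Rightarrow> nat \<Rightarrow> real" where "rv s x = reals s x"
definition setv :: "state \<Rightarrow> nat \<Rightarrow> nat \<Rightarrow> state" where
  "setv s x v = s\<lparr>words := (words s)(x := v)\<rparr>"
definition seta :: "state \<Rightarrow> nat \<Rightarrow> nat \<Rightarrow> nat \<Rightarrow> state" where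
  "seta s k i v = s\<lparr>words := (words s)(adr k i := v)\<rparr>"
definition setrv :: "state \<Rightarrow> nat \<Rightarrow> real \<Rightarrow> state" where
  "setrv s x v = s\<lparr>reals := (reals s)(x := v)\<rparr>"

definition Var :: "nat \<Rightarrow> wexp" where "Var x = W (Lit x)"
definition Adr :: "nat \<Rightarrow> wexp \<Rightarrow> wexp" where "Adr k e = WAdd (Lit (40 + k)) (WMul (Lit 16) e)"
definition Arr :: "nat \<Rightarrow> wexp \<Rightarrow> wexp" where "Arr k e = W (Adr k e)"
definition SetV :: "nat \<Rightarrow> wexp \<Rightarrow> com" where "SetV x f = SetW (Lit x) f"
definition SetA :: "nat \<Rightarrow> wexp \<Rightarrow> wexp \<Rightarrow> com" where "SetA k e f = SetW (Adr k e) f"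
definition RVar :: "nat \<Rightarrow> rexp" where "RVar x = R (Lit x)"
definition SetRV :: "nat \<Rightarrow> rexp \<Rightarrow> com" where "SetRV x f = SetR (Lit x) f"

text \<open>No operator is short-circuited, not even \<open>And\<close>, so the number of events of
  an evaluation is a function of the syntax alone and enters the time as a constant.\<close>

primrec wlen :: "wexp \<Rightarrow> nat" where
  "wlen (Lit c) = 1"
| "wlen (W e) = wlen e + 2"
| "wlen Label = 1"
| "wlen (WAdd e f) = wlen e + wlen f + 1"
| "wlen (WSub e f) = wlen e + wlen f + 1"
| "wlen (WMul e f) = wlen e + wlen f + 1"
| "wlen (WDiv e f) = wlen e + wlen f + 1"
| "wlen (WMod e f) = wlen e + wlen f + 1"

primrec rlen :: "rexp \<Rightarrow> nat" where
  "rlen (R e) = wlen e + 1"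
| "rlen (Feature e) = wlen e + 1"
| "rlen (OfWord e) = wlen e + 1"
| "rlen (RAdd e f) = rlen e + rlen f + 1"
| "rlen (RSub e f) = rlen e + rlen f + 1"
| "rlen (RMul e f) = rlen e + rlen f + 1"
| "rlen (RDiv e f) = rlen e + rlen f + 1"

primrec tlen :: "test \<Rightarrow> nat" where
  "tlen (WLess e f) = wlen e + wlen f + 1"
| "tlen (RLess e f) = rlen e + rlen f + 1"
| "tlen (Not b) = tlen b + 1"
| "tlen (And b c) = tlen b + tlen c + 1"

lemma length_wtrace [simp]: "length (wtrace z s e) = wlen e"
  by (induction e) auto

lemma length_rtrace [simp]: "length (rtrace z s e) = rlen e"
  by (induction e) auto

lemma length_ttrace [simp]: "length (ttrace z s e) = tlen e"
  by (induction e) auto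

lemma macro_len [simp]:
  "wlen (Var x) = 3" "wlen (Adr k e) = wlen e + 4" "wlen (Arr k e) = wlen e + 6" "rlen (RVar x) = 2"
  by (simp_all add: Var_def Arr_def Adr_def RVar_def)

lemma macro_val [simp]:
  "wval z s (Var x) = sc s x" "wval z s (Arr k e) = ar s k (wval z s e)"
  "wval z s (Adr k e) = adr k (wval z s e)" "rval z s (RVar x) = rv s x"
  by (simp_all add: Var_def Arr_def Adr_def RVar_def sc_def ar_def rv_def adr_def ac_simps)

declare split_paired_All [simp del] split_paired_Ex [simp del]

text \<open>The programs are defined for fixed \<open>d\<close>, \<open>k\<close>, \<open>h\<close>,
  which occur in them as literals, whereas \<epsilon> is read from real cell 2. The bound 1/12
  weakens \<epsilon> < \<beta>/12.5 with \<beta> \<le> 1.\<close>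

locale params =
  fixes d k h :: nat and \<epsilon> :: real
  assumes d1: "1 \<le> d" and k1: "1 \<le> k" and h1: "1 \<le> h"
    and eps0: "0 < \<epsilon>" and eps1: "\<epsilon> < 1 / (real k + 1)" and eps2: "\<epsilon> < 1 / 12"
begin

definition radr :: "nat \<Rightarrow> nat \<Rightarrow> nat" where "radr i c = 8 + (d + 3) * i + c"

lemma radr_eq [simp]:
  assumes "c < d + 3" "c' < d + 3"
  shows "radr i c = radr i' c' \<longleftrightarrow> i = i' \<and> c = c'"
proof
  assume "radr i c = radr i' c'"
  then have e: "(d + 3) * i + c = (d + 3) * i' + c'" by (simp add: radr_def)
  have "i = ((d + 3) * i + c) div (d + 3)" "i' = ((d + 3) * i' + c') div (d + 3)"
    using assms by (simp_all add: div_mult_self4 add.commute)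
  with e have "i = i'" by metis
  with e show "i = i' \<and> c = c'" by simp
qed simp

lemma radr_neq [simp]: "x < 8 \<Longrightarrow> radr i c \<noteq> x" "x < 8 \<Longrightarrow> x \<noteq> radr i c"
  unfolding radr_def by auto

text \<open>The reals from address 8 on form a table. Columns below \<open>d\<close> of a row are
  features, column \<open>d\<close> is the label, column \<open>d + 1\<close> a flag that is
  positive for dead rows. Column \<open>d + 2\<close> has nothing to do with the example: in row
  \<open>v\<close> it is the threshold of the tree node with address \<open>v\<close>. The value 0
  beyond the last column prevents a row from showing cells of the next one.\<close>

definition rw :: "state \<Rightarrow> nat \<Rightarrow> nat \<Rightarrow> real" where
  "rw s i c = (if c < d + 3 then reals s (radr i c) else 0)"
definition setrw :: "state \<Rightarrow> nat \<Rightarrow> nat \<Rightarrow> real \<Rightarrow> state" where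
  "setrw s i c v = s\<lparr>reals := (reals s)(radr i c := v)\<rparr>"
definition Radr :: "wexp \<Rightarrow> wexp \<Rightarrow> wexp" where
  "Radr e c = WAdd (Lit 8) (WAdd (WMul (Lit (d + 3)) e) c)"
definition Row :: "wexp \<Rightarrow> wexp \<Rightarrow> rexp" where "Row e c = R (Radr e c)"
definition SetRow :: "wexp \<Rightarrow> wexp \<Rightarrow> rexp \<Rightarrow> com" where "SetRow e c f = SetR (Radr e c) f"

lemma Row_len [simp]: "wlen (Radr e c) = wlen e + wlen c + 5" "rlen (Row e c) = wlen e + wlen c + 6"
  by (simp_all add: Radr_def Row_def)

lemma Radr_val [simp]: "wval z s (Radr e c) = radr (wval z s e) (wval z s c)"
  by (simp add: Radr_def radr_def)

lemma Row_val [simp]: "wval z s c < d + 3 \<Longrightarrow> rval z s (Row e c) = rw s (wval z s e) (wval z s c)"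
  by (simp add: Row_def rw_def)

lemma state_simps [simp]:
  "sc (setv s x v) y = (if y = x then v else sc s y)"
  "y < 40 \<Longrightarrow> sc (seta s a i v) y = sc s y"
  "sc (setrv s x r) = sc s"
  "sc (setrw s i c r) = sc s"
  "x < 40 \<Longrightarrow> ar (setv s x v) = ar s"
  "ar (setrv s x r) = ar s"
  "ar (setrw s i c r) = ar s"
  "rv (setv s x v) = rv s"
  "rv (seta s a i v) = rv s"
  "rv (setrv s x r) y = (if y = x then r else rv s y)"
  "y < 8 \<Longrightarrow> rv (setrw s i c r) y = rv s y"
  "rw (setv s x v) = rw s"
  "rw (seta s a i v) = rw s"
  "x < 8 \<Longrightarrow> rw (setrv s x r) = rw s"
  by (auto simp: sc_def setv_def seta_def setrv_def setrw_def ar_def rv_def rw_def fun_eq_iff)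

lemma ar_seta [simp]:
  "a < 16 \<Longrightarrow> b < 16 \<Longrightarrow> ar (seta s a i v) b = (if a = b then (ar s b)(i := v) else ar s b)"
  by (auto simp: seta_def ar_def fun_eq_iff)

lemma rw_setrw [simp]: "c < d + 3 \<Longrightarrow> rw (setrw s i c v) = (rw s)(i := (rw s i)(c := v))"
  by (auto simp: setrw_def rw_def fun_eq_iff)

end

section \<open>Bounds on words and a weakest precondition calculus with time\<close>

text \<open>
  The bound \<open>IB\<close> on the indices in use is linear in the peak size, so it may bound addresses.
  Column numbers (below \<open>d + 3\<close>) and parameters only obey weaker bounds.
\<close>

locale machine = params +
  fixes IB :: nat
  assumes IB: "100 \<le> IB"
begin

definition bdv :: "nat \<Rightarrow> nat" where
  "bdv x = (if x \<in> {8, 9, 10, 28, 29} then d + 3 else if x \<in> {1, 2, 3} then d + k + h else IB)"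
definition bda :: "nat \<Rightarrow> nat" where
  "bda a = (if a = 4 then d + 3 else if a = 13 then d + k + h else IB)"
definition bd :: "nat \<Rightarrow> nat" where
  "bd a = (if a < 40 then bdv a else bda ((a - 40) mod 16))"

lemma bd_simps [simp]: "x < 40 \<Longrightarrow> bd x = bdv x" "a < 16 \<Longrightarrow> bd (adr a i) = bda a"
  by (simp_all add: bd_def)

definition bounded :: "state \<Rightarrow> bool" where "bounded s \<longleftrightarrow> (\<forall>a. words s a \<le> bd a)"

text \<open>A bound valid in all bounded states can be derived from the expression alone, so that
  most writes need no fact about the current state.\<close>

definition wub :: "wexp \<Rightarrow> nat \<Rightarrow> bool" where
  "wub e u \<longleftrightarrow> (\<forall>z s. bounded s \<longrightarrow> wval z s e \<le> u)"

lemma bounded_sc: "bounded s \<Longrightarrow> x < 40 \<Longrightarrow> sc s x \<le> bdv x"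
  by (metis bounded_def bd_simps(1) sc_def)

lemma bounded_ar: "bounded s \<Longrightarrow> a < 16 \<Longrightarrow> ar s a i \<le> bda a"
  by (metis bounded_def bd_simps(2) ar_def)

lemma wub_simps [simp]:
  "c \<le> u \<Longrightarrow> wub (Lit c) u"
  "x < 40 \<Longrightarrow> bdv x \<le> u \<Longrightarrow> wub (Var x) u"
  "a < 16 \<Longrightarrow> bda a \<le> u \<Longrightarrow> wub (Arr a e) u"
  "1 \<le> u \<Longrightarrow> wub Label u"
  "wub e u \<Longrightarrow> wub (WSub e f) u"
  "wub e u \<Longrightarrow> wub (WDiv e f) u"
  "wub e u \<Longrightarrow> wub (WMod e f) u"
  unfolding wub_def
  by (auto intro: bounded_sc[THEN order_trans] bounded_ar[THEN order_trans] diff_le_self[THEN order_trans]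
      div_le_dividend[THEN order_trans] mod_less_eq_dividend[THEN order_trans])

lemma wub_add: "wub e u \<Longrightarrow> wub f v \<Longrightarrow> u + v \<le> w \<Longrightarrow> wub (WAdd e f) w"
  unfolding wub_def using add_mono order_trans by (metis wval.simps(4))

lemma wub_mul: "wub e u \<Longrightarrow> c * u \<le> w \<Longrightarrow> wub (WMul (Lit c) e) w"
  unfolding wub_def by (auto intro: order_trans[OF mult_le_mono2])

text \<open>A variant of \<open>exec\<close> for reasoning: the trace is reduced to a clock, and a
  word may be stored only if it respects the bound of its cell. This may be known statically or, as
  for increments, by the actual value.\<close>

inductive sx :: "example \<Rightarrow> com \<Rightarrow> nat \<Rightarrow> state \<Rightarrow> nat \<Rightarrow> state \<Rightarrow> bool" for z where
  Skip: "sx z Skip t s (t + 1) s"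
| SetW: "wub f (bd (wval z s e)) \<or> wval z s f \<le> bd (wval z s e) \<Longrightarrow>
    sx z (SetW e f) t s (t + wlen e + wlen f + 1) (s\<lparr>words := (words s)(wval z s e := wval z s f)\<rparr>)"
| SetR: "sx z (SetR e f) t s (t + wlen e + rlen f + 1)
    (s\<lparr>reals := (reals s)(wval z s e := rval z s f)\<rparr>)"
| Seq: "sx z c t s t' s' \<Longrightarrow> sx z c' t' s' t'' s'' \<Longrightarrow> sx z (Seq c c') t s t'' s''"
| CondTrue: "tval z s b \<Longrightarrow> sx z c (t + tlen b) s t' s' \<Longrightarrow> sx z (Cond b c c') t s t' s'"
| CondFalse: "\<not> tval z s b \<Longrightarrow> sx z c' (t + tlen b) s t' s' \<Longrightarrow> sx z (Cond b c c') t s t' s'"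
| WhileFalse: "\<not> tval z s b \<Longrightarrow> sx z (While b c) t s (t + tlen b) s"
| WhileTrue: "tval z s b \<Longrightarrow> sx z c (t + tlen b) s t' s' \<Longrightarrow> sx z (While b c) t' s' t'' s'' \<Longrightarrow>
    sx z (While b c) t s t'' s''"

inductive_cases sx_SkipE: "sx z Skip t s t' s'"
inductive_cases sx_SetWE: "sx z (SetW e f) t s t' s'"
inductive_cases sx_SetRE: "sx z (SetR e f) t s t' s'"
inductive_cases sx_SeqE: "sx z (Seq c c') t s t' s'"
inductive_cases sx_CondE: "sx z (Cond b c c') t s t' s'"
inductive_cases sx_WhileE: "sx z (While b c) t s t' s'"

text \<open>Total correctness; since execution is deterministic, the existence of a terminating run
  with the postcondition suffices. The clock is an argument of the postcondition, so that running
  times are proved together with results.\<close>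

definition wp :: "example \<Rightarrow> com \<Rightarrow> (nat \<Rightarrow> state \<Rightarrow> bool) \<Rightarrow> nat \<Rightarrow> state \<Rightarrow> bool" where
  "wp z c Q t s \<longleftrightarrow> (\<exists>t' s'. sx z c t s t' s' \<and> Q t' s')"

lemma wp_Skip [simp]: "wp z Skip Q t s \<longleftrightarrow> Q (t + 1) s"
  unfolding wp_def by (metis sx.Skip sx_SkipE)

lemma wp_SetW:
  "wp z (SetW e f) Q t s \<longleftrightarrow> (wub f (bd (wval z s e)) \<or> wval z s f \<le> bd (wval z s e)) \<and>
     Q (t + wlen e + wlen f + 1) (s\<lparr>words := (words s)(wval z s e := wval z s f)\<rparr>)"
  unfolding wp_def by (metis sx.SetW sx_SetWE)

lemma wp_SetR:
  "wp z (SetR e f) Q t s \<longleftrightarrow> Q (t + wlen e + rlen f + 1) (s\<lparr>reals := (reals s)(wval z s e := rval z s f)\<rparr>)"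
  unfolding wp_def by (metis sx.SetR sx_SetRE)

lemma wp_Seq [simp]: "wp z (Seq c c') Q t s \<longleftrightarrow> wp z c (wp z c' Q) t s"
  unfolding wp_def by (blast intro: sx.intros elim!: sx_SeqE)

lemma wp_Cond [simp]:
  "wp z (Cond b c c') Q t s \<longleftrightarrow>
     (tval z s b \<longrightarrow> wp z c Q (t + tlen b) s) \<and> (\<not> tval z s b \<longrightarrow> wp z c' Q (t + tlen b) s)"
  unfolding wp_def by (blast intro: sx.intros elim!: sx_CondE)

lemma wp_While_unfold:
  "wp z (While b c) Q t s \<longleftrightarrow>
     (if tval z s b then wp z c (wp z (While b c) Q) (t + tlen b) s else Q (t + tlen b) s)"
  unfolding wp_def by (smt (verit, best) sx.intros(7,8) sx_WhileE)

lemma wp_SetV [simp]: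
  "x < 40 \<Longrightarrow> wp z (SetV x f) Q t s \<longleftrightarrow> (wub f (bdv x) \<or> wval z s f \<le> bdv x) \<and>
     Q (t + wlen f + 2) (setv s x (wval z s f))"
  by (simp add: SetV_def wp_SetW setv_def)

lemma wp_SetA [simp]:
  "a < 16 \<Longrightarrow> wp z (SetA a e f) Q t s \<longleftrightarrow> (wub f (bda a) \<or> wval z s f \<le> bda a) \<and>
     Q (t + wlen e + wlen f + 5) (seta s a (wval z s e) (wval z s f))"
  by (simp add: SetA_def wp_SetW seta_def algebra_simps)

lemma wp_SetRV [simp]: "wp z (SetRV x f) Q t s \<longleftrightarrow> Q (t + rlen f + 2) (setrv s x (rval z s f))"
  by (simp add: SetRV_def wp_SetR setrv_def)

lemma wp_SetRow [simp]:
  "wp z (SetRow e c f) Q t s \<longleftrightarrow>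
     Q (t + wlen e + wlen c + rlen f + 6) (setrw s (wval z s e) (wval z s c) (rval z s f))"
  by (simp add: SetRow_def wp_SetR setrw_def algebra_simps)

subsection \<open>Frames\<close>

primrec nv :: "com \<Rightarrow> nat \<Rightarrow> bool" where
  "nv Skip x = True"
| "nv (SetW e f) x = (\<forall>z s. wval z s e \<noteq> x)"
| "nv (SetR e f) x = True"
| "nv (Seq c c') x = (nv c x \<and> nv c' x)"
| "nv (Cond b c c') x = (nv c x \<and> nv c' x)"
| "nv (While b c) x = nv c x"

primrec na :: "com \<Rightarrow> nat \<Rightarrow> bool" where
  "na Skip a = True"
| "na (SetW e f) a = (\<forall>z s i. wval z s e \<noteq> adr a i)"
| "na (SetR e f) a = True"
| "na (Seq c c') a = (na c a \<and> na c' a)"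
| "na (Cond b c c') a = (na c a \<and> na c' a)"
| "na (While b c) a = na c a"

primrec nrv :: "com \<Rightarrow> nat \<Rightarrow> bool" where
  "nrv Skip x = True"
| "nrv (SetW e f) x = True"
| "nrv (SetR e f) x = (\<forall>z s. wval z s e \<noteq> x)"
| "nrv (Seq c c') x = (nrv c x \<and> nrv c' x)"
| "nrv (Cond b c c') x = (nrv c x \<and> nrv c' x)"
| "nrv (While b c) x = nrv c x"

primrec nrw :: "com \<Rightarrow> bool" where
  "nrw Skip = True"
| "nrw (SetW e f) = True"
| "nrw (SetR e f) = (\<forall>z s. wval z s e < 8)"
| "nrw (Seq c c') = (nrw c \<and> nrw c')"
| "nrw (Cond b c c') = (nrw c \<and> nrw c')"
| "nrw (While b c) = nrw c"

lemma writes_simps [simp]: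
  "nv (SetV y f) x \<longleftrightarrow> x \<noteq> y" "x < 40 \<Longrightarrow> nv (SetA a e f) x" "nv (SetRV y g) x" "nv (SetRow e c g) x"
  "y < 40 \<Longrightarrow> na (SetV y f) a" "a < 16 \<Longrightarrow> b < 16 \<Longrightarrow> na (SetA a e f) b \<longleftrightarrow> a \<noteq> b"
  "na (SetRV y g) a" "na (SetRow e c g) a"
  "nrv (SetV y f) x" "nrv (SetA a e f) x" "nrv (SetRV y g) x \<longleftrightarrow> x \<noteq> y" "x < 8 \<Longrightarrow> nrv (SetRow e c g) x"
  "nrw (SetV y f)" "nrw (SetA a e f)" "nrw (SetRV y g) \<longleftrightarrow> y < 8" "\<not> nrw (SetRow e c g)"
  by (auto simp: SetV_def SetA_def SetRV_def SetRow_def radr_def)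

text \<open>What a command leaves alone is read off its syntax (\<open>sx_fr\<close>).
  Specifications of subprograms therefore need to mention only the cells that they change.\<close>

definition fr :: "com \<Rightarrow> state \<Rightarrow> state \<Rightarrow> bool" where
  "fr c s s' \<longleftrightarrow> (\<forall>x < 40. nv c x \<longrightarrow> sc s' x = sc s x) \<and> (\<forall>a < 16. na c a \<longrightarrow> ar s' a = ar s a) \<and>
     (\<forall>x < 8. nrv c x \<longrightarrow> rv s' x = rv s x) \<and> (nrw c \<longrightarrow> rw s' = rw s)"

lemma frD:
  assumes "fr c s s'"
  shows "x < 40 \<Longrightarrow> nv c x \<Longrightarrow> sc s' x = sc s x" "a < 16 \<Longrightarrow> na c a \<Longrightarrow> ar s' a = ar s a"
    "x < 8 \<Longrightarrow> nrv c x \<Longrightarrow> rv s' x = rv s x" "nrw c \<Longrightarrow> rw s' = rw s"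
  using assms unfolding fr_def by blast+

lemma fr_refl [simp]: "fr c s s"
  by (simp add: fr_def)

lemma fr_trans: "fr c s s' \<Longrightarrow> fr c s' s'' \<Longrightarrow> fr c s s''"
  by (auto simp: fr_def)

lemma fr_mono:
  "fr c s s' \<Longrightarrow> (\<And>x. nv c' x \<Longrightarrow> nv c x) \<Longrightarrow> (\<And>a. na c' a \<Longrightarrow> na c a) \<Longrightarrow>
   (\<And>x. nrv c' x \<Longrightarrow> nrv c x) \<Longrightarrow> (nrw c' \<Longrightarrow> nrw c) \<Longrightarrow> fr c' s s'"
  unfolding fr_def by blast

lemma sx_fr: "sx z c t s t' s' \<Longrightarrow> fr c s s'"
proof (induction rule: sx.induct)
  case (SetW f s e t)
  have "adr a x \<noteq> wval z s e" if "\<forall>z s i. wval z s e \<noteq> adr a i" for a x using that by metis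
  then show ?case by (auto simp: fr_def sc_def ar_def rv_def rw_def fun_eq_iff)
next
  case (SetR e f t s)
  have "radr i c \<noteq> wval z s e" if "\<forall>z s. wval z s e < 8" for i c
    using that[rule_format, of z s] by (simp add: radr_def)
  then show ?case by (auto simp: fr_def sc_def ar_def rv_def rw_def fun_eq_iff)
next
  case (Seq c t s t' s' c' t'' s'')
  have "fr (Seq c c') s s'" by (rule fr_mono[OF Seq.IH(1)]) auto
  moreover have "fr (Seq c c') s' s''" by (rule fr_mono[OF Seq.IH(2)]) auto
  ultimately show ?case by (rule fr_trans)
next
  case (CondTrue s b c t t' s' c')
  show ?case by (rule fr_mono[OF CondTrue.IH]) auto
next
  case (CondFalse s b c' t t' s' c)
  show ?case by (rule fr_mono[OF CondFalse.IH]) auto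
next
  case (WhileTrue s b c t t' s' t'' s'')
  have "fr (While b c) s s'" by (rule fr_mono[OF WhileTrue.IH(1)]) auto
  then show ?case using WhileTrue.IH(2) by (rule fr_trans)
qed auto

lemma wp_mono:
  "wp z c Q' t s \<Longrightarrow> (\<And>t' s'. Q' t' s' \<Longrightarrow> fr c s s' \<Longrightarrow> Q t' s') \<Longrightarrow> wp z c Q t s"
  unfolding wp_def using sx_fr by blast

text \<open>Besides the invariant, each iteration may use the frame relation between the state at
  loop entry and the current one, so that invariants stay silent about cells the body cannot write.
  The measure gives termination; time is bounded inside the invariant.\<close>

lemma wp_while:
  fixes \<mu> :: "state \<Rightarrow> nat"
  assumes init: "I t s"
    and step: "\<And>t' s'. I t' s' \<Longrightarrow> fr c s s' \<Longrightarrow> tval z s' b \<Longrightarrow>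
      wp z c (\<lambda>t'' s''. I t'' s'' \<and> \<mu> s'' < \<mu> s') (t' + tlen b) s'"
    and fin: "\<And>t' s'. I t' s' \<Longrightarrow> fr c s s' \<Longrightarrow> \<not> tval z s' b \<Longrightarrow> Q (t' + tlen b) s'"
  shows "wp z (While b c) Q t s"
proof -
  have "I t' s' \<Longrightarrow> fr c s s' \<Longrightarrow> wp z (While b c) Q t' s'" for t' s'
  proof (induction "\<mu> s'" arbitrary: t' s' rule: less_induct)
    case less
    show ?case
    proof (cases "tval z s' b")
      case True
      have "wp z c (wp z (While b c) Q) (t' + tlen b) s'"
      proof (rule wp_mono[OF step[OF less.prems True]])
        fix t'' s''
        assume "I t'' s'' \<and> \<mu> s'' < \<mu> s'" "fr c s' s''"
        then show "wp z (While b c) Q t'' s''"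
          using less.hyps[of s'' t''] fr_trans[OF less.prems(2)] by blast
      qed
      with True show ?thesis by (simp add: wp_While_unfold)
    next
      case False
      with fin[OF less.prems] show ?thesis by (simp add: wp_While_unfold)
    qed
  qed
  with init show ?thesis by simp
qed

subsection \<open>Space and word length\<close>

definition U :: nat where "U = IB + d + k + h + 60"
text \<open>Indices reach about \<open>2 * IB\<close>, not \<open>IB\<close>, because the links of
  node \<open>v\<close> sit in the slots \<open>2 * v\<close> and \<open>2 * v + 1\<close>.\<close>

definition AW :: nat where "AW = 40 + 16 * (2 * IB + 4)"
definition AR :: nat where "AR = 8 + (d + 3) * (2 * IB + 4)"

fun good :: "event \<Rightarrow> bool" where
  "good (Word w) \<longleftrightarrow> w \<le> U ^ 12"
| "good (CellW a) \<longleftrightarrow> a < AW"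
| "good (CellR a) \<longleftrightarrow> a < AR"
| "good Step \<longleftrightarrow> True"

definition aokw :: "wexp \<Rightarrow> bool" where "aokw e \<longleftrightarrow> (\<forall>z s. bounded s \<longrightarrow> wval z s e < AW)"
definition aokr :: "wexp \<Rightarrow> bool" where "aokr e \<longleftrightarrow> (\<forall>z s. bounded s \<longrightarrow> wval z s e < AR)"

text \<open>An exponent of \<open>U\<close>: literals, stored words and labels are at most
  \<open>U\<close>, multiplication adds exponents, and addition does no worse because a sum of
  numbers at least 2 is at most their product (\<open>U_add\<close>). This bounds all intermediate
  results by a fixed power of \<open>U\<close> (\<open>wval_deg\<close>).\<close>

primrec deg :: "wexp \<Rightarrow> nat" where
  "deg (Lit c) = 1"
| "deg (W e) = 1"
| "deg Label = 1"
| "deg (WAdd e f) = deg e + deg f"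
| "deg (WSub e f) = deg e + deg f"
| "deg (WMul e f) = deg e + deg f"
| "deg (WDiv e f) = deg e + deg f"
| "deg (WMod e f) = deg e + deg f"

primrec wst :: "wexp \<Rightarrow> bool" where
  "wst (Lit c) = (c \<le> U)"
| "wst (W e) = (wst e \<and> deg e \<le> 12 \<and> aokw e)"
| "wst Label = True"
| "wst (WAdd e f) = (wst e \<and> wst f)"
| "wst (WSub e f) = (wst e \<and> wst f)"
| "wst (WMul e f) = (wst e \<and> wst f)"
| "wst (WDiv e f) = (wst e \<and> wst f)"
| "wst (WMod e f) = (wst e \<and> wst f)"

definition ww :: "wexp \<Rightarrow> bool" where "ww e \<longleftrightarrow> wst e \<and> deg e \<le> 12"

primrec rst :: "rexp \<Rightarrow> bool" where
  "rst (R e) = (ww e \<and> aokr e)"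
| "rst (Feature e) = ww e"
| "rst (OfWord e) = ww e"
| "rst (RAdd e f) = (rst e \<and> rst f)"
| "rst (RSub e f) = (rst e \<and> rst f)"
| "rst (RMul e f) = (rst e \<and> rst f)"
| "rst (RDiv e f) = (rst e \<and> rst f)"

primrec tst :: "test \<Rightarrow> bool" where
  "tst (WLess e f) = (ww e \<and> ww f)"
| "tst (RLess e f) = (rst e \<and> rst f)"
| "tst (Not b) = tst b"
| "tst (And b c) = (tst b \<and> tst c)"

primrec csafe :: "com \<Rightarrow> bool" where
  "csafe Skip = True"
| "csafe (SetW e f) = (ww e \<and> ww f \<and> aokw e)"
| "csafe (SetR e f) = (ww e \<and> rst f \<and> aokr e)"
| "csafe (Seq c c') = (csafe c \<and> csafe c')"
| "csafe (Cond b c c') = (tst b \<and> csafe c \<and> csafe c')"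
| "csafe (While b c) = (tst b \<and> csafe c)"

lemma U60: "60 \<le> U" by (simp add: U_def)

lemma deg_pos: "0 < deg e" by (induction e) auto

lemma bd_le_U: "bd a \<le> U"
  by (auto simp: bd_def bdv_def bda_def U_def)

lemma U_add: "0 < a \<Longrightarrow> 0 < b \<Longrightarrow> U ^ a + U ^ b \<le> U ^ (a + b)"
proof -
  assume "0 < a" "0 < b"
  then have "U \<le> U ^ a" "U \<le> U ^ b"
    using U60 by (simp_all add: self_le_power)
  then have 2: "2 \<le> U ^ a" "2 \<le> U ^ b" using U60 by linarith+
  have "x + y \<le> x * y" if "2 \<le> x" "2 \<le> y" for x y :: nat
  proof -
    have "x + y \<le> 2 * max x y" by simp
    also have "\<dots> \<le> min x y * max x y" using that by (intro mult_le_mono1) simp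
    also have "\<dots> = x * y" by (simp add: min_def max_def)
    finally show ?thesis .
  qed
  from this[OF 2] show ?thesis by (simp add: power_add)
qed

lemma wval_deg: "bounded s \<Longrightarrow> wst e \<Longrightarrow> wval z s e \<le> U ^ deg e"
proof (induction e)
  case (W e)
  then show ?case using bd_le_U by (auto simp: bounded_def intro: order_trans)
next
  case Label
  then show ?case using U60 by (auto simp: of_bool_def)
next
  case (WAdd e f)
  then show ?case using U_add[OF deg_pos deg_pos, of e f] by fastforce
next
  case (WSub e f)
  then have "wval z s e \<le> U ^ deg e" by simp
  also have "\<dots> \<le> U ^ (deg e + deg f)" using U60 by (intro power_increasing) auto
  finally show ?case by simp
next
  case (WMul e f)
  then show ?case by (simp add: power_add mult_le_mono)
next
  case (WDiv e f)
  then have "wval z s e \<le> U ^ deg e" by simp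
  also have "\<dots> \<le> U ^ (deg e + deg f)" using U60 by (intro power_increasing) auto
  finally show ?case by simp (meson div_le_dividend order_trans)
next
  case (WMod e f)
  then have "wval z s e \<le> U ^ deg e" by simp
  also have "\<dots> \<le> U ^ (deg e + deg f)" using U60 by (intro power_increasing) auto
  finally show ?case by simp (meson mod_less_eq_dividend order_trans)
qed auto

lemma wval_ww: "bounded s \<Longrightarrow> wst e \<Longrightarrow> deg e \<le> 12 \<Longrightarrow> wval z s e \<le> U ^ 12"
proof -
  assume "bounded s" "wst e" "deg e \<le> 12"
  then have "wval z s e \<le> U ^ deg e" by (simp add: wval_deg)
  also have "\<dots> \<le> U ^ 12" using U60 \<open>deg e \<le> 12\<close> by (intro power_increasing) auto
  finally show ?thesis .
qed

lemma wtrace_good: "bounded s \<Longrightarrow> wst e \<Longrightarrow> deg e \<le> 12 \<Longrightarrow> ev \<in> set (wtrace z s e) \<Longrightarrow> good ev"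
proof (induction e)
  case (Lit c)
  then show ?case using wval_ww[of s "Lit c" z] by auto
next
  case (W e)
  then show ?case using wval_ww[of s "W e" z] wval_ww[of s e z]
    by (auto simp: aokw_def)
next
  case Label
  then show ?case using wval_ww[of s "Label" z] by auto
next
  case (WAdd e f)
  then show ?case using wval_ww[of s "WAdd e f" z] by auto
next
  case (WSub e f)
  then show ?case using wval_ww[of s "WSub e f" z] by auto
next
  case (WMul e f)
  then show ?case using wval_ww[of s "WMul e f" z] by auto
next
  case (WDiv e f)
  then show ?case using wval_ww[of s "WDiv e f" z] by auto
next
  case (WMod e f)
  then show ?case using wval_ww[of s "WMod e f" z] by auto
qed

lemma rtrace_good: "bounded s \<Longrightarrow> rst e \<Longrightarrow> ev \<in> set (rtrace z s e) \<Longrightarrow> good ev"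
  by (induction e) (auto simp: ww_def aokr_def dest: wtrace_good)

lemma ttrace_good: "bounded s \<Longrightarrow> tst b \<Longrightarrow> ev \<in> set (ttrace z s b) \<Longrightarrow> good ev"
  by (induction b) (auto simp: ww_def dest: wtrace_good rtrace_good)

text \<open>By induction the stored words remain bounded, because \<open>sx\<close> checks every
  write; in bounded states the static conditions of \<open>csafe\<close> make every event good,
  because they hold for all bounded states. Neither half needs the other's facts about the
  program.\<close>

lemma sx_exec:
  "sx z c t s t' s' \<Longrightarrow> \<exists>tr. exec z c s tr s' \<and> t' = t + length tr \<and>
     (csafe c \<and> bounded s \<longrightarrow> bounded s' \<and> (\<forall>ev \<in> set tr. good ev))"
proof (induction rule: sx.induct)
  case (Skip t s)
  then show ?case by (intro exI[of _ "[Step]"]) (auto intro: exec.intros)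
next
  case (SetW f s e t)
  let ?tr = "wtrace z s e @ wtrace z s f @ [CellW (wval z s e)]"
  have "exec z (SetW e f) s ?tr (s\<lparr>words := (words s)(wval z s e := wval z s f)\<rparr>)" by (rule exec.SetW)
  with SetW show ?case
    by (intro exI[of _ ?tr]) (auto simp: ww_def aokw_def bounded_def wub_def dest: wtrace_good[rotated 3] intro: wtrace_good)
next
  case (SetR e f t s)
  let ?tr = "wtrace z s e @ rtrace z s f @ [CellR (wval z s e)]"
  have "exec z (SetR e f) s ?tr (s\<lparr>reals := (reals s)(wval z s e := rval z s f)\<rparr>)" by (rule exec.SetR)
  then show ?case
    by (intro exI[of _ ?tr]) (auto simp: ww_def aokr_def bounded_def intro: wtrace_good rtrace_good)
next
  case (Seq c t s t' s' c' t'' s'')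
  then obtain tr tr' where "exec z c s tr s'" "exec z c' s' tr' s''" "t' = t + length tr" "t'' = t' + length tr'"
    "csafe c \<and> bounded s \<longrightarrow> bounded s' \<and> (\<forall>ev \<in> set tr. good ev)"
    "csafe c' \<and> bounded s' \<longrightarrow> bounded s'' \<and> (\<forall>ev \<in> set tr'. good ev)" by blast
  then show ?case by (intro exI[of _ "tr @ tr'"]) (auto intro: exec.intros)
next
  case (CondTrue s b c t t' s' c')
  then obtain tr where "exec z c s tr s'" "t' = t + tlen b + length tr"
    "csafe c \<and> bounded s \<longrightarrow> bounded s' \<and> (\<forall>ev \<in> set tr. good ev)" by blast
  with CondTrue.hyps show ?case
    by (intro exI[of _ "ttrace z s b @ tr"]) (auto intro: exec.intros ttrace_good)
next
  case (CondFalse s b c' t t' s' c)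
  then obtain tr where "exec z c' s tr s'" "t' = t + tlen b + length tr"
    "csafe c' \<and> bounded s \<longrightarrow> bounded s' \<and> (\<forall>ev \<in> set tr. good ev)" by blast
  with CondFalse.hyps show ?case
    by (intro exI[of _ "ttrace z s b @ tr"]) (auto intro: exec.intros ttrace_good)
next
  case (WhileFalse s b c t)
  then show ?case by (intro exI[of _ "ttrace z s b"]) (auto intro: exec.intros ttrace_good)
next
  case (WhileTrue s b c t t' s' t'' s'')
  then obtain tr tr' where "exec z c s tr s'" "exec z (While b c) s' tr' s''" "t' = t + tlen b + length tr"
    "t'' = t' + length tr'" "csafe c \<and> bounded s \<longrightarrow> bounded s' \<and> (\<forall>ev \<in> set tr. good ev)"
    "csafe (While b c) \<and> bounded s' \<longrightarrow> bounded s'' \<and> (\<forall>ev \<in> set tr'. good ev)" by blast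
  with WhileTrue.hyps(1) show ?case
    by (intro exI[of _ "ttrace z s b @ tr @ tr'"]) (auto intro: exec.intros ttrace_good)
qed

lemma wp_exec:
  assumes "wp z c Q 0 s" "csafe c" "bounded s"
  obtains tr s' where "exec z c s tr s'" "Q (length tr) s'" "bounded s'" "\<forall>ev \<in> set tr. good ev"
  using assms sx_exec[of z c 0 s] unfolding wp_def by fastforce

lemma space_used_good:
  assumes "\<forall>ev \<in> set tr. good ev"
  shows "space_used tr \<le> AW + AR"
proof -
  have "finite {a. CellW a \<in> set tr}"
    by (rule finite_subset[of _ "{..<AW}"]) (use assms in fastforce)+
  moreover have "finite {a. CellR a \<in> set tr}"
    by (rule finite_subset[of _ "{..<AR}"]) (use assms in fastforce)+
  moreover have "Suc a \<le> AW" if "CellW a \<in> set tr" for a using assms that by fastforce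
  moreover have "Suc a \<le> AR" if "CellR a \<in> set tr" for a using assms that by fastforce
  ultimately show ?thesis unfolding space_used_def by (intro add_mono) auto
qed

lemma static_simps [simp]:
  "x < 40 \<Longrightarrow> ww (Var x)"
  "x < 8 \<Longrightarrow> rst (RVar x)"
  unfolding Var_def RVar_def ww_def by (auto simp: ww_def U_def aokw_def AW_def aokr_def AR_def)

end

section \<open>Array segments, lexicographic keys and bottom-up merge sort\<close>

definition seg :: "(nat \<Rightarrow> 'a) \<Rightarrow> nat \<Rightarrow> nat \<Rightarrow> 'a list" where "seg f lo hi = map f [lo..<hi]"

lemma length_seg [simp]: "length (seg f lo hi) = hi - lo"
  by (simp add: seg_def)

lemma seg_empty [simp]: "hi \<le> lo \<Longrightarrow> seg f lo hi = []"
  by (simp add: seg_def)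

lemma nth_seg [simp]: "i < hi - lo \<Longrightarrow> seg f lo hi ! i = f (lo + i)"
  by (simp add: seg_def)

lemma set_seg: "set (seg f lo hi) = f ` {lo..<hi}"
  by (auto simp: seg_def)

lemma seg_cong: "(\<And>i. lo \<le> i \<Longrightarrow> i < hi \<Longrightarrow> f i = g i) \<Longrightarrow> seg f lo hi = seg g lo hi"
  by (simp add: seg_def)

lemma seg_append: "lo \<le> mid \<Longrightarrow> mid \<le> hi \<Longrightarrow> seg f lo hi = seg f lo mid @ seg f mid hi"
  unfolding seg_def by (metis le_Suc_ex map_append upt_add_eq_append le_add1 add_diff_inverse_nat not_less)

lemma seg_Suc: "lo \<le> hi \<Longrightarrow> seg f lo (Suc hi) = seg f lo hi @ [f hi]"
  by (simp add: seg_def)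

lemma seg_Cons: "lo < hi \<Longrightarrow> seg f lo hi = f lo # seg f (Suc lo) hi"
  by (simp add: seg_def upt_conv_Cons)

lemma mset_seg_change:
  assumes "\<And>i. i < a \<or> b \<le> i \<Longrightarrow> g i = f i" "mset (seg g a b) = mset (seg f a b)"
    "lo \<le> a" "a \<le> b" "b \<le> hi"
  shows "mset (seg g lo hi) = mset (seg f lo hi)"
proof -
  have "seg f lo hi = seg f lo a @ seg f a b @ seg f b hi" for f :: "nat \<Rightarrow> 'a"
    using assms(3-5) by (metis order_trans seg_append)
  moreover have "seg g lo a = seg f lo a" "seg g b hi = seg f b hi"
    by (rule seg_cong, simp add: assms(1))+
  ultimately show ?thesis by (simp add: assms(2))
qed

text \<open>Lists of reals are compared lexicographically. A single column serves to sort by a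
  feature, the columns below \<open>d + 2\<close> serve to order the dictionary.\<close>

definition key :: "(nat \<Rightarrow> nat \<Rightarrow> real) \<Rightarrow> nat \<Rightarrow> nat \<Rightarrow> nat \<Rightarrow> real list" where
  "key G ca cb a = seg (G a) ca cb"

lemma append_less_iff [simp]: "(zs @ xs < zs @ ys) \<longleftrightarrow> xs < (ys :: 'a :: linorder list)"
  by (induction zs) auto

lemma key_split:
  "ca \<le> c \<Longrightarrow> c < cb \<Longrightarrow> key G ca cb a = seg (G a) ca c @ G a c # seg (G a) (Suc c) cb"
  unfolding key_def by (metis less_imp_le seg_Cons seg_append)

lemma key_less:
  assumes "ca \<le> c" "c < cb" "\<And>i. ca \<le> i \<Longrightarrow> i < c \<Longrightarrow> G a i = G b i" "G a c < G b c"
  shows "key G ca cb a < key G ca cb b"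
proof -
  have "seg (G a) ca c = seg (G b) ca c" by (rule seg_cong) (use assms in auto)
  then show ?thesis using assms by (simp add: key_split)
qed

lemma key_eq: "(\<And>i. ca \<le> i \<Longrightarrow> i < cb \<Longrightarrow> G a i = G b i) \<Longrightarrow> key G ca cb a = key G ca cb b"
  unfolding key_def by (rule seg_cong) auto

fun mrg :: "('a \<Rightarrow> 'b :: linorder) \<Rightarrow> 'a list \<Rightarrow> 'a list \<Rightarrow> 'a list" where
  "mrg f [] ys = ys"
| "mrg f xs [] = xs"
| "mrg f (x # xs) (y # ys) = (if f x \<le> f y then x # mrg f xs (y # ys) else y # mrg f (x # xs) ys)"

lemma mrg_Nil2 [simp]: "mrg f xs [] = xs"
  by (cases xs) auto

lemma mset_mrg [simp]: "mset (mrg f xs ys) = mset xs + mset ys"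
  by (induction f xs ys rule: mrg.induct) auto

lemma set_mrg [simp]: "set (mrg f xs ys) = set xs \<union> set ys"
  by (metis mset_mrg set_mset_mset set_mset_union)

lemma sorted_mrg:
  "sorted (map f xs) \<Longrightarrow> sorted (map f ys) \<Longrightarrow> sorted (map f (mrg f xs ys))"
proof (induction f xs ys rule: mrg.induct)
  case (3 f x xs y ys)
  then show ?case by (auto simp: ball_Un intro: order_trans)
qed auto

context params
begin

definition CMP :: com where
  "CMP = Seq (SetV 10 (Var 8)) (Seq
     (While (And (WLess (Var 10) (Var 9))
         (And (Not (RLess (Row (Var 6) (Var 10)) (Row (Var 7) (Var 10))))
              (Not (RLess (Row (Var 7) (Var 10)) (Row (Var 6) (Var 10))))))
       (SetV 10 (WAdd (Var 10) (Lit 1))))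
     (Cond (And (WLess (Var 10) (Var 9)) (RLess (Row (Var 7) (Var 10)) (Row (Var 6) (Var 10))))
       (SetV 11 (Lit 0)) (SetV 11 (Lit 1))))"

definition MERGE :: "nat \<Rightarrow> com" where
  "MERGE Z = Seq (SetV 15 (Var 12)) (Seq (SetV 16 (Var 13)) (Seq (SetV 17 (Var 12)) (Seq
     (While (WLess (Var 17) (Var 14)) (Seq
       (Cond (WLess (Var 16) (Var 14))
         (Cond (WLess (Var 15) (Var 13))
           (Seq (SetV 6 (Arr Z (Var 15))) (Seq (SetV 7 (Arr Z (Var 16))) CMP))
           (SetV 11 (Lit 0)))
         (SetV 11 (Lit 1))) (Seq
       (Cond (WLess (Lit 0) (Var 11))
         (Seq (SetA 2 (Var 17) (Arr Z (Var 15))) (SetV 15 (WAdd (Var 15) (Lit 1))))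
         (Seq (SetA 2 (Var 17) (Arr Z (Var 16))) (SetV 16 (WAdd (Var 16) (Lit 1)))))
       (SetV 17 (WAdd (Var 17) (Lit 1)))))) (Seq
     (SetV 17 (Var 12))
     (While (WLess (Var 17) (Var 14))
       (Seq (SetA Z (Var 17) (Arr 2 (Var 17))) (SetV 17 (WAdd (Var 17) (Lit 1)))))))))"

definition SORT :: "nat \<Rightarrow> com" where
  "SORT Z = Seq (SetV 20 (Lit 1))
     (While (WLess (WAdd (Var 18) (Var 20)) (Var 19)) (Seq
       (SetV 12 (Var 18)) (Seq
       (While (WLess (WAdd (Var 12) (Var 20)) (Var 19)) (Seq
         (SetV 13 (WAdd (Var 12) (Var 20))) (Seq
         (Cond (WLess (WAdd (Var 13) (Var 20)) (Var 19)) (SetV 14 (WAdd (Var 13) (Var 20))) (SetV 14 (Var 19))) (Seq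
         (MERGE Z)
         (SetV 12 (Var 14))))))
       (SetV 20 (WAdd (Var 20) (Var 20))))))"

end

context machine
begin

lemma bd_num [simp]:
  "bdv 0 = IB" "bdv 4 = IB" "bdv 5 = IB" "bdv 6 = IB" "bdv 7 = IB" "bdv 8 = d + 3" "bdv 9 = d + 3"
  "bdv 10 = d + 3" "bdv 28 = d + 3" "bdv 29 = d + 3"
  "x < 40 \<Longrightarrow> 10 < x \<Longrightarrow> x \<noteq> 28 \<Longrightarrow> x \<noteq> 29 \<Longrightarrow> bdv x = IB"
  "a \<noteq> 4 \<Longrightarrow> a \<noteq> 13 \<Longrightarrow> bda a = IB" "bda 4 = d + 3" "bda 13 = d + k + h"
  by (simp_all add: bdv_def bda_def)

lemma IB_lits [simp]: "0 < IB" "Suc 0 \<le> IB" "1 \<le> IB" "2 \<le> IB"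
  using IB by simp_all

lemma CMP_writes [simp]:
  "nv CMP x \<longleftrightarrow> x \<noteq> 10 \<and> x \<noteq> 11" "na CMP a" "nrv CMP x" "nrw CMP"
  by (auto simp: CMP_def)

text \<open>The loop skips the columns on which the rows agree, so the first difference decides. As
  \<open>And\<close> evaluates both operands, the exit test still reads column
  \<open>sc s 9\<close>; the limit \<open>d + 2\<close> keeps this read inside the row.\<close>

lemma wp_CMP:
  assumes "sc s 8 \<le> sc s 9" "sc s 9 \<le> d + 2"
  shows "wp z CMP (\<lambda>t' s'. t' \<le> t + 200 * (sc s 9 - sc s 8 + 1) \<and>
    (0 < sc s' 11 \<longleftrightarrow> key (rw s) (sc s 8) (sc s 9) (sc s 6) \<le> key (rw s) (sc s 8) (sc s 9) (sc s 7))) t s"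
proof -
  define ca cb G a b where defs: "ca = sc s 8" "cb = sc s 9" "G = rw s" "a = sc s 6" "b = sc s 7"
  note [simp] = defs[symmetric]
  have le: "ca \<le> cb" "cb \<le> d + 2" using assms by simp_all
  define I where "I = (\<lambda>t' s'. \<exists>u. sc s' 10 = ca + u \<and> ca + u \<le> cb \<and> t' \<le> t + 5 + 100 * u \<and>
    (\<forall>i. ca \<le> i \<longrightarrow> i < ca + u \<longrightarrow> G a i = G b i))"
  show ?thesis unfolding CMP_def
    apply simp
    apply (rule wp_while[where I = I and \<mu> = "\<lambda>s. cb - sc s 10"])
  proof goal_cases
    case 1
    show ?case using le by (auto simp: I_def)
  next
    case (2 t' s')
    note [simp] = frD[OF 2(2)]
    from 2(1) obtain u where u: "sc s' 10 = ca + u" "ca + u \<le> cb" "t' \<le> t + 5 + 100 * u"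
      "\<forall>i. ca \<le> i \<longrightarrow> i < ca + u \<longrightarrow> G a i = G b i" by (auto simp: I_def)
    from 2(3) u le have c: "ca + u < cb" "G a (ca + u) = G b (ca + u)" by (auto simp: not_less)
    have "\<forall>i. ca \<le> i \<longrightarrow> i < ca + Suc u \<longrightarrow> G a i = G b i" using u(4) c(2) by (auto simp: less_Suc_eq)
    then show ?case using u c le by (auto simp: I_def intro!: exI[of _ "Suc u"])
  next
    case (3 t' s')
    note [simp] = frD[OF 3(2)]
    from 3(1) obtain u where u: "sc s' 10 = ca + u" "ca + u \<le> cb" "t' \<le> t + 5 + 100 * u"
      "\<And>i. ca \<le> i \<Longrightarrow> i < ca + u \<Longrightarrow> G a i = G b i" by (auto simp: I_def)
    have t: "t' + 200 \<le> t + 205 + 100 * (cb - ca)" using u(2,3) by auto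
    show ?case
    proof (cases "ca + u < cb")
      case True
      then have ne: "G a (ca + u) < G b (ca + u) \<or> G b (ca + u) < G a (ca + u)" using 3(3) u le by auto
      then show ?thesis
      proof
        assume l: "G a (ca + u) < G b (ca + u)"
        with u True have "key G ca cb a < key G ca cb b" by (intro key_less) auto
        with l u True le t show ?thesis by auto
      next
        assume l: "G b (ca + u) < G a (ca + u)"
        with u True have "key G ca cb b < key G ca cb a" by (intro key_less) auto
        with l u True le t show ?thesis by auto
      qed
    next
      case False
      then have "key G ca cb a = key G ca cb b" using u by (intro key_eq) auto
      with False u le t show ?thesis by auto
    qed
  qed
qed

lemma MERGE_writes [simp]:
  "Z < 16 \<Longrightarrow> x < 40 \<Longrightarrow> nv (MERGE Z) x \<longleftrightarrow> x \<notin> {6, 7, 10, 11, 15, 16, 17}"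
  "Z < 16 \<Longrightarrow> a < 16 \<Longrightarrow> na (MERGE Z) a \<longleftrightarrow> a \<noteq> Z \<and> a \<noteq> 2"
  "nrv (MERGE Z) x" "nrw (MERGE Z)"
  by (auto simp: MERGE_def)

lemma wp_MERGE:
  assumes Z: "Z < 2" and col: "sc s 8 \<le> sc s 9" "sc s 9 \<le> d + 2"
    and ord: "sc s 12 \<le> sc s 13" "sc s 13 \<le> sc s 14" "sc s 14 \<le> IB"
  shows "wp z (MERGE Z) (\<lambda>t' s'. t' \<le> t + 400 * (sc s 9 - sc s 8 + 1) * (sc s 14 - sc s 12 + 1) \<and>
      seg (ar s' Z) (sc s 12) (sc s 14) = mrg (key (rw s) (sc s 8) (sc s 9))
        (seg (ar s Z) (sc s 12) (sc s 13)) (seg (ar s Z) (sc s 13) (sc s 14)) \<and>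
      (\<forall>i. i < sc s 12 \<or> sc s 14 \<le> i \<longrightarrow> ar s' Z i = ar s Z i)) t s"
proof -
  define ml mm mh f cc A where defs: "ml = sc s 12" "mm = sc s 13" "mh = sc s 14" "f = key (rw s) (sc s 8) (sc s 9)"
    "cc = sc s 9 - sc s 8 + 1" "A = ar s Z"
  note d' = defs(1-3)[symmetric] defs(4) defs(6)[symmetric]
  note [simp] = defs(1-3,6)[symmetric]
  have le: "ml \<le> mm" "mm \<le> mh" "mh \<le> IB" using ord by simp_all
  have cc: "1 \<le> cc" "n \<le> n * cc" for n by (simp_all add: defs)
  have bZ [simp]: "bda Z = IB" "Z < 16" "Z \<noteq> 2" "2 \<noteq> Z" using Z by auto
  define M where "M = mrg f (seg A ml mm) (seg A mm mh)"
  \<comment> \<open>The part already written followed by the merge of the two remaining parts is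
    always the final list \<open>M\<close>.\<close>
  define I where "I = (\<lambda>t' s'. \<exists>u v. sc s' 15 = ml + u \<and> sc s' 16 = mm + v \<and> sc s' 17 = ml + u + v \<and>
     ml + u \<le> mm \<and> mm + v \<le> mh \<and> t' \<le> t + 15 + 300 * (u + v) * cc \<and> ar s' Z = A \<and>
     seg (ar s' 2) ml (ml + u + v) @ mrg f (seg A (ml + u) mm) (seg A (mm + v) mh) = M)"
  define J where "J = (\<lambda>t' s'. \<exists>u. sc s' 17 = ml + u \<and> ml + u \<le> mh \<and>
     t' \<le> t + 27 + 300 * (mh - ml) * cc + 50 * u \<and> seg (ar s' 2) ml mh = M \<and>
     (\<forall>i < u. ar s' Z (ml + i) = ar s' 2 (ml + i)) \<and> (\<forall>i. i < ml \<or> mh \<le> i \<longrightarrow> ar s' Z i = A i))"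
  show ?thesis unfolding MERGE_def
    apply simp
    apply (rule wp_while[where I = I and \<mu> = "\<lambda>s. mh - sc s 17"])
  proof goal_cases
    case 1
    show ?case using le by (auto simp: I_def M_def intro!: exI[of _ 0])
  next
    case (2 t' s')
    note fr = 2(2)
    note [simp] = frD[OF fr]
    from 2(1) obtain u v where uv: "sc s' 15 = ml + u" "sc s' 16 = mm + v" "sc s' 17 = ml + u + v"
      "ml + u \<le> mm" "mm + v \<le> mh" "t' \<le> t + 15 + 300 * (u + v) * cc" "ar s' Z = A"
      "seg (ar s' 2) ml (ml + u + v) @ mrg f (seg A (ml + u) mm) (seg A (mm + v) mh) = M"
      unfolding I_def by blast
    have lt: "ml + u + v < mh" using 2(3) uv by simp
    have T: "t' + 100 + 200 * cc \<le> t + 15 + 300 * (Suc (u + v)) * cc" using uv(6) cc(1) by (simp add: algebra_simps)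
    have left: "I t2 s2"
      if "t2 \<le> t' + 100 + 200 * cc" "ml + u < mm" "sc s2 15 = ml + u + 1" "sc s2 16 = mm + v"
        "sc s2 17 = ml + u + v + 1" "ar s2 Z = A" "ar s2 2 = (ar s' 2)(ml + u + v := A (ml + u))"
        "mm + v < mh \<longrightarrow> f (A (ml + u)) \<le> f (A (mm + v))" for t2 s2
    proof -
      have e: "mrg f (seg A (ml + u) mm) (seg A (mm + v) mh) = A (ml + u) # mrg f (seg A (ml + Suc u) mm) (seg A (mm + v) mh)"
        using that(2,8) uv(5) by (cases "mm + v < mh") (auto simp: seg_Cons)
      have "seg (ar s2 2) ml (ml + Suc u + v) = seg (ar s' 2) ml (ml + u + v) @ [A (ml + u)]"
        by (simp add: seg_Suc that(7)) (rule seg_cong, simp)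
      with e uv(8) have "seg (ar s2 2) ml (ml + Suc u + v) @ mrg f (seg A (ml + Suc u) mm) (seg A (mm + v) mh) = M"
        by simp
      then show ?thesis using that uv T lt unfolding I_def
        by (auto simp: algebra_simps intro!: exI[of _ "Suc u"] exI[of _ v])
    qed
    have right: "I t2 s2"
      if "t2 \<le> t' + 100 + 200 * cc" "mm + v < mh" "sc s2 15 = ml + u" "sc s2 16 = mm + v + 1"
        "sc s2 17 = ml + u + v + 1" "ar s2 Z = A" "ar s2 2 = (ar s' 2)(ml + u + v := A (mm + v))"
        "ml + u < mm \<longrightarrow> \<not> f (A (ml + u)) \<le> f (A (mm + v))" for t2 s2
    proof -
      have e: "mrg f (seg A (ml + u) mm) (seg A (mm + v) mh) = A (mm + v) # mrg f (seg A (ml + u) mm) (seg A (mm + Suc v) mh)"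
        using that(2,8) uv(4) by (cases "ml + u < mm") (auto simp: seg_Cons)
      have "seg (ar s2 2) ml (ml + u + Suc v) = seg (ar s' 2) ml (ml + u + v) @ [A (mm + v)]"
        by (simp add: seg_Suc that(7)) (rule seg_cong, simp)
      with e uv(8) have "seg (ar s2 2) ml (ml + u + Suc v) @ mrg f (seg A (ml + u) mm) (seg A (mm + Suc v) mh) = M"
        by simp
      then show ?thesis using that uv T lt unfolding I_def
        by (auto simp: algebra_simps intro!: exI[of _ u] exI[of _ "Suc v"])
    qed
    have iu: "ml + u < mm \<or> mm + v < mh" using lt uv by auto
    show ?case
    proof (cases "mm + v < mh")
      case v: True
      show ?thesis
      proof (cases "ml + u < mm")
        case u: True
        let ?s = "setv (setv s' 6 (A (ml + u))) 7 (A (mm + v))"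
        show ?thesis using u v uv
          apply simp
          apply (rule wp_mono[OF wp_CMP])
          subgoal using col by simp
          subgoal using col by simp
          subgoal premises p for t2 s2
          proof -
            note [simp] = frD[OF p(9)]
            have sc11: "0 < sc s2 11 \<longleftrightarrow> f (A (ml + u)) \<le> f (A (mm + v))" using p(8) by (simp add: defs(4))
            have t2: "t2 \<le> t' + 50 + 200 * cc" using p(8) by (simp add: defs(5))
            show ?thesis
            proof (cases "f (A (ml + u)) \<le> f (A (mm + v))")
              case True
              then show ?thesis using u v uv sc11 t2 le lt by (auto intro!: left)
            next
              case False
              then show ?thesis using u v uv sc11 t2 le lt by (auto intro!: right)
            qed
          qed
          done
      next
        case False
        then show ?thesis using v uv le lt by (auto intro!: right)
      qed
    next
      case False
      then show ?thesis using iu uv le lt by (auto intro!: left)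
    qed
  next
    case (3 t' s')
    note fr = 3(2)
    note [simp] = frD[OF fr]
    from 3(1) obtain u v where uv: "sc s' 15 = ml + u" "sc s' 16 = mm + v" "sc s' 17 = ml + u + v"
      "ml + u \<le> mm" "mm + v \<le> mh" "t' \<le> t + 15 + 300 * (u + v) * cc" "ar s' Z = A"
      "seg (ar s' 2) ml (ml + u + v) @ mrg f (seg A (ml + u) mm) (seg A (mm + v) mh) = M"
      unfolding I_def by blast
    from 3(3) uv have e: "ml + u = mm" "mm + v = mh" by auto
    then have uve: "u + v = mh - ml" by simp
    have s2: "seg (ar s' 2) ml mh = M" using uv(8) e by simp
    show ?case
      apply simp
      apply (rule wp_while[where I = J and \<mu> = "\<lambda>s. mh - sc s 17"])
    proof goal_cases
      case 1
      show ?case using le uv s2 uve unfolding J_def by (intro exI[of _ 0]) auto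
    next
      case (2 t2 s2)
      note [simp] = frD[OF 2(2)]
      from 2(1) obtain w where w: "sc s2 17 = ml + w" "ml + w \<le> mh"
        "t2 \<le> t + 27 + 300 * (mh - ml) * cc + 50 * w" "seg (ar s2 2) ml mh = M"
        "\<forall>i < w. ar s2 Z (ml + i) = ar s2 2 (ml + i)" "\<forall>i. i < ml \<or> mh \<le> i \<longrightarrow> ar s2 Z i = A i"
        unfolding J_def by blast
      show ?case using 2(3) w le
        unfolding J_def by (auto simp: less_Suc_eq intro!: exI[of _ "Suc w"])
    next
      case (3 t2 s2)
      note [simp] = frD[OF 3(2)]
      from 3(1) obtain w where w: "sc s2 17 = ml + w" "ml + w \<le> mh"
        "t2 \<le> t + 27 + 300 * (mh - ml) * cc + 50 * w" "seg (ar s2 2) ml mh = M"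
        "\<forall>i < w. ar s2 Z (ml + i) = ar s2 2 (ml + i)" "\<forall>i. i < ml \<or> mh \<le> i \<longrightarrow> ar s2 Z i = A i"
        unfolding J_def by blast
      with 3(3) have we: "ml + w = mh" by simp
      have "seg (ar s2 Z) ml mh = seg (ar s2 2) ml mh"
      proof (rule seg_cong)
        fix i assume "ml \<le> i" "i < mh"
        with w(5)[rule_format, of "i - ml"] we show "ar s2 Z i = ar s2 2 i" by auto
      qed
      moreover have "t2 + 10 \<le> t + 400 * cc * (mh - ml + 1)"
      proof -
        define X where "X = w * cc"
        have e: "mh - ml = w" using we by simp
        have e1: "300 * (mh - ml) * cc = 300 * X" "400 * cc * (mh - ml + 1) = 400 * X + 400 * cc"
          unfolding e X_def by (simp_all only: distrib_left mult_1_right mult.assoc mult.commute[of w])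
        have "w \<le> X" unfolding X_def by (rule cc(2))
        then show ?thesis using w(3) cc(1) unfolding e1 by linarith
      qed
      ultimately show ?case using w(4,6) by (simp add: M_def defs(4,5))
    qed
  qed
qed

lemma SORT_writes [simp]:
  "Z < 16 \<Longrightarrow> x < 40 \<Longrightarrow> nv (SORT Z) x \<longleftrightarrow> x \<notin> {6, 7, 10, 11, 12, 13, 14, 15, 16, 17, 20}"
  "Z < 16 \<Longrightarrow> a < 16 \<Longrightarrow> na (SORT Z) a \<longleftrightarrow> a \<noteq> Z \<and> a \<noteq> 2"
  "nrv (SORT Z) x" "nrw (SORT Z)"
  by (auto simp: SORT_def)

text \<open>After \<open>p\<close> rounds every aligned block of width \<open>2 ^ p\<close> is
  sorted; at most \<open>L\<close> rounds are needed, each linear in the segment up to the cost of a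
  comparison. The width is doubled once past the middle, hence the bound on twice the end of the
  segment.\<close>

lemma wp_SORT:
  assumes Z: "Z < 2" and col: "sc s 8 \<le> sc s 9" "sc s 9 \<le> d + 2"
    and ord: "sc s 18 \<le> sc s 19" "2 * sc s 19 \<le> IB" and L: "sc s 19 - sc s 18 \<le> 2 ^ L"
  shows "wp z (SORT Z) (\<lambda>t' s'. t' \<le> t + 2000 * (sc s 9 - sc s 8 + 1) * (sc s 19 - sc s 18 + 1) * (L + 1) \<and>
      mset (seg (ar s' Z) (sc s 18) (sc s 19)) = mset (seg (ar s Z) (sc s 18) (sc s 19)) \<and>
      sorted (map (key (rw s) (sc s 8) (sc s 9)) (seg (ar s' Z) (sc s 18) (sc s 19))) \<and>
      (\<forall>i. i < sc s 18 \<or> sc s 19 \<le> i \<longrightarrow> ar s' Z i = ar s Z i)) t s"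
proof -
  define lo hi f cc A where defs: "lo = sc s 18" "hi = sc s 19" "f = key (rw s) (sc s 8) (sc s 9)"
    "cc = sc s 9 - sc s 8 + 1" "A = ar s Z"
  note [simp] = defs(1,2,5)[symmetric]
  have le: "lo \<le> hi" "2 * hi \<le> IB" "hi - lo \<le> 2 ^ L" using ord L by simp_all
  have cc: "1 \<le> cc" by (simp add: defs)
  have bZ [simp]: "bda Z = IB" "Z < 16" "Z \<noteq> 2" "2 \<noteq> Z" using Z by auto
  define G where "G = (\<lambda>s'. mset (seg (ar s' Z) lo hi) = mset (seg A lo hi) \<and>
    (\<forall>i. i < lo \<or> hi \<le> i \<longrightarrow> ar s' Z i = A i))"
  define blk where "blk = (\<lambda>s' x w. sorted (map f (seg (ar s' Z) x (min (x + w) hi))))"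
  define I where "I = (\<lambda>t' s'. \<exists>p \<le> L. sc s' 20 = 2 ^ p \<and> t' \<le> t + 5 + 1000 * p * cc * (hi - lo + 1) \<and> G s' \<and>
    (\<forall>b. blk s' (lo + b * 2 ^ p) (2 ^ p)))"
  show ?thesis unfolding SORT_def
    apply simp
    apply (rule wp_while[where I = I and \<mu> = "\<lambda>s. hi - sc s 20"])
  proof goal_cases
    case 1
    have "sorted (map f (seg A x (min (Suc x) hi)))" for x
      by (cases "x < hi") (simp_all add: seg_def)
    then show ?case using le by (auto simp: I_def G_def blk_def intro!: exI[of _ 0])
  next
    case (2 t1 s1)
    note fr1 = frD[OF 2(2)]
    note [simp] = fr1
    from 2(1) obtain p where p: "p \<le> L" "sc s1 20 = 2 ^ p" "t1 \<le> t + 5 + 1000 * p * cc * (hi - lo + 1)" "G s1"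
      "\<And>b. blk s1 (lo + b * 2 ^ p) (2 ^ p)" unfolding I_def by blast
    define w :: nat where "w = 2 ^ p"
    note p = p[folded w_def]
    have w1: "1 \<le> w" by (simp add: w_def)
    have wm: "lo + w < hi" using 2(3) p by simp
    then have "2 ^ p < hi - lo" by (simp add: w_def)
    also note le(3)
    finally have pL: "Suc p \<le> L" by simp
    \<comment> \<open>Within a round, the blocks that start before scalar 12 already have double
      width, and those from there on still have single width. A last block without partner is left
      as it is.\<close>
    define J where "J = (\<lambda>t' s'. lo \<le> sc s' 12 \<and> sc s' 12 \<le> hi \<and> (sc s' 12 = hi \<or> (\<exists>b. sc s' 12 = lo + b * (2 * w))) \<and>
      t' \<le> t1 + 20 + 900 * cc * (sc s' 12 - lo) \<and> G s' \<and>
      (\<forall>b. lo + b * (2 * w) < sc s' 12 \<longrightarrow> blk s' (lo + b * (2 * w)) (2 * w)) \<and>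
      (\<forall>b. sc s' 12 \<le> lo + b * w \<longrightarrow> blk s' (lo + b * w) w))"
    show ?case
      apply simp
      apply (rule wp_while[where I = J and \<mu> = "\<lambda>s. hi - sc s 12"])
    proof goal_cases
      case 1
      show ?case using p le by (auto simp: J_def G_def blk_def)
    next
      case (2 t2 s2)
      note [simp] = frD[OF 2(2)]
      define ml where "ml = sc s2 12"
      note [simp] = ml_def[symmetric]
      have lt: "ml + w < hi" using 2(3) p by simp
      with 2(1) obtain B where B: "ml = lo + B * (2 * w)" by (auto simp: J_def)
      from 2(1) have J: "t2 \<le> t1 + 20 + 900 * cc * (ml - lo)" "G s2"
        "\<And>b. lo + b * (2 * w) < ml \<Longrightarrow> blk s2 (lo + b * (2 * w)) (2 * w)"
        "\<And>b. ml \<le> lo + b * w \<Longrightarrow> blk s2 (lo + b * w) w"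
        by (auto simp: J_def)
      define mh where "mh = min (ml + 2 * w) hi"
      have mh: "(if ml + w + w < hi then ml + w + w else hi) = mh" by (auto simp: mh_def)
      have mlt: "ml + w < mh" "mh \<le> hi" using lt w1 by (auto simp: mh_def)
      have M: "wp z (MERGE Z) (\<lambda>t' s'. J (5 + t') (setv s' 12 (sc s' 14)) \<and> sc s' 14 = mh \<and> ml < mh) u s3"
        if u: "u \<le> t2 + 100" and s3: "ar s3 = ar s2" "rw s3 = rw s2" "sc s3 8 = sc s 8" "sc s3 9 = sc s 9"
          "sc s3 12 = ml" "sc s3 13 = ml + w" "sc s3 14 = mh" "sc s3 20 = w" for u s3
      proof (rule wp_mono[OF wp_MERGE], goal_cases)
        case (7 t4 s4)
        note fr4 = frD[OF 7(2)]
        have t4: "t4 \<le> u + 400 * cc * (mh - ml + 1)" using 7(1) s3 by (simp add: defs(4))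
        have sm: "seg (ar s4 Z) ml mh = mrg f (seg (ar s2 Z) ml (ml + w)) (seg (ar s2 Z) (ml + w) mh)"
          using 7(1) s3 by (simp add: defs(3))
        have out: "ar s4 Z i = ar s2 Z i" if "i < ml \<or> mh \<le> i" for i
          using 7(1) s3 that by auto
        have "mset (seg (ar s4 Z) lo hi) = mset (seg (ar s2 Z) lo hi)"
        proof (rule mset_seg_change[where a = ml and b = mh])
          show "mset (seg (ar s4 Z) ml mh) = mset (seg (ar s2 Z) ml mh)"
            using mlt by (simp add: sm) (metis le_add1 less_imp_le mset_append seg_append)
        qed (use out mlt B in auto)
        then have G4: "G s4" using J(2) out mlt B unfolding G_def by auto
        have "blk s2 ml w" using J(4)[of "2 * B"] B by (simp add: algebra_simps)
        moreover have "blk s2 (ml + w) w" using J(4)[of "2 * B + 1"] B by (simp add: algebra_simps)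
        ultimately have srt: "sorted (map f (seg (ar s4 Z) ml mh))"
          unfolding sm using lt by (intro sorted_mrg) (auto simp: blk_def mh_def add.assoc mult_2)
        have b1: "blk s4 (lo + b * (2 * w)) (2 * w)" if "lo + b * (2 * w) < mh" for b
        proof (cases "b < B")
          case True
          then have "(b + 1) * (2 * w) \<le> B * (2 * w)" by (intro mult_le_mono1) simp
          then have le': "lo + b * (2 * w) + 2 * w \<le> ml" using B by simp
          then have "seg (ar s4 Z) (lo + b * (2 * w)) (min (lo + b * (2 * w) + 2 * w) hi) =
              seg (ar s2 Z) (lo + b * (2 * w)) (min (lo + b * (2 * w) + 2 * w) hi)"
            by (intro seg_cong out) auto
          moreover have "lo + b * (2 * w) < ml" using le' w1 by linarith
          ultimately show ?thesis using J(3)[of b] by (simp add: blk_def)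
        next
          case False
          have "b = B"
          proof (rule ccontr)
            assume "b \<noteq> B"
            with False have "(B + 1) * (2 * w) \<le> b * (2 * w)" by (intro mult_le_mono1) simp
            then show False using that B by (simp add: mh_def)
          qed
          then show ?thesis using srt B by (simp add: blk_def mh_def)
        qed
        have b2: "blk s4 (lo + b * w) w" if "mh \<le> lo + b * w" for b
        proof -
          have "seg (ar s4 Z) (lo + b * w) (min (lo + b * w + w) hi) = seg (ar s2 Z) (lo + b * w) (min (lo + b * w + w) hi)"
            using that by (intro seg_cong out) auto
          then show ?thesis using J(4)[of b] that mlt by (simp add: blk_def)
        qed
        have mm: "mh = hi \<or> (\<exists>b. mh = lo + b * (2 * w))"
          using B by (auto simp: mh_def min_def intro!: exI[of _ "Suc B"])
        have "2 \<le> mh - ml" using mlt w1 by simp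
        then have x: "cc * 2 \<le> cc * (mh - ml)" by simp
        have "cc * (ml - lo) + cc * (mh - ml) = cc * (mh - lo)"
          using mlt B by (simp add: distrib_left[symmetric])
        then have "t4 + 5 \<le> t1 + 20 + 900 * cc * (mh - lo)"
          using t4 u J(1) x cc by (simp add: algebra_simps)
        moreover have "blk (setv s4 12 mh) = blk s4" "G (setv s4 12 mh) = G s4" by (simp_all add: blk_def G_def fun_eq_iff)
        moreover have "sc s4 14 = mh" using s3 Z by (simp add: fr4)
        ultimately show ?case using mlt mm G4 b1 b2 B by (auto simp: J_def)
      qed (use s3 col mlt le Z in auto)
      have "hi - mh < hi - ml" using mlt by auto
      then show ?case using lt p le mh mlt w1
        by (auto simp: mh_def[symmetric] intro!: wp_mono[OF M] split: if_splits)
    next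
      case (3 t2 s2)
      note [simp] = frD[OF 3(2)]
      define ml where "ml = sc s2 12"
      note [simp] = ml_def[symmetric]
      have lt: "hi \<le> ml + w" using 3(3) p by simp
      from 3(1) have J: "lo \<le> ml" "ml \<le> hi" "t2 \<le> t1 + 20 + 900 * cc * (ml - lo)" "G s2"
        "\<And>b. lo + b * (2 * w) < ml \<Longrightarrow> blk s2 (lo + b * (2 * w)) (2 * w)"
        "\<And>b. ml \<le> lo + b * w \<Longrightarrow> blk s2 (lo + b * w) w"
        by (auto simp: J_def)
      have b: "blk s2 (lo + b * (2 * w)) (2 * w)" for b
      proof (cases "lo + b * (2 * w) < ml")
        case False
        then have "min (lo + b * (2 * w) + 2 * w) hi = min (lo + b * (2 * w) + w) hi" using lt by auto
        then show ?thesis using J(6)[of "2 * b"] False by (simp add: blk_def algebra_simps)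
      qed (rule J)
      have "cc * (ml - lo) \<le> cc * (hi - lo)" by (rule mult_le_mono2) (use J in auto)
      then have "t2 + 30 \<le> t + 5 + 1000 * Suc p * cc * (hi - lo + 1)"
        using p(3) J(3) cc by (simp add: algebra_simps)
      moreover have "hi - 2 * w < hi - w" using wm w1 by auto
      ultimately show ?case using p(2) J(4) b pL wm le
        by (auto simp: I_def w_def G_def blk_def mult_2[symmetric] intro!: exI[of _ "Suc p"])
    qed
  next
    case (3 t1 s1)
    note [simp] = frD[OF 3(2)]
    from 3(1) obtain p where p: "p \<le> L" "sc s1 20 = 2 ^ p" "t1 \<le> t + 5 + 1000 * p * cc * (hi - lo + 1)" "G s1"
      "\<And>b. blk s1 (lo + b * 2 ^ p) (2 ^ p)" unfolding I_def by blast
    have "hi \<le> lo + 2 ^ p" using 3(3) p by simp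
    with p(5)[of 0] have "sorted (map f (seg (ar s1 Z) lo hi))" by (simp add: blk_def min_absorb2)
    moreover have "t1 + 20 \<le> t + 2000 * cc * (hi - lo + 1) * (L + 1)"
    proof -
      define X where "X = cc * (hi - lo + 1)"
      have "p * X \<le> L * X" "1 \<le> X" using p(1) cc by (simp_all add: X_def)
      moreover have "1000 * p * cc * (hi - lo + 1) = 1000 * (p * X)"
        "2000 * cc * (hi - lo + 1) * (L + 1) = 2000 * (L * X) + 2000 * X"
        by (simp_all only: X_def distrib_left distrib_right mult_1_right ac_simps)
      ultimately show ?thesis using p(3) by linarith
    qed
    ultimately show ?case using p(4) by (simp add: G_def defs(3,4))
  qed
qed

end

section \<open>Lipschitz bounds for the weighted Gini index\<close>

text \<open>The Gini index of a set with \<open>a\<close> examples of one label and \<open>b\<close>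
  of the other, multiplied by its size; division by zero gives the right value 0 for the empty
  set.\<close>

definition wf :: "real \<Rightarrow> real \<Rightarrow> real" where "wf a b = 2 * a * b / (a + b)"

lemma wf_comm: "wf a b = wf b a"
  by (simp add: wf_def ac_simps)

lemma wf_nonneg: "0 \<le> a \<Longrightarrow> 0 \<le> b \<Longrightarrow> 0 \<le> wf a b"
  by (simp add: wf_def)

text \<open>The difference of the two values is \<open>2 * (a' - a)\<close> times a product of two
  fractions \<open>b / (a + b)\<close> and \<open>b / (a' + b)\<close>, both of which lie between 0
  and 1.\<close>

lemma wf_step:
  assumes "0 \<le> a" "a \<le> a'" "0 \<le> b"
  shows "wf a b \<le> wf a' b" "wf a' b \<le> wf a b + 2 * (a' - a)"
proof -
  have "wf a b \<le> wf a' b \<and> wf a' b \<le> wf a b + 2 * (a' - a)"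
  proof (cases "a + b = 0 \<or> b = 0")
    case True
    then have "b = 0" using assms by auto
    then show ?thesis using assms by (simp add: wf_def)
  next
    case False
    then have b: "0 < b" "0 < a + b" "0 < a' + b" using assms by auto
    have e: "wf a' b - wf a b = 2 * (a' - a) * (b / (a + b) * (b / (a' + b)))"
      using b by (simp add: wf_def field_simps)
    have "b / (a + b) * (b / (a' + b)) \<le> 1 * 1" using b assms by (intro mult_mono) auto
    then have "2 * (a' - a) * (b / (a + b) * (b / (a' + b))) \<le> 2 * (a' - a) * 1"
      using assms by (intro mult_left_mono) auto
    moreover have "0 \<le> 2 * (a' - a) * (b / (a + b) * (b / (a' + b)))" using b assms by simp
    ultimately show ?thesis using e by linarith
  qed
  then show "wf a b \<le> wf a' b" "wf a' b \<le> wf a b + 2 * (a' - a)" by auto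
qed

lemma wf_lipschitz:
  assumes "0 \<le> a" "0 \<le> a'" "0 \<le> b" "0 \<le> b'"
  shows "wf a b \<le> wf a' b' + 2 * \<bar>a - a'\<bar> + 2 * \<bar>b - b'\<bar>"
proof -
  have 1: "wf a b \<le> wf a' b + 2 * \<bar>a - a'\<bar>" if "0 \<le> a" "0 \<le> a'" "0 \<le> b" for a a' b
    using wf_step[of a a' b] wf_step[of a' a b] that by (cases "a \<le> a'") auto
  show ?thesis using 1[of a a' b] 1[of b b' a'] assms by (simp add: wf_comm)
qed

definition sd :: "'a set \<Rightarrow> 'a set \<Rightarrow> nat" where "sd X Y = card (X - Y) + card (Y - X)"

lemma sd_refl [simp]: "sd X X = 0" by (simp add: sd_def)

lemma card_diff_sd:
  assumes "finite X" "finite Y"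
  shows "\<bar>real (card X) - real (card Y)\<bar> \<le> real (sd X Y)"
proof -
  have "card X \<le> card (X - Y) + card Y"
    by (metis Un_Diff_cancel2 assms card_Un_le card_mono finite_UnI le_trans sup_ge1)
  moreover have "card Y \<le> card (Y - X) + card X"
    by (metis Un_Diff_cancel2 assms card_Un_le card_mono finite_UnI le_trans sup_ge1)
  ultimately show ?thesis by (simp add: sd_def)
qed

lemma sd_split:
  assumes "finite X" "finite Y"
  shows "sd X Y = sd {i \<in> X. P i} {i \<in> Y. P i} + sd {i \<in> X. \<not> P i} {i \<in> Y. \<not> P i}"
proof -
  have c: "card (X - Y) = card ({i \<in> X. P i} - {i \<in> Y. P i}) + card ({i \<in> X. \<not> P i} - {i \<in> Y. \<not> P i})"
    if "finite X" for X Y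
    using that by (subst card_Un_disjoint[symmetric]) (auto intro: arg_cong[where f = card])
  show ?thesis unfolding sd_def c[OF assms(1), of Y] c[OF assms(2), of X] by simp
qed

lemma sd_insert: "finite X \<Longrightarrow> finite Y \<Longrightarrow> sd X (insert i Y) \<le> sd X Y + 1"
proof -
  assume f: "finite X" "finite Y"
  have "card (X - insert i Y) \<le> card (X - Y)" using f by (intro card_mono) auto
  moreover have "card (insert i Y - X) \<le> card (insert i (Y - X))" using f by (intro card_mono) auto
  moreover have "card (insert i (Y - X)) \<le> card (Y - X) + 1" using f by (simp add: card_insert_if)
  ultimately show ?thesis by (simp add: sd_def)
qed

lemma sd_remove: "finite X \<Longrightarrow> finite Y \<Longrightarrow> sd X (Y - {i}) \<le> sd X Y + 1"
proof -
  assume f: "finite X" "finite Y"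
  have "card (X - (Y - {i})) \<le> card (insert i (X - Y))" using f by (intro card_mono) auto
  moreover have "card (insert i (X - Y)) \<le> card (X - Y) + 1" using f by (simp add: card_insert_if)
  moreover have "card (Y - {i} - X) \<le> card (Y - X)" using f by (intro card_mono) auto
  ultimately show ?thesis by (simp add: sd_def)
qed

context params
begin

definition c0 :: "(nat \<Rightarrow> nat \<Rightarrow> real) \<Rightarrow> nat set \<Rightarrow> nat" where "c0 G X = card {i \<in> X. \<not> 0 < G i d}"
definition c1 :: "(nat \<Rightarrow> nat \<Rightarrow> real) \<Rightarrow> nat set \<Rightarrow> nat" where "c1 G X = card {i \<in> X. 0 < G i d}"
definition Wt :: "(nat \<Rightarrow> nat \<Rightarrow> real) \<Rightarrow> nat set \<Rightarrow> real" where "Wt G X = wf (real (c0 G X)) (real (c1 G X))"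
definition lft :: "(nat \<Rightarrow> nat \<Rightarrow> real) \<Rightarrow> nat set \<Rightarrow> nat \<Rightarrow> real \<Rightarrow> nat set" where
  "lft G X j t = {i \<in> X. G i j \<le> t}"
definition rgt :: "(nat \<Rightarrow> nat \<Rightarrow> real) \<Rightarrow> nat set \<Rightarrow> nat \<Rightarrow> real \<Rightarrow> nat set" where
  "rgt G X j t = {i \<in> X. \<not> G i j \<le> t}"
text \<open>The size of \<open>X\<close> times the Gini gain of the split
  (\<open>gini_gain_ms\<close>). In this scaling the Lipschitz constants do not depend on the
  size.\<close>

definition sco :: "(nat \<Rightarrow> nat \<Rightarrow> real) \<Rightarrow> nat set \<Rightarrow> nat \<Rightarrow> real \<Rightarrow> real" where
  "sco G X j t = Wt G X - Wt G (lft G X j t) - Wt G (rgt G X j t)"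

lemma finite_lft [simp]: "finite X \<Longrightarrow> finite (lft G X j t)" by (simp add: lft_def)
lemma finite_rgt [simp]: "finite X \<Longrightarrow> finite (rgt G X j t)" by (simp add: rgt_def)
lemma lft_Un_rgt: "lft G X j t \<union> rgt G X j t = X" by (auto simp: lft_def rgt_def)
lemma lft_Int_rgt: "lft G X j t \<inter> rgt G X j t = {}" by (auto simp: lft_def rgt_def)
lemma lft_sub: "lft G X j t \<subseteq> X" by (auto simp: lft_def)
lemma rgt_sub: "rgt G X j t \<subseteq> X" by (auto simp: rgt_def)

lemma card_lft_rgt: "finite X \<Longrightarrow> card (lft G X j t) + card (rgt G X j t) = card X"
  by (metis card_Un_disjoint finite_lft finite_rgt lft_Int_rgt lft_Un_rgt)

lemma c_Un:
  assumes "finite X" "finite Y" "X \<inter> Y = {}"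
  shows "c0 G (X \<union> Y) = c0 G X + c0 G Y" "c1 G (X \<union> Y) = c1 G X + c1 G Y"
proof -
  have "{i \<in> X \<union> Y. P i} = {i \<in> X. P i} \<union> {i \<in> Y. P i}" "{i \<in> X. P i} \<inter> {i \<in> Y. P i} = {}" for P
    using assms(3) by auto
  then show "c0 G (X \<union> Y) = c0 G X + c0 G Y" "c1 G (X \<union> Y) = c1 G X + c1 G Y"
    using assms unfolding c0_def c1_def by (simp_all add: card_Un_disjoint)
qed

lemma c_empty [simp]: "c0 G {} = 0" "c1 G {} = 0"
  by (simp_all add: c0_def c1_def)

lemma c_sum: "finite X \<Longrightarrow> c0 G X + c1 G X = card X"
  unfolding c0_def c1_def by (subst card_Un_disjoint[symmetric]) (auto intro: arg_cong[where f = card])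

lemma Wt_nonneg: "0 \<le> Wt G X" by (simp add: Wt_def wf_nonneg)

lemma Wt_empty [simp]: "Wt G {} = 0" by (simp add: Wt_def wf_def)

lemma Wt_lipschitz:
  assumes "finite X" "finite Y"
  shows "Wt G X \<le> Wt G Y + 2 * real (sd X Y)"
proof -
  have "\<bar>real (c0 G X) - real (c0 G Y)\<bar> + \<bar>real (c1 G X) - real (c1 G Y)\<bar> \<le> real (sd X Y)"
    using card_diff_sd[of "{i \<in> X. 0 < G i d}" "{i \<in> Y. 0 < G i d}"]
      card_diff_sd[of "{i \<in> X. \<not> 0 < G i d}" "{i \<in> Y. \<not> 0 < G i d}"]
      sd_split[OF assms, of "\<lambda>i. 0 < G i d"] assms
    by (simp add: c0_def c1_def)
  then show ?thesis
    using wf_lipschitz[of "real (c0 G X)" "real (c0 G Y)" "real (c1 G X)" "real (c1 G Y)"]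
    by (simp add: Wt_def)
qed

text \<open>The node itself contributes twice the symmetric difference. The two sides together
  contribute twice as well, because the symmetric difference is distributed over them by
  \<open>sd_split\<close>.\<close>

lemma sco_lipschitz:
  assumes "finite X" "finite Y"
  shows "sco G X j t \<le> sco G Y j t + 4 * real (sd X Y)"
proof -
  have s: "sd Y X = sd X Y" by (simp add: sd_def)
  have "sd Y X = sd (lft G Y j t) (lft G X j t) + sd (rgt G Y j t) (rgt G X j t)"
    unfolding lft_def rgt_def using assms by (intro sd_split) auto
  then show ?thesis
    using Wt_lipschitz[OF assms, of G] Wt_lipschitz[of "lft G Y j t" "lft G X j t" G]
      Wt_lipschitz[of "rgt G Y j t" "rgt G X j t" G] assms s
    by (simp add: sco_def)
qed

lemma sco_le_Wt: "sco G X j t \<le> Wt G X"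
  using Wt_nonneg[of G "lft G X j t"] Wt_nonneg[of G "rgt G X j t"] by (simp add: sco_def)

text \<open>Removing one side from \<open>X\<close> leaves the other side, at a distance equal to
  the number of removed elements, so the weighted index drops by at most twice that number. A split
  with a large score is therefore balanced; this is the source of the height bound.\<close>

lemma sco_le_sides:
  assumes "finite X"
  shows "sco G X j t \<le> 2 * real (card (lft G X j t))" "sco G X j t \<le> 2 * real (card (rgt G X j t))"
proof -
  have "X - rgt G X j t = lft G X j t" "X - lft G X j t = rgt G X j t"
    "rgt G X j t - X = {}" "lft G X j t - X = {}"
    by (auto simp: lft_def rgt_def)
  then have "sd X (rgt G X j t) = card (lft G X j t)" "sd X (lft G X j t) = card (rgt G X j t)"
    unfolding sd_def by (simp_all only: card.empty)
  then show "sco G X j t \<le> 2 * real (card (lft G X j t))" "sco G X j t \<le> 2 * real (card (rgt G X j t))"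
    using Wt_lipschitz[OF assms finite_rgt[OF assms], of G G j t] Wt_lipschitz[OF assms finite_lft[OF assms], of G G j t]
      Wt_nonneg[of G "lft G X j t"] Wt_nonneg[of G "rgt G X j t"]
    by (simp_all add: sco_def)
qed

lemma sco_trivial: "lft G X j t = {} \<or> rgt G X j t = {} \<Longrightarrow> sco G X j t = 0"
  using lft_Un_rgt[of G X j t] by (auto simp: sco_def)

lemma sco_counts:
  assumes "finite X"
  shows "sco G X j t = wf (real (c0 G X)) (real (c1 G X))
    - wf (real (c0 G (lft G X j t))) (real (c1 G (lft G X j t)))
    - wf (real (c0 G X - c0 G (lft G X j t))) (real (c1 G X - c1 G (lft G X j t)))"
proof -
  have "c0 G X = c0 G (lft G X j t) + c0 G (rgt G X j t)" "c1 G X = c1 G (lft G X j t) + c1 G (rgt G X j t)"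
    using c_Un[of "lft G X j t" "rgt G X j t" G] assms by (simp_all add: lft_Un_rgt lft_Int_rgt)
  then show ?thesis by (simp add: sco_def Wt_def)
qed

lemma agree_cong:
  assumes "\<And>i c. i \<in> X \<Longrightarrow> c \<le> d \<Longrightarrow> G' i c = G i c"
  shows "c0 G' X = c0 G X" "c1 G' X = c1 G X" "Wt G' X = Wt G X"
    "j < d \<Longrightarrow> lft G' X j t = lft G X j t" "j < d \<Longrightarrow> rgt G' X j t = rgt G X j t"
    "j < d \<Longrightarrow> sco G' X j t = sco G X j t"
proof -
  have *: "c0 G' Y = c0 G Y" "c1 G' Y = c1 G Y" "Wt G' Y = Wt G Y" if "Y \<subseteq> X" for Y
  proof -
    have "{i \<in> Y. 0 < G' i d} = {i \<in> Y. 0 < G i d}" "{i \<in> Y. \<not> 0 < G' i d} = {i \<in> Y. \<not> 0 < G i d}"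
      using assms that by auto
    then show "c0 G' Y = c0 G Y" "c1 G' Y = c1 G Y" by (simp_all add: c0_def c1_def)
    then show "Wt G' Y = Wt G Y" by (simp add: Wt_def)
  qed
  from *[of X] show "c0 G' X = c0 G X" "c1 G' X = c1 G X" "Wt G' X = Wt G X" by simp_all
  show l: "j < d \<Longrightarrow> lft G' X j t = lft G X j t" and r: "j < d \<Longrightarrow> rgt G' X j t = rgt G X j t"
    using assms by (auto simp: lft_def rgt_def)
  show "j < d \<Longrightarrow> sco G' X j t = sco G X j t"
    using *[of X] *[OF lft_sub[of G X j t]] *[OF rgt_sub[of G X j t]] by (simp add: sco_def l r)
qed

subsection \<open>Link with the Gini index\<close>

definition ex :: "(nat \<Rightarrow> nat \<Rightarrow> real) \<Rightarrow> nat \<Rightarrow> example" where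
  "ex G i = (seg (G i) 0 d, 0 < G i d)"
definition ms :: "(nat \<Rightarrow> nat \<Rightarrow> real) \<Rightarrow> nat set \<Rightarrow> example multiset" where
  "ms G X = image_mset (ex G) (mset_set X)"

lemma size_ms: "size (ms G X) = card X"
  by (simp add: ms_def)

lemma filter_ms:
  assumes "finite X"
  shows "filter_mset P (ms G X) = ms G {i \<in> X. P (ex G i)}"
  unfolding ms_def using assms by (simp add: filter_mset_image_mset)

lemma gini_ms:
  assumes "finite X"
  shows "real (card X) * gini (ms G X) = Wt G X"
proof (cases "X = {}")
  case False
  have "(\<Sum>(x, y)\<in>#ms G X. of_bool y) = (\<Sum>i\<in>X. of_bool (0 < G i d) :: real)"
    by (simp add: ms_def image_mset.compositionality sum_unfold_sum_mset ex_def comp_def)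
  also have "\<dots> = real (c1 G X)" using assms by (simp add: c1_def sum.If_cases of_bool_def Int_def)
  finally have p: "pos_fraction (ms G X) = real (c1 G X) / real (card X)"
    by (simp add: pos_fraction_def size_ms)
  have n: "0 < real (card X)" using assms False by (simp add: card_gt_0_iff)
  have s: "real (card X) = real (c0 G X) + real (c1 G X)" using c_sum[OF assms, of G] by linarith
  have "real (card X) * gini (ms G X) = 2 * real (c1 G X) * (real (card X) - real (c1 G X)) / real (card X)"
    using n by (simp add: gini_def p field_simps)
  also have "\<dots> = Wt G X" unfolding Wt_def wf_def s by (simp add: ac_simps)
  finally show ?thesis .
qed simp

lemma below_ms: "finite X \<Longrightarrow> j < d \<Longrightarrow> below (ms G X) j t = ms G (lft G X j t)"
  by (simp add: below_def filter_ms ex_def lft_def case_prod_beta)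

lemma above_ms: "finite X \<Longrightarrow> j < d \<Longrightarrow> above (ms G X) j t = ms G (rgt G X j t)"
  by (simp add: above_def filter_ms ex_def rgt_def case_prod_beta not_le)

lemma gini_gain_ms:
  assumes "finite X" "j < d"
  shows "real (card X) * gini_gain (ms G X) j t = sco G X j t"
proof (cases "X = {}")
  case True
  then show ?thesis by (simp add: sco_def lft_def rgt_def)
next
  case False
  have n: "0 < real (card X)" using assms False by (simp add: card_gt_0_iff)
  have "real (card X) * gini_gain (ms G X) j t = real (card X) * gini (ms G X)
      - (real (card (lft G X j t)) * gini (ms G (lft G X j t)) + real (card (rgt G X j t)) * gini (ms G (rgt G X j t)))"
    using n False by (simp add: gini_gain_def below_ms above_ms assms size_ms field_simps)
  then show ?thesis using assms by (simp add: gini_ms sco_def)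
qed

lemma majority_ms:
  assumes "finite X"
  shows "majority_label (ms G X) b \<longleftrightarrow> (if b then c0 G X \<le> c1 G X else c1 G X \<le> c0 G X)"
proof -
  have "size {#(x, y) \<in># ms G X. y = b'#} = (if b' then c1 G X else c0 G X)" for b'
    using assms by (cases b') (simp_all add: filter_ms size_ms case_prod_beta ex_def c0_def c1_def)
  then have "size {#(x, y) \<in># ms G X. y = b#} = (if b then c1 G X else c0 G X)"
    "size {#(x, y) \<in># ms G X. y = (\<not> b)#} = (if b then c0 G X else c1 G X)" by simp_all
  moreover have "(\<lambda>(x, y). y \<noteq> b) = (\<lambda>(x :: point, y). y = (\<not> b))" by auto
  ultimately show ?thesis by (cases b) (simp_all only: majority_label_def if_True if_False)
qed

subsection \<open>Thresholds and prefixes of sorted segments\<close>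

lemma prefix_split:
  fixes P :: "nat \<Rightarrow> nat"
  assumes srt: "\<And>a b. lo \<le> a \<Longrightarrow> a \<le> b \<Longrightarrow> b < hi \<Longrightarrow> G (P a) j \<le> G (P b) j"
    and p: "lo \<le> p" "p \<le> hi" "\<And>a. lo \<le> a \<Longrightarrow> a < p \<Longrightarrow> G (P a) j \<le> t" "p < hi \<Longrightarrow> t < G (P p) j"
  shows "lft G (set (seg P lo hi)) j t = set (seg P lo p)" "rgt G (set (seg P lo hi)) j t = set (seg P p hi)"
proof -
  have r: "\<not> G (P a) j \<le> t" if "p \<le> a" "a < hi" for a using srt[of p a] p that by force
  have U: "set (seg P lo hi) = set (seg P lo p) \<union> set (seg P p hi)"
    using p(1,2) by (metis seg_append set_append)
  have l: "\<forall>i \<in> set (seg P lo p). G i j \<le> t" and u: "\<forall>i \<in> set (seg P p hi). \<not> G i j \<le> t"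
    using p(3) r by (auto simp: set_seg)
  show "lft G (set (seg P lo hi)) j t = set (seg P lo p)" "rgt G (set (seg P lo hi)) j t = set (seg P p hi)"
    unfolding lft_def rgt_def U using l u by blast+
qed

text \<open>In a segment sorted by the feature each threshold cuts off a prefix, which ends at the
  first entry above the threshold.\<close>

lemma threshold_prefix:
  fixes P :: "nat \<Rightarrow> nat" and G :: "nat \<Rightarrow> nat \<Rightarrow> real"
  assumes "\<And>a b. lo \<le> a \<Longrightarrow> a \<le> b \<Longrightarrow> b < hi \<Longrightarrow> G (P a) j \<le> G (P b) j" "lo \<le> hi"
  obtains p where "lo \<le> p" "p \<le> hi" "\<And>a. lo \<le> a \<Longrightarrow> a < p \<Longrightarrow> G (P a) j \<le> t" "p < hi \<Longrightarrow> t < G (P p) j"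
proof (cases "\<exists>a. lo \<le> a \<and> a < hi \<and> t < G (P a) j")
  case True
  define p where "p = (LEAST a. lo \<le> a \<and> a < hi \<and> t < G (P a) j)"
  have p: "lo \<le> p \<and> p < hi \<and> t < G (P p) j" unfolding p_def using True by (rule LeastI_ex)
  have "\<not> (lo \<le> a \<and> a < hi \<and> t < G (P a) j)" if "a < p" for a
    using that unfolding p_def by (rule not_less_Least)
  then have "G (P a) j \<le> t" if "lo \<le> a" "a < p" for a
    using that p by (meson less_trans not_le)
  with p that[of p] show thesis by auto
next
  case False
  then show thesis by (intro that[of hi]) (use assms(2) in force)+
qed

end

section \<open>Processing one node: the best split by sorting and scanning\<close>

fun sqn :: "com list \<Rightarrow> com" where
  "sqn [] = Skip"
| "sqn [c] = c"
| "sqn (c # c' # cs) = Seq c (sqn (c' # cs))"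

definition Wfe :: "wexp \<Rightarrow> wexp \<Rightarrow> rexp" where
  "Wfe e f = RDiv (RMul (RMul (OfWord (Lit 2)) (OfWord e)) (OfWord f)) (RAdd (OfWord e) (OfWord f))"

lemma Wfe_simps [simp]:
  "rval z s (Wfe e f) = wf (real (wval z s e)) (real (wval z s f))" "rlen (Wfe e f) = 2 * wlen e + 2 * wlen f + 10"
  by (simp_all add: Wfe_def wf_def)

definition Inc :: "nat \<Rightarrow> com" where "Inc x = SetV x (WAdd (Var x) (Lit 1))"
definition Pos :: "rexp \<Rightarrow> test" where "Pos e = RLess (OfWord (Lit 0)) e"

lemma Pos_simps [simp]: "tval z s (Pos e) \<longleftrightarrow> 0 < rval z s e" "tlen (Pos e) = rlen e + 3"
  by (simp_all add: Pos_def)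

context params
begin

definition COUNT :: com where
  "COUNT = sqn [SetV 23 (Lit 0), SetV 24 (Lit 0), SetV 27 (Var 18),
     While (WLess (Var 27) (Var 19)) (sqn [
       SetV 31 (Arr 0 (Var 27)),
       Cond (Pos (Row (Var 31) (Lit d))) (Inc 24) (Inc 23),
       Inc 27])]"

text \<open>Considers the cut between two neighbours of the sorted segment. It is realised by a
  threshold only if the feature strictly increases there, and then the value before the cut is such
  a threshold. Scalars 23 and 24 are the label counts of the node, 25 and 26 those of the prefix.
  The best candidate is kept as score (real cell 3), threshold (real cell 4), feature plus one
  (scalar 29) and end of the prefix (scalar 30).\<close>

definition CAND :: com where
  "CAND = Cond (RLess (Row (Var 31) (Var 28)) (Row (Arr 0 (Var 27)) (Var 28))) (sqn [
     SetRV 5 (RSub (RSub (Wfe (Var 23) (Var 24)) (Wfe (Var 25) (Var 26)))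
       (Wfe (WSub (Var 23) (Var 25)) (WSub (Var 24) (Var 26)))),
     Cond (RLess (RVar 3) (RVar 5)) (sqn [
       SetRV 3 (RVar 5), SetRV 4 (Row (Var 31) (Var 28)),
       SetV 29 (WAdd (Var 28) (Lit 1)), SetV 30 (Var 27)]) Skip]) Skip"

definition FEAT :: com where
  "FEAT = sqn [SetV 8 (Var 28), SetV 9 (WAdd (Var 28) (Lit 1)), SORT 0,
     SetV 25 (Lit 0), SetV 26 (Lit 0), SetV 27 (Var 18),
     While (WLess (WAdd (Var 27) (Lit 1)) (Var 19)) (sqn [
       SetV 31 (Arr 0 (Var 27)),
       Cond (Pos (Row (Var 31) (Lit d))) (Inc 26) (Inc 25),
       Inc 27,
       CAND]),
     Inc 28]"

text \<open>The rule for counters: a child with more than half the reference size inherits that size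
  and shares the counter, whereas a smaller child gets its own counter, with its own size as
  reference. Halving is what makes the number of counters on a path logarithmic.\<close>

definition NEWCH :: "nat \<Rightarrow> nat \<Rightarrow> nat \<Rightarrow> com" where
  "NEWCH b x y = sqn [Inc 4, SetA 3 (WAdd (WAdd (Var 22) (Var 22)) (Lit b)) (Var 4),
     SetA 11 (Var 4) (Var x), SetA 12 (Var 4) (Var y), SetA 13 (Var 4) (WAdd (Arr 13 (Var 22)) (Lit 1)),
     SetA 4 (Var 4) (Lit 0), SetA 9 (Var 4) (Lit 0), SetA 10 (Var 4) (Lit 0),
     Cond (WLess (Arr 8 (Var 22)) (WMul (Lit 2) (WSub (Var y) (Var x))))
       (sqn [SetA 7 (Var 4) (Lit 1), SetA 8 (Var 4) (Arr 8 (Var 22))])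
       (sqn [SetA 7 (Var 4) (Lit 0), SetA 8 (Var 4) (WSub (Var y) (Var x))])]"

text \<open>The best score starts at 4\<epsilon> times the size, so only splits with a larger gain
  are ever recorded. The features are tried in turn on the same segment, so a final sort by the
  winning feature is needed to make the two children adjacent subsegments.\<close>

definition NODE :: com where
  "NODE = sqn [SetV 18 (Arr 11 (Var 22)), SetV 19 (Arr 12 (Var 22)), COUNT,
     SetA 5 (Var 22) (Var 23), SetA 6 (Var 22) (Var 24), SetA 4 (Var 22) (Lit 0), SetV 29 (Lit 0),
     Cond (And (WLess (Lit k) (WSub (Var 19) (Var 18))) (WLess (Arr 13 (Var 22)) (Lit h))) (sqn [
       SetRV 3 (RMul (RMul (OfWord (Lit 4)) (RVar 2)) (OfWord (WSub (Var 19) (Var 18)))),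
       SetV 28 (Lit 0),
       While (WLess (Var 28) (Lit d)) FEAT,
       Cond (WLess (Lit 0) (Var 29)) (sqn [
         SetV 8 (WSub (Var 29) (Lit 1)), SetV 9 (Var 29), SORT 0,
         SetA 4 (Var 22) (Var 29), SetRow (Var 22) (Lit (d + 2)) (RVar 4),
         NEWCH 0 18 30, NEWCH 1 30 19]) Skip]) Skip]"

lemma key_single [simp]: "key G j (Suc j) i = [G i j]"
  by (simp add: key_def seg_def)

lemma sorted_key_single:
  assumes "sorted (map (key G j (Suc j)) (seg P lo hi))" "lo \<le> a" "a \<le> b" "b < hi"
  shows "G (P a) j \<le> G (P b) j"
proof -
  have "map (key G j (Suc j)) (seg P lo hi) ! (a - lo) \<le> map (key G j (Suc j)) (seg P lo hi) ! (b - lo)"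
    using assms by (intro sorted_nth_mono) auto
  then show ?thesis using assms by auto
qed

end

context machine
begin

lemma Inc_simps [simp]:
  "x < 40 \<Longrightarrow> wp z (Inc x) Q t s \<longleftrightarrow> (wub (WAdd (Var x) (Lit 1)) (bdv x) \<or> sc s x + 1 \<le> bdv x) \<and> Q (t + 7) (setv s x (sc s x + 1))"
  "nv (Inc x) y \<longleftrightarrow> y \<noteq> x" "x < 40 \<Longrightarrow> na (Inc x) a" "nrv (Inc x) y" "nrw (Inc x)"
  by (auto simp: Inc_def numeral_eq_Suc)

lemma COUNT_writes [simp]:
  "x < 40 \<Longrightarrow> nv COUNT x \<longleftrightarrow> x \<notin> {23, 24, 27, 31}" "a < 16 \<Longrightarrow> na COUNT a" "nrv COUNT x" "nrw COUNT"
  by (auto simp: COUNT_def)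

lemma c_snoc:
  assumes "i \<notin> X" "finite X"
  shows "c0 G (insert i X) = c0 G X + of_bool (\<not> 0 < G i d)" "c1 G (insert i X) = c1 G X + of_bool (0 < G i d)"
proof -
  have "c0 G {i} = of_bool (\<not> 0 < G i d)" "c1 G {i} = of_bool (0 < G i d)"
    by (auto simp: c0_def c1_def Collect_conv_if)
  then show "c0 G (insert i X) = c0 G X + of_bool (\<not> 0 < G i d)" "c1 G (insert i X) = c1 G X + of_bool (0 < G i d)"
    using c_Un[of X "{i}" G] assms by auto
qed

lemma c_seg_Suc:
  assumes "distinct (seg P lo hi)" "lo \<le> i" "i < hi"
  shows "c0 G (set (seg P lo (Suc i))) = c0 G (set (seg P lo i)) + of_bool (\<not> 0 < G (P i) d)"
    "c1 G (set (seg P lo (Suc i))) = c1 G (set (seg P lo i)) + of_bool (0 < G (P i) d)"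
proof -
  have "seg P lo hi = seg P lo i @ P i # seg P (Suc i) hi"
    using assms by (metis less_imp_le seg_Cons seg_append)
  with assms(1) have "P i \<notin> set (seg P lo i)" by simp
  moreover have "set (seg P lo (Suc i)) = insert (P i) (set (seg P lo i))"
    using assms by (simp add: seg_Suc)
  ultimately show "c0 G (set (seg P lo (Suc i))) = c0 G (set (seg P lo i)) + of_bool (\<not> 0 < G (P i) d)"
    "c1 G (set (seg P lo (Suc i))) = c1 G (set (seg P lo i)) + of_bool (0 < G (P i) d)"
    by (simp_all add: c_snoc)
qed

lemma c_le_length: "c0 G (set xs) \<le> length xs" "c1 G (set xs) \<le> length xs"
proof -
  have "c0 G (set xs) + c1 G (set xs) \<le> length xs" by (simp add: c_sum card_length)
  then show "c0 G (set xs) \<le> length xs" "c1 G (set xs) \<le> length xs" by simp_all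
qed

lemma wp_COUNT:
  assumes "sc s 18 \<le> sc s 19" "2 * sc s 19 \<le> IB" "distinct (seg (ar s 0) (sc s 18) (sc s 19))"
  shows "wp z COUNT (\<lambda>t' s'. t' \<le> t + 100 * (sc s 19 - sc s 18 + 1) \<and>
      sc s' 23 = c0 (rw s) (set (seg (ar s 0) (sc s 18) (sc s 19))) \<and>
      sc s' 24 = c1 (rw s) (set (seg (ar s 0) (sc s 18) (sc s 19)))) t s"
proof -
  define lo hi P G where defs: "lo = sc s 18" "hi = sc s 19" "P = ar s 0" "G = rw s"
  note [simp] = defs[symmetric]
  have le: "lo \<le> hi" "2 * hi \<le> IB" using assms by simp_all
  have ds: "distinct (seg P lo hi)" using assms by simp
  define I where "I = (\<lambda>t' s'. lo \<le> sc s' 27 \<and> sc s' 27 \<le> hi \<and> t' \<le> t + 20 + 90 * (sc s' 27 - lo) \<and>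
     sc s' 23 = c0 G (set (seg P lo (sc s' 27))) \<and> sc s' 24 = c1 G (set (seg P lo (sc s' 27))))"
  show ?thesis unfolding COUNT_def
    apply simp
    apply (rule wp_while[where I = I and \<mu> = "\<lambda>s. hi - sc s 27"])
  proof goal_cases
    case 1
    show ?case using le by (simp add: I_def)
  next
    case (2 t' s')
    note [simp] = frD[OF 2(2)]
    define i where "i = sc s' 27"
    note [simp] = i_def[symmetric]
    from 2(1,3) have I: "lo \<le> i" "i < hi" "t' \<le> t + 20 + 90 * (i - lo)"
      "sc s' 23 = c0 G (set (seg P lo i))" "sc s' 24 = c1 G (set (seg P lo i))"
      by (simp_all add: I_def)
    have b: "c0 G (set (seg P lo i)) \<le> i - lo" "c1 G (set (seg P lo i)) \<le> i - lo"
      using c_le_length[of G "seg P lo i"] by simp_all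
    show ?case using I b le by (auto simp: I_def c_seg_Suc[OF ds])
  next
    case (3 t' s')
    note [simp] = frD[OF 3(2)]
    from 3(1,3) have "sc s' 27 = hi" by (simp add: I_def)
    with 3(1) show ?case by (simp add: I_def)
  qed
qed

lemma NEWCH_writes [simp]:
  "x < 40 \<Longrightarrow> nv (NEWCH b p r) x \<longleftrightarrow> x \<noteq> 4" "a < 16 \<Longrightarrow> na (NEWCH b p r) a \<longleftrightarrow> a \<notin> {3, 4, 7, 8, 9, 10, 11, 12, 13}"
  "nrv (NEWCH b p r) x" "nrw (NEWCH b p r)"
  by (auto simp: NEWCH_def)

lemma wp_NEWCH:
  assumes "x \<in> {18, 19, 30}" "y \<in> {18, 19, 30}" "sc s 4 + 1 \<le> IB" "ar s 13 (sc s 22) < h" "sc s 22 \<le> sc s 4"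
  shows "wp z (NEWCH b x y) (\<lambda>t' s'. t' \<le> t + 200 \<and> (let q = sc s 22; c = sc s 4 + 1; m = sc s y - sc s x; B = ar s 8 q in
     sc s' 4 = c \<and> ar s' 3 = (ar s 3)(2 * q + b := c) \<and> ar s' 11 = (ar s 11)(c := sc s x) \<and> ar s' 12 = (ar s 12)(c := sc s y) \<and>
     ar s' 13 = (ar s 13)(c := ar s 13 q + 1) \<and> ar s' 4 = (ar s 4)(c := 0) \<and> ar s' 9 = (ar s 9)(c := 0) \<and> ar s' 10 = (ar s 10)(c := 0) \<and>
     ar s' 7 = (ar s 7)(c := (if B < 2 * m then 1 else 0)) \<and> ar s' 8 = (ar s 8)(c := (if B < 2 * m then B else m)))) t s"
proof -
  have [simp]: "x < 40" "y < 40" "x \<noteq> 4" "y \<noteq> 4" "bdv x = IB" "bdv y = IB" "sc s 22 \<noteq> sc s 4 + 1" "sc s 22 \<noteq> Suc (sc s 4)"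
    using assms by auto
  show ?thesis unfolding NEWCH_def using assms(3,4) by (simp add: Let_def mult_2[of "sc s 22", symmetric])
qed

definition best_inv :: "(nat \<Rightarrow> nat \<Rightarrow> real) \<Rightarrow> nat set \<Rightarrow> state \<Rightarrow> bool" where
  "best_inv G X s \<longleftrightarrow>
     (sc s 29 = 0 \<and> rv s 3 = 4 * \<epsilon> * real (card X)) \<or>
     (\<exists>j. sc s 29 = Suc j \<and> j < d \<and> 4 * \<epsilon> * real (card X) < rv s 3 \<and> rv s 3 = sco G X j (rv s 4) \<and>
        sc s 30 = sc s 18 + card (lft G X j (rv s 4)))"

definition covered :: "(nat \<Rightarrow> nat \<Rightarrow> real) \<Rightarrow> nat set \<Rightarrow> state \<Rightarrow> nat \<Rightarrow> bool" where
  "covered G X s n \<longleftrightarrow> (\<forall>j < n. \<forall>t. sco G X j t \<le> rv s 3)"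

lemma CAND_writes [simp]:
  "x < 40 \<Longrightarrow> nv CAND x \<longleftrightarrow> x \<notin> {29, 30}" "a < 16 \<Longrightarrow> na CAND a" "x < 8 \<Longrightarrow> nrv CAND x \<longleftrightarrow> x \<notin> {3, 4, 5}" "nrw CAND"
  by (auto simp: CAND_def)

lemma FEAT_writes [simp]:
  "x < 40 \<Longrightarrow> nv FEAT x \<longleftrightarrow> x \<notin> {6, 7, 8, 9, 10, 11, 12, 13, 14, 15, 16, 17, 20, 25, 26, 27, 28, 29, 30, 31}"
  "a < 16 \<Longrightarrow> na FEAT a \<longleftrightarrow> a \<noteq> 0 \<and> a \<noteq> 2" "x < 8 \<Longrightarrow> nrv FEAT x \<longleftrightarrow> x \<notin> {3, 4, 5}" "nrw FEAT"
  by (auto simp: FEAT_def)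

lemma best_inv_nonneg: "best_inv G X s \<Longrightarrow> 0 \<le> rv s 3"
proof -
  assume "best_inv G X s"
  then have "4 * \<epsilon> * real (card X) \<le> rv s 3" by (auto simp: best_inv_def)
  moreover have "0 \<le> 4 * \<epsilon> * real (card X)" using eps0 by simp
  ultimately show "0 \<le> rv s 3" by linarith
qed

text \<open>One sort and one scan cover all real thresholds: a threshold either leaves one side
  empty and scores 0, or induces the same left side as one of the candidates of the scan.\<close>

lemma wp_FEAT:
  assumes j: "sc s 28 < d" and le: "sc s 18 \<le> sc s 19" "2 * sc s 19 \<le> IB" "sc s 19 - sc s 18 \<le> 2 ^ L"
    and ds: "distinct (seg (ar s 0) (sc s 18) (sc s 19))" and X: "X = set (seg (ar s 0) (sc s 18) (sc s 19))"
    and G: "G = rw s" and n: "sc s 23 = c0 G X" "sc s 24 = c1 G X"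
    and best: "best_inv G X s" "covered G X s (sc s 28)"
  shows "wp z FEAT (\<lambda>t' s'. t' \<le> t + 5000 * (sc s 19 - sc s 18 + 1) * (L + 1) \<and>
      mset (seg (ar s' 0) (sc s 18) (sc s 19)) = mset (seg (ar s 0) (sc s 18) (sc s 19)) \<and>
      (\<forall>i. i < sc s 18 \<or> sc s 19 \<le> i \<longrightarrow> ar s' 0 i = ar s 0 i) \<and>
      best_inv G X s' \<and> covered G X s' (Suc (sc s 28)) \<and> sc s' 28 = Suc (sc s 28)) t s"
proof -
  define lo hi j where defs: "lo = sc s 18" "hi = sc s 19" "j = sc s 28"
  note [simp] = defs[symmetric] G[symmetric]
  have le': "lo \<le> hi" "2 * hi \<le> IB" "hi - lo \<le> 2 ^ L" "j < d" using le j by simp_all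
  have finX [simp]: "finite X" using X by simp
  show ?thesis unfolding FEAT_def
    apply (simp add: le' j)
    apply (rule conjI)
    subgoal using le' by (simp add: disjI2)
    apply (rule wp_mono[OF wp_SORT[where L = L]])
    using le' apply (simp_all)[6]
  proof goal_cases
    case (1 t1 s1)
    note fr1 = frD[OF 1(2)]
    note [simp] = fr1
    define P where "P = ar s1 0"
    note [simp] = P_def[symmetric]
    from 1(1) have t1: "t1 \<le> t + 12 + 4000 * (hi - lo + 1) * (L + 1)"
      and ms: "mset (seg P lo hi) = mset (seg (ar s 0) lo hi)"
      and srt': "sorted (map (key G j (Suc j)) (seg P lo hi))"
      and out: "\<And>i. i < lo \<or> hi \<le> i \<Longrightarrow> P i = ar s 0 i"
      by auto
    have dP: "distinct (seg P lo hi)" and setP: "set (seg P lo hi) = X"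
      using ms ds X by (metis defs(1,2) mset_eq_imp_distinct_iff, metis defs(1,2) mset_eq_setD)
    have cX: "card X = hi - lo" using dP setP by (metis distinct_card length_seg)
    have srt: "G (P a) j \<le> G (P b) j" if "lo \<le> a" "a \<le> b" "b < hi" for a b
      using sorted_key_single[OF srt' that] .
    have pre: "lft G X j t = set (seg P lo p)" "card (lft G X j t) = p - lo"
      if "lo \<le> p" "p \<le> hi" "\<And>a. lo \<le> a \<Longrightarrow> a < p \<Longrightarrow> G (P a) j \<le> t" "p < hi \<Longrightarrow> t < G (P p) j" for p t
    proof -
      show e: "lft G X j t = set (seg P lo p)" using prefix_split(1)[of lo hi G P j p t] srt that setP by auto
      have "distinct (seg P lo p)" using dP seg_append[OF that(1,2), of P] by simp
      then show "card (lft G X j t) = p - lo" unfolding e by (simp add: distinct_card)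
    qed
    define I where "I = (\<lambda>t' s'. lo \<le> sc s' 27 \<and> sc s' 27 \<le> hi \<and> (sc s' 27 = lo \<or> sc s' 27 < hi) \<and>
       t' \<le> t1 + 20 + 250 * (sc s' 27 - lo) \<and>
       sc s' 25 = c0 G (set (seg P lo (sc s' 27))) \<and> sc s' 26 = c1 G (set (seg P lo (sc s' 27))) \<and>
       best_inv G X s' \<and> covered G X s' j \<and>
       (\<forall>p. lo < p \<and> p \<le> sc s' 27 \<and> G (P (p - 1)) j < G (P p) j \<longrightarrow> sco G X j (G (P (p - 1)) j) \<le> rv s' 3))"
    show ?case
      apply simp
      apply (rule wp_while[where I = I and \<mu> = "\<lambda>s. hi - sc s 27"])
    proof goal_cases
      case 1
      have "best_inv G X (setv (setv (setv s1 25 0) 26 0) 27 lo) = best_inv G X s"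
        "covered G X (setv (setv (setv s1 25 0) 26 0) 27 lo) j = covered G X s j"
        by (simp_all add: best_inv_def covered_def)
      then show ?case using best le' by (simp add: I_def)
    next
      case (2 t2 s2)
      note [simp] = frD[OF 2(2)]
      define i where "i = sc s2 27"
      note [simp] = i_def[symmetric]
      from 2(1,3) have I: "lo \<le> i" "Suc i < hi" "t2 \<le> t1 + 20 + 250 * (i - lo)"
        "sc s2 25 = c0 G (set (seg P lo i))" "sc s2 26 = c1 G (set (seg P lo i))" "best_inv G X s2" "covered G X s2 j"
        "\<And>p. lo < p \<Longrightarrow> p \<le> i \<Longrightarrow> G (P (p - 1)) j < G (P p) j \<Longrightarrow> sco G X j (G (P (p - 1)) j) \<le> rv s2 3"
        by (auto simp: I_def)
      have b: "c0 G (set (seg P lo i)) \<le> i - lo" "c1 G (set (seg P lo i)) \<le> i - lo"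
        using c_le_length[of G "seg P lo i"] by simp_all
      define l0 l1 where l: "l0 = c0 G (set (seg P lo (Suc i)))" "l1 = c1 G (set (seg P lo (Suc i)))"
      have lS: "l0 = c0 G (set (seg P lo i)) + of_bool (\<not> 0 < G (P i) d)" "l1 = c1 G (set (seg P lo i)) + of_bool (0 < G (P i) d)"
        using c_seg_Suc[OF dP, of i G] I by (simp_all add: l)
      have fin: "I t3 s3" if
        "t3 \<le> t2 + 240" "sc s3 27 = Suc i" "sc s3 25 = l0" "sc s3 26 = l1" "sc s3 18 = lo"
        "best_inv G X s3" "rv s2 3 \<le> rv s3 3" "G (P i) j < G (P (Suc i)) j \<Longrightarrow> sco G X j (G (P i) j) \<le> rv s3 3" for t3 s3
      proof -
        have "covered G X s3 j" using I(7) that(7) by (auto simp: covered_def intro: order_trans)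
        moreover have "sco G X j (G (P (p - 1)) j) \<le> rv s3 3" if "lo < p" "p \<le> Suc i" "G (P (p - 1)) j < G (P p) j" for p
        proof (cases "p = Suc i")
          case True
          with that(3) show ?thesis using \<open>G (P i) j < G (P (Suc i)) j \<Longrightarrow> _\<close> by simp
        next
          case False
          then show ?thesis using I(8)[of p] that \<open>rv s2 3 \<le> rv s3 3\<close> by simp
        qed
        ultimately show ?thesis using that I by (simp add: I_def l)
      qed
      have fin_same: "I t3 s3" if
        "t3 \<le> t2 + 240" "sc s3 27 = Suc i" "sc s3 25 = l0" "sc s3 26 = l1" "sc s3 18 = lo" "sc s3 29 = sc s2 29" "sc s3 30 = sc s2 30"
        "rv s3 3 = rv s2 3" "rv s3 4 = rv s2 4" "G (P i) j < G (P (Suc i)) j \<Longrightarrow> sco G X j (G (P i) j) \<le> rv s2 3" for t3 s3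
      proof (rule fin)
        show "best_inv G X s3" using I(6) that by (simp add: best_inv_def)
      qed (use that in auto)
      have sc_eq: "sco G X j (G (P i) j) = wf (real (c0 G X)) (real (c1 G X)) - wf (real l0) (real l1)
          - wf (real (c0 G X - l0)) (real (c1 G X - l1))" and cl: "card (lft G X j (G (P i) j)) = Suc i - lo"
        if "G (P i) j < G (P (Suc i)) j"
      proof -
        have a: "lft G X j (G (P i) j) = set (seg P lo (Suc i))" "card (lft G X j (G (P i) j)) = Suc i - lo"
          using pre[of "Suc i" "G (P i) j"] I srt that by auto
        then show "card (lft G X j (G (P i) j)) = Suc i - lo" by simp
        show "sco G X j (G (P i) j) = wf (real (c0 G X)) (real (c1 G X)) - wf (real l0) (real l1)
          - wf (real (c0 G X - l0)) (real (c1 G X - l1))"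
          unfolding sco_counts[OF finX] a l ..
      qed
      have fin_new: "I t3 s3" if
        "t3 \<le> t2 + 240" "sc s3 27 = Suc i" "sc s3 25 = l0" "sc s3 26 = l1" "sc s3 18 = lo" "sc s3 29 = Suc j" "sc s3 30 = Suc i"
        "rv s3 3 = sco G X j (G (P i) j)" "rv s3 4 = G (P i) j" "rv s2 3 < sco G X j (G (P i) j)" "G (P i) j < G (P (Suc i)) j" for t3 s3
      proof (rule fin)
        have "4 * \<epsilon> * real (card X) \<le> rv s2 3" using I(6) by (auto simp: best_inv_def)
        then show "best_inv G X s3" using that le' cl I(1) by (auto simp: best_inv_def)
      qed (use that in auto)
      have m: "hi - Suc i < hi - i" using I by simp
      have step: "wp z CAND (\<lambda>t'' s''. I t'' s'' \<and> hi - sc s'' 27 < hi - i) t3 s3"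
        if "t3 \<le> t2 + 80" "sc s3 27 = Suc i" "sc s3 25 = l0" "sc s3 26 = l1" "sc s3 18 = lo" "sc s3 31 = P i"
          "sc s3 28 = j" "sc s3 23 = c0 G X" "sc s3 24 = c1 G X" "sc s3 29 = sc s2 29" "sc s3 30 = sc s2 30"
          "rv s3 = rv s2" "rw s3 = G" "ar s3 0 = P" for t3 s3
      proof (cases "G (P i) j < G (P (Suc i)) j")
        case c: True
        show ?thesis
        proof (cases "rv s2 3 < sco G X j (G (P i) j)")
          case True
          note b' = True[unfolded sc_eq[OF c]]
          show ?thesis using that le' I(2) m
            by (simp add: c b' CAND_def) (intro fin_new, simp_all add: sc_eq[OF c] c b')
        next
          case False
          note b' = False[unfolded sc_eq[OF c]]
          show ?thesis using that le' I(2) m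
            by (simp add: c b' CAND_def) (intro fin_same, simp_all add: sc_eq[OF c] c b' not_less[symmetric])
        qed
      next
        case False
        then show ?thesis using that le' m by (simp add: CAND_def) (intro fin_same, simp_all)
      qed
      show ?case using I(1,2,4,5) b le' lS n by (auto intro!: step)
    next
      case (3 t2 s2)
      note [simp] = frD[OF 3(2)]
      define i where "i = sc s2 27"
      note [simp] = i_def[symmetric]
      from 3(1,3) have I: "lo \<le> i" "i \<le> hi" "hi \<le> Suc i" "t2 \<le> t1 + 20 + 250 * (i - lo)"
        "best_inv G X s2" "covered G X s2 j"
        "\<And>p. lo < p \<Longrightarrow> p \<le> i \<Longrightarrow> G (P (p - 1)) j < G (P p) j \<Longrightarrow> sco G X j (G (P (p - 1)) j) \<le> rv s2 3"
        by (auto simp: I_def)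
      \<comment> \<open>The threshold cuts the sorted segment at some \<open>p\<close>. At an end of
        the segment the split is trivial. Otherwise the feature strictly increases at
        \<open>p\<close>, and the value just before \<open>p\<close> has the same left side, hence
        the same score.\<close>
      have "sco G X j th \<le> rv s2 3" for th
      proof -
        obtain p where p: "lo \<le> p" "p \<le> hi" "\<And>a. lo \<le> a \<Longrightarrow> a < p \<Longrightarrow> G (P a) j \<le> th" "p < hi \<Longrightarrow> th < G (P p) j"
          using threshold_prefix[of lo hi G P j th] srt le'(1) by blast
        show ?thesis
        proof (cases "p = lo \<or> p = hi")
          case True
          have "set (seg P lo hi) = X" by (rule setP)
          then have "lft G X j th = {} \<or> rgt G X j th = {}"
            using True prefix_split[of lo hi G P j p th] srt p by auto
          then show ?thesis using sco_trivial best_inv_nonneg[OF I(5)] by simp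
        next
          case False
          then have p': "lo < p" "p < hi" using p by auto
          have lt: "G (P (p - 1)) j < G (P p) j" using p(3)[of "p - 1"] p(4) p' by force
          have "lft G X j (G (P (p - 1)) j) = set (seg P lo p)"
            using p' lt srt by (intro pre) auto
          moreover have "lft G X j th = set (seg P lo p)" using pre(1)[OF p] .
          ultimately have "lft G X j th = lft G X j (G (P (p - 1)) j)" by simp
          then have "sco G X j th = sco G X j (G (P (p - 1)) j)" by (simp add: sco_counts)
          then show ?thesis using I(7)[of p] p' lt I by simp
        qed
      qed
      then have "covered G X s2 (Suc j)" using I(6) by (auto simp: covered_def less_Suc_eq)
      moreover have "best_inv G X (setv s2 28 (Suc j)) = best_inv G X s2"
        "covered G X (setv s2 28 (Suc j)) (Suc j) = covered G X s2 (Suc j)"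
        by (simp_all add: best_inv_def covered_def)
      moreover have "t2 + 30 \<le> t + 5000 * (hi - lo + 1) * (L + 1)"
      proof -
        define M where "M = (hi - lo + 1) * (L + 1)"
        have "i - lo + 1 \<le> M" using I(1,2) by (simp add: M_def)
        moreover have "t1 \<le> t + 12 + 4000 * M" using t1 by (simp only: M_def mult.assoc)
        ultimately show ?thesis using I(4) by (simp only: M_def[symmetric] mult.assoc)
      qed
      ultimately show ?case using I(5) le' ms out by auto
    qed
  qed
qed

lemma NODE_writes [simp]:
  "x < 40 \<Longrightarrow> nv NODE x \<longleftrightarrow> x \<notin> {4, 6, 7, 8, 9, 10, 11, 12, 13, 14, 15, 16, 17, 18, 19, 20, 23, 24, 25, 26, 27, 28, 29, 30, 31}"
  "a < 16 \<Longrightarrow> na NODE a \<longleftrightarrow> a \<notin> {0, 2, 3, 4, 5, 6, 7, 8, 9, 10, 11, 12, 13}" "x < 8 \<Longrightarrow> nrv NODE x \<longleftrightarrow> x \<notin> {3, 4, 5}"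
  by (auto simp: NODE_def)

text \<open>The decision made on the set present while the node is built, with a tolerance of
  4\<epsilon> in the gain. Feasibility tolerates more than 12.5\<epsilon>; the gap absorbs later
  changes of the set.\<close>

definition leaf_cond :: "(nat \<Rightarrow> nat \<Rightarrow> real) \<Rightarrow> nat set \<Rightarrow> nat \<Rightarrow> bool" where
  "leaf_cond G X e \<longleftrightarrow> card X \<le> k \<or> h \<le> e \<or> (\<forall>j < d. \<forall>t. sco G X j t \<le> 4 * \<epsilon> * real (card X))"

definition split_cond :: "(nat \<Rightarrow> nat \<Rightarrow> real) \<Rightarrow> nat set \<Rightarrow> nat \<Rightarrow> nat \<Rightarrow> real \<Rightarrow> bool" where
  "split_cond G X e j t \<longleftrightarrow> k < card X \<and> e < h \<and> j < d \<and> 4 * \<epsilon> * real (card X) < sco G X j t \<and>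
     (\<forall>j' < d. \<forall>t'. sco G X j' t' \<le> sco G X j t)"

text \<open>The effect is spelled out array by array, so that everything outside the processed node,
  its segment and its new children is seen to be unchanged by mere evaluation.\<close>

definition node_post :: "state \<Rightarrow> state \<Rightarrow> bool" where
  "node_post s s' \<longleftrightarrow> (let q = sc s 22; lo = ar s 11 q; hi = ar s 12 q; X = set (seg (ar s 0) lo hi); G = rw s;
       F = sc s 4; e = ar s 13 q; B = ar s 8 q in
     mset (seg (ar s' 0) lo hi) = mset (seg (ar s 0) lo hi) \<and> (\<forall>i. i < lo \<or> hi \<le> i \<longrightarrow> ar s' 0 i = ar s 0 i) \<and>
     ar s' 5 = (ar s 5)(q := c0 G X) \<and> ar s' 6 = (ar s 6)(q := c1 G X) \<and>
     (leaf_cond G X e \<and> sc s' 4 = F \<and> ar s' 4 = (ar s 4)(q := 0) \<and> ar s' 3 = ar s 3 \<and> ar s' 7 = ar s 7 \<and> ar s' 8 = ar s 8 \<and>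
        ar s' 9 = ar s 9 \<and> ar s' 10 = ar s 10 \<and> ar s' 11 = ar s 11 \<and> ar s' 12 = ar s 12 \<and> ar s' 13 = ar s 13 \<and> rw s' = rw s \<or>
      (\<exists>j t mid. lo \<le> mid \<and> mid \<le> hi \<and> split_cond G X e j t \<and>
        set (seg (ar s' 0) lo mid) = lft G X j t \<and> set (seg (ar s' 0) mid hi) = rgt G X j t \<and>
        sc s' 4 = F + 2 \<and> ar s' 4 = (ar s 4)(q := Suc j, F + 1 := 0, F + 2 := 0) \<and>
        ar s' 3 = (ar s 3)(2 * q := F + 1, 2 * q + 1 := F + 2) \<and>
        ar s' 7 = (ar s 7)(F + 1 := (if B < 2 * (mid - lo) then 1 else 0), F + 2 := (if B < 2 * (hi - mid) then 1 else 0)) \<and>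
        ar s' 8 = (ar s 8)(F + 1 := (if B < 2 * (mid - lo) then B else mid - lo), F + 2 := (if B < 2 * (hi - mid) then B else hi - mid)) \<and>
        ar s' 9 = (ar s 9)(F + 1 := 0, F + 2 := 0) \<and> ar s' 10 = (ar s 10)(F + 1 := 0, F + 2 := 0) \<and>
        ar s' 11 = (ar s 11)(F + 1 := lo, F + 2 := mid) \<and> ar s' 12 = (ar s 12)(F + 1 := mid, F + 2 := hi) \<and>
        ar s' 13 = (ar s 13)(F + 1 := e + 1, F + 2 := e + 1) \<and>
        rw s' = (rw s)(q := (rw s q)(d + 2 := t)))))"

lemma wp_NODE:
  assumes le: "ar s 11 (sc s 22) \<le> ar s 12 (sc s 22)" "2 * ar s 12 (sc s 22) \<le> IB"
    and L: "ar s 12 (sc s 22) - ar s 11 (sc s 22) \<le> 2 ^ L"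
    and ds: "distinct (seg (ar s 0) (ar s 11 (sc s 22)) (ar s 12 (sc s 22)))"
    and F: "sc s 22 \<le> sc s 4" "sc s 4 + 2 \<le> IB" and eps: "rv s 2 = \<epsilon>"
  shows "wp z NODE (\<lambda>t' s'. t' \<le> t + 20000 * (d * ((ar s 12 (sc s 22) - ar s 11 (sc s 22) + 1) * (L + 1))) \<and> node_post s s') t s"
proof -
  define q lo hi P G X where defs: "q = sc s 22" "lo = ar s 11 q" "hi = ar s 12 q" "P = ar s 0" "G = rw s" "X = set (seg P lo hi)"
  define M where "M = (hi - lo + 1) * (L + 1)"
  note [simp] = defs(1-5)[symmetric]
  have le': "lo \<le> hi" "2 * hi \<le> IB" "hi - lo \<le> 2 ^ L" using le L by simp_all
  have dP: "distinct (seg P lo hi)" using ds by simp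
  have cX: "card X = hi - lo" using dP by (simp add: defs(6) distinct_card)
  have finX [simp]: "finite X" by (simp only: defs(6) finite_set)
  have X: "set (seg P lo hi) = X" by (rule defs(6)[symmetric])
  have M: "hi - lo + 1 \<le> M" "1 \<le> M" by (simp_all add: M_def)
  have dM: "M \<le> d * M" using d1 by simp
  have perm: "set (seg A lo hi) = X" "distinct (seg A lo hi)" if "mset (seg A lo hi) = mset (seg P lo hi)" for A :: "nat \<Rightarrow> nat"
    using mset_eq_setD[OF that] mset_eq_imp_distinct_iff[OF that] dP X by simp_all
  have m5: "c0 G X \<le> IB" "c1 G X \<le> IB"
    using c_sum[OF finX, of G] cX le' by linarith+
  have "wp z NODE (\<lambda>t' s'. t' \<le> t + 20000 * (d * M) \<and> node_post s s') t s" unfolding NODE_def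
    apply simp
    apply (rule wp_mono[OF wp_COUNT])
    using le' dP apply (simp_all)[3]
  proof goal_cases
    case (1 t1 s1)
    note [simp] = frD[OF 1(2)]
    from 1(1) have s1: "t1 \<le> t + 130 + 100 * (hi - lo)" "sc s1 23 = c0 G X" "sc s1 24 = c1 G X" by (auto simp: X)
    define Q where "Q = (\<lambda>t' s'. t' \<le> t + 20000 * (d * M) \<and> node_post s s')"
    show ?case
    proof (cases "k < hi - lo \<and> ar s 13 q < h")
      case False
      then have "leaf_cond G X (ar s 13 q)" by (auto simp: leaf_cond_def cX)
      moreover have "t1 + 60 \<le> t + 20000 * (d * M)" using s1(1) M dM by linarith
      ultimately show ?thesis using False s1
        by (auto simp: node_post_def X)
    next
      case True
      define I where "I = (\<lambda>t' s'. sc s' 28 \<le> d \<and> t' \<le> t1 + 150 + (5000 * M + 10) * sc s' 28 \<and>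
        mset (seg (ar s' 0) lo hi) = mset (seg P lo hi) \<and> (\<forall>i. i < lo \<or> hi \<le> i \<longrightarrow> ar s' 0 i = P i) \<and>
        best_inv G X s' \<and> covered G X s' (sc s' 28))"
      show ?thesis
        apply (simp add: True)
        apply (rule wp_while[where I = I and \<mu> = "\<lambda>s. d - sc s 28"])
      proof goal_cases
        case 1
        show ?case using eps s1 cX by (simp add: I_def best_inv_def covered_def)
      next
        case (2 t2 s2)
        note [simp] = frD[OF 2(2)]
        define j where "j = sc s2 28"
        note [simp] = j_def[symmetric]
        from 2(1,3) have I: "j < d" "t2 \<le> t1 + 150 + (5000 * M + 10) * j"
          "mset (seg (ar s2 0) lo hi) = mset (seg P lo hi)" "\<And>i. i < lo \<or> hi \<le> i \<Longrightarrow> ar s2 0 i = P i"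
          "best_inv G X s2" "covered G X s2 j" by (auto simp: I_def)
        have "wp z FEAT (\<lambda>t'' s''. I t'' s'' \<and> d - sc s'' 28 < d - j) (t2 + 5) s2"
          apply (rule wp_mono[OF wp_FEAT[where L = L and X = X and G = G]])
          using le' I perm[OF I(3)] s1 apply (simp_all)[11]
          subgoal premises p for t3 s3
          proof -
            from p(1) have t3: "t3 \<le> t2 + 5 + 5000 * M" by (simp add: M_def algebra_simps)
            then have "t3 \<le> t1 + 150 + (5000 * M + 10) * Suc j" using I(2) by simp
            then show ?thesis using p(1) I by (auto simp: I_def)
          qed
          done
        then show ?case by simp
      next
        case (3 t2 s2)
        note [simp] = frD[OF 3(2)]
        from 3(1,3) have j: "sc s2 28 = d" by (simp add: I_def)
        from 3(1) have I: "t2 \<le> t1 + 150 + (5000 * M + 10) * d"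
          "mset (seg (ar s2 0) lo hi) = mset (seg P lo hi)" "\<And>i. i < lo \<or> hi \<le> i \<Longrightarrow> ar s2 0 i = P i"
          "best_inv G X s2" "covered G X s2 d" by (auto simp: I_def j)
        have dd: "1 \<le> d * M" "d \<le> d * M" using d1 M by simp_all
        have t2: "t2 + 4000 * M + 600 \<le> t + 20000 * (d * M)"
        proof -
          have "(5000 * M + 10) * d = 5000 * (d * M) + 10 * d" by (simp add: algebra_simps)
          then have "t2 \<le> t + 280 + 100 * M + 5000 * (d * M) + 10 * d" using I(1) s1(1) M by linarith
          then show ?thesis using dd dM M by linarith
        qed
        show ?case
        proof (cases "sc s2 29")
          case 0
          then have "rv s2 3 = 4 * \<epsilon> * real (card X)" using I(4) by (auto simp: best_inv_def)
          with I(5) have "leaf_cond G X (ar s 13 q)" by (auto simp: leaf_cond_def covered_def)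
          then show ?thesis using 0 I s1 t2 by (auto simp: node_post_def X)
        next
          case (Suc j)
          define th mid where th: "th = rv s2 4" "mid = sc s2 30"
          from Suc I(4) have b: "j < d" "4 * \<epsilon> * real (card X) < rv s2 3" "rv s2 3 = sco G X j th"
            "mid = lo + card (lft G X j th)" by (auto simp: best_inv_def th)
          have mid: "lo \<le> mid" "mid \<le> hi"
            using b(4) card_mono[OF finX lft_sub, of G j th] cX le' by auto
          have spl: "split_cond G X (ar s 13 q) j th"
            using True b I(5) cX by (auto simp: split_cond_def covered_def)
          show ?thesis
            apply (simp add: Suc b(1) le' less_imp_le)
            apply (rule wp_mono[OF wp_SORT[where L = L]])
            using b(1) le' apply (simp_all)[6]
            subgoal premises p for t3 s3
            proof -
              note [simp] = frD[OF p(2)]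
              have s3: "mset (seg (ar s3 0) lo hi) = mset (seg P lo hi)" "\<And>i. i < lo \<or> hi \<le> i \<Longrightarrow> ar s3 0 i = P i"
                "sorted (map (key G j (Suc j)) (seg (ar s3 0) lo hi))"
                using p(1) I by auto
              have t3: "t3 \<le> t2 + 30 + 4000 * M" using p(1) by (simp add: M_def algebra_simps)
              obtain r where r: "lo \<le> r" "r \<le> hi" "\<And>a. lo \<le> a \<Longrightarrow> a < r \<Longrightarrow> G (ar s3 0 a) j \<le> th" "r < hi \<Longrightarrow> th < G (ar s3 0 r) j"
                using threshold_prefix[of lo hi G "ar s3 0" j th] sorted_key_single[OF s3(3)] le'(1) by blast
              have lr: "lft G X j th = set (seg (ar s3 0) lo r)" "rgt G X j th = set (seg (ar s3 0) r hi)"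
                using prefix_split[of lo hi G "ar s3 0" j r th] sorted_key_single[OF s3(3)] r perm(1)[OF s3(1)] by auto
              have "distinct (seg (ar s3 0) lo r)" using perm(2)[OF s3(1)] seg_append[OF r(1,2), of "ar s3 0"] by simp
              \<comment> \<open>Scalar 30 was recorded while the segment had a different order. It
                is still the right cut, because it equals \<open>lo\<close> plus the size of the
                left side, which no permutation changes.\<close>
              then have rm: "r = mid" using b(4) lr r by (simp add: distinct_card)
              have qF: "q \<le> sc s 4" "sc s 4 + 2 \<le> IB" using F by simp_all
              show ?thesis
                apply (simp add: qF True)
                apply (rule wp_mono[OF wp_NEWCH])
                using qF True apply (simp_all)[5]
                subgoal premises p4 for t4 s4
                proof -
                  note [simp] = frD[OF p4(2)]
                  note s4 = p4(1)[unfolded Let_def, simplified]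
                  show ?thesis
                    apply (rule wp_mono[OF wp_NEWCH])
                    using s4 qF True apply (simp_all)[5]
                    subgoal premises p5 for t5 s5
                    proof -
                      note [simp] = frD[OF p5(2)]
                      note s5 = p5(1)[unfolded Let_def, simplified]
                      note s3' = s3(1,2)[unfolded rm] lr[unfolded rm, symmetric]
                      have time: "t5 \<le> t + 20000 * (d * M)" using s5(1) s4(1) t3 t2 by simp
                      have qn: "q \<noteq> Suc (sc s 4)" using qF by simp
                      have a: "sc s5 4 = sc s 4 + 2" "ar s5 0 = ar s3 0"
                        "ar s5 5 = (ar s 5)(q := c0 G X)" "ar s5 6 = (ar s 6)(q := c1 G X)"
                        "ar s5 4 = (ar s 4)(q := Suc j, sc s 4 + 1 := 0, sc s 4 + 2 := 0)"
                        "ar s5 3 = (ar s 3)(2 * q := sc s 4 + 1, 2 * q + 1 := sc s 4 + 2)"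
                        using s5 s4 s1 by (simp_all add: Suc)
                      have b: "ar s5 7 = (ar s 7)(sc s 4 + 1 := (if ar s 8 q < 2 * (mid - lo) then 1 else 0), sc s 4 + 2 := (if ar s 8 q < 2 * (hi - mid) then 1 else 0))"
                        "ar s5 8 = (ar s 8)(sc s 4 + 1 := (if ar s 8 q < 2 * (mid - lo) then ar s 8 q else mid - lo), sc s 4 + 2 := (if ar s 8 q < 2 * (hi - mid) then ar s 8 q else hi - mid))"
                        "ar s5 9 = (ar s 9)(sc s 4 + 1 := 0, sc s 4 + 2 := 0)" "ar s5 10 = (ar s 10)(sc s 4 + 1 := 0, sc s 4 + 2 := 0)"
                        using s5 s4 qn by (simp_all add: th cong: if_cong)
                      have c: "ar s5 11 = (ar s 11)(sc s 4 + 1 := lo, sc s 4 + 2 := mid)" "ar s5 12 = (ar s 12)(sc s 4 + 1 := mid, sc s 4 + 2 := hi)"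
                        "ar s5 13 = (ar s 13)(sc s 4 + 1 := ar s 13 q + 1, sc s 4 + 2 := ar s 13 q + 1)"
                        "rw s5 = (rw s)(q := (rw s q)(d + 2 := th))"
                        using s5 s4 qn by (simp_all add: th cong: if_cong)
                      have "node_post s s5"
                        unfolding node_post_def Let_def defs(1-5)[symmetric] X a b c
                        using s3' mid spl by blast
                      with time show ?thesis by simp
                    qed
                    done
                qed
                done
            qed
            done
        qed
      qed
    qed
  qed
  then show ?thesis by (simp add: M_def)
qed

end

section \<open>Building a tree in level order\<close>

text \<open>Trees labelled with the addresses of their nodes.\<close>

datatype sk = SL nat | SN nat sk sk

primrec root :: "sk \<Rightarrow> nat" where
  "root (SL v) = v"
| "root (SN v l r) = v"

primrec adrs :: "sk \<Rightarrow> nat list" where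
  "adrs (SL v) = [v]"
| "adrs (SN v l r) = v # adrs l @ adrs r"

primrec sh :: "sk \<Rightarrow> nat" where
  "sh (SL v) = 0"
| "sh (SN v l r) = Suc (max (sh l) (sh r))"

lemma root_in_adrs [simp]: "root T \<in> set (adrs T)"
  by (cases T) auto

context params
begin

text \<open>New children are appended behind all existing nodes, and the nodes are processed by
  increasing address. The interval from scalar 22 to scalar 4 is thus the queue of pending nodes and
  needs no storage of its own.\<close>

definition BUILD :: com where
  "BUILD = While (Not (WLess (Var 4) (Var 22))) (Seq NODE (Inc 22))"

definition START :: "wexp \<Rightarrow> com" where
  "START e = sqn [SetV 22 (WAdd (Var 34) (Lit 1)), SetA 11 (Var 22) (Var 21), SetA 12 (Var 22) (Var 22),
     SetA 13 (Var 22) e, SetA 9 (Var 22) (Lit 0), SetA 10 (Var 22) (Lit 0), SetA 7 (Var 22) (Lit 0),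
     SetA 8 (Var 22) (WSub (Var 22) (Var 21)), SetA 3 (Var 33) (Var 22), SetV 4 (Var 22), BUILD]"

end

context machine
begin

definition bnode :: "(nat \<Rightarrow> nat \<Rightarrow> nat) \<Rightarrow> nat \<Rightarrow> nat \<Rightarrow> nat \<Rightarrow> nat set \<Rightarrow> nat \<Rightarrow> nat \<Rightarrow> bool" where
  "bnode A v e B X lo hi \<longleftrightarrow> lo \<le> hi \<and> A 11 v = lo \<and> A 12 v = hi \<and> A 13 v = e \<and> A 9 v = 0 \<and> A 10 v = 0 \<and>
     distinct (seg (A 0) lo hi) \<and> set (seg (A 0) lo hi) = X \<and>
     (A 7 v = 0 \<and> A 8 v = hi - lo \<and> 2 * (hi - lo) \<le> B \<or> A 7 v = 1 \<and> A 8 v = B \<and> B < 2 * (hi - lo))"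

text \<open>While a tree is being built, the nodes from \<open>q\<close> on are pending leaves.\<close>

primrec BT :: "(nat \<Rightarrow> nat \<Rightarrow> nat) \<Rightarrow> (nat \<Rightarrow> nat \<Rightarrow> real) \<Rightarrow> nat \<Rightarrow> sk \<Rightarrow> nat \<Rightarrow> nat \<Rightarrow> nat set \<Rightarrow> nat \<Rightarrow> nat \<Rightarrow> bool" where
  "BT A G q (SL v) e B X lo hi \<longleftrightarrow> bnode A v e B X lo hi \<and>
     (v < q \<longrightarrow> A 4 v = 0 \<and> A 5 v = c0 G X \<and> A 6 v = c1 G X \<and> leaf_cond G X e)"
| "BT A G q (SN v l r) e B X lo hi \<longleftrightarrow> bnode A v e B X lo hi \<and> v < q \<and>
     A 3 (2 * v) = root l \<and> A 3 (2 * v + 1) = root r \<and>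
     (\<exists>j mid. A 4 v = Suc j \<and> split_cond G X e j (G v (d + 2)) \<and> lo \<le> mid \<and> mid \<le> hi \<and>
        BT A G q l (Suc e) (A 8 v) (lft G X j (G v (d + 2))) lo mid \<and>
        BT A G q r (Suc e) (A 8 v) (rgt G X j (G v (d + 2))) mid hi)"

lemma BT_root: "BT A G q T e B X lo hi \<Longrightarrow> bnode A (root T) e B X lo hi"
  by (cases T) auto

lemma bnode_card: "bnode A v e B X lo hi \<Longrightarrow> finite X \<and> card X = hi - lo"
  using distinct_card[of "seg (A 0) lo hi"] by (auto simp: bnode_def)

lemma split_cond_nonempty:
  assumes "split_cond G X e j t" "finite X"
  shows "0 < card (lft G X j t)" "0 < card (rgt G X j t)" "0 < card X"
proof -
  have "0 \<le> 4 * \<epsilon> * real (card X)" using eps0 by simp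
  then have "0 < sco G X j t" using assms(1) by (auto simp: split_cond_def)
  then show "0 < card (lft G X j t)" "0 < card (rgt G X j t)"
    using sco_le_sides[OF assms(2), of G j t] by auto
  then show "0 < card X" using card_lft_rgt[OF assms(2), of G j t] by simp
qed

lemma BT_pending:
  assumes "BT A G q T e B X lo hi" "q \<in> set (adrs T)"
  shows "lo \<le> A 11 q \<and> A 11 q \<le> A 12 q \<and> A 12 q \<le> hi \<and> distinct (seg (A 0) (A 11 q) (A 12 q))"
  using assms
proof (induction T arbitrary: e B X lo hi)
  case (SL v)
  then show ?case by (auto simp: bnode_def)
next
  case (SN v l r)
  then obtain j mid where m: "lo \<le> mid" "mid \<le> hi"
    "BT A G q l (Suc e) (A 8 v) (lft G X j (G v (d + 2))) lo mid"
    "BT A G q r (Suc e) (A 8 v) (rgt G X j (G v (d + 2))) mid hi" "v < q" by auto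
  from SN.prems(2) m(5) consider "q \<in> set (adrs l)" | "q \<in> set (adrs r)" by auto
  then show ?case
  proof cases
    case 1
    from SN.IH(1)[OF m(3) 1] m(2) show ?thesis by auto
  next
    case 2
    from SN.IH(2)[OF m(4) 2] m(1) show ?thesis by auto
  qed
qed

text \<open>Both sides of every split are nonempty, so a segment of length m yields at most max(1,
  m) leaves. The segments on one level are disjoint parts of the root's segment, so each of the
  \<open>sh T + 1\<close> levels contributes at most m.\<close>

lemma BT_size:
  "BT A G q T e B X lo hi \<Longrightarrow> length (adrs T) + 1 \<le> 2 * max 1 (hi - lo) \<and>
    (\<Sum>v\<leftarrow>adrs T. A 12 v - A 11 v) \<le> (sh T + 1) * (hi - lo)"
proof (induction T arbitrary: e B X lo hi)
  case (SL v)
  then show ?case by (simp add: bnode_def)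
next
  case (SN v l r)
  then obtain j mid where m: "lo \<le> mid" "mid \<le> hi" "split_cond G X e j (G v (d + 2))"
    "BT A G q l (Suc e) (A 8 v) (lft G X j (G v (d + 2))) lo mid"
    "BT A G q r (Suc e) (A 8 v) (rgt G X j (G v (d + 2))) mid hi" "bnode A v e B X lo hi" by auto
  have "finite X" using bnode_card[OF m(6)] by simp
  then have ne: "0 < mid - lo" "0 < hi - mid"
    using split_cond_nonempty[OF m(3)] bnode_card[OF BT_root[OF m(4)]] bnode_card[OF BT_root[OF m(5)]] by simp_all
  note IH = SN.IH(1)[OF m(4)] SN.IH(2)[OF m(5)]
  have "length (adrs (SN v l r)) + 1 \<le> 2 * max 1 (hi - lo)"
    using conjunct1[OF IH(1)] conjunct1[OF IH(2)] ne m(1,2) by simp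
  moreover have "(\<Sum>v\<leftarrow>adrs (SN v l r). A 12 v - A 11 v) \<le> (sh (SN v l r) + 1) * (hi - lo)"
  proof -
    define D where "D = max (sh l) (sh r) + 1"
    have "(\<Sum>v\<leftarrow>adrs l. A 12 v - A 11 v) \<le> D * (mid - lo)"
      by (rule order_trans[OF conjunct2[OF IH(1)]]) (intro mult_le_mono1, simp add: D_def)
    moreover have "(\<Sum>v\<leftarrow>adrs r. A 12 v - A 11 v) \<le> D * (hi - mid)"
      by (rule order_trans[OF conjunct2[OF IH(2)]]) (intro mult_le_mono1, simp add: D_def)
    moreover have "A 12 v - A 11 v = hi - lo" using m(6) by (simp add: bnode_def)
    moreover have "D * (mid - lo) + D * (hi - mid) = D * (hi - lo)"
      using m(1,2) by (simp only: distrib_left[symmetric]) simp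
    moreover have "(sh (SN v l r) + 1) * (hi - lo) = D * (hi - lo) + (hi - lo)" by (simp add: D_def)
    ultimately show ?thesis by simp
  qed
  ultimately show ?case by blast
qed

lemma cond_cong:
  assumes "\<And>i c. i \<in> X \<Longrightarrow> c \<le> d \<Longrightarrow> G' i c = G i c"
  shows "leaf_cond G' X e = leaf_cond G X e" "split_cond G' X e j t = split_cond G X e j t"
proof -
  have "j < d \<Longrightarrow> sco G' X j t = sco G X j t" for j t using assms by (intro agree_cong(6)) auto
  then show "leaf_cond G' X e = leaf_cond G X e" "split_cond G' X e j t = split_cond G X e j t"
    unfolding leaf_cond_def split_cond_def by auto
qed

lemma BT_frame:
  assumes "BT A G q T e B X lo hi" "q \<notin> set (adrs T)"
    and "\<And>a v. v \<in> set (adrs T) \<Longrightarrow> 4 \<le> a \<Longrightarrow> a \<le> 13 \<Longrightarrow> A' a v = A a v"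
    and "\<And>v. v \<in> set (adrs T) \<Longrightarrow> A' 3 (2 * v) = A 3 (2 * v) \<and> A' 3 (2 * v + 1) = A 3 (2 * v + 1)"
    and "\<And>i. lo \<le> i \<Longrightarrow> i < hi \<Longrightarrow> A' 0 i = A 0 i"
    and G: "\<And>i c. c \<le> d \<Longrightarrow> G' i c = G i c" "\<And>v. v \<in> set (adrs T) \<Longrightarrow> G' v (d + 2) = G v (d + 2)"
  shows "BT A' G' (Suc q) T e B X lo hi"
  using assms(1-5,7)
proof (induction T arbitrary: e B X lo hi)
  case (SL v)
  have "seg (A' 0) lo hi = seg (A 0) lo hi" by (rule seg_cong) (use SL in auto)
  with SL G show ?case by (auto simp: bnode_def agree_cong(1,2)[of X G' G] cond_cong[of X G' G])
next
  case (SN v l r)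
  then obtain j mid where m: "lo \<le> mid" "mid \<le> hi" "split_cond G X e j (G v (d + 2))" "A 4 v = Suc j"
    "BT A G q l (Suc e) (A 8 v) (lft G X j (G v (d + 2))) lo mid"
    "BT A G q r (Suc e) (A 8 v) (rgt G X j (G v (d + 2))) mid hi" "bnode A v e B X lo hi" "v < q" by auto
  have j: "j < d" using m(3) by (simp add: split_cond_def)
  have "seg (A' 0) lo hi = seg (A 0) lo hi" by (rule seg_cong) (use SN in auto)
  then have "bnode A' v e B X lo hi" using m(7) SN.prems(3)[of v] by (simp add: bnode_def)
  moreover have "BT A' G' (Suc q) l (Suc e) (A 8 v) (lft G X j (G v (d + 2))) lo mid"
    by (rule SN.IH(1)) (use m SN.prems in auto)
  moreover have "BT A' G' (Suc q) r (Suc e) (A 8 v) (rgt G X j (G v (d + 2))) mid hi"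
    by (rule SN.IH(2)) (use m SN.prems in auto)
  moreover have "lft G' X j t = lft G X j t" "rgt G' X j t = rgt G X j t" for t
    using agree_cong(4,5)[of X G' G j t] G j by auto
  ultimately show ?case using m SN.prems G cond_cong[of X G' G]
    by (auto intro!: exI[of _ j] exI[of _ mid])
qed

text \<open>What processing the node \<open>q\<close> leaves untouched.\<close>

lemma node_post_frame:
  assumes "node_post s s'" "q = sc s 22" "F = sc s 4" "q \<le> F"
  shows "\<And>a v. v \<noteq> q \<Longrightarrow> v \<le> F \<Longrightarrow> 4 \<le> a \<Longrightarrow> a \<le> 13 \<Longrightarrow> ar s' a v = ar s a v"
    "\<And>v. v \<noteq> q \<Longrightarrow> ar s' 3 (2 * v) = ar s 3 (2 * v) \<and> ar s' 3 (2 * v + 1) = ar s 3 (2 * v + 1)"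
    "\<And>i. i < ar s 11 q \<or> ar s 12 q \<le> i \<Longrightarrow> ar s' 0 i = ar s 0 i"
    "\<And>i c. i \<noteq> q \<or> c \<noteq> d + 2 \<Longrightarrow> rw s' i c = rw s i c"
    "\<And>a. 11 \<le> a \<Longrightarrow> a \<le> 12 \<Longrightarrow> ar s' a q = ar s a q"
    "F \<le> sc s' 4" "sc s' 4 \<le> F + 2"
proof -
  have c4: "a = 4 \<or> a = 5 \<or> a = 6 \<or> a = 7 \<or> a = 8 \<or> a = 9 \<or> a = 10 \<or> a = 11 \<or> a = 12 \<or> a = 13" if "4 \<le> a" "a \<le> 13" for a :: nat
    using that by presburger
  note np = assms(1)[unfolded node_post_def Let_def, folded assms(2,3)]
  show "ar s' a v = ar s a v" if "v \<noteq> q" "v \<le> F" "4 \<le> a" "a \<le> 13" for a v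
    using np that(1,2) c4[OF that(3,4)] by (elim conjE disjE exE) simp_all
  show "ar s' 3 (2 * v) = ar s 3 (2 * v) \<and> ar s' 3 (2 * v + 1) = ar s 3 (2 * v + 1)" if "v \<noteq> q" for v
  proof -
    have "2 * v + 1 \<noteq> 2 * q" "2 * v \<noteq> 2 * q + 1" by presburger+
    with np that show ?thesis by (elim conjE disjE exE) simp_all
  qed
  show "ar s' 0 i = ar s 0 i" if "i < ar s 11 q \<or> ar s 12 q \<le> i" for i
    using np that by blast
  show "rw s' i c = rw s i c" if "i \<noteq> q \<or> c \<noteq> d + 2" for i c
    using np that by (elim conjE disjE exE) auto
  show "ar s' a q = ar s a q" if "11 \<le> a" "a \<le> 12" for a
  proof -
    have "a = 11 \<or> a = 12" using that by linarith
    then show ?thesis using np assms(4) by (elim conjE disjE exE) simp_all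
  qed
  show "F \<le> sc s' 4" "sc s' 4 \<le> F + 2"
    using np by (auto elim!: disjE)
qed

text \<open>The pending leaf \<open>q\<close> is either settled or replaced by a split with two
  pending leaves at the fresh addresses. The induction carries this to the root: entries are
  permuted only within the segment of \<open>q\<close>, which is contained in the segment of each
  ancestor and disjoint from the segments of the other subtrees.\<close>

lemma BT_step:
  assumes np: "node_post s s'" and q: "q = sc s 22" and F: "F = sc s 4" "q \<le> F"
    and "BT (ar s) (rw s) q T e B X lo hi" "distinct (adrs T)" "set (adrs T) \<subseteq> {..F}" "q \<in> set (adrs T)"
  shows "\<exists>T'. BT (ar s') (rw s') (Suc q) T' e B X lo hi \<and> root T' = root T \<and> distinct (adrs T') \<and>
    set (adrs T') = set (adrs T) \<union> {F<..sc s' 4}"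
  using assms(5-8)
proof (induction T arbitrary: e B X lo hi)
  case (SL v)
  then have vq: "v = q" and bn: "bnode (ar s) q e B X lo hi" by auto
  note n = np[unfolded node_post_def Let_def, folded q F(1)]
  have lh: "ar s 11 q = lo" "ar s 12 q = hi" "ar s 13 q = e" "set (seg (ar s 0) lo hi) = X" "lo \<le> hi"
    "distinct (seg (ar s 0) lo hi)" using bn by (auto simp: bnode_def)
  have ms: "mset (seg (ar s' 0) lo hi) = mset (seg (ar s 0) lo hi)" using n lh by simp
  then have P: "distinct (seg (ar s' 0) lo hi)" "set (seg (ar s' 0) lo hi) = X"
    using lh mset_eq_setD[OF ms] mset_eq_imp_distinct_iff[OF ms] by auto
  have qn: "q \<noteq> Suc F" "q \<noteq> Suc (Suc F)" "q \<noteq> F + 1" "q \<noteq> F + 2" using F by auto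
  from n show ?case unfolding lh
  proof (elim conjE disjE exE, goal_cases)
    case 1
    then show ?case using bn P vq by (intro exI[of _ "SL q"]) (auto simp: bnode_def)
  next
    case (2 j t mid)
    let ?T = "SN q (SL (F + 1)) (SL (F + 2))"
    have j: "j < d" using 2 by (simp add: split_cond_def)
    have Gd: "rw s' i c = rw s i c" if "c \<le> d" for i c using 2 that by auto
    have Gt: "rw s' q (d + 2) = t" using 2 by simp
    have sp: "split_cond (rw s') X e j t" using 2 cond_cong(2)[of X "rw s'" "rw s"] Gd by simp
    have lr: "lft (rw s') X j t = lft (rw s) X j t" "rgt (rw s') X j t = rgt (rw s) X j t"
      using agree_cong(4,5)[of X "rw s'" "rw s" j t] Gd j by auto
    have dd: "distinct (seg (ar s' 0) lo mid)" "distinct (seg (ar s' 0) mid hi)"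
      using P(1) seg_append[of lo mid hi "ar s' 0"] 2 by auto
    have b: "bnode (ar s') q e B X lo hi" using bn P 2 qn by (simp add: bnode_def)
    have b8: "ar s' 8 q = ar s 8 q" using 2 qn by simp
    have b1: "bnode (ar s') (F + 1) (Suc e) (ar s' 8 q) (lft (rw s) X j t) lo mid"
      unfolding bnode_def b8 using 2 dd by (simp split: if_split)
    have b2: "bnode (ar s') (F + 2) (Suc e) (ar s' 8 q) (rgt (rw s) X j t) mid hi"
      unfolding bnode_def b8 using 2 dd by (simp split: if_split)
    have j4: "ar s' 4 q = Suc j" "ar s' 3 (2 * q) = F + 1" "ar s' 3 (2 * q + 1) = F + 2" using 2 qn by simp_all
    have "BT (ar s') (rw s') (Suc q) ?T e B X lo hi"
      using b b1 b2 j4 sp lr F 2 unfolding BT.simps Gt by (auto simp: Gt intro!: exI[of _ j] exI[of _ mid])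
    moreover have "{F<..sc s' 4} = {F + 1, F + 2}" using 2 by auto
    ultimately show ?case using qn vq by (intro exI[of _ ?T]) auto
  qed
next
  case (SN v l r)
  then obtain j mid where m: "lo \<le> mid" "mid \<le> hi" "split_cond (rw s) X e j (rw s v (d + 2))" "ar s 4 v = Suc j"
    "BT (ar s) (rw s) q l (Suc e) (ar s 8 v) (lft (rw s) X j (rw s v (d + 2))) lo mid"
    "BT (ar s) (rw s) q r (Suc e) (ar s 8 v) (rgt (rw s) X j (rw s v (d + 2))) mid hi"
    "bnode (ar s) v e B X lo hi" "v < q" by auto
  note fra = node_post_frame[OF np q F]
  have j: "j < d" using m(3) by (simp add: split_cond_def)
  have vq: "v \<noteq> q" "v \<le> F" using m(8) F by auto
  have Gd: "rw s' i c = rw s i c" if "c \<le> d" for i c using fra(4)[of i c] that by simp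
  have Gv: "rw s' v (d + 2) = rw s v (d + 2)" using fra(4)[of v "d + 2"] vq by simp
  have sp: "split_cond (rw s') X e j (rw s v (d + 2))" using m(3) cond_cong(2)[of X "rw s'" "rw s"] Gd by simp
  have lr: "lft (rw s') X j t = lft (rw s) X j t" "rgt (rw s') X j t = rgt (rw s) X j t" for t
    using agree_cong(4,5)[of X "rw s'" "rw s" j t] Gd j by auto
  have pend: "lo \<le> ar s 11 q" "ar s 11 q \<le> ar s 12 q" "ar s 12 q \<le> hi"
    using BT_pending[OF SN.prems(1,4)] by auto
  have "mset (seg (ar s' 0) lo hi) = mset (seg (ar s 0) lo hi)"
    by (rule mset_seg_change[OF fra(3) _ pend]) (use np q in \<open>auto simp: node_post_def Let_def\<close>)
  then have P: "distinct (seg (ar s' 0) lo hi) = distinct (seg (ar s 0) lo hi)"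
    "set (seg (ar s' 0) lo hi) = set (seg (ar s 0) lo hi)"
    by (metis mset_eq_imp_distinct_iff, metis mset_eq_setD)
  have f: "ar s' a v = ar s a v" if "4 \<le> a" "a \<le> 13" for a using fra(1)[OF vq that] .
  have b: "bnode (ar s') v e B X lo hi" using m(7) by (simp add: bnode_def P f)
  have ch: "ar s' 3 (2 * v) = root l" "ar s' 3 (2 * v + 1) = root r" using fra(2)[OF vq(1)] SN.prems(1) by auto
  have dis: "distinct (adrs l)" "distinct (adrs r)" "set (adrs l) \<inter> set (adrs r) = {}" "v \<notin> set (adrs l)" "v \<notin> set (adrs r)"
    "set (adrs l) \<subseteq> {..F}" "set (adrs r) \<subseteq> {..F}"
    using SN.prems by auto
  from SN.prems(4) vq consider "q \<in> set (adrs l)" | "q \<in> set (adrs r)" by auto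
  then show ?case
  proof cases
    case 1
    then obtain l' where l': "BT (ar s') (rw s') (Suc q) l' (Suc e) (ar s 8 v) (lft (rw s) X j (rw s v (d + 2))) lo mid"
      "root l' = root l" "distinct (adrs l')" "set (adrs l') = set (adrs l) \<union> {F<..sc s' 4}"
      using SN.IH(1)[OF m(5)] dis by blast
    have nr: "u \<noteq> q" "u \<le> F" if "u \<in> set (adrs r)" for u using that 1 dis by auto
    have qr: "q \<notin> set (adrs r)" using 1 dis by auto
    have "BT (ar s') (rw s') (Suc q) r (Suc e) (ar s 8 v) (rgt (rw s) X j (rw s v (d + 2))) mid hi"
    proof (rule BT_frame[OF m(6) qr])
      fix i assume "mid \<le> i" "i < hi"
      then show "ar s' 0 i = ar s 0 i" using BT_pending[OF m(5) 1] by (intro fra(3)) auto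
    qed (use nr in \<open>simp_all add: fra(1,4) fra(2)[simplified] Gd\<close>)
    then show ?thesis using l' b ch m(1,2,4,8) sp lr dis f vq
      by (intro exI[of _ "SN v l' r"]) (auto simp: Gv[simplified] intro!: exI[of _ j] exI[of _ mid])
  next
    case 2
    then obtain r' where r': "BT (ar s') (rw s') (Suc q) r' (Suc e) (ar s 8 v) (rgt (rw s) X j (rw s v (d + 2))) mid hi"
      "root r' = root r" "distinct (adrs r')" "set (adrs r') = set (adrs r) \<union> {F<..sc s' 4}"
      using SN.IH(2)[OF m(6)] dis by blast
    have nl: "u \<noteq> q" "u \<le> F" if "u \<in> set (adrs l)" for u using that 2 dis by auto
    have ql: "q \<notin> set (adrs l)" using 2 dis by auto
    have "BT (ar s') (rw s') (Suc q) l (Suc e) (ar s 8 v) (lft (rw s) X j (rw s v (d + 2))) lo mid"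
    proof (rule BT_frame[OF m(5) ql])
      fix i assume "lo \<le> i" "i < mid"
      then show "ar s' 0 i = ar s 0 i" using BT_pending[OF m(6) 2] by (intro fra(3)) auto
    qed (use nl in \<open>simp_all add: fra(1,4) fra(2)[simplified] Gd\<close>)
    then show ?thesis using r' b ch m(1,2,4,8) sp lr dis f vq
      by (intro exI[of _ "SN v l r'"]) (auto simp: Gv[simplified] intro!: exI[of _ j] exI[of _ mid])
  qed
qed

definition build_frame :: "nat \<Rightarrow> nat \<Rightarrow> nat \<Rightarrow> state \<Rightarrow> state \<Rightarrow> bool" where
  "build_frame r lo hi s s' \<longleftrightarrow>
     (\<forall>a v. v < r \<longrightarrow> 4 \<le> a \<longrightarrow> a \<le> 13 \<longrightarrow> ar s' a v = ar s a v) \<and> (\<forall>i < 2 * r. ar s' 3 i = ar s 3 i) \<and>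
     (\<forall>i. i < lo \<or> hi \<le> i \<longrightarrow> ar s' 0 i = ar s 0 i) \<and> (\<forall>i c. i < r \<or> c \<noteq> d + 2 \<longrightarrow> rw s' i c = rw s i c)"

lemma BUILD_writes [simp]:
  "x < 40 \<Longrightarrow> nv BUILD x \<longleftrightarrow> x \<notin> {4, 6, 7, 8, 9, 10, 11, 12, 13, 14, 15, 16, 17, 18, 19, 20, 22, 23, 24, 25, 26, 27, 28, 29, 30, 31}"
  "a < 16 \<Longrightarrow> na BUILD a \<longleftrightarrow> a \<notin> {0, 2, 3, 4, 5, 6, 7, 8, 9, 10, 11, 12, 13}" "x < 8 \<Longrightarrow> nrv BUILD x \<longleftrightarrow> x \<notin> {3, 4, 5}"
  by (auto simp: BUILD_def)

text \<open>The cost of a node is d(L+1) times its segment length plus one. Summed over all nodes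
  this is governed by \<open>BT_size\<close>.\<close>

lemma wp_BUILD:
  assumes r: "sc s 22 = r" "sc s 4 = r" and bn: "bnode (ar s) r e (2 * (hi - lo)) X lo hi"
    and le: "hi - lo \<le> 2 ^ L" "2 * hi \<le> IB" "r + 2 * (hi - lo) + 4 \<le> IB" and eps: "rv s 2 = \<epsilon>"
  shows "wp z BUILD (\<lambda>t' s'. \<exists>T. BT (ar s') (rw s') (Suc (sc s' 4)) T e (2 * (hi - lo)) X lo hi \<and> root T = r \<and>
     distinct (adrs T) \<and> set (adrs T) = {r..sc s' 4} \<and> sc s' 4 + 2 \<le> r + 2 * max 1 (hi - lo) \<and>
     t' \<le> t + 30000 * (d * (L + 1)) * ((sh T + 3) * (hi - lo + 1)) \<and> build_frame r lo hi s s') t s"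
proof -
  define K where "K = d * (L + 1)"
  have K1: "1 \<le> K" using d1 by (simp add: K_def)
  \<comment> \<open>The work already done, up to the factor \<open>K\<close>, as a sum over the
    processed addresses. It can be rewritten as a sum over the tree at the end, when these addresses
    are exactly its nodes.\<close>
  define W where "W = (\<lambda>s' q. \<Sum>v = r..<q. ar s' 12 v - ar s' 11 v + 1)"
  define I where "I = (\<lambda>t' s'. r \<le> sc s' 22 \<and> r \<le> sc s' 4 \<and> sc s' 22 \<le> Suc (sc s' 4) \<and>
    t' \<le> t + 20100 * K * W s' (sc s' 22) \<and> build_frame r lo hi s s' \<and>
    (\<exists>T. BT (ar s') (rw s') (sc s' 22) T e (2 * (hi - lo)) X lo hi \<and> root T = r \<and> distinct (adrs T) \<and> set (adrs T) = {r..sc s' 4}))"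
  have len: "length (adrs T) + r = F + 1" if "distinct (adrs T)" "set (adrs T) = {r..F}" "r \<le> F" for T F
    using distinct_card[OF that(1)] that by simp
  show ?thesis unfolding BUILD_def
  proof (rule wp_while[where I = I and \<mu> = "\<lambda>s. IB - sc s 22"], goal_cases)
    case 1
    show ?case using r bn by (auto simp: I_def W_def build_frame_def intro!: exI[of _ "SL r"])
  next
    case (2 t1 s1)
    note [simp] = frD[OF 2(2)]
    define q F where qF: "q = sc s1 22" "F = sc s1 4"
    note [simp] = qF[symmetric]
    from 2(1,3) obtain T where T: "r \<le> q" "q \<le> F" "t1 \<le> t + 20100 * K * W s1 q" "build_frame r lo hi s s1"
      "BT (ar s1) (rw s1) q T e (2 * (hi - lo)) X lo hi" "root T = r" "distinct (adrs T)" "set (adrs T) = {r..F}"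
      by (auto simp: I_def)
    have qT: "q \<in> set (adrs T)" using T by simp
    note pend = BT_pending[OF T(5) qT]
    have sz: "F + 2 \<le> r + 2 * max 1 (hi - lo)" using BT_size[OF T(5)] len[OF T(7,8)] T(1,2) by linarith
    have FI: "F + 4 \<le> IB" using sz le(3) by (cases "hi - lo") auto
    define m where "m = ar s1 12 q - ar s1 11 q"
    have "wp z NODE (\<lambda>t' s'. wp z (Inc 22) (\<lambda>t'' s''. I t'' s'' \<and> IB - sc s'' 22 < IB - q) t' s') (t1 + 8) s1"
      apply (rule wp_mono[OF wp_NODE[where L = L]])
      using pend le FI T(2) eps apply (auto)[7]
      subgoal premises p for t2 s2
      proof -
        note [simp] = frD[OF p(2)]
        have np: "node_post s1 s2" and t2: "t2 \<le> t1 + 8 + 20000 * (d * ((m + 1) * (L + 1)))" using p(1) by (simp_all add: m_def)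
        note fra = node_post_frame[OF np qF T(2)]
        obtain T' where T': "BT (ar s2) (rw s2) (Suc q) T' e (2 * (hi - lo)) X lo hi" "root T' = r" "distinct (adrs T')"
          "set (adrs T') = {r..F} \<union> {F<..sc s2 4}"
          using BT_step[OF np qF T(2,5,7) _ qT] T by auto
        have s': "set (adrs T') = {r..sc s2 4}" using T'(4) ivl_disj_un_two(8)[of r F "sc s2 4"] fra(6) order_trans[OF T(1,2)] by simp
        have fv: "ar s2 a v = ar s1 a v" if "a = 11 \<or> a = 12" "v \<le> q" for a v
          using fra(1)[of v a] fra(5)[of a] that T(2) by (cases "v = q") auto
        have "W s2 q = W s1 q" unfolding W_def by (rule sum.cong) (use fv in auto)
        then have W: "W s2 (Suc q) = W s1 q + (m + 1)" using T(1) fv unfolding W_def m_def by simp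
        have bf: "build_frame r lo hi s s2"
          unfolding build_frame_def
        proof (intro conjI allI impI)
          show "ar s2 a v = ar s a v" if "v < r" "4 \<le> a" "a \<le> 13" for a v
            using fra(1)[of v a] T(1,2,4) that by (auto simp: build_frame_def)
          show "ar s2 3 i = ar s 3 i" if "i < 2 * r" for i
          proof -
            have ne: "i div 2 \<noteq> q" using that T(1) by linarith
            have "i = 2 * (i div 2) \<or> i = 2 * (i div 2) + 1" by presburger
            then have "ar s2 3 i = ar s1 3 i" using fra(2)[OF ne] by metis
            then show ?thesis using T(4) that by (auto simp: build_frame_def)
          qed
          show "ar s2 0 i = ar s 0 i" if "i < lo \<or> hi \<le> i" for i
            using fra(3)[of i] T(4) that pend by (auto simp: build_frame_def)
          show "rw s2 i c = rw s i c" if "i < r \<or> c \<noteq> d + 2" for i c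
            using fra(4)[of i c] T(1,4) that by (auto simp: build_frame_def)
        qed
        have "t2 + 7 \<le> t + 20100 * K * W s2 (Suc q)"
        proof -
          have "d * ((m + 1) * (L + 1)) = K * (m + 1)" by (simp only: K_def ac_simps)
          moreover have "20100 * K * W s2 (Suc q) = 20100 * K * W s1 q + 20100 * (K * (m + 1))"
            unfolding W by (simp only: distrib_left mult.assoc)
          moreover have "1 \<le> K * (m + 1)" using K1 by simp
          ultimately show ?thesis using t2 T(3) by linarith
        qed
        moreover have "build_frame r lo hi s (setv s2 22 (Suc q)) = build_frame r lo hi s s2" by (simp add: build_frame_def)
        moreover have "W (setv s2 22 (Suc q)) = W s2" by (simp add: W_def fun_eq_iff)
        ultimately show ?thesis using T' s' bf T(1,2) fra(6) FI by (auto simp: I_def intro!: exI[of _ T'])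
      qed
      done
    then show ?case by (simp del: Inc_simps)
  next
    case (3 t1 s1)
    from 3(1,3) obtain T where T: "r \<le> sc s1 4" "t1 \<le> t + 20100 * K * W s1 (Suc (sc s1 4))" "build_frame r lo hi s s1"
      "BT (ar s1) (rw s1) (Suc (sc s1 4)) T e (2 * (hi - lo)) X lo hi" "root T = r" "distinct (adrs T)" "set (adrs T) = {r..sc s1 4}"
      by (auto simp: I_def le_Suc_eq)
    note sz = BT_size[OF T(4)]
    have "W s1 (Suc (sc s1 4)) = (\<Sum>v\<in>set (adrs T). ar s1 12 v - ar s1 11 v + 1)"
      unfolding W_def T(7) by (simp add: atLeastLessThanSuc_atLeastAtMost)
    also have "\<dots> = (\<Sum>v\<leftarrow>adrs T. ar s1 12 v - ar s1 11 v + 1)" using T(6) by (simp add: sum_list_distinct_conv_sum_set)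
    also have "\<dots> = (\<Sum>v\<leftarrow>adrs T. ar s1 12 v - ar s1 11 v) + length (adrs T)" by (simp add: sum_list_Suc)
    also have "\<dots> \<le> (sh T + 3) * (hi - lo + 1)"
    proof -
      define m where "m = hi - lo"
      have "(sh T + 3) * (m + 1) = (sh T + 1) * m + (2 * m + sh T + 3)" by (simp add: algebra_simps)
      moreover have "2 * max 1 m \<le> 2 * m + 2" by simp
      ultimately show ?thesis using sz unfolding m_def[symmetric] by linarith
    qed
    finally have "K * W s1 (Suc (sc s1 4)) \<le> K * ((sh T + 3) * (hi - lo + 1))" by simp
    moreover have "1 \<le> K * ((sh T + 3) * (hi - lo + 1))" using K1 by simp
    ultimately have t1: "t1 + 8 \<le> t + 30000 * K * ((sh T + 3) * (hi - lo + 1))"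
      using T(2) unfolding mult.assoc by linarith
    have "sc s1 4 + 2 \<le> r + 2 * max 1 (hi - lo)" using sz len[OF T(6,7,1)] by linarith
    then show ?case using T t1 unfolding K_def by (intro exI[of _ T]) auto
  qed
qed

lemma START_writes [simp]:
  "x < 40 \<Longrightarrow> nv (START e) x \<longleftrightarrow> x \<notin> {4, 6, 7, 8, 9, 10, 11, 12, 13, 14, 15, 16, 17, 18, 19, 20, 22, 23, 24, 25, 26, 27, 28, 29, 30, 31}"
  "a < 16 \<Longrightarrow> na (START e) a \<longleftrightarrow> a \<notin> {0, 2, 3, 4, 5, 6, 7, 8, 9, 10, 11, 12, 13}" "x < 8 \<Longrightarrow> nrv (START e) x \<longleftrightarrow> x \<notin> {3, 4, 5}"
  by (auto simp: START_def)

text \<open>The new tree is rooted at the address following the segment of its examples.\<close>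

lemma wp_START:
  assumes r: "r = Suc (sc s 34)" and lo: "lo = sc s 21" "lo \<le> r" and lk: "sc s 33 < 2 * r"
    and e: "\<And>s'. ar s' 13 = (ar s 13) \<Longrightarrow> sc s' 32 = sc s 32 \<Longrightarrow> wval z s' de = e" "wub de (d + k + h)" "wlen de \<le> 20"
    and X: "distinct (seg (ar s 0) lo r)" "set (seg (ar s 0) lo r) = X"
    and le: "r - lo \<le> 2 ^ L" "2 * r \<le> IB" "r + 2 * (r - lo) + 4 \<le> IB" and eps: "rv s 2 = \<epsilon>"
  shows "wp z (START de) (\<lambda>t' s'. \<exists>T. BT (ar s') (rw s') (Suc (sc s' 4)) T e (2 * (r - lo)) X lo r \<and> root T = r \<and>
     ar s' 3 (sc s 33) = r \<and> ar s' 7 r = 0 \<and>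
     distinct (adrs T) \<and> set (adrs T) = {r..sc s' 4} \<and> sc s' 4 + 2 \<le> r + 2 * max 1 (r - lo) \<and>
     t' \<le> t + 100 + wlen de + 30000 * (d * (L + 1)) * ((sh T + 3) * (r - lo + 1)) \<and>
     (\<forall>a v. v < r \<longrightarrow> 4 \<le> a \<longrightarrow> a \<le> 13 \<longrightarrow> ar s' a v = ar s a v) \<and> (\<forall>i < 2 * r. i \<noteq> sc s 33 \<longrightarrow> ar s' 3 i = ar s 3 i) \<and>
     (\<forall>i. i < lo \<or> r \<le> i \<longrightarrow> ar s' 0 i = ar s 0 i) \<and> (\<forall>i c. i < r \<or> c \<noteq> d + 2 \<longrightarrow> rw s' i c = rw s i c)) t s"
proof -
  define s0 where "s0 = setv (seta (seta (seta (seta (seta (seta (seta (seta (setv s 22 r) 11 r lo) 12 r r) 13 r e) 9 r 0) 10 r 0) 7 r 0) 8 r (r - lo)) 3 (sc s 33) r) 4 r"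
  have ev: "wval z (seta (seta (setv s 22 r) 11 r lo) 12 r r) de = e" by (rule e) simp_all
  have bn: "bnode (ar s0) r e (2 * (r - lo)) X lo r"
    using X lo by (simp add: bnode_def s0_def)
  have c4: "a = 4 \<or> a = 5 \<or> a = 6 \<or> a = 7 \<or> a = 8 \<or> a = 9 \<or> a = 10 \<or> a = 11 \<or> a = 12 \<or> a = 13" if "4 \<le> a" "a \<le> 13" for a :: nat
    using that by presburger
  have f0: "ar s0 a v = ar s a v" if "v < r" "4 \<le> a" "a \<le> 13" for a v
    using c4[OF that(2,3)] that(1) by (elim disjE) (simp_all add: s0_def)
  have "wp z BUILD (\<lambda>t' s'. \<exists>T. BT (ar s') (rw s') (Suc (sc s' 4)) T e (2 * (r - lo)) X lo r \<and> root T = r \<and>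
     distinct (adrs T) \<and> set (adrs T) = {r..sc s' 4} \<and> sc s' 4 + 2 \<le> r + 2 * max 1 (r - lo) \<and>
     t' \<le> u + 30000 * (d * (L + 1)) * ((sh T + 3) * (r - lo + 1)) \<and> build_frame r lo r s0 s') u s0" for u
    by (rule wp_BUILD) (use bn le eps in \<open>simp_all add: s0_def\<close>)
  note B = this
  have B': "wp z BUILD (\<lambda>t' s'. \<exists>T. BT (ar s') (rw s') (Suc (sc s' 4)) T e (2 * (r - lo)) X lo r \<and> root T = r \<and>
     ar s' 3 (sc s 33) = r \<and> ar s' 7 r = 0 \<and>
     distinct (adrs T) \<and> set (adrs T) = {r..sc s' 4} \<and> sc s' 4 + 2 \<le> r + 2 * max 1 (r - lo) \<and>
     t' \<le> u + 30000 * (d * (L + 1)) * ((sh T + 3) * (r - lo + 1)) \<and>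
     (\<forall>a v. v < r \<longrightarrow> 4 \<le> a \<longrightarrow> a \<le> 13 \<longrightarrow> ar s' a v = ar s a v) \<and> (\<forall>i < 2 * r. i \<noteq> sc s 33 \<longrightarrow> ar s' 3 i = ar s 3 i) \<and>
     (\<forall>i. i < lo \<or> r \<le> i \<longrightarrow> ar s' 0 i = ar s 0 i) \<and> (\<forall>i c. i < r \<or> c \<noteq> d + 2 \<longrightarrow> rw s' i c = rw s i c)) u s0" for u
  proof (rule wp_mono[OF B])
    fix t' s'
    assume "\<exists>T. BT (ar s') (rw s') (Suc (sc s' 4)) T e (2 * (r - lo)) X lo r \<and> root T = r \<and>
     distinct (adrs T) \<and> set (adrs T) = {r..sc s' 4} \<and> sc s' 4 + 2 \<le> r + 2 * max 1 (r - lo) \<and>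
     t' \<le> u + 30000 * (d * (L + 1)) * ((sh T + 3) * (r - lo + 1)) \<and> build_frame r lo r s0 s'"
    then obtain T where T: "BT (ar s') (rw s') (Suc (sc s' 4)) T e (2 * (r - lo)) X lo r" "root T = r"
     "distinct (adrs T)" "set (adrs T) = {r..sc s' 4}" "sc s' 4 + 2 \<le> r + 2 * max 1 (r - lo)"
     "t' \<le> u + 30000 * (d * (L + 1)) * ((sh T + 3) * (r - lo + 1))" "build_frame r lo r s0 s'" by blast
    note bf = T(7)[unfolded build_frame_def]
    have "ar s' 7 r = 0" using BT_root[OF T(1)] T(2) by (auto simp: bnode_def)
    moreover have "ar s' 3 (sc s 33) = r" using bf lk by (simp add: s0_def)
    moreover have "\<forall>i < 2 * r. i \<noteq> sc s 33 \<longrightarrow> ar s' 3 i = ar s 3 i" using bf by (simp add: s0_def)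
    moreover have "\<forall>a v. v < r \<longrightarrow> 4 \<le> a \<longrightarrow> a \<le> 13 \<longrightarrow> ar s' a v = ar s a v" using bf f0 by simp
    moreover have "\<forall>i. i < lo \<or> r \<le> i \<longrightarrow> ar s' 0 i = ar s 0 i" using bf by (simp add: s0_def)
    moreover have "\<forall>i c. i < r \<or> c \<noteq> d + 2 \<longrightarrow> rw s' i c = rw s i c" using bf by (simp add: s0_def)
    ultimately show "\<exists>T. BT (ar s') (rw s') (Suc (sc s' 4)) T e (2 * (r - lo)) X lo r \<and> root T = r \<and>
     ar s' 3 (sc s 33) = r \<and> ar s' 7 r = 0 \<and>
     distinct (adrs T) \<and> set (adrs T) = {r..sc s' 4} \<and> sc s' 4 + 2 \<le> r + 2 * max 1 (r - lo) \<and>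
     t' \<le> u + 30000 * (d * (L + 1)) * ((sh T + 3) * (r - lo + 1)) \<and>
     (\<forall>a v. v < r \<longrightarrow> 4 \<le> a \<longrightarrow> a \<le> 13 \<longrightarrow> ar s' a v = ar s a v) \<and> (\<forall>i < 2 * r. i \<noteq> sc s 33 \<longrightarrow> ar s' 3 i = ar s 3 i) \<and>
     (\<forall>i. i < lo \<or> r \<le> i \<longrightarrow> ar s' 0 i = ar s 0 i) \<and> (\<forall>i c. i < r \<or> c \<noteq> d + 2 \<longrightarrow> rw s' i c = rw s i c)"
      using T by (intro exI[of _ T]) blast
  qed
  show ?thesis unfolding START_def
    apply (simp add: r[symmetric] lo(1)[symmetric] ev e(2) Suc_eq_plus1[symmetric] del: One_nat_def)
    apply (intro conjI)
    subgoal using le by (simp add: disjI2)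
    subgoal
      unfolding s0_def[symmetric]
      apply (rule wp_mono[OF B'])
      apply (erule exE)
      subgoal for t' s' T
        by (rule exI[of _ T]) auto
      done
    done
qed

end

section \<open>The maintained tree: insertion lists, counters and their invariant\<close>

text \<open>A linked list ending in 0 whose pointers strictly decrease. It is thus finite, and it
  lies below its head, so that later allocations cannot disturb it
  (\<open>lst_frame\<close>).\<close>

inductive lst :: "(nat \<Rightarrow> nat) \<Rightarrow> (nat \<Rightarrow> nat) \<Rightarrow> nat \<Rightarrow> nat list \<Rightarrow> bool" for CS CX where
  Nil: "lst CS CX 0 []"
| Cons: "0 < p \<Longrightarrow> CX p < p \<Longrightarrow> lst CS CX (CX p) xs \<Longrightarrow> lst CS CX p (CS p # xs)"

inductive_cases lst_posE: "lst CS CX p xs"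

lemma lst_frame:
  "lst CS CX p xs \<Longrightarrow> p \<le> F \<Longrightarrow> (\<And>i. i \<le> F \<Longrightarrow> CS' i = CS i \<and> CX' i = CX i) \<Longrightarrow> lst CS' CX' p xs"
proof (induction rule: lst.induct)
  case (Cons p xs)
  then have "lst CS' CX' p (CS' p # xs)" by (intro lst.Cons) auto
  with Cons show ?case by simp
qed (rule lst.Nil)

lemma lst_pos: "lst CS CX p xs \<Longrightarrow> 0 < p \<Longrightarrow> CX p < p \<and> (\<exists>ys. xs = CS p # ys \<and> lst CS CX (CX p) ys)"
  by (auto elim: lst_posE)

lemma lst_0 [simp]: "lst CS CX 0 xs \<longleftrightarrow> xs = []"
  by (auto elim: lst_posE intro: lst.Nil)

context params
begin

definition COPY :: com where
  "COPY = Cond (Pos (Row (Var 31) (Lit (d + 1)))) Skip (sqn [Inc 34, SetA 0 (Var 34) (Var 31)])"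

text \<open>The rows of a subtree are those of its segment from build time and those inserted since.
  Deletions have left only flags, so dead rows are filtered out here. The live ones are appended
  behind the last address in use, and \<open>START\<close> puts the new root right after
  them.\<close>

definition COLLECT :: com where
  "COLLECT = sqn [SetV 21 (WAdd (Var 4) (Lit 1)), SetV 34 (Var 4), SetV 27 (Arr 11 (Var 32)),
     While (WLess (Var 27) (Arr 12 (Var 32))) (sqn [SetV 31 (Arr 0 (Var 27)), COPY, Inc 27]),
     SetV 27 (Arr 10 (Var 32)),
     While (WLess (Lit 0) (Var 27)) (sqn [SetV 31 (Arr 14 (Var 27)), COPY, SetV 27 (Arr 15 (Var 27))])]"

definition REBUILD :: com where
  "REBUILD = Seq COLLECT (START (Arr 13 (Var 32)))"

end

context machine
begin

definition curc :: "(nat \<Rightarrow> nat \<Rightarrow> nat) \<Rightarrow> nat \<Rightarrow> nat \<Rightarrow> nat" where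
  "curc A v c = (if A 7 v = 0 then A 9 v else c)"

text \<open>All rows that have been routed to \<open>v\<close> since it was built, dead ones
  included. The list is no longer than the number of counted updates, which bounds the cost of a
  rebuild.\<close>

definition members :: "(nat \<Rightarrow> nat \<Rightarrow> nat) \<Rightarrow> nat \<Rightarrow> nat \<Rightarrow> nat list \<Rightarrow> bool" where
  "members A Fb v xs \<longleftrightarrow> (\<exists>ys. xs = seg (A 0) (A 11 v) (A 12 v) @ ys \<and> lst (A 14) (A 15) (A 10 v) ys \<and>
     A 10 v \<le> Fb \<and> A 12 v \<le> Suc Fb \<and> length ys \<le> A 9 v)"

text \<open>
  A node \<open>v\<close> with \<open>A 7 v = 0\<close> has its own update counter \<open>A 9 v\<close>;
  the other nodes share the counter \<open>c\<close> and the size \<open>B\<close> of their closest such ancestor.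
\<close>

definition ltn :: "(nat \<Rightarrow> nat \<Rightarrow> nat) \<Rightarrow> nat set \<Rightarrow> nat \<Rightarrow> nat \<Rightarrow> nat \<Rightarrow> nat \<Rightarrow> nat \<Rightarrow> nat set \<Rightarrow> bool" where
  "ltn A Al N Fb v e B X \<longleftrightarrow> v \<le> Fb \<and> A 13 v = e \<and> A 11 v \<le> A 12 v \<and> A 8 v \<le> 2 * (A 12 v - A 11 v) \<and> A 12 v - A 11 v \<le> A 8 v \<and>
     (if A 7 v = 0
      then A 8 v = A 12 v - A 11 v \<and> 4 * A 8 v \<le> 3 * B \<and>
        (\<exists>xs. members A Fb v xs \<and> distinct xs \<and> set xs \<subseteq> {..<N} \<and> set xs \<inter> Al = X)
      else A 8 v = B)"

text \<open>The trigger of rebuilding has not fired. As the reference size is at most twice the size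
  of the node, at most \<epsilon>/4 times that size many updates have passed since the node was
  built.\<close>

definition quiet :: "(nat \<Rightarrow> nat \<Rightarrow> nat) \<Rightarrow> nat \<Rightarrow> nat \<Rightarrow> bool" where
  "quiet A v c \<longleftrightarrow> 8 * real (curc A v c) \<le> \<epsilon> * real (A 8 v)"

abbreviation sz :: "(nat \<Rightarrow> nat \<Rightarrow> nat) \<Rightarrow> nat \<Rightarrow> nat" where
  "sz A v \<equiv> A 12 v - A 11 v"

text \<open>\<open>X0\<close> is the set for which the node was built. It is not stored, hence the
  existential quantifiers in \<open>LT\<close>; its row numbers keep their meaning since rows move
  only in a compaction, which rebuilds the entire tree.\<close>

definition near :: "(nat \<Rightarrow> nat \<Rightarrow> nat) \<Rightarrow> nat \<Rightarrow> nat \<Rightarrow> nat \<Rightarrow> nat set \<Rightarrow> nat set \<Rightarrow> bool" where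
  "near A N v c X X0 \<longleftrightarrow> X0 \<subseteq> {..<N} \<and> card X0 = sz A v \<and> sd X0 X \<le> curc A v c"

text \<open>The first part bounds the height. In the second, \<open>L0\<close> is the side of the
  parent's original split: when a child with its own counter is rebuilt, its size has grown from at
  most half the reference size by the drift only, and so stays below three quarters of it.\<close>

definition chld :: "(nat \<Rightarrow> nat \<Rightarrow> nat) \<Rightarrow> nat \<Rightarrow> nat \<Rightarrow> nat set \<Rightarrow> bool" where
  "chld A v w L0 \<longleftrightarrow> real (sz A w) \<le> (1 - \<epsilon>) * real (sz A v) \<and> (A 7 w = 0 \<longrightarrow> 2 * card L0 \<le> A 8 v)"

text \<open>\<open>Al\<close> is the set of live rows, \<open>N\<close> the number of rows,
  \<open>Fb\<close> the last address in use; \<open>e\<close> is the depth, \<open>B\<close> and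
  \<open>c\<close> are the reference size and the counter handed down by the parent, and
  \<open>X\<close> is the set of live rows routed to the node. Children are attached to the current
  set \<open>X\<close>, but the quality of the split is asserted for the old set
  \<open>X0\<close>.\<close>

primrec LT :: "(nat \<Rightarrow> nat \<Rightarrow> nat) \<Rightarrow> (nat \<Rightarrow> nat \<Rightarrow> real) \<Rightarrow> nat set \<Rightarrow> nat \<Rightarrow> nat \<Rightarrow> sk \<Rightarrow> nat \<Rightarrow> nat \<Rightarrow> nat \<Rightarrow> nat set \<Rightarrow> bool" where
  "LT A G Al N Fb (SL v) e B c X \<longleftrightarrow> ltn A Al N Fb v e B X \<and> quiet A v c \<and>
     A 4 v = 0 \<and> A 5 v = c0 G X \<and> A 6 v = c1 G X \<and> (\<exists>X0. near A N v c X X0 \<and> leaf_cond G X0 e)"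
| "LT A G Al N Fb (SN v l r) e B c X \<longleftrightarrow> ltn A Al N Fb v e B X \<and> quiet A v c \<and>
     A 3 (2 * v) = root l \<and> A 3 (2 * v + 1) = root r \<and>
     (\<exists>j X0. A 4 v = Suc j \<and> near A N v c X X0 \<and> split_cond G X0 e j (G v (d + 2)) \<and>
        chld A v (root l) (lft G X0 j (G v (d + 2))) \<and> chld A v (root r) (rgt G X0 j (G v (d + 2))) \<and>
        LT A G Al N Fb l (Suc e) (A 8 v) (curc A v c) (lft G X j (G v (d + 2))) \<and>
        LT A G Al N Fb r (Suc e) (A 8 v) (curc A v c) (rgt G X j (G v (d + 2))))"

primrec csum :: "(nat \<Rightarrow> nat \<Rightarrow> nat) \<Rightarrow> sk \<Rightarrow> nat" where
  "csum A (SL v) = (if A 7 v = 0 then A 9 v else 0)"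
| "csum A (SN v l r) = (if A 7 v = 0 then A 9 v else 0) + csum A l + csum A r"

text \<open>The largest number of separate counters on a path from the root, hence a bound on the
  counter increments per update. The sum \<open>csum\<close> of all counters is the part of the
  potential that pays for rebuilding.\<close>

primrec tp :: "(nat \<Rightarrow> nat \<Rightarrow> nat) \<Rightarrow> sk \<Rightarrow> nat" where
  "tp A (SL v) = (if A 7 v = 0 then 1 else 0)"
| "tp A (SN v l r) = (if A 7 v = 0 then 1 else 0) + max (tp A l) (tp A r)"

lemma LT_root: "LT A G Al N Fb T e B c X \<Longrightarrow> ltn A Al N Fb (root T) e B X \<and> quiet A (root T) c"
  by (cases T) auto

lemma LT_SN:
  assumes "LT A G Al N Fb (SN v l r) e B c X"
  obtains j X0 where "ltn A Al N Fb v e B X" "quiet A v c" "A 3 (2 * v) = root l" "A 3 (2 * v + 1) = root r"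
    "A 4 v = Suc j" "near A N v c X X0" "split_cond G X0 e j (G v (d + 2))"
    "chld A v (root l) (lft G X0 j (G v (d + 2)))" "chld A v (root r) (rgt G X0 j (G v (d + 2)))"
    "LT A G Al N Fb l (Suc e) (A 8 v) (curc A v c) (lft G X j (G v (d + 2)))"
    "LT A G Al N Fb r (Suc e) (A 8 v) (curc A v c) (rgt G X j (G v (d + 2)))"
  using assms unfolding LT.simps by blast

lemma LT_adrs: "LT A G Al N Fb T e B c X \<Longrightarrow> set (adrs T) \<subseteq> {..Fb}"
proof (induction T arbitrary: e B c X)
  case (SL v)
  then show ?case by (simp add: ltn_def)
next
  case (SN v l r)
  from SN.prems show ?case
  proof (rule LT_SN)
    fix j X0
    assume "ltn A Al N Fb v e B X" "LT A G Al N Fb l (Suc e) (A 8 v) (curc A v c) (lft G X j (G v (d + 2)))"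
      "LT A G Al N Fb r (Suc e) (A 8 v) (curc A v c) (rgt G X j (G v (d + 2)))"
    then show ?thesis using SN.IH by (simp add: ltn_def)
  qed
qed

lemma members_frame:
  assumes "members A Fb v xs" "Fb \<le> Fb'"
    and "\<And>a. 4 \<le> a \<Longrightarrow> a \<le> 13 \<Longrightarrow> A' a v = A a v"
    and "\<And>i a. i \<le> Fb \<Longrightarrow> a = 0 \<or> a = 14 \<or> a = 15 \<Longrightarrow> A' a i = A a i"
  shows "members A' Fb' v xs"
proof -
  from assms(1) obtain ys where ys: "xs = seg (A 0) (A 11 v) (A 12 v) @ ys" "lst (A 14) (A 15) (A 10 v) ys"
    "A 10 v \<le> Fb" "A 12 v \<le> Suc Fb" "length ys \<le> A 9 v" by (auto simp: members_def)
  have "seg (A' 0) (A 11 v) (A 12 v) = seg (A 0) (A 11 v) (A 12 v)"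
    by (rule seg_cong) (use assms(4) ys(4) in auto)
  moreover have "lst (A' 14) (A' 15) (A 10 v) ys"
    by (rule lst_frame[OF ys(2,3)]) (use assms(4) in auto)
  ultimately show ?thesis using ys assms(2,3) by (auto simp: members_def)
qed

lemma ltn_frame:
  assumes "ltn A Al N Fb v e B X" "Fb \<le> Fb'" "N \<le> N'"
    and A: "\<And>a. 4 \<le> a \<Longrightarrow> a \<le> 13 \<Longrightarrow> A' a v = A a v"
    and cells: "\<And>i a. i \<le> Fb \<Longrightarrow> a = 0 \<or> a = 14 \<or> a = 15 \<Longrightarrow> A' a i = A a i"
    and S: "\<And>S. S \<subseteq> {..<N} \<Longrightarrow> S \<inter> Al = X \<Longrightarrow> S \<inter> Al' = X"
  shows "ltn A' Al' N' Fb' v e B X"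
proof -
  have "\<exists>xs. members A' Fb' v xs \<and> distinct xs \<and> set xs \<subseteq> {..<N'} \<and> set xs \<inter> Al' = X" if "A 7 v = 0"
  proof -
    from assms(1) that obtain xs where xs: "members A Fb v xs" "distinct xs" "set xs \<subseteq> {..<N}" "set xs \<inter> Al = X"
      by (auto simp: ltn_def)
    have "members A' Fb' v xs" using xs(1) assms(2) A cells by (rule members_frame)
    moreover have "set xs \<subseteq> {..<N'}" using xs(3) assms(3) by auto
    ultimately show ?thesis using xs S[of "set xs"] by blast
  qed
  then show ?thesis using assms(1,2) A by (cases "A 7 v = 0") (simp_all add: ltn_def)
qed

text \<open>Made for the subtrees off the path of an update: a row \<open>i0\<close> outside
  \<open>X\<close> may die, rows and addresses may be added, and the counter shared with an ancestor
  may grow, provided that it stays within the limit for nodes that depend on it.\<close>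

lemma LT_frame:
  assumes "LT A G Al N Fb T e B c X" "c \<le> c'" "A 7 (root T) \<noteq> 0 \<Longrightarrow> 8 * real c' \<le> \<epsilon> * real B"
    and "\<And>a v. v \<in> set (adrs T) \<Longrightarrow> 4 \<le> a \<Longrightarrow> a \<le> 13 \<Longrightarrow> A' a v = A a v"
    and "\<And>v. v \<in> set (adrs T) \<Longrightarrow> A' 3 (2 * v) = A 3 (2 * v) \<and> A' 3 (2 * v + 1) = A 3 (2 * v + 1)"
    and cells: "\<And>i a. i \<le> Fb \<Longrightarrow> a = 0 \<or> a = 14 \<or> a = 15 \<Longrightarrow> A' a i = A a i"
    and G: "\<And>i c. i < N \<Longrightarrow> c \<le> d \<Longrightarrow> G' i c = G i c" "\<And>v. v \<in> set (adrs T) \<Longrightarrow> G' v (d + 2) = G v (d + 2)"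
    and mono: "Fb \<le> Fb'" "N \<le> N'"
    and al: "\<And>i. i < N \<Longrightarrow> i \<noteq> i0 \<Longrightarrow> i \<in> Al' \<longleftrightarrow> i \<in> Al" "i0 < N \<Longrightarrow> i0 \<in> Al' \<Longrightarrow> i0 \<in> Al" "i0 \<notin> X" and XN: "X \<subseteq> {..<N}"
  shows "LT A' G' Al' N' Fb' T e B c' X"
  using assms(1-5,8) al(3) XN
proof (induction T arbitrary: e B c c' X)
  case (SL v)
  have ltn: "ltn A' Al' N' Fb' v e B X"
  proof (rule ltn_frame[where A = A and Al = Al and N = N and Fb = Fb])
    fix S assume "S \<subseteq> {..<N}" "S \<inter> Al = X"
    then show "S \<inter> Al' = X" using al SL.prems(7) by blast
  qed (use SL.prems mono cells in auto)
  have av: "A' a v = A a v" if "4 \<le> a" "a \<le> 13" for a using SL.prems(4)[of v a] that by simp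
  from SL.prems(1) obtain X0 where X0: "near A N v c X X0" "leaf_cond G X0 e" and l: "ltn A Al N Fb v e B X" "quiet A v c"
    "A 4 v = 0" "A 5 v = c0 G X" "A 6 v = c1 G X" by auto
  have "near A' N' v c' X X0" using X0(1) SL.prems(2) mono av by (auto simp: near_def curc_def)
  moreover have "leaf_cond G' X0 e" using X0 G cond_cong(1)[of X0 G' G e] by (auto simp: near_def)
  moreover have "quiet A' v c'" using l(1,2) SL.prems(3) av by (auto simp: quiet_def curc_def ltn_def)
  moreover have "c0 G' X = c0 G X" "c1 G' X = c1 G X" using SL.prems(8) G by (intro agree_cong, auto)+
  ultimately show ?case using ltn l av by auto
next
  case (SN v l r)
  from SN.prems(1) obtain j X0 where m: "ltn A Al N Fb v e B X" "quiet A v c" "A 4 v = Suc j" "near A N v c X X0" "split_cond G X0 e j (G v (d + 2))"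
    "chld A v (root l) (lft G X0 j (G v (d + 2)))" "chld A v (root r) (rgt G X0 j (G v (d + 2)))"
    "LT A G Al N Fb l (Suc e) (A 8 v) (curc A v c) (lft G X j (G v (d + 2)))"
    "LT A G Al N Fb r (Suc e) (A 8 v) (curc A v c) (rgt G X j (G v (d + 2)))"
    "A 3 (2 * v) = root l" "A 3 (2 * v + 1) = root r" by (rule LT_SN)
  have j: "j < d" using m(5) by (simp add: split_cond_def)
  have av: "A' a v = A a v" if "4 \<le> a" "a \<le> 13" for a using SN.prems(4)[of v a] that by simp
  have ltn: "ltn A' Al' N' Fb' v e B X"
  proof (rule ltn_frame[where A = A and Al = Al and N = N and Fb = Fb])
    fix S assume "S \<subseteq> {..<N}" "S \<inter> Al = X"
    then show "S \<inter> Al' = X" using al SN.prems(7) by blast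
  qed (use m av mono cells in auto)
  have q: "quiet A' v c'" using m(1,2) SN.prems(3) av by (auto simp: quiet_def curc_def ltn_def)
  have cc: "curc A' v c' = curc A v c'" "curc A v c \<le> curc A v c'" using SN.prems(2) av by (auto simp: curc_def)
  have near: "near A' N' v c' X X0" using m(4) mono av cc by (auto simp: near_def)
  have X0: "X0 \<subseteq> {..<N}" using m(4) by (simp add: near_def)
  have Gv: "G' v (d + 2) = G v (d + 2)" using SN.prems(6) by simp
  have lr: "lft G' Y j t = lft G Y j t" "rgt G' Y j t = rgt G Y j t" if "Y \<subseteq> {..<N}" for Y t
    using agree_cong(4,5)[of Y G' G j t] that G(1) j by auto
  have Gx: "G' i c = G i c" if "i \<in> X0" "c \<le> d" for i c using that X0 G(1) by auto
  have sp: "split_cond G' X0 e j (G v (d + 2))" using m(5) cond_cong(2)[of X0 G' G, OF Gx] by simp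
  have nt: "A 7 w \<noteq> 0 \<Longrightarrow> 8 * real (curc A v c') \<le> \<epsilon> * real (A 8 v)" for w
    using q cc av by (simp add: quiet_def)
  have rl: "chld A' v (root l) Y = chld A v (root l) Y" "chld A' v (root r) Y = chld A v (root r) Y" for Y
    using SN.prems(4)[of "root l"] SN.prems(4)[of "root r"] av by (simp_all add: chld_def)
  have "LT A' G' Al' N' Fb' l (Suc e) (A 8 v) (curc A v c') (lft G' X j (G v (d + 2)))"
    unfolding lr(1)[OF SN.prems(8)]
    by (rule SN.IH(1)[OF m(8) cc(2) nt]) (use SN.prems lft_sub[of G X j "G v (d + 2)"] in auto)
  moreover have "LT A' G' Al' N' Fb' r (Suc e) (A 8 v) (curc A v c') (rgt G' X j (G v (d + 2)))"
    unfolding lr(2)[OF SN.prems(8)]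
    by (rule SN.IH(2)[OF m(9) cc(2) nt]) (use SN.prems rgt_sub[of G X j "G v (d + 2)"] in auto)
  moreover have "A' 4 v = Suc j" "A' 3 (2 * v) = root l" "A' 3 (2 * v + 1) = root r" and a8: "A' 8 v = A 8 v"
    using m(3,10,11) SN.prems(5)[of v] av[of 4] av[of 8] by simp_all
  moreover have "chld A' v (root l) (lft G' X0 j (G v (d + 2)))" "chld A' v (root r) (rgt G' X0 j (G v (d + 2)))"
    using m(6,7) by (simp_all only: rl lr[OF X0])
  ultimately show ?case
    using ltn q near sp unfolding LT.simps Gv cc a8 by blast
qed

lemma LT_top: "LT A G Al N Fb T e B c X \<Longrightarrow> A 7 (root T) = 0 \<Longrightarrow> 4 * A 8 (root T) \<le> 3 * B' \<Longrightarrow> LT A G Al N Fb T e B' c' X"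
  by (cases T) (auto simp: ltn_def quiet_def curc_def near_def)

lemma csum_cong: "(\<And>v. v \<in> set (adrs T) \<Longrightarrow> A' 7 v = A 7 v \<and> A' 9 v = A 9 v) \<Longrightarrow> csum A' T = csum A T"
  by (induction T) auto

lemma tp_cong: "(\<And>v. v \<in> set (adrs T) \<Longrightarrow> A' 7 v = A 7 v) \<Longrightarrow> tp A' T = tp A T"
  by (induction T) auto

text \<open>For a fresh tree \<open>X0\<close> is \<open>X\<close> itself and all counters are 0. A
  score above 4\<epsilon>|X| leaves at least 2\<epsilon>|X| rows on each side, so each child
  satisfies the bound 1-\<epsilon> with room to spare; this room later pays for the drift.\<close>

lemma BT_LT:
  assumes "BT A G q T e B X lo hi" "\<And>v. v \<in> set (adrs T) \<Longrightarrow> v < q \<and> v \<le> Fb" "X \<subseteq> {..<N}" "X \<subseteq> Al" "hi \<le> Suc Fb" "hi - lo \<le> B"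
  shows "LT A G Al N Fb T e B 0 X \<and> csum A T = 0"
  using assms
proof (induction T arbitrary: e B X lo hi)
  case (SL v)
  then have b: "bnode A v e B X lo hi" by simp
  have "members A Fb v (seg (A 0) lo hi)" using b SL.prems(5) by (auto simp: members_def bnode_def)
  then have "ltn A Al N Fb v e B X" using b SL.prems by (auto simp: ltn_def bnode_def intro!: exI[of _ "seg (A 0) lo hi"])
  moreover have "quiet A v 0" using b eps0 by (auto simp: quiet_def curc_def bnode_def)
  moreover have "near A N v 0 X X" using b bnode_card[OF b] SL.prems by (auto simp: near_def bnode_def)
  ultimately show ?case using SL.prems b by (auto simp: bnode_def)
next
  case (SN v l r)
  then obtain j mid where m: "lo \<le> mid" "mid \<le> hi" "split_cond G X e j (G v (d + 2))" "A 4 v = Suc j"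
    "BT A G q l (Suc e) (A 8 v) (lft G X j (G v (d + 2))) lo mid"
    "BT A G q r (Suc e) (A 8 v) (rgt G X j (G v (d + 2))) mid hi" and b: "bnode A v e B X lo hi" by auto
  have bl: "bnode A (root l) (Suc e) (A 8 v) (lft G X j (G v (d + 2))) lo mid" using BT_root[OF m(5)] .
  have br: "bnode A (root r) (Suc e) (A 8 v) (rgt G X j (G v (d + 2))) mid hi" using BT_root[OF m(6)] .
  have finX: "finite X" using bnode_card[OF b] by simp
  have cards: "card (lft G X j (G v (d + 2))) = mid - lo" "card (rgt G X j (G v (d + 2))) = hi - mid" "card X = hi - lo"
    using bnode_card[OF bl] bnode_card[OF br] bnode_card[OF b] by auto
  have ms: "members A Fb v (seg (A 0) lo hi)" using b SN.prems(5) by (auto simp: members_def bnode_def)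
  have "ltn A Al N Fb v e B X" using b SN.prems ms by (auto simp: ltn_def bnode_def intro!: exI[of _ "seg (A 0) lo hi"])
  moreover have "quiet A v 0" using b eps0 by (auto simp: quiet_def curc_def bnode_def)
  moreover have "near A N v 0 X X" using b cards SN.prems by (auto simp: near_def bnode_def)
  moreover have "chld A v (root l) (lft G X j (G v (d + 2)))" "chld A v (root r) (rgt G X j (G v (d + 2)))"
  proof -
    have s: "4 * \<epsilon> * real (hi - lo) < sco G X j (G v (d + 2))" using m(3) cards by (simp add: split_cond_def)
    have "2 * \<epsilon> * real (hi - lo) \<le> real (mid - lo)" "2 * \<epsilon> * real (hi - lo) \<le> real (hi - mid)"
      using s sco_le_sides[OF finX, of G j "G v (d + 2)"] unfolding cards by linarith+
    moreover have "real (hi - lo) = real (mid - lo) + real (hi - mid)" using m(1,2) by simp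
    moreover have "0 \<le> \<epsilon> * real (hi - lo)" using eps0 by simp
    ultimately have "real (mid - lo) \<le> (1 - \<epsilon>) * real (hi - lo)" "real (hi - mid) \<le> (1 - \<epsilon>) * real (hi - lo)"
      by (simp_all add: left_diff_distrib)
    then show "chld A v (root l) (lft G X j (G v (d + 2)))" "chld A v (root r) (rgt G X j (G v (d + 2)))"
      using b bl br cards by (auto simp: chld_def bnode_def)
  qed
  moreover have c: "curc A v 0 = 0" using b by (auto simp: curc_def bnode_def)
  moreover have "LT A G Al N Fb l (Suc e) (A 8 v) 0 (lft G X j (G v (d + 2))) \<and> csum A l = 0"
    by (rule SN.IH(1)[OF m(5)]) (use SN.prems m b lft_sub[of G X j "G v (d + 2)"] in \<open>auto simp: bnode_def\<close>)
  moreover have "LT A G Al N Fb r (Suc e) (A 8 v) 0 (rgt G X j (G v (d + 2))) \<and> csum A r = 0"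
    by (rule SN.IH(2)[OF m(6)]) (use SN.prems m b rgt_sub[of G X j "G v (d + 2)"] in \<open>auto simp: bnode_def\<close>)
  moreover have "A 9 v = 0" using b by (simp add: bnode_def)
  ultimately show ?case using SN.prems(1) m(3,4) by auto
qed

subsection \<open>Rebuilding a subtree\<close>

lemma COPY_writes [simp]:
  "x < 40 \<Longrightarrow> nv COPY x \<longleftrightarrow> x \<noteq> 34" "a < 16 \<Longrightarrow> na COPY a \<longleftrightarrow> a \<noteq> 0" "nrv COPY x" "nrw COPY"
  by (auto simp: COPY_def)

lemma COLLECT_writes [simp]:
  "x < 40 \<Longrightarrow> nv COLLECT x \<longleftrightarrow> x \<notin> {21, 27, 31, 34}" "a < 16 \<Longrightarrow> na COLLECT a \<longleftrightarrow> a \<noteq> 0" "nrv COLLECT x" "nrw COLLECT"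
  by (auto simp: COLLECT_def)

lemma wp_COLLECT:
  assumes F: "F = sc s 4" and u: "u = sc s 32" and mem: "members (ar s) F u xs"
    and le: "F + length xs + 2 \<le> IB" "ar s 11 u \<le> ar s 12 u"
    and ys: "ys = filter (\<lambda>i. \<not> 0 < rw s i (d + 1)) xs"
  shows "wp z COLLECT (\<lambda>t' s'. sc s' 21 = F + 1 \<and> sc s' 34 = F + length ys \<and>
      seg (ar s' 0) (Suc F) (Suc (F + length ys)) = ys \<and> (\<forall>i \<le> F. ar s' 0 i = ar s 0 i) \<and>
      t' \<le> t + 100 * (length xs + 1)) t s"
proof -
  define P al where P: "P = ar s 0" "al = (\<lambda>i. \<not> 0 < rw s i (d + 1))"
  define lo hi where lh: "lo = ar s 11 u" "hi = ar s 12 u"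
  note [simp] = F[symmetric] u[symmetric] P(1)[symmetric] lh[symmetric]
  from mem obtain zs where zs: "xs = seg P lo hi @ zs" "lst (ar s 14) (ar s 15) (ar s 10 u) zs" "hi \<le> Suc F"
    by (auto simp: members_def)
  have le': "lo \<le> hi" "F + (hi - lo) + length zs + 2 \<le> IB" using le zs(1) by simp_all
  define I where "I = (\<lambda>K ws t' s'. F \<le> sc s' 34 \<and> seg (ar s' 0) (Suc F) (Suc (sc s' 34)) = filter al ws \<and>
    (\<forall>i \<le> F. ar s' 0 i = P i) \<and> t' \<le> t + K + 90 * length ws)"
  have step: "wp z COPY (\<lambda>t' s'. I K (ws @ [x]) (t' + 25) s') u s1"
    if "u \<le> t1 + 30" "I K ws t1 s0" "sc s1 34 = sc s0 34" "ar s1 0 = ar s0 0" "sc s1 31 = x" "rw s1 = rw s" "F + length ws + 1 \<le> IB" for K ws x s1 s0 t1 u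
  proof -
    from that have i: "F \<le> sc s1 34" "seg (ar s1 0) (Suc F) (Suc (sc s1 34)) = filter al ws" "\<forall>i \<le> F. ar s1 0 i = P i"
      "t1 \<le> t + K + 90 * length ws" by (auto simp: I_def)
    have len: "sc s1 34 = F + length (filter al ws)" using arg_cong[OF i(2), of length] i(1) by simp
    have le34: "sc s1 34 \<le> F + length ws" unfolding len by simp
    then have le35: "Suc (sc s1 34) \<le> IB" using that(7) by simp
    have alx: "al x \<longleftrightarrow> \<not> 0 < rw s x (Suc d)" by (simp add: P(2))
    have "seg ((ar s1 0)(Suc (sc s1 34) := x)) (Suc F) (Suc (Suc (sc s1 34))) = filter al ws @ [x]"
      using i(1) unfolding seg_Suc[OF le_SucI[OF i(1)], THEN sym, simplified] i(2)[symmetric]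
      by (subst seg_Suc) (auto intro: seg_cong)
    then show ?thesis using i that le34 le35 unfolding COPY_def
      by (auto simp: I_def alx)
  qed
  have I0: "I 40 [] (23 + t) (setv (setv (setv s 21 (Suc F)) 34 F) 27 lo)" by (simp add: I_def)
  show ?thesis unfolding COLLECT_def
    apply simp
    apply (intro conjI)
    subgoal using le' by (simp add: disjI2)
    apply (rule wp_while[where I = "\<lambda>t' s'. lo \<le> sc s' 27 \<and> sc s' 27 \<le> hi \<and> I 40 (seg P lo (sc s' 27)) t' s' \<and> sc s' 21 = Suc F"
        and \<mu> = "\<lambda>s. hi - sc s 27"])
  proof goal_cases
    case 1
    show ?case using I0 le' by simp
  next
    case (2 t1 s1)
    note [simp] = frD[OF 2(2)]
    define i where "i = sc s1 27"
    note [simp] = i_def[symmetric]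
    from 2 have i: "lo \<le> i" "i < hi" "I 40 (seg P lo i) t1 s1" "sc s1 21 = Suc F" by auto
    have Pi: "ar s1 0 i = P i" using i(2,3) zs(3) by (auto simp: I_def)
    have sg: "seg P lo i @ [P i] = seg P lo (Suc i)" using i by (simp add: seg_Suc)
    have b: "F + (i - lo) + 1 \<le> IB" using i le' by linarith
    have iI: "Suc i \<le> IB" using i zs(3) le' by linarith
    have "wp z COPY (\<lambda>t' s'. I 40 (seg P lo (Suc i)) (t' + 25) s') (t1 + 24) (setv s1 31 (P i))"
      using step[of "t1 + 24" t1 40 "seg P lo i" s1 "setv s1 31 (P i)" "P i"] i b by (simp add: sg)
    then have "wp z COPY (\<lambda>t' s'. I 40 (seg P lo (Suc i)) (t' + 7) (setv s' 27 (Suc i)) \<and> sc s' 27 = i \<and> sc s' 21 = Suc F) (t1 + 24) (setv s1 31 (P i))"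
    proof (rule wp_mono)
      fix t' s' assume I: "I 40 (seg P lo (Suc i)) (t' + 25) s'" and fr: "fr COPY (setv s1 31 (P i)) s'"
      show "I 40 (seg P lo (Suc i)) (t' + 7) (setv s' 27 (Suc i)) \<and> sc s' 27 = i \<and> sc s' 21 = Suc F"
        using I frD[OF fr] i by (auto simp: I_def)
    qed
    then show ?case
      apply (simp add: Pi add.commute)
      apply (erule wp_mono)
      using i iI by (auto simp: add.commute)
  next
    case (3 t1 s1)
    note [simp] = frD[OF 3(2)]
    from 3 have i: "sc s1 27 = hi" "I 40 (seg P lo hi) t1 s1" "sc s1 21 = Suc F" by auto
    show ?case
      apply simp
      apply (rule wp_while[where I = "\<lambda>t' s'. \<exists>ws rs. zs = ws @ rs \<and> lst (ar s 14) (ar s 15) (sc s' 27) rs \<and>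
         I 80 (seg P lo hi @ ws) t' s' \<and> sc s' 21 = Suc F" and \<mu> = "\<lambda>s. sc s 27"])
    proof goal_cases
      case 1
      have "I 80 (seg P lo hi) (24 + t1) (setv s1 27 (ar s 10 u))" using i by (auto simp: I_def)
      then show ?case using zs(2) i by (intro exI[of _ "[]"] exI[of _ zs]) (simp add: add.commute)
    next
      case (2 t2 s2)
      note [simp] = frD[OF 2(2)]
      from 2(1) obtain ws rs where w: "zs = ws @ rs" "lst (ar s 14) (ar s 15) (sc s2 27) rs"
         "I 80 (seg P lo hi @ ws) t2 s2" "sc s2 21 = Suc F" by blast
      define p where "p = sc s2 27"
      note [simp] = p_def[symmetric]
      from 2(3) have p0: "0 < p" by simp
      obtain rs' where r: "rs = ar s 14 p # rs'" "lst (ar s 14) (ar s 15) (ar s 15 p) rs'" "ar s 15 p < p"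
        using lst_pos[OF w(2)] p0 by auto
      have b: "F + length (seg P lo hi @ ws) + 1 \<le> IB" using le'(2) w(1) r(1) by simp
      have "wp z COPY (\<lambda>t' s'. I 80 ((seg P lo hi @ ws) @ [ar s 14 p]) (t' + 25) s') (t2 + 16) (setv s2 31 (ar s 14 p))"
        using step[of "t2 + 16" t2 80 "seg P lo hi @ ws" s2 "setv s2 31 (ar s 14 p)" "ar s 14 p"] w b by simp
      then have "wp z COPY (\<lambda>t' s'. I 80 ((seg P lo hi @ ws) @ [ar s 14 p]) (t' + 11) (setv s' 27 (ar s 15 p)) \<and>
          sc s' 27 = p \<and> sc s' 21 = Suc F \<and> ar s' 15 = ar s 15) (t2 + 16) (setv s2 31 (ar s 14 p))"
      proof (rule wp_mono)
        fix t' s' assume I: "I 80 ((seg P lo hi @ ws) @ [ar s 14 p]) (t' + 25) s'" and fr: "fr COPY (setv s2 31 (ar s 14 p)) s'"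
        show "I 80 ((seg P lo hi @ ws) @ [ar s 14 p]) (t' + 11) (setv s' 27 (ar s 15 p)) \<and>
          sc s' 27 = p \<and> sc s' 21 = Suc F \<and> ar s' 15 = ar s 15"
          using I frD[OF fr] w by (auto simp: I_def)
      qed
      then show ?case
        apply (simp add: add.commute)
        apply (erule wp_mono)
        subgoal for t' s'
          apply (simp add: r(3))
          apply (rule exI[of _ "ws @ [ar s 14 p]"], rule exI[of _ rs'])
          using w(1,4) r(1,2) by (simp add: add.commute)
        done
    next
      case (3 t2 s2)
      from 3(1,3) have "I 80 (seg P lo hi @ zs) t2 s2" "sc s2 21 = Suc F" by auto
      then have j: "F \<le> sc s2 34" "seg (ar s2 0) (Suc F) (Suc (sc s2 34)) = ys" "\<forall>i \<le> F. ar s2 0 i = P i"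
        "t2 \<le> t + 80 + 90 * length xs" "sc s2 21 = Suc F" by (auto simp: I_def zs(1) ys P(2))
      have "sc s2 34 = F + length ys" using arg_cong[OF j(2), of length] j(1) by simp
      then show ?case using j by simp
    qed
  qed
qed

lemma REBUILD_writes [simp]:
  "x < 40 \<Longrightarrow> nv REBUILD x \<longleftrightarrow> x \<notin> {4, 6, 7, 8, 9, 10, 11, 12, 13, 14, 15, 16, 17, 18, 19, 20, 21, 22, 23, 24, 25, 26, 27, 28, 29, 30, 31, 34}"
  "a < 16 \<Longrightarrow> na REBUILD a \<longleftrightarrow> a \<notin> {0, 2, 3, 4, 5, 6, 7, 8, 9, 10, 11, 12, 13}" "x < 8 \<Longrightarrow> nrv REBUILD x \<longleftrightarrow> x \<notin> {3, 4, 5}"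
  by (auto simp: REBUILD_def)

lemma wp_REBUILD:
  assumes F: "F = sc s 4" and u: "u = sc s 32" and mem: "members (ar s) F u xs"
    and xs: "distinct xs" "set xs \<subseteq> {..<N}" "X = set xs \<inter> Al" and al: "\<And>i. i < N \<Longrightarrow> \<not> 0 < rw s i (d + 1) \<longleftrightarrow> i \<in> Al"
    and le: "ar s 11 u \<le> ar s 12 u" "2 * (F + 3 * N + 10) \<le> IB" "IB \<le> 2 ^ L" and lk: "sc s 33 \<le> 2 * F + 1" and eps: "rv s 2 = \<epsilon>"
  shows "wp z REBUILD (\<lambda>t' s'. \<exists>T. LT (ar s') (rw s') Al N (sc s' 4) T (ar s 13 u) (2 * card X) 0 X \<and> csum (ar s') T = 0 \<and>
     ar s' 7 (root T) = 0 \<and> ar s' 8 (root T) = card X \<and> sz (ar s') (root T) = card X \<and> ar s' 3 (sc s 33) = root T \<and>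
     distinct (adrs T) \<and> set (adrs T) \<subseteq> {F<..sc s' 4} \<and> F \<le> sc s' 4 \<and> sc s' 4 \<le> F + 3 * (length xs + 1) \<and>
     t' \<le> t + 40000 * (d * (L + 1)) * ((sh T + 3) * (length xs + 1)) \<and>
     (\<forall>a v. v \<le> F \<longrightarrow> 4 \<le> a \<longrightarrow> a \<le> 13 \<longrightarrow> ar s' a v = ar s a v) \<and> (\<forall>i \<le> 2 * F + 1. i \<noteq> sc s 33 \<longrightarrow> ar s' 3 i = ar s 3 i) \<and>
     (\<forall>i \<le> F. ar s' 0 i = ar s 0 i) \<and> (\<forall>i c. i \<le> F \<or> c \<noteq> d + 2 \<longrightarrow> rw s' i c = rw s i c)) t s"
proof -
  define ys where "ys = filter (\<lambda>i. \<not> 0 < rw s i (d + 1)) xs"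
  have ys: "distinct ys" "set ys = X" "length ys \<le> length xs"
    using xs al by (auto simp: ys_def)
  have lx: "length xs \<le> N" using xs(1,2) card_mono[of "{..<N}" "set xs"] by (simp add: distinct_card)
  have cX: "card X = length ys" using ys by (metis distinct_card)
  define r where "r = Suc (F + length ys)"
  note [simp] = F[symmetric] u[symmetric]
  show ?thesis unfolding REBUILD_def
    apply simp
    apply (rule wp_mono[OF wp_COLLECT[OF F u mem _ le(1) ys_def]])
    subgoal using le lx by simp
    subgoal premises p for t1 s1
    proof -
      note [simp] = frD[OF p(2)]
      from p(1) have p1: "sc s1 21 = Suc F" "sc s1 34 = F + length ys" "seg (ar s1 0) (Suc F) r = ys"
        "\<And>i. i \<le> F \<Longrightarrow> ar s1 0 i = ar s 0 i" "t1 \<le> t + 100 * (length xs + 1)" by (auto simp: r_def)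
      show ?thesis
        apply (rule wp_mono[OF wp_START[where r = r and lo = "Suc F" and e = "ar s 13 u" and X = X and L = L]])
        subgoal using p1 by (simp add: r_def)
        subgoal using p1 by simp
        subgoal by (simp add: r_def)
        subgoal using lk by (simp add: r_def)
        subgoal by simp
        subgoal by simp
        subgoal by simp
        subgoal using p1 ys by simp
        subgoal using p1 ys by simp
        subgoal using le lx ys by (simp add: r_def)
        subgoal using le lx ys by (simp add: r_def)
        subgoal using le lx ys by (simp add: r_def)
        subgoal using eps by simp
        subgoal premises p' for t2 s2
        proof -
          have rF: "r - Suc F = length ys" by (simp add: r_def)
          from p'(1)[unfolded rF] obtain T where T: "BT (ar s2) (rw s2) (Suc (sc s2 4)) T (ar s 13 u) (2 * length ys) X (Suc F) r"
            "root T = r" "ar s2 3 (sc s1 33) = r" "ar s2 7 r = 0" "distinct (adrs T)" "set (adrs T) = {r..sc s2 4}"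
            "sc s2 4 + 2 \<le> r + 2 * max 1 (length ys)"
            "t2 \<le> t1 + 100 + wlen (Arr 13 (Var 32)) + 30000 * (d * (L + 1)) * ((sh T + 3) * (length ys + 1))"
            and f: "\<forall>a v. v < r \<longrightarrow> 4 \<le> a \<longrightarrow> a \<le> 13 \<longrightarrow> ar s2 a v = ar s1 a v" "\<forall>i < 2 * r. i \<noteq> sc s1 33 \<longrightarrow> ar s2 3 i = ar s1 3 i"
            "\<forall>i. i < Suc F \<or> r \<le> i \<longrightarrow> ar s2 0 i = ar s1 0 i" "\<forall>i c. i < r \<or> c \<noteq> d + 2 \<longrightarrow> rw s2 i c = rw s1 i c"
            by (elim exE conjE) (rule that; assumption)
          have T8: "t2 \<le> t1 + 109 + 30000 * (d * (L + 1)) * ((sh T + 3) * (length ys + 1))" using T(8) by simp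
          have rin: "r \<le> sc s2 4" using T(2,6) root_in_adrs[of T] by auto
          have LT: "LT (ar s2) (rw s2) Al N (sc s2 4) T (ar s 13 u) (2 * card X) 0 X \<and> csum (ar s2) T = 0"
            unfolding cX by (rule BT_LT[OF T(1)]) (use T(6) xs rin rF in auto)
          have bn: "bnode (ar s2) r (ar s 13 u) (2 * length ys) X (Suc F) r" using BT_root[OF T(1)] T(2) by simp
          have b: "ar s2 8 r = card X" "sz (ar s2) r = card X" using bn T(4) rF cX by (auto simp: bnode_def)
          have s4: "sc s2 4 \<le> F + 3 * (length xs + 1)" "F \<le> sc s2 4" using T(7) ys(3) rin by (auto simp: r_def)
          have time: "t2 \<le> t + 40000 * (d * (L + 1)) * ((sh T + 3) * (length xs + 1))"
          proof -
            define K where "K = d * (L + 1)"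
            have K: "1 \<le> K" using d1 by (simp add: K_def)
            define Z where "Z = K * ((sh T + 3) * (length xs + 1))"
            define Y where "Y = K * ((sh T + 3) * (length ys + 1))"
            have "1 * (1 * (length xs + 1)) \<le> Z" unfolding Z_def by (intro mult_le_mono K) auto
            then have 1: "length xs + 1 \<le> Z" by simp
            have 2: "Y \<le> Z"
              unfolding Z_def Y_def using ys(3) by (intro mult_le_mono) auto
            have "t2 \<le> t1 + 109 + 30000 * Y" using T8 by (simp only: K_def Y_def mult.assoc)
            moreover have "1 \<le> Z" using 1 by simp
            moreover have "t1 \<le> t + 100 * length xs + 100" using p1(5) by simp
            ultimately have "t2 \<le> t + 40000 * Z" using 1 2 by linarith
            then show ?thesis by (simp only: K_def Z_def mult.assoc)
          qed
          show ?thesis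
            apply (rule exI[of _ T])
            using LT T(2-6) b s4 time f p1(4) rin
            by (auto simp: r_def)
        qed
        done
    qed
    done
qed

end

section \<open>Routing one update down the tree\<close>

context params
begin

text \<open>Run only at nodes with their own counter; \<open>b\<close> distinguishes insertion from
  deletion. The inserted row is the last row of the table, hence the number
  \<open>sc s 5 - 1\<close> in the new list cell. Scalar 35 reports that the counter has passed
  \<epsilon>/8 of the reference size.\<close>

definition TOP :: "bool \<Rightarrow> com" where
  "TOP b = Seq (SetA 9 (Var 37) (WAdd (Arr 9 (Var 37)) (Lit 1)))
     (Seq (if b then sqn [Inc 4, SetA 14 (Var 4) (WSub (Var 5) (Lit 1)), SetA 15 (Var 4) (Arr 10 (Var 37)), SetA 10 (Var 37) (Var 4)]
       else Skip)
     (Cond (RLess (RMul (RVar 2) (OfWord (Arr 8 (Var 37)))) (OfWord (WMul (Lit 8) (Arr 9 (Var 37))))) (SetV 35 (Lit 1)) Skip))"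

definition PRE :: "bool \<Rightarrow> com" where
  "PRE b = sqn [SetV 37 (Arr 3 (Var 33)), SetV 35 (Lit 0), Cond (WLess (Arr 7 (Var 37)) (Lit 1)) (TOP b) Skip]"

definition LEAFUPD :: "bool \<Rightarrow> com" where
  "LEAFUPD b = (if b then sqn [SetA 5 (Var 37) (WAdd (Arr 5 (Var 37)) (WSub (Lit 1) Label)), SetA 6 (Var 37) (WAdd (Arr 6 (Var 37)) Label)]
     else sqn [SetA 5 (Var 37) (WSub (Arr 5 (Var 37)) (WSub (Lit 1) Label)), SetA 6 (Var 37) (WSub (Arr 6 (Var 37)) Label)])"

definition GO :: com where
  "GO = Cond (RLess (Row (Var 37) (Lit (d + 2))) (Feature (WSub (Arr 4 (Var 37)) (Lit 1))))
     (SetV 33 (WAdd (WAdd (Var 37) (Var 37)) (Lit 1))) (SetV 33 (WAdd (Var 37) (Var 37)))"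

text \<open>Scalar 33 is the link slot through which the current node was reached, so that a rebuilt
  subtree can be hooked in there. A rebuild ends the walk, because the new subtree already reflects
  the update.\<close>

definition LOOP :: "bool \<Rightarrow> com" where
  "LOOP b = While (WLess (Lit 0) (Var 36)) (sqn [PRE b,
     Cond (WLess (Lit 0) (Var 35)) (sqn [SetV 32 (Var 37), REBUILD, SetV 36 (Lit 0)])
       (Cond (WLess (Arr 4 (Var 37)) (Lit 1)) (sqn [LEAFUPD b, SetV 36 (Lit 0)]) GO)])"

end

context machine
begin

text \<open>An insertion always uses the fresh row number \<open>N\<close>, whereas a deletion
  removes a live row and keeps the table as long as it was.\<close>

definition upd :: "bool \<Rightarrow> nat \<Rightarrow> nat \<Rightarrow> nat \<Rightarrow> nat set \<Rightarrow> nat set \<Rightarrow> bool" where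
  "upd b i N N' Al Al' \<longleftrightarrow> (if b then i = N \<and> N' = Suc N \<and> Al' = insert N Al else N' = N \<and> i < N \<and> i \<in> Al \<and> Al' = Al - {i})"

definition chg :: "bool \<Rightarrow> nat \<Rightarrow> nat set \<Rightarrow> nat set" where
  "chg b i X = (if b then insert i X else X - {i})"

lemma PRE_writes [simp]:
  "x < 40 \<Longrightarrow> nv (PRE b) x \<longleftrightarrow> x \<noteq> 35 \<and> x \<noteq> 37 \<and> (b \<longrightarrow> x \<noteq> 4)" "a < 16 \<Longrightarrow> na (PRE b) a \<longleftrightarrow> a \<noteq> 9 \<and> (b \<longrightarrow> a \<noteq> 10 \<and> a \<noteq> 14 \<and> a \<noteq> 15)"
  "nrv (PRE b) x" "nrw (PRE b)"
  by (cases b; auto simp: PRE_def TOP_def)+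

text \<open>The effect of counting the update at the node \<open>v\<close>.\<close>

definition touched :: "bool \<Rightarrow> nat \<Rightarrow> state \<Rightarrow> state \<Rightarrow> bool" where
  "touched b v s s' \<longleftrightarrow> (let F = sc s 4 in
     if ar s 7 v = 0
     then ar s' 9 = (ar s 9)(v := Suc (ar s 9 v)) \<and>
       (if b then sc s' 4 = Suc F \<and> ar s' 14 = (ar s 14)(Suc F := sc s 5 - 1) \<and> ar s' 15 = (ar s 15)(Suc F := ar s 10 v) \<and>
          ar s' 10 = (ar s 10)(v := Suc F)
        else sc s' 4 = F \<and> ar s' 14 = ar s 14 \<and> ar s' 15 = ar s 15 \<and> ar s' 10 = ar s 10)
     else sc s' 4 = F \<and> ar s' 9 = ar s 9 \<and> ar s' 14 = ar s 14 \<and> ar s' 15 = ar s 15 \<and> ar s' 10 = ar s 10)"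

lemma wp_PRE:
  assumes "ar s 3 (sc s 33) = v" "ar s 7 v = 0 \<Longrightarrow> ar s 9 v + 1 \<le> IB" "sc s 4 + 1 \<le> IB" "rv s 2 = \<epsilon>"
  shows "wp z (PRE b) (\<lambda>t' s'. t' \<le> t + 200 \<and> sc s' 37 = v \<and> touched b v s s' \<and>
     (0 < sc s' 35 \<longleftrightarrow> ar s 7 v = 0 \<and> \<epsilon> * real (ar s 8 v) < 8 * real (Suc (ar s 9 v)))) t s"
  using assms by (cases b) (auto simp: PRE_def TOP_def touched_def)

lemma touched_frame:
  assumes "touched b v s s'" "fr (PRE b) s s'" "F = sc s 4"
  shows "\<And>a w. w \<noteq> v \<Longrightarrow> 4 \<le> a \<Longrightarrow> a \<le> 13 \<Longrightarrow> ar s' a w = ar s a w"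
    "\<And>a. 4 \<le> a \<Longrightarrow> a \<le> 13 \<Longrightarrow> a \<noteq> 9 \<Longrightarrow> a \<noteq> 10 \<Longrightarrow> ar s' a = ar s a"
    "\<And>i a. i \<le> F \<Longrightarrow> a = 0 \<or> a = 14 \<or> a = 15 \<Longrightarrow> ar s' a i = ar s a i" "ar s' 3 = ar s 3" "rw s' = rw s"
    "F \<le> sc s' 4" "sc s' 4 \<le> F + (if ar s 7 v = 0 then 1 else 0)" "b \<Longrightarrow> ar s 7 v = 0 \<Longrightarrow> F < sc s' 4"
    "curc (ar s') v (Suc c) = Suc (curc (ar s) v c)" "ar s 7 v = 0 \<Longrightarrow> ar s' 9 v = Suc (ar s 9 v)"
proof -
  note [simp] = frD[OF assms(2)]
  note t = assms(1)[unfolded touched_def Let_def, folded assms(3)]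
  show g: "ar s' a = ar s a" if "4 \<le> a" "a \<le> 13" "a \<noteq> 9" "a \<noteq> 10" for a
    using that by simp
  show "ar s' a w = ar s a w" if "w \<noteq> v" "4 \<le> a" "a \<le> 13" for a w
    using g[of a] that t by (cases "a = 9"; cases "a = 10") (auto split: if_splits)
  show "ar s' a i = ar s a i" if "i \<le> F" "a = 0 \<or> a = 14 \<or> a = 15" for i a
    using that t by (auto split: if_splits)
  show "ar s' 3 = ar s 3" "rw s' = rw s" by simp_all
  show "F \<le> sc s' 4" "sc s' 4 \<le> F + (if ar s 7 v = 0 then 1 else 0)" "b \<Longrightarrow> ar s 7 v = 0 \<Longrightarrow> F < sc s' 4"
    "ar s 7 v = 0 \<Longrightarrow> ar s' 9 v = Suc (ar s 9 v)"
    using t by (auto split: if_splits)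
  have "ar s' 7 = ar s 7" by simp
  then show "curc (ar s') v (Suc c) = Suc (curc (ar s) v c)" using t by (auto simp: curc_def split: if_splits)
qed

lemma touched_ltn:
  assumes t: "touched b v s s'" and fr: "fr (PRE b) s s'" and F: "F = sc s 4"
    and l: "ltn (ar s) Al N F v e B X" and u: "upd b i N N' Al Al'" "sc s 5 = N'" and v: "v \<le> F" and X: "X \<subseteq> {..<N}" "\<not> b \<Longrightarrow> i \<in> X"
  shows "ltn (ar s') Al' N' (sc s' 4) v e B (chg b i X) \<and>
    (ar s 7 v = 0 \<longrightarrow> (\<exists>xs. members (ar s') (sc s' 4) v xs \<and> distinct xs \<and> set xs \<subseteq> {..<N'} \<and> set xs \<inter> Al' = chg b i X \<and>
       length xs \<le> sz (ar s) v + ar s 9 v + 1))"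
proof -
  note f = touched_frame[OF t fr F]
  have eq: "ar s' 13 = ar s 13" "ar s' 11 = ar s 11" "ar s' 12 = ar s 12" "ar s' 8 = ar s 8" "ar s' 7 = ar s 7"
    using f(2)[of 13] f(2)[of 11] f(2)[of 12] f(2)[of 8] f(2)[of 7] by simp_all
  have top: "\<exists>xs. members (ar s') (sc s' 4) v xs \<and> distinct xs \<and> set xs \<subseteq> {..<N'} \<and> set xs \<inter> Al' = chg b i X \<and>
       length xs \<le> sz (ar s) v + ar s 9 v + 1" if 7: "ar s 7 v = 0"
  proof -
    from l 7 obtain xs where xs: "members (ar s) F v xs" "distinct xs" "set xs \<subseteq> {..<N}" "set xs \<inter> Al = X"
      by (auto simp: ltn_def)
    from xs(1) obtain ys where ys: "xs = seg (ar s 0) (ar s 11 v) (ar s 12 v) @ ys" "lst (ar s 14) (ar s 15) (ar s 10 v) ys"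
      "ar s 10 v \<le> F" "ar s 12 v \<le> Suc F" "length ys \<le> ar s 9 v" by (auto simp: members_def)
    have sg: "seg (ar s' 0) (ar s 11 v) (ar s 12 v) = seg (ar s 0) (ar s 11 v) (ar s 12 v)"
      by (rule seg_cong) (use f(3) ys(4) in auto)
    have ls: "lst (ar s' 14) (ar s' 15) (ar s 10 v) ys"
      by (rule lst_frame[OF ys(2,3)]) (use f(3) in auto)
    show ?thesis
    proof (cases b)
      case True
      with t 7 u F have e: "sc s' 4 = Suc F" "ar s' 14 (Suc F) = N" "ar s' 15 (Suc F) = ar s 10 v" "ar s' 10 v = Suc F" "i = N" "N' = Suc N" "Al' = insert N Al"
        by (auto simp: touched_def upd_def Let_def)
      have "lst (ar s' 14) (ar s' 15) (Suc F) (ar s' 14 (Suc F) # ys)"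
        by (rule lst.Cons) (use e ys ls in auto)
      then have "members (ar s') (sc s' 4) v (seg (ar s 0) (ar s 11 v) (ar s 12 v) @ N # ys)"
        using e ys(3-5) sg eq f(10)[OF 7] by (auto simp: members_def)
      moreover have "distinct (seg (ar s 0) (ar s 11 v) (ar s 12 v) @ N # ys)" using xs(2,3) ys(1) by auto
      moreover have "set (seg (ar s 0) (ar s 11 v) (ar s 12 v) @ N # ys) = insert N (set xs)" using ys(1) by auto
      moreover have "insert N (set xs) \<inter> Al' = chg b i X" using xs(4) e True by (auto simp: chg_def)
      moreover have "insert N (set xs) \<subseteq> {..<N'}" using xs(3) e by auto
      ultimately show ?thesis using ys(5) by (intro exI[of _ "seg (ar s 0) (ar s 11 v) (ar s 12 v) @ N # ys"]) simp
    next
      case False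
      with t 7 u F have e: "sc s' 4 = F" "ar s' 10 v = ar s 10 v" "N' = N" "Al' = Al - {i}"
        by (auto simp: touched_def upd_def Let_def)
      have "members (ar s') (sc s' 4) v xs"
        using e ys sg ls eq f(10)[OF 7] by (auto simp: members_def)
      moreover have "set xs \<inter> Al' = chg b i X" using xs(4) e False by (auto simp: chg_def)
      ultimately show ?thesis using xs ys(1,5) e by (intro exI[of _ xs]) simp
    qed
  qed
  have "ltn (ar s') Al' N' (sc s' 4) v e B (chg b i X)"
    using l top v f(6) eq by (cases "ar s 7 v = 0") (auto simp: ltn_def)
  with top show ?thesis by blast
qed

definition dframe :: "state \<Rightarrow> sk \<Rightarrow> state \<Rightarrow> bool" where
  "dframe s T s' \<longleftrightarrow>
     (\<forall>v a. v \<le> sc s 4 \<longrightarrow> v \<notin> set (adrs T) \<longrightarrow> 4 \<le> a \<longrightarrow> a \<le> 13 \<longrightarrow> ar s' a v = ar s a v) \<and>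
     (\<forall>i \<le> 2 * sc s 4 + 1. i \<noteq> sc s 33 \<longrightarrow> i div 2 \<notin> set (adrs T) \<longrightarrow> ar s' 3 i = ar s 3 i) \<and>
     (\<forall>i a. i \<le> sc s 4 \<longrightarrow> a = 0 \<or> a = 14 \<or> a = 15 \<longrightarrow> ar s' a i = ar s a i) \<and>
     (\<forall>i c. i \<le> sc s 4 \<or> c \<noteq> d + 2 \<longrightarrow> rw s' i c = rw s i c)"

text \<open>
  In the postcondition, \<open>\<rho>\<close> bounds the size of a rebuilt subtree, \<open>\<chi>\<close> is the counter that
  its root had reached, and \<open>\<tau>\<close> is the number of counters incremented on the way.
\<close>

definition dpost :: "bool \<Rightarrow> nat \<Rightarrow> nat set \<Rightarrow> nat \<Rightarrow> nat \<Rightarrow> state \<Rightarrow> sk \<Rightarrow> nat \<Rightarrow> nat \<Rightarrow> nat \<Rightarrow> nat set \<Rightarrow> nat \<Rightarrow> state \<Rightarrow> bool" where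
  "dpost b L Al' N' t s T e B c X' t' s' \<longleftrightarrow> (\<exists>T' \<rho> \<tau> \<chi> :: nat. LT (ar s') (rw s') Al' N' (sc s' 4) T' e B (Suc c) X' \<and>
     distinct (adrs T') \<and> set (adrs T') \<subseteq> set (adrs T) \<union> {sc s 4<..sc s' 4} \<and> ar s' 3 (sc s 33) = root T' \<and>
     (root T' = root T \<and> sz (ar s') (root T') = sz (ar s) (root T) \<and> ar s' 7 (root T) = ar s 7 (root T) \<or>
      sz (ar s') (root T') = card X' \<and> ar s' 7 (root T') = 0 \<and> ar s 7 (root T) = 0) \<and>
     t' \<le> t + 500 * (sh T + 1) + 40000 * (d * (L + 1)) * ((sh T' + 3) * \<rho>) \<and>
     sc s' 4 \<le> sc s 4 + \<tau> + 3 * \<rho> \<and> sc s 4 \<le> sc s' 4 \<and>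
     csum (ar s') T' + \<chi> \<le> csum (ar s) T + \<tau> \<and> \<epsilon> * real \<rho> \<le> 20 * real \<chi> \<and> \<tau> \<le> tp (ar s) T \<and>
     (b \<longrightarrow> ar s 7 (root T) = 0 \<longrightarrow> sc s 4 < sc s' 4) \<and> \<rho> \<le> 2 * N' \<and> dframe s T s')"

text \<open>Row \<open>i\<close> carries the features and the label of the request, so comparing the
  request with thresholds follows the route of row \<open>i\<close>. The last inequality reserves
  one list cell for every remaining level and the memory for one rebuild; the height term shrinks as
  fast as the cells are used.\<close>

definition dpre :: "bool \<Rightarrow> nat \<Rightarrow> nat \<Rightarrow> nat \<Rightarrow> nat set \<Rightarrow> nat set \<Rightarrow> example \<Rightarrow> state \<Rightarrow> sk \<Rightarrow> nat \<Rightarrow> nat \<Rightarrow> nat \<Rightarrow> nat set \<Rightarrow> bool" where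
  "dpre b i N N' Al Al' z s T e B c X \<longleftrightarrow> LT (ar s) (rw s) Al N (sc s 4) T e B c X \<and> distinct (adrs T) \<and>
     ar s 3 (sc s 33) = root T \<and> sc s 33 \<le> 2 * sc s 4 + 1 \<and> sc s 33 div 2 \<notin> set (adrs T) \<and> 0 < sc s 36 \<and> sc s 5 = N' \<and>
     (\<forall>i < N'. \<not> 0 < rw s i (d + 1) \<longleftrightarrow> i \<in> Al') \<and> (\<forall>c < d. rw s i c = fst z ! c) \<and> (0 < rw s i d \<longleftrightarrow> snd z) \<and> length (fst z) = d \<and>
     (\<not> b \<longrightarrow> i \<in> X) \<and> X \<subseteq> {..<N} \<and> upd b i N N' Al Al' \<and>
     (ar s 7 (root T) \<noteq> 0 \<longrightarrow> 8 * real (Suc c) \<le> \<epsilon> * real B) \<and> (ar s 7 (root T) = 0 \<longrightarrow> 4 * card (chg b i X) \<le> 3 * B) \<and>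
     rv s 2 = \<epsilon> \<and> 2 * (sc s 4 + sh T + 3 * N' + 11) \<le> IB"

lemma finish: "\<not> 0 < sc s 36 \<Longrightarrow> Q (t + 5) s \<Longrightarrow> wp z (LOOP b) Q t s"
  unfolding LOOP_def by (subst wp_While_unfold) simp

lemma c_chg:
  assumes "finite X" "\<not> b \<Longrightarrow> i \<in> X" "b \<Longrightarrow> i \<notin> X"
  shows "c0 G (chg b i X) = (if b then c0 G X + of_bool (\<not> 0 < G i d) else c0 G X - of_bool (\<not> 0 < G i d))"
    "c1 G (chg b i X) = (if b then c1 G X + of_bool (0 < G i d) else c1 G X - of_bool (0 < G i d))"
proof -
  have "insert i (X - {i}) = X" if "\<not> b" using assms(2)[OF that] by auto
  then show "c0 G (chg b i X) = (if b then c0 G X + of_bool (\<not> 0 < G i d) else c0 G X - of_bool (\<not> 0 < G i d))"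
    "c1 G (chg b i X) = (if b then c1 G X + of_bool (0 < G i d) else c1 G X - of_bool (0 < G i d))"
    using c_snoc[of i X G] c_snoc[of i "X - {i}" G] assms by (auto simp: chg_def)
qed

lemma sd_chg: "finite X \<Longrightarrow> finite Y \<Longrightarrow> sd X (chg b i Y) \<le> Suc (sd X Y)"
  using sd_insert[of X Y i] sd_remove[of X Y i] by (auto simp: chg_def)

lemma lft_chg:
  "G i j \<le> t \<Longrightarrow> lft G (chg b i X) j t = chg b i (lft G X j t)" "G i j \<le> t \<Longrightarrow> rgt G (chg b i X) j t = rgt G X j t"
  "\<not> G i j \<le> t \<Longrightarrow> lft G (chg b i X) j t = lft G X j t" "\<not> G i j \<le> t \<Longrightarrow> rgt G (chg b i X) j t = chg b i (rgt G X j t)"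
  by (auto simp: lft_def rgt_def chg_def)

text \<open>The walk stops at a node whose counter overflows. The witnesses of \<open>dpost\<close>
  are the number of collected rows plus one, a single incremented counter, and the value this
  counter had reached, which disappears from \<open>csum\<close> together with all other counters of
  the subtree.\<close>

lemma wp_LOOP_rebuild:
  assumes pre: "dpre b i N N' Al Al' z s T e B c X" and v: "v = root T" and L: "IB \<le> 2 ^ L"
    and top: "ar s 7 v = 0" and over: "\<epsilon> * real (ar s 8 v) < 8 * real (Suc (ar s 9 v))"
    and t1: "t1 \<le> t + 210" and s1: "touched b v s s1" "fr (PRE b) s s1" "sc s1 37 = v"
  shows "wp z (Seq (sqn [SetV 32 (Var 37), REBUILD, SetV 36 (Lit 0)]) (LOOP b)) (dpost b L Al' N' t s T e B c (chg b i X)) t1 s1"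
proof -
  define F where "F = sc s 4"
  note P = pre[unfolded dpre_def]
  note f = touched_frame[OF s1(1,2) F_def]
  note [simp] = frD[OF s1(2)]
  have lt: "ltn (ar s) Al N F v e B X" "quiet (ar s) v c" using LT_root[of "ar s" "rw s"] P v by (auto simp: F_def)
  have vF: "v \<le> F" using lt by (simp add: ltn_def)
  have u: "upd b i N N' Al Al'" "sc s 5 = N'" and X: "X \<subseteq> {..<N}" "\<not> b \<Longrightarrow> i \<in> X" and finX: "finite X"
    using P finite_subset[of X "{..<N}"] by auto
  from touched_ltn[OF s1(1,2) F_def lt(1) u vF X] top
  obtain xs where xs: "members (ar s1) (sc s1 4) v xs" "distinct xs" "set xs \<subseteq> {..<N'}" "set xs \<inter> Al' = chg b i X"
    "length xs \<le> sz (ar s) v + ar s 9 v + 1" by auto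
  have F1: "F \<le> sc s1 4" "sc s1 4 \<le> F + 1" using f(6,7) top by auto
  have A: "ar s1 11 v = ar s 11 v" "ar s1 12 v = ar s 12 v" "ar s1 13 v = ar s 13 v" by simp_all
  have le: "ar s 11 v \<le> ar s 12 v" "ar s 8 v = sz (ar s) v" "ar s 13 v = e" using lt(1) top by (auto simp: ltn_def)
  define \<rho> where "\<rho> = length xs + 1"
  have lN: "length xs \<le> N'" using xs(2,3) card_mono[of "{..<N'}" "set xs"] by (simp add: distinct_card)
  show ?thesis
    apply simp
    apply (rule wp_mono[OF wp_REBUILD[where F = "sc s1 4" and u = v and xs = xs and X = "chg b i X" and Al = Al' and N = N' and L = L]])
    using s1(3) xs(1) xs(2) xs(3) xs(4)[symmetric] apply (simp_all)[6]
    subgoal using P by simp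
    subgoal using le A by simp
    subgoal using F1 P by (simp add: F_def)
    subgoal using L .
    subgoal using F1 P by (simp add: F_def)
    subgoal using P by simp
    subgoal premises p for t2 s2
    proof -
      note [simp] = frD[OF p(2)]
      show ?thesis
        apply (insert p(1), erule exE)
        subgoal premises q for T'
        proof -
          have T: "LT (ar s2) (rw s2) Al' N' (sc s2 4) T' e (2 * card (chg b i X)) 0 (chg b i X)"
            "csum (ar s2) T' = 0" "ar s2 7 (root T') = 0" "ar s2 8 (root T') = card (chg b i X)" "sz (ar s2) (root T') = card (chg b i X)"
            "ar s2 3 (sc s 33) = root T'" "distinct (adrs T')" "set (adrs T') \<subseteq> {sc s1 4<..sc s2 4}" "sc s1 4 \<le> sc s2 4"
            "sc s2 4 \<le> sc s1 4 + 3 * \<rho>" using q le A by (simp_all add: \<rho>_def)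
          have t2: "t2 \<le> t1 + 5 + 40000 * (d * (L + 1)) * ((sh T' + 3) * \<rho>)" using q by (simp add: \<rho>_def)
          have T2: "\<And>a v. v \<le> sc s1 4 \<Longrightarrow> 4 \<le> a \<Longrightarrow> a \<le> 13 \<Longrightarrow> ar s2 a v = ar s1 a v"
            "\<And>i. i \<le> 2 * sc s1 4 + 1 \<Longrightarrow> i \<noteq> sc s 33 \<Longrightarrow> ar s2 3 i = ar s1 3 i"
            "\<And>i. i \<le> sc s1 4 \<Longrightarrow> ar s2 0 i = ar s1 0 i" "\<And>i c. i \<le> sc s1 4 \<or> c \<noteq> d + 2 \<Longrightarrow> rw s2 i c = rw s1 i c"
            using q by auto
          have LT: "LT (ar s2) (rw s2) Al' N' (sc s2 4) T' e B (Suc c) (chg b i X)"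
            using T(1,3) by (rule LT_top) (use T(4) P v top in simp)
          have df: "dframe s T (setv s2 36 0)"
            unfolding dframe_def
          proof (intro conjI allI impI)
            show "ar (setv s2 36 0) a w = ar s a w" if "w \<le> sc s 4" "w \<notin> set (adrs T)" "4 \<le> a" "a \<le> 13" for a w
            proof -
              have "w \<noteq> v" using that(2) v root_in_adrs[of T] by metis
              then show ?thesis using T2(1)[of w a] f(1)[of w a] that F1 by (auto simp: F_def)
            qed
            show "ar (setv s2 36 0) 3 i = ar s 3 i" if "i \<le> 2 * sc s 4 + 1" "i \<noteq> sc s 33" for i
              using T2(2)[of i] that F1 f(4) by (auto simp: F_def)
            show "ar (setv s2 36 0) a i = ar s a i" if "i \<le> sc s 4" "a = 0 \<or> a = 14 \<or> a = 15" for a i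
              using T2(3)[of i] f(3)[of i a] that F1 by (auto simp: F_def)
            show "rw (setv s2 36 0) i c = rw s i c" if "i \<le> sc s 4 \<or> c \<noteq> d + 2" for i c
              using T2(4)[of i c] that F1 f(5) by (auto simp: F_def)
          qed
          \<comment> \<open>Overflow means that \<epsilon> times the old size is below 8 times the
            counter, and the insertions collected on top are bounded by the counter as well.\<close>
          have rho: "\<epsilon> * real \<rho> \<le> 20 * real (Suc (ar s 9 v))"
          proof -
            have "real \<rho> \<le> real (ar s 8 v) + 2 * real (Suc (ar s 9 v))" using xs(5) le by (simp add: \<rho>_def)
            then have "\<epsilon> * real \<rho> \<le> \<epsilon> * (real (ar s 8 v) + 2 * real (Suc (ar s 9 v)))" using eps0 by (intro mult_left_mono) auto
            moreover have "\<epsilon> * real (Suc (ar s 9 v)) \<le> 1 * real (Suc (ar s 9 v))" using eps2 by (intro mult_right_mono) auto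
            ultimately show ?thesis using over by (simp add: distrib_left)
          qed
          have cs: "csum (ar s2) T' + Suc (ar s 9 v) \<le> csum (ar s) T + 1" using T(2) top v by (cases T) auto
          have tpT: "1 \<le> tp (ar s) T" using top v by (cases T) auto
          have sd: "set (adrs T') \<subseteq> set (adrs T) \<union> {sc s 4<..sc s2 4}" using T(8) F1 by (auto simp: F_def)
          have bb: "b \<Longrightarrow> sc s 4 < sc s2 4" using f(8) top T(9) by (simp add: F_def)
          have t3: "t2 + 8 \<le> t + 500 * (sh T + 1) + 40000 * (d * (L + 1)) * ((sh T' + 3) * \<rho>)" using t2 t1 by simp
          have N1: "0 < N'" using u by (auto simp: upd_def split: if_splits)
          have "dpost b L Al' N' t s T e B c (chg b i X) (t2 + 8) (setv s2 36 0)"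
            unfolding dpost_def
            using LT T(3,5-7,9,10) df rho cs tpT sd bb t3 F1 v top lN N1
            by (intro exI[of _ T'] exI[of _ \<rho>] exI[of _ 1] exI[of _ "Suc (ar s 9 v)"])
               (auto simp: F_def \<rho>_def)
          then show ?thesis by (simp, intro finish) (simp_all add: add.commute)
        qed
        done
    qed
    done
qed


text \<open>Row \<open>i\<close> affects only the left subtree, which is covered by the induction
  hypothesis; the right one is moved along by \<open>LT_frame\<close>. The delicate point is the
  relation \<open>chld\<close> between the node and its left child, which may have been rebuilt with
  a different size. It follows from the closeness of the node's current set to its set at build
  time.\<close>

lemma wp_LOOP_l:
  assumes pre: "dpre b i N N' Al Al' z s (SN v l r) e B c X"
    and s1: "touched b v s s1" "fr (PRE b) s s1" "sc s1 37 = v"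
    and calm: "\<not> (ar s 7 v = 0 \<and> \<epsilon> * real (ar s 8 v) < 8 * real (Suc (ar s 9 v)))"
    and j: "ar s 4 v = Suc j" and go: "rw s i j \<le> rw s v (d + 2)" and t1: "t1 \<le> t + 300"
    and IH: "\<And>e B c X s t. dpre b i N N' Al Al' z s l e B c X \<Longrightarrow> wp z (LOOP b) (dpost b L Al' N' t s l e B c (chg b i X)) t s"
  shows "wp z (LOOP b) (dpost b L Al' N' t s (SN v l r) e B c (chg b i X)) t1 (setv s1 33 (2 * v))"
proof -
  define F th where "F = sc s 4" and th: "th = rw s v (d + 2)"
  note P = pre[unfolded dpre_def]
  note f = touched_frame[OF s1(1,2) F_def]
  from P have "LT (ar s) (rw s) Al N F (SN v l r) e B c X" by (simp add: F_def)
  then obtain j' X0 where m: "ltn (ar s) Al N F v e B X" "quiet (ar s) v c" "ar s 3 (2 * v) = root l" "ar s 3 (2 * v + 1) = root r"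
    "ar s 4 v = Suc j'" "near (ar s) N v c X X0" "split_cond (rw s) X0 e j' th"
    "chld (ar s) v (root l) (lft (rw s) X0 j' th)" "chld (ar s) v (root r) (rgt (rw s) X0 j' th)"
    "LT (ar s) (rw s) Al N F l (Suc e) (ar s 8 v) (curc (ar s) v c) (lft (rw s) X j' th)"
    "LT (ar s) (rw s) Al N F r (Suc e) (ar s 8 v) (curc (ar s) v c) (rgt (rw s) X j' th)" unfolding th by (rule LT_SN)
  have jj: "j' = j" using m(5) j by simp
  note m = m[unfolded jj]
  have jd: "j < d" using m(7) by (simp add: split_cond_def)
  have u: "upd b i N N' Al Al'" "sc s 5 = N'" and X: "X \<subseteq> {..<N}" "\<not> b \<Longrightarrow> i \<in> X" and finX: "finite X"
    using P finite_subset[of X "{..<N}"] by auto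
  have biX: "b \<Longrightarrow> i \<notin> X" using u X by (auto simp: upd_def)
  have NN: "N \<le> N'" using u by (auto simp: upd_def split: if_splits)
  have dis: "distinct (adrs l)" "distinct (adrs r)" "set (adrs l) \<inter> set (adrs r) = {}" "v \<notin> set (adrs l)" "v \<notin> set (adrs r)"
    using P by auto
  have sub: "set (adrs l) \<subseteq> {..F}" "set (adrs r) \<subseteq> {..F}" using LT_adrs[OF m(10)] LT_adrs[OF m(11)] by auto
  have vF: "v \<le> F" using m(1) by (simp add: ltn_def)
  have F1: "F \<le> sc s1 4" "sc s1 4 \<le> F + (if ar s 7 v = 0 then 1 else 0)" using f(6,7) by auto
  note tl = touched_ltn[OF s1(1,2) F_def m(1) u vF X]
  let ?X' = "chg b i X"
  let ?C = "curc (ar s) v c"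
  have q1: "8 * real (Suc ?C) \<le> \<epsilon> * real (ar s 8 v)"
  proof (cases "ar s 7 v = 0")
    case True
    with calm show ?thesis by (simp add: curc_def)
  next
    case False
    have "8 * real (Suc c) \<le> \<epsilon> * real B" using P False by simp
    with m(1) False show ?thesis by (simp add: curc_def ltn_def)
  qed
  have finX0: "finite X0" and cX0: "card X0 = sz (ar s) v" and sdX: "sd X0 ?X' \<le> Suc ?C"
    using m(6) finite_subset[of X0 "{..<N}"] sd_chg[of X0 X b i] finX by (auto simp: near_def)
  have finX': "finite ?X'" using finX by (simp add: chg_def)
  have chX: "lft (rw s) ?X' j th = chg b i (lft (rw s) X j th)" "rgt (rw s) ?X' j th = rgt (rw s) X j th"
    using lft_chg[of "rw s" i j th b X] go th by auto
  have iCF: "\<not> b \<Longrightarrow> i \<in> lft (rw s) X j th" and iOF: "i \<notin> rgt (rw s) X j th"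
    using X(2) go th biX by (auto simp: lft_def rgt_def)
  define n' where "n' = card (lft (rw s) ?X' j th)"
  have card': "real n' \<le> real (card (lft (rw s) X0 j th)) + real (Suc ?C)"
  proof -
    have "sd X0 ?X' = sd (lft (rw s) X0 j th) (lft (rw s) ?X' j th) + sd (rgt (rw s) X0 j th) (rgt (rw s) ?X' j th)"
      unfolding lft_def rgt_def by (rule sd_split[OF finX0 finX'])
    then have "sd (lft (rw s) X0 j th) (lft (rw s) ?X' j th) \<le> Suc ?C" using sdX by simp
    then show ?thesis
      using card_diff_sd[of "lft (rw s) X0 j th" "lft (rw s) ?X' j th"] finX0 finX' by (simp add: n'_def)
  qed
  have A8: "real (ar s 8 v) \<le> 2 * real (sz (ar s) v)"
  proof -
    have "ar s 8 v \<le> 2 * sz (ar s) v" using m(1) by (simp add: ltn_def)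
    then show ?thesis by linarith
  qed
  \<comment> \<open>At build time the other side had at least 2\<epsilon>|X0| rows. The drift is at
    most \<epsilon>|X0|/4, so the left side still has at most (1-\<epsilon>)|X0| rows.\<close>
  have size1: "real n' \<le> (1 - \<epsilon>) * real (sz (ar s) v)"
  proof -
    have "2 * \<epsilon> * real (card X0) \<le> real (card (rgt (rw s) X0 j th))"
      using m(7) sco_le_sides[OF finX0, of "rw s" j th] by (auto simp: split_cond_def)
    moreover have "card (lft (rw s) X0 j th) + card (rgt (rw s) X0 j th) = card X0" by (rule card_lft_rgt[OF finX0])
    then have "real (card (lft (rw s) X0 j th)) + real (card (rgt (rw s) X0 j th)) = real (card X0)" by linarith
    moreover have "\<epsilon> * real (ar s 8 v) \<le> \<epsilon> * (2 * real (sz (ar s) v))" using A8 eps0 by (intro mult_left_mono) auto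
    then have "\<epsilon> * real (ar s 8 v) \<le> 2 * (\<epsilon> * real (sz (ar s) v))" by (simp only: ac_simps)
    moreover have "0 \<le> \<epsilon> * real (sz (ar s) v)" using eps0 by simp
    moreover have "n \<le> M - eM" if "2 * eM \<le> R" "L + R = M" "eA \<le> 2 * eM" "0 \<le> eM" "n \<le> L + S" "8 * S \<le> eA"
      for n M eM R L S eA :: real using that by linarith
    ultimately show ?thesis using card' q1 unfolding cX0 left_diff_distrib mult_1_left mult.assoc by blast
  qed
  \<comment> \<open>Half of the reference size at build time, plus a drift of at most one eighth of
    it, is below three quarters.\<close>
  have size2: "4 * n' \<le> 3 * ar s 8 v" if "2 * card (lft (rw s) X0 j th) \<le> ar s 8 v"
  proof -
    have "\<epsilon> * real (ar s 8 v) \<le> 1 * real (ar s 8 v)" using eps2 by (intro mult_right_mono) auto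
    moreover have "2 * real (card (lft (rw s) X0 j th)) \<le> real (ar s 8 v)" using that by linarith
    moreover have "4 * n \<le> 3 * A" if "eA \<le> 1 * A" "2 * L \<le> A" "n \<le> L + S" "8 * S \<le> eA" "0 \<le> A"
      for n L S eA A :: real using that by linarith
    ultimately have "4 * real n' \<le> 3 * real (ar s 8 v)" using card' q1 of_nat_0_le_iff by blast
    then show ?thesis by linarith
  qed
  define s2 where "s2 = setv s1 33 (2 * v)"
  have s2 [simp]: "ar s2 = ar s1" "rw s2 = rw s1" "sc s2 4 = sc s1 4" "sc s2 33 = 2 * v" "rv s2 = rv s1"
    by (simp_all add: s2_def)
  have nvl: "w \<noteq> v" if "w \<in> set (adrs l)" for w using that dis by auto
  have pre2: "dpre b i N N' Al Al' z s2 l (Suc e) (ar s 8 v) ?C (lft (rw s) X j th)"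
  proof -
    have "LT (ar s1) (rw s1) Al N (sc s1 4) l (Suc e) (ar s 8 v) ?C (lft (rw s) X j th)"
    proof (rule LT_frame[where ?i0.0 = N, OF m(10)])
      show "8 * real ?C \<le> \<epsilon> * real (ar s 8 v)" using m(2) by (simp add: quiet_def)
    qed (use f(1,3-6) nvl X lft_sub[of "rw s" X j th] in auto)
    note LT2 = this
    have e7: "ar s1 7 = ar s 7" using f(2)[of 7] by simp
    have fx: "rv s1 2 = rv s 2" "sc s1 36 = sc s 36" "sc s1 5 = sc s 5" using frD(1,3)[OF s1(2)] by simp_all
    have fx2: "sc s2 36 = sc s1 36" "sc s2 5 = sc s1 5" by (simp_all add: s2_def)
    have Pz: "\<forall>i < N'. \<not> 0 < rw s i (d + 1) \<longleftrightarrow> i \<in> Al'" "\<forall>c < d. rw s i c = fst z ! c" "0 < rw s i d \<longleftrightarrow> snd z" "length (fst z) = d"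
      "rv s 2 = \<epsilon>" "0 < sc s 36" "2 * (F + sh (SN v l r) + 3 * N' + 11) \<le> IB" using P by (simp_all add: F_def)
    have shl: "Suc (sh l) \<le> sh (SN v l r)" by simp
    show ?thesis unfolding dpre_def s2 fx2 fx f(4,5) e7
    proof (intro conjI)
      show "ar s 3 (2 * v) = root l" by (rule m(3))
      show "2 * v \<le> 2 * sc s1 4 + 1" using vF F1 by simp
      show "2 * v div 2 \<notin> set (adrs l)" using dis by simp
      show "ar s 7 (root l) \<noteq> 0 \<longrightarrow> 8 * real (Suc ?C) \<le> \<epsilon> * real (ar s 8 v)" using q1 by blast
      show "ar s 7 (root l) = 0 \<longrightarrow> 4 * card (chg b i (lft (rw s) X j th)) \<le> 3 * ar s 8 v"
        using size2 m(8) unfolding n'_def chX chld_def by blast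
      show "2 * (sc s1 4 + sh l + 3 * N' + 11) \<le> IB" using Pz(7) F1(2) shl by (simp split: if_splits)
      show "lft (rw s) X j th \<subseteq> {..<N}" using X(1) lft_sub[of "rw s" X j th] by blast
    qed (use LT2 f(5) dis iCF u Pz in \<open>simp_all\<close>)
  qed
  show ?thesis unfolding s2_def[symmetric]
  proof (rule wp_mono[OF IH[OF pre2]])
    fix t3 s3
    assume D: "dpost b L Al' N' t1 s2 l (Suc e) (ar s 8 v) ?C (chg b i (lft (rw s) X j th)) t3 s3"
    then obtain T2 \<rho> \<tau> \<chi> where
      D: "LT (ar s3) (rw s3) Al' N' (sc s3 4) T2 (Suc e) (ar s 8 v) (Suc ?C) (lft (rw s) ?X' j th)"
        "distinct (adrs T2)" "set (adrs T2) \<subseteq> set (adrs l) \<union> {sc s1 4<..sc s3 4}" "ar s3 3 (2 * v) = root T2"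
        "root T2 = root l \<and> sz (ar s3) (root T2) = sz (ar s1) (root l) \<and> ar s3 7 (root l) = ar s1 7 (root l) \<or>
          sz (ar s3) (root T2) = n' \<and> ar s3 7 (root T2) = 0 \<and> ar s1 7 (root l) = 0"
        "t3 \<le> t1 + 500 * (sh l + 1) + 40000 * (d * (L + 1)) * ((sh T2 + 3) * \<rho>)"
        "sc s3 4 \<le> sc s1 4 + \<tau> + 3 * \<rho>" "sc s1 4 \<le> sc s3 4"
        "csum (ar s3) T2 + \<chi> \<le> csum (ar s1) l + \<tau>" "\<epsilon> * real \<rho> \<le> 20 * real \<chi>" "\<tau> \<le> tp (ar s1) l" "\<rho> \<le> 2 * N'" "dframe s2 l s3"
      unfolding dpost_def chX[symmetric] s2 n'_def by blast
    note df = D(13)[unfolded dframe_def s2]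
    have inl: "w \<le> F" "w \<noteq> v" "w \<le> sc s1 4" "w \<notin> set (adrs r)" if "w \<in> set (adrs l)" for w using that sub dis F1 by auto
    have inr: "w \<le> F" "w \<noteq> v" "w \<le> sc s1 4" "w \<notin> set (adrs l)" if "w \<in> set (adrs r)" for w using that sub dis F1 by auto
    have vl: "v \<notin> set (adrs l)" "v \<le> sc s1 4" using dis vF F1 by auto
    have gr: "ar s3 a w = ar s a w" if "w \<in> set (adrs r)" "4 \<le> a" "a \<le> 13" for a w
      using df inr[OF that(1)] that f(1)[of w a] by simp
    have gv: "ar s3 a v = ar s1 a v" if "4 \<le> a" "a \<le> 13" for a using df vl that by simp
    have gv': "ar s3 a v = ar s a v" if "4 \<le> a" "a \<le> 13" "a \<noteq> 9" "a \<noteq> 10" for a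
      using gv[of a] f(2)[of a] that by simp
    have ch3: "ar s3 3 p = ar s 3 p" if "p div 2 \<le> sc s1 4" "p \<noteq> 2 * v" "p div 2 \<notin> set (adrs l)" for p
    proof -
      have "p \<le> 2 * sc s1 4 + 1" using that(1) by linarith
      then show ?thesis using df that f(4) by simp
    qed
    have Gd: "rw s3 a p = rw s a p" if "p \<noteq> d + 2 \<or> a \<le> F" for a p
      using df that f(5) F1 by auto
    have th3: "rw s3 v (d + 2) = th" using Gd[of "d + 2" v] vF th by simp
    have cells: "ar s3 a p = ar s a p" if "p \<le> F" "a = 0 \<or> a = 14 \<or> a = 15" for a p
      using df that f(3)[of p a] F1 by auto
    \<comment> \<open>The sibling is off the path: its set does not contain row \<open>i\<close>,
      and \<open>q1\<close> keeps the incremented counter within the limit for those of its nodes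
      that share it.\<close>
    have lr: "LT (ar s3) (rw s3) Al' N' (sc s3 4) r (Suc e) (ar s 8 v) (Suc ?C) (rgt (rw s) X j th)"
    proof (rule LT_frame[where ?i0.0 = i, OF m(11)])
      show "ar s3 3 (2 * w) = ar s 3 (2 * w) \<and> ar s3 3 (2 * w + 1) = ar s 3 (2 * w + 1)" if "w \<in> set (adrs r)" for w
      proof -
        have "2 * w \<noteq> 2 * v" "2 * w + 1 \<noteq> 2 * v" using inr(2)[OF that] by presburger+
        then show ?thesis using inr[OF that] ch3[of "2 * w"] ch3[of "2 * w + 1"] by simp
      qed
      show "8 * real (Suc ?C) \<le> \<epsilon> * real (ar s 8 v)" by (rule q1)
      show "rgt (rw s) X j th \<subseteq> {..<N}" using X(1) rgt_sub[of "rw s" X j th] by blast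
      show "p \<in> Al' \<longleftrightarrow> p \<in> Al" if "p < N" "p \<noteq> i" for p using u(1) that by (auto simp: upd_def split: if_splits)
      show "i < N \<Longrightarrow> i \<in> Al' \<Longrightarrow> i \<in> Al" using u(1) by (auto simp: upd_def split: if_splits)
    qed (use gr cells Gd inr iOF NN F1 D(8) in auto)
    have ltn3: "ltn (ar s3) Al' N' (sc s3 4) v e B ?X'"
    proof -
      have "ltn (ar s1) Al' N' (sc s1 4) v e B ?X'" using tl by blast
      then show ?thesis
        by (rule ltn_frame[where A = "ar s1" and Al = Al' and N = N' and Fb = "sc s1 4"]) (use D(8) gv df in auto)
    qed
    have curc3: "curc (ar s3) v (Suc c) = Suc ?C" 
    proof -
      have "curc (ar s3) v (Suc c) = curc (ar s1) v (Suc c)" by (simp add: curc_def gv)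
      then show ?thesis using f(9)[of c] by simp
    qed
    have quiet3: "quiet (ar s3) v (Suc c)" using q1 by (simp add: quiet_def curc3 gv')
    have near3: "near (ar s3) N' v (Suc c) ?X' X0" using m(6) sdX NN by (auto simp: near_def curc3 gv')
    have agr: "rw s3 p q = rw s p q" if "q \<le> d" for p q using Gd[of q p] that by simp
    have spl3: "split_cond (rw s3) X0 e j th" using m(7) cond_cong(2)[of X0 "rw s3" "rw s", OF agr] by simp
    have lr3: "lft (rw s3) Y j th = lft (rw s) Y j th" "rgt (rw s3) Y j th = rgt (rw s) Y j th" for Y
      using agree_cong(4,5)[of Y "rw s3" "rw s" j th, OF agr] jd by auto
    have fch: "ar s1 a (root l) = ar s a (root l)" if "4 \<le> a" "a \<le> 13" for a
      using f(1)[of "root l" a] inl(2)[OF root_in_adrs] that by simp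
    have chl: "chld (ar s3) v (root T2) (lft (rw s) X0 j th)"
      using D(5) m(8) size1 size2 fch[of 11] fch[of 12] fch[of 7] gv'[of 11] gv'[of 12] gv'[of 8]
      by (auto simp: chld_def)
    have chr: "chld (ar s3) v (root r) (rgt (rw s) X0 j th)"
      using m(9) gr[OF root_in_adrs] gv' by (auto simp: chld_def)
    have ok: "ar s3 3 (2 * v + 1) = root r"
      using ch3[of "2 * v + 1"] vl m(4) by simp
    have LT3: "LT (ar s3) (rw s3) Al' N' (sc s3 4) (SN v T2 r) e B (Suc c) ?X'"
      unfolding LT.simps th3 curc3
      using ltn3 quiet3 D(1,4) ok near3 spl3 chl chr lr lr3 gv'[of 4] gv'[of 8] j chX
      by (intro conjI exI[of _ j] exI[of _ X0]) simp_all
    have cs1: "csum (ar s1) l = csum (ar s) l" by (rule csum_cong) (use f(1) inl in auto)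
    have cs3: "csum (ar s3) r = csum (ar s) r" by (rule csum_cong) (use gr in auto)
    have tp1: "tp (ar s1) l = tp (ar s) l" by (rule tp_cong) (use f(1) inl in auto)
    have own: "(if ar s3 7 v = 0 then ar s3 9 v else 0) = (if ar s 7 v = 0 then ar s 9 v else 0) + (if ar s 7 v = 0 then 1 else 0)"
      using gv[of 9] gv'[of 7] f(10) by simp
    define \<tau>' where "\<tau>' = \<tau> + (if ar s 7 v = 0 then 1 else 0)"
    have "(sh T2 + 3) * \<rho> \<le> (sh (SN v T2 r) + 3) * \<rho>" by (intro mult_le_mono1) simp
    then have "40000 * (d * (L + 1)) * ((sh T2 + 3) * \<rho>) \<le> 40000 * (d * (L + 1)) * ((sh (SN v T2 r) + 3) * \<rho>)"
      by (rule mult_le_mono2)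
    moreover have "500 * (sh l + 1) + 500 \<le> 500 * (sh (SN v l r) + 1)" by simp
    ultimately have time: "t3 \<le> t + 500 * (sh (SN v l r) + 1) + 40000 * (d * (L + 1)) * ((sh (SN v T2 r) + 3) * \<rho>)"
      using D(6) t1 by linarith
    have dfr: "dframe s (SN v l r) s3"
      unfolding dframe_def F_def[symmetric]
    proof (intro conjI allI impI)
      show "ar s3 a w = ar s a w" if "w \<le> F" "w \<notin> set (adrs (SN v l r))" "4 \<le> a" "a \<le> 13" for a w
        using df that F1 f(1)[of w a] by auto
      show "ar s3 3 p = ar s 3 p" if "p \<le> 2 * F + 1" "p \<noteq> sc s 33" "p div 2 \<notin> set (adrs (SN v l r))" for p
      proof (rule ch3)
        show "p \<noteq> 2 * v" using that(3) by auto
      qed (use that F1 in auto)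
    qed (use cells Gd in auto)
    have dist: "distinct (adrs (SN v T2 r))" "set (adrs (SN v T2 r)) \<subseteq> set (adrs (SN v l r)) \<union> {F<..sc s3 4}"
    proof -
      have "set (adrs T2) \<inter> set (adrs r) = {}" "v \<notin> set (adrs T2)" using D(3) dis sub vF F1 by fastforce+
      then show "distinct (adrs (SN v T2 r))" using D(2) dis by auto
      show "set (adrs (SN v T2 r)) \<subseteq> set (adrs (SN v l r)) \<union> {F<..sc s3 4}" using D(3) F1 by auto
    qed
    have lk3: "ar s3 3 (sc s 33) = v"
    proof -
      have Pl: "ar s 3 (sc s 33) = v" "sc s 33 \<le> 2 * F + 1" "sc s 33 div 2 \<notin> set (adrs (SN v l r))"
        using P by (simp_all add: F_def)
      have "sc s 33 \<noteq> 2 * v" using Pl(3) by auto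
      moreover have "sc s 33 div 2 \<le> sc s1 4" using Pl(2) F1(1) by linarith
      moreover have "sc s 33 div 2 \<notin> set (adrs l)" using Pl(3) by auto
      ultimately show ?thesis using ch3[of "sc s 33"] Pl(1) by simp
    qed
    show "dpost b L Al' N' t s (SN v l r) e B c ?X' t3 s3"
      unfolding dpost_def
    proof (intro exI conjI)
      show "csum (ar s3) (SN v T2 r) + \<chi> \<le> csum (ar s) (SN v l r) + \<tau>'"
        using D(9) own by (simp add: cs1 cs3 \<tau>'_def)
      show "\<tau>' \<le> tp (ar s) (SN v l r)" using D(11) by (simp add: tp1 \<tau>'_def)
      show "sc s3 4 \<le> sc s 4 + \<tau>' + 3 * \<rho>" using D(7) F1 by (simp add: \<tau>'_def F_def)
      show "b \<longrightarrow> ar s 7 (root (SN v l r)) = 0 \<longrightarrow> sc s 4 < sc s3 4" using f(8) D(8) by (auto simp: F_def)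
      show "root (SN v T2 r) = root (SN v l r) \<and> sz (ar s3) (root (SN v T2 r)) = sz (ar s) (root (SN v l r)) \<and>
          ar s3 7 (root (SN v l r)) = ar s 7 (root (SN v l r)) \<or>
        sz (ar s3) (root (SN v T2 r)) = card ?X' \<and> ar s3 7 (root (SN v T2 r)) = 0 \<and> ar s 7 (root (SN v l r)) = 0"
        using gv' by simp
    qed (use LT3 dist lk3 time D(8,10,12) dfr F1 in \<open>auto simp: F_def\<close>)
  qed
qed

text \<open>The mirror image of \<open>wp_LOOP_l\<close>, with the link slot
  \<open>2 * v + 1\<close>.\<close>

lemma wp_LOOP_r:
  assumes pre: "dpre b i N N' Al Al' z s (SN v l r) e B c X"
    and s1: "touched b v s s1" "fr (PRE b) s s1" "sc s1 37 = v"
    and calm: "\<not> (ar s 7 v = 0 \<and> \<epsilon> * real (ar s 8 v) < 8 * real (Suc (ar s 9 v)))"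
    and j: "ar s 4 v = Suc j" and go: "\<not> rw s i j \<le> rw s v (d + 2)" and t1: "t1 \<le> t + 300"
    and IH: "\<And>e B c X s t. dpre b i N N' Al Al' z s r e B c X \<Longrightarrow> wp z (LOOP b) (dpost b L Al' N' t s r e B c (chg b i X)) t s"
  shows "wp z (LOOP b) (dpost b L Al' N' t s (SN v l r) e B c (chg b i X)) t1 (setv s1 33 (2 * v + 1))"
proof -
  define F th where "F = sc s 4" and th: "th = rw s v (d + 2)"
  note P = pre[unfolded dpre_def]
  note f = touched_frame[OF s1(1,2) F_def]
  from P have "LT (ar s) (rw s) Al N F (SN v l r) e B c X" by (simp add: F_def)
  then obtain j' X0 where m: "ltn (ar s) Al N F v e B X" "quiet (ar s) v c" "ar s 3 (2 * v) = root l" "ar s 3 (2 * v + 1) = root r"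
    "ar s 4 v = Suc j'" "near (ar s) N v c X X0" "split_cond (rw s) X0 e j' th"
    "chld (ar s) v (root l) (lft (rw s) X0 j' th)" "chld (ar s) v (root r) (rgt (rw s) X0 j' th)"
    "LT (ar s) (rw s) Al N F l (Suc e) (ar s 8 v) (curc (ar s) v c) (lft (rw s) X j' th)"
    "LT (ar s) (rw s) Al N F r (Suc e) (ar s 8 v) (curc (ar s) v c) (rgt (rw s) X j' th)" unfolding th by (rule LT_SN)
  have jj: "j' = j" using m(5) j by simp
  note m = m[unfolded jj]
  have jd: "j < d" using m(7) by (simp add: split_cond_def)
  have u: "upd b i N N' Al Al'" "sc s 5 = N'" and X: "X \<subseteq> {..<N}" "\<not> b \<Longrightarrow> i \<in> X" and finX: "finite X"
    using P finite_subset[of X "{..<N}"] by auto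
  have biX: "b \<Longrightarrow> i \<notin> X" using u X by (auto simp: upd_def)
  have NN: "N \<le> N'" using u by (auto simp: upd_def split: if_splits)
  have dis: "distinct (adrs l)" "distinct (adrs r)" "set (adrs l) \<inter> set (adrs r) = {}" "v \<notin> set (adrs l)" "v \<notin> set (adrs r)"
    using P by auto
  have sub: "set (adrs l) \<subseteq> {..F}" "set (adrs r) \<subseteq> {..F}" using LT_adrs[OF m(10)] LT_adrs[OF m(11)] by auto
  have vF: "v \<le> F" using m(1) by (simp add: ltn_def)
  have F1: "F \<le> sc s1 4" "sc s1 4 \<le> F + (if ar s 7 v = 0 then 1 else 0)" using f(6,7) by auto
  note tl = touched_ltn[OF s1(1,2) F_def m(1) u vF X]
  let ?X' = "chg b i X"
  let ?C = "curc (ar s) v c"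
  have q1: "8 * real (Suc ?C) \<le> \<epsilon> * real (ar s 8 v)"
  proof (cases "ar s 7 v = 0")
    case True
    with calm show ?thesis by (simp add: curc_def)
  next
    case False
    have "8 * real (Suc c) \<le> \<epsilon> * real B" using P False by simp
    with m(1) False show ?thesis by (simp add: curc_def ltn_def)
  qed
  have finX0: "finite X0" and cX0: "card X0 = sz (ar s) v" and sdX: "sd X0 ?X' \<le> Suc ?C"
    using m(6) finite_subset[of X0 "{..<N}"] sd_chg[of X0 X b i] finX by (auto simp: near_def)
  have finX': "finite ?X'" using finX by (simp add: chg_def)
  have chX: "rgt (rw s) ?X' j th = chg b i (rgt (rw s) X j th)" "lft (rw s) ?X' j th = lft (rw s) X j th"
    using lft_chg[of "rw s" i j th b X] go th by auto
  have iCF: "\<not> b \<Longrightarrow> i \<in> rgt (rw s) X j th" and iOF: "i \<notin> lft (rw s) X j th"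
    using X(2) go th biX by (auto simp: lft_def rgt_def)
  define n' where "n' = card (rgt (rw s) ?X' j th)"
  have card': "real n' \<le> real (card (rgt (rw s) X0 j th)) + real (Suc ?C)"
  proof -
    have "sd X0 ?X' = sd (lft (rw s) X0 j th) (lft (rw s) ?X' j th) + sd (rgt (rw s) X0 j th) (rgt (rw s) ?X' j th)"
      unfolding lft_def rgt_def by (rule sd_split[OF finX0 finX'])
    then have "sd (rgt (rw s) X0 j th) (rgt (rw s) ?X' j th) \<le> Suc ?C" using sdX by simp
    then show ?thesis
      using card_diff_sd[of "rgt (rw s) X0 j th" "rgt (rw s) ?X' j th"] finX0 finX' by (simp add: n'_def)
  qed
  have A8: "real (ar s 8 v) \<le> 2 * real (sz (ar s) v)"
  proof -
    have "ar s 8 v \<le> 2 * sz (ar s) v" using m(1) by (simp add: ltn_def)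
    then show ?thesis by linarith
  qed
  have size1: "real n' \<le> (1 - \<epsilon>) * real (sz (ar s) v)"
  proof -
    have "2 * \<epsilon> * real (card X0) \<le> real (card (lft (rw s) X0 j th))"
      using m(7) sco_le_sides[OF finX0, of "rw s" j th] by (auto simp: split_cond_def)
    moreover have "card (lft (rw s) X0 j th) + card (rgt (rw s) X0 j th) = card X0" by (rule card_lft_rgt[OF finX0])
    then have "real (card (rgt (rw s) X0 j th)) + real (card (lft (rw s) X0 j th)) = real (card X0)" by linarith
    moreover have "\<epsilon> * real (ar s 8 v) \<le> \<epsilon> * (2 * real (sz (ar s) v))" using A8 eps0 by (intro mult_left_mono) auto
    then have "\<epsilon> * real (ar s 8 v) \<le> 2 * (\<epsilon> * real (sz (ar s) v))" by (simp only: ac_simps)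
    moreover have "0 \<le> \<epsilon> * real (sz (ar s) v)" using eps0 by simp
    moreover have "n \<le> M - eM" if "2 * eM \<le> R" "L + R = M" "eA \<le> 2 * eM" "0 \<le> eM" "n \<le> L + S" "8 * S \<le> eA"
      for n M eM R L S eA :: real using that by linarith
    ultimately show ?thesis using card' q1 unfolding cX0 left_diff_distrib mult_1_left mult.assoc by blast
  qed
  have size2: "4 * n' \<le> 3 * ar s 8 v" if "2 * card (rgt (rw s) X0 j th) \<le> ar s 8 v"
  proof -
    have "\<epsilon> * real (ar s 8 v) \<le> 1 * real (ar s 8 v)" using eps2 by (intro mult_right_mono) auto
    moreover have "2 * real (card (rgt (rw s) X0 j th)) \<le> real (ar s 8 v)" using that by linarith
    moreover have "4 * n \<le> 3 * A" if "eA \<le> 1 * A" "2 * L \<le> A" "n \<le> L + S" "8 * S \<le> eA" "0 \<le> A"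
      for n L S eA A :: real using that by linarith
    ultimately have "4 * real n' \<le> 3 * real (ar s 8 v)" using card' q1 of_nat_0_le_iff by blast
    then show ?thesis by linarith
  qed
  define s2 where "s2 = setv s1 33 (2 * v + 1)"
  have s2 [simp]: "ar s2 = ar s1" "rw s2 = rw s1" "sc s2 4 = sc s1 4" "sc s2 33 = 2 * v + 1" "rv s2 = rv s1"
    by (simp_all add: s2_def)
  have nvr: "w \<noteq> v" if "w \<in> set (adrs r)" for w using that dis by auto
  have pre2: "dpre b i N N' Al Al' z s2 r (Suc e) (ar s 8 v) ?C (rgt (rw s) X j th)"
  proof -
    have "LT (ar s1) (rw s1) Al N (sc s1 4) r (Suc e) (ar s 8 v) ?C (rgt (rw s) X j th)"
    proof (rule LT_frame[where ?i0.0 = N, OF m(11)])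
      show "8 * real ?C \<le> \<epsilon> * real (ar s 8 v)" using m(2) by (simp add: quiet_def)
    qed (use f(1,3-6) nvr X rgt_sub[of "rw s" X j th] in auto)
    note LT2 = this
    have e7: "ar s1 7 = ar s 7" using f(2)[of 7] by simp
    have fx: "rv s1 2 = rv s 2" "sc s1 36 = sc s 36" "sc s1 5 = sc s 5" using frD(1,3)[OF s1(2)] by simp_all
    have fx2: "sc s2 36 = sc s1 36" "sc s2 5 = sc s1 5" by (simp_all add: s2_def)
    have Pz: "\<forall>i < N'. \<not> 0 < rw s i (d + 1) \<longleftrightarrow> i \<in> Al'" "\<forall>c < d. rw s i c = fst z ! c" "0 < rw s i d \<longleftrightarrow> snd z" "length (fst z) = d"
      "rv s 2 = \<epsilon>" "0 < sc s 36" "2 * (F + sh (SN v l r) + 3 * N' + 11) \<le> IB" using P by (simp_all add: F_def)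
    have shl: "Suc (sh r) \<le> sh (SN v l r)" by simp
    show ?thesis unfolding dpre_def s2 fx2 fx f(4,5) e7
    proof (intro conjI)
      show "ar s 3 (2 * v + 1) = root r" by (rule m(4))
      show "2 * v + 1 \<le> 2 * sc s1 4 + 1" using vF F1 by simp
      show "(2 * v + 1) div 2 \<notin> set (adrs r)" using dis by simp
      show "ar s 7 (root r) \<noteq> 0 \<longrightarrow> 8 * real (Suc ?C) \<le> \<epsilon> * real (ar s 8 v)" using q1 by blast
      show "ar s 7 (root r) = 0 \<longrightarrow> 4 * card (chg b i (rgt (rw s) X j th)) \<le> 3 * ar s 8 v"
        using size2 m(9) unfolding n'_def chX chld_def by blast
      show "2 * (sc s1 4 + sh r + 3 * N' + 11) \<le> IB" using Pz(7) F1(2) shl by (simp split: if_splits)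
      show "rgt (rw s) X j th \<subseteq> {..<N}" using X(1) rgt_sub[of "rw s" X j th] by blast
    qed (use LT2 f(5) dis iCF u Pz in \<open>simp_all\<close>)
  qed
  show ?thesis unfolding s2_def[symmetric]
  proof (rule wp_mono[OF IH[OF pre2]])
    fix t3 s3
    assume D: "dpost b L Al' N' t1 s2 r (Suc e) (ar s 8 v) ?C (chg b i (rgt (rw s) X j th)) t3 s3"
    then obtain T2 \<rho> \<tau> \<chi> where
      D: "LT (ar s3) (rw s3) Al' N' (sc s3 4) T2 (Suc e) (ar s 8 v) (Suc ?C) (rgt (rw s) ?X' j th)"
        "distinct (adrs T2)" "set (adrs T2) \<subseteq> set (adrs r) \<union> {sc s1 4<..sc s3 4}" "ar s3 3 (2 * v + 1) = root T2"
        "root T2 = root r \<and> sz (ar s3) (root T2) = sz (ar s1) (root r) \<and> ar s3 7 (root r) = ar s1 7 (root r) \<or>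
          sz (ar s3) (root T2) = n' \<and> ar s3 7 (root T2) = 0 \<and> ar s1 7 (root r) = 0"
        "t3 \<le> t1 + 500 * (sh r + 1) + 40000 * (d * (L + 1)) * ((sh T2 + 3) * \<rho>)"
        "sc s3 4 \<le> sc s1 4 + \<tau> + 3 * \<rho>" "sc s1 4 \<le> sc s3 4"
        "csum (ar s3) T2 + \<chi> \<le> csum (ar s1) r + \<tau>" "\<epsilon> * real \<rho> \<le> 20 * real \<chi>" "\<tau> \<le> tp (ar s1) r" "\<rho> \<le> 2 * N'" "dframe s2 r s3"
      unfolding dpost_def chX[symmetric] s2 n'_def by blast
    note df = D(13)[unfolded dframe_def s2]
    have inr: "w \<le> F" "w \<noteq> v" "w \<le> sc s1 4" "w \<notin> set (adrs l)" if "w \<in> set (adrs r)" for w using that sub dis F1 by auto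
    have inl: "w \<le> F" "w \<noteq> v" "w \<le> sc s1 4" "w \<notin> set (adrs r)" if "w \<in> set (adrs l)" for w using that sub dis F1 by auto
    have vr: "v \<notin> set (adrs r)" "v \<le> sc s1 4" using dis vF F1 by auto
    have gl: "ar s3 a w = ar s a w" if "w \<in> set (adrs l)" "4 \<le> a" "a \<le> 13" for a w
      using df inl[OF that(1)] that f(1)[of w a] by simp
    have gv: "ar s3 a v = ar s1 a v" if "4 \<le> a" "a \<le> 13" for a using df vr that by simp
    have gv': "ar s3 a v = ar s a v" if "4 \<le> a" "a \<le> 13" "a \<noteq> 9" "a \<noteq> 10" for a
      using gv[of a] f(2)[of a] that by simp
    have ch3: "ar s3 3 p = ar s 3 p" if "p div 2 \<le> sc s1 4" "p \<noteq> 2 * v + 1" "p div 2 \<notin> set (adrs r)" for p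
    proof -
      have "p \<le> 2 * sc s1 4 + 1" using that(1) by linarith
      then show ?thesis using df that f(4) by simp
    qed
    have Gd: "rw s3 a p = rw s a p" if "p \<noteq> d + 2 \<or> a \<le> F" for a p
      using df that f(5) F1 by auto
    have th3: "rw s3 v (d + 2) = th" using Gd[of "d + 2" v] vF th by simp
    have cells: "ar s3 a p = ar s a p" if "p \<le> F" "a = 0 \<or> a = 14 \<or> a = 15" for a p
      using df that f(3)[of p a] F1 by auto
    have ll: "LT (ar s3) (rw s3) Al' N' (sc s3 4) l (Suc e) (ar s 8 v) (Suc ?C) (lft (rw s) X j th)"
    proof (rule LT_frame[where ?i0.0 = i, OF m(10)])
      show "ar s3 3 (2 * w) = ar s 3 (2 * w) \<and> ar s3 3 (2 * w + 1) = ar s 3 (2 * w + 1)" if "w \<in> set (adrs l)" for w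
      proof -
        have "2 * w \<noteq> 2 * v + 1" "2 * w + 1 \<noteq> 2 * v + 1" using inl(2)[OF that] by presburger+
        then show ?thesis using inl[OF that] ch3[of "2 * w"] ch3[of "2 * w + 1"] by simp
      qed
      show "8 * real (Suc ?C) \<le> \<epsilon> * real (ar s 8 v)" by (rule q1)
      show "lft (rw s) X j th \<subseteq> {..<N}" using X(1) lft_sub[of "rw s" X j th] by blast
      show "p \<in> Al' \<longleftrightarrow> p \<in> Al" if "p < N" "p \<noteq> i" for p using u(1) that by (auto simp: upd_def split: if_splits)
      show "i < N \<Longrightarrow> i \<in> Al' \<Longrightarrow> i \<in> Al" using u(1) by (auto simp: upd_def split: if_splits)
    qed (use gl cells Gd inl iOF NN F1 D(8) in auto)
    have ltn3: "ltn (ar s3) Al' N' (sc s3 4) v e B ?X'"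
    proof -
      have "ltn (ar s1) Al' N' (sc s1 4) v e B ?X'" using tl by blast
      then show ?thesis
        by (rule ltn_frame[where A = "ar s1" and Al = Al' and N = N' and Fb = "sc s1 4"]) (use D(8) gv df in auto)
    qed
    have curc3: "curc (ar s3) v (Suc c) = Suc ?C" 
    proof -
      have "curc (ar s3) v (Suc c) = curc (ar s1) v (Suc c)" by (simp add: curc_def gv)
      then show ?thesis using f(9)[of c] by simp
    qed
    have quiet3: "quiet (ar s3) v (Suc c)" using q1 by (simp add: quiet_def curc3 gv')
    have near3: "near (ar s3) N' v (Suc c) ?X' X0" using m(6) sdX NN by (auto simp: near_def curc3 gv')
    have agr: "rw s3 p q = rw s p q" if "q \<le> d" for p q using Gd[of q p] that by simp
    have spl3: "split_cond (rw s3) X0 e j th" using m(7) cond_cong(2)[of X0 "rw s3" "rw s", OF agr] by simp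
    have lr3: "lft (rw s3) Y j th = lft (rw s) Y j th" "rgt (rw s3) Y j th = rgt (rw s) Y j th" for Y
      using agree_cong(4,5)[of Y "rw s3" "rw s" j th, OF agr] jd by auto
    have fch: "ar s1 a (root r) = ar s a (root r)" if "4 \<le> a" "a \<le> 13" for a
      using f(1)[of "root r" a] inr(2)[OF root_in_adrs] that by simp
    have chl: "chld (ar s3) v (root T2) (rgt (rw s) X0 j th)"
      using D(5) m(9) size1 size2 fch[of 11] fch[of 12] fch[of 7] gv'[of 11] gv'[of 12] gv'[of 8]
      by (auto simp: chld_def)
    have cho: "chld (ar s3) v (root l) (lft (rw s) X0 j th)"
      using m(8) gl[OF root_in_adrs] gv' by (auto simp: chld_def)
    have ok: "ar s3 3 (2 * v) = root l"
      using ch3[of "2 * v"] vr m(3) by simp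
    have LT3: "LT (ar s3) (rw s3) Al' N' (sc s3 4) (SN v l T2) e B (Suc c) ?X'"
      unfolding LT.simps th3 curc3
      using ltn3 quiet3 D(1,4) ok near3 spl3 chl cho ll lr3 gv'[of 4] gv'[of 8] j chX
      by (intro conjI exI[of _ j] exI[of _ X0]) simp_all
    have cs1: "csum (ar s1) r = csum (ar s) r" by (rule csum_cong) (use f(1) inr in auto)
    have cs3: "csum (ar s3) l = csum (ar s) l" by (rule csum_cong) (use gl in auto)
    have tp1: "tp (ar s1) r = tp (ar s) r" by (rule tp_cong) (use f(1) inr in auto)
    have own: "(if ar s3 7 v = 0 then ar s3 9 v else 0) = (if ar s 7 v = 0 then ar s 9 v else 0) + (if ar s 7 v = 0 then 1 else 0)"
      using gv[of 9] gv'[of 7] f(10) by simp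
    define \<tau>' where "\<tau>' = \<tau> + (if ar s 7 v = 0 then 1 else 0)"
    have "(sh T2 + 3) * \<rho> \<le> (sh (SN v l T2) + 3) * \<rho>" by (intro mult_le_mono1) simp
    then have "40000 * (d * (L + 1)) * ((sh T2 + 3) * \<rho>) \<le> 40000 * (d * (L + 1)) * ((sh (SN v l T2) + 3) * \<rho>)"
      by (rule mult_le_mono2)
    moreover have "500 * (sh r + 1) + 500 \<le> 500 * (sh (SN v l r) + 1)" by simp
    ultimately have time: "t3 \<le> t + 500 * (sh (SN v l r) + 1) + 40000 * (d * (L + 1)) * ((sh (SN v l T2) + 3) * \<rho>)"
      using D(6) t1 by linarith
    have dfr: "dframe s (SN v l r) s3"
      unfolding dframe_def F_def[symmetric]
    proof (intro conjI allI impI)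
      show "ar s3 a w = ar s a w" if "w \<le> F" "w \<notin> set (adrs (SN v l r))" "4 \<le> a" "a \<le> 13" for a w
        using df that F1 f(1)[of w a] by auto
      show "ar s3 3 p = ar s 3 p" if "p \<le> 2 * F + 1" "p \<noteq> sc s 33" "p div 2 \<notin> set (adrs (SN v l r))" for p
      proof (rule ch3)
        show "p \<noteq> 2 * v + 1" using that(3) by auto
      qed (use that F1 in auto)
    qed (use cells Gd in auto)
    have dist: "distinct (adrs (SN v l T2))" "set (adrs (SN v l T2)) \<subseteq> set (adrs (SN v l r)) \<union> {F<..sc s3 4}"
    proof -
      have "set (adrs T2) \<inter> set (adrs l) = {}" "v \<notin> set (adrs T2)" using D(3) dis sub vF F1 by fastforce+
      then show "distinct (adrs (SN v l T2))" using D(2) dis by auto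
      show "set (adrs (SN v l T2)) \<subseteq> set (adrs (SN v l r)) \<union> {F<..sc s3 4}" using D(3) F1 by auto
    qed
    have lk3: "ar s3 3 (sc s 33) = v"
    proof -
      have Pl: "ar s 3 (sc s 33) = v" "sc s 33 \<le> 2 * F + 1" "sc s 33 div 2 \<notin> set (adrs (SN v l r))"
        using P by (simp_all add: F_def)
      have "sc s 33 \<noteq> 2 * v + 1" using Pl(3) by auto
      moreover have "sc s 33 div 2 \<le> sc s1 4" using Pl(2) F1(1) by linarith
      moreover have "sc s 33 div 2 \<notin> set (adrs r)" using Pl(3) by auto
      ultimately show ?thesis using ch3[of "sc s 33"] Pl(1) by simp
    qed
    show "dpost b L Al' N' t s (SN v l r) e B c ?X' t3 s3"
      unfolding dpost_def
    proof (intro exI conjI)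
      show "csum (ar s3) (SN v l T2) + \<chi> \<le> csum (ar s) (SN v l r) + \<tau>'"
        using D(9) own by (simp add: cs1 cs3 \<tau>'_def)
      show "\<tau>' \<le> tp (ar s) (SN v l r)" using D(11) by (simp add: tp1 \<tau>'_def)
      show "sc s3 4 \<le> sc s 4 + \<tau>' + 3 * \<rho>" using D(7) F1 by (simp add: \<tau>'_def F_def)
      show "b \<longrightarrow> ar s 7 (root (SN v l r)) = 0 \<longrightarrow> sc s 4 < sc s3 4" using f(8) D(8) by (auto simp: F_def)
      show "root (SN v l T2) = root (SN v l r) \<and> sz (ar s3) (root (SN v l T2)) = sz (ar s) (root (SN v l r)) \<and>
          ar s3 7 (root (SN v l r)) = ar s 7 (root (SN v l r)) \<or>
        sz (ar s3) (root (SN v l T2)) = card ?X' \<and> ar s3 7 (root (SN v l T2)) = 0 \<and> ar s 7 (root (SN v l r)) = 0"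
        using gv' by simp
    qed (use LT3 dist lk3 time D(8,10,12) dfr F1 in \<open>auto simp: F_def\<close>)
  qed
qed

text \<open>The counting step common to leaves and internal nodes. The incremented counter fits its
  cell because \<open>quiet\<close> bounds it by the reference size of the node, which is bounded by
  the addresses in use.\<close>

lemma wp_LOOP_enter:
  assumes pre: "dpre b i N N' Al Al' z s T e B c X" and v: "v = root T"
    and cont: "\<And>t1 s1. t1 \<le> t + 205 \<Longrightarrow> touched b v s s1 \<Longrightarrow> fr (PRE b) s s1 \<Longrightarrow> sc s1 37 = v \<Longrightarrow>
      (0 < sc s1 35 \<longleftrightarrow> ar s 7 v = 0 \<and> \<epsilon> * real (ar s 8 v) < 8 * real (Suc (ar s 9 v))) \<Longrightarrow>
      wp z (Cond (WLess (Lit 0) (Var 35)) (sqn [SetV 32 (Var 37), REBUILD, SetV 36 (Lit 0)])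
       (Cond (WLess (Arr 4 (Var 37)) (Lit 1)) (sqn [LEAFUPD b, SetV 36 (Lit 0)]) GO)) (wp z (LOOP b) Q) t1 s1"
  shows "wp z (LOOP b) Q t s"
proof -
  note P = pre[unfolded dpre_def]
  have lt: "ltn (ar s) Al N (sc s 4) v e B X" "quiet (ar s) v c" using LT_root[of "ar s" "rw s"] P v by auto
  have c: "ar s 9 v + 1 \<le> IB" if "ar s 7 v = 0"
  proof -
    have "8 * real (ar s 9 v) \<le> \<epsilon> * real (ar s 8 v)" using lt(2) that by (simp add: quiet_def curc_def)
    also have "\<dots> \<le> 1 * real (ar s 8 v)" using eps2 by (intro mult_right_mono) auto
    finally have "8 * ar s 9 v \<le> ar s 8 v" by linarith
    moreover have "ar s 8 v \<le> Suc (sc s 4)" using lt(1) that by (auto simp: ltn_def members_def)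
    moreover have "2 * (sc s 4 + 11) \<le> IB" using P by simp
    ultimately show ?thesis by simp
  qed
  have 36: "0 < sc s 36" using P by simp
  show ?thesis
    unfolding LOOP_def
    apply (subst wp_While_unfold)
    unfolding LOOP_def[symmetric]
    using 36 apply simp
    apply (rule wp_mono[OF wp_PRE[where v = v]])
    subgoal using P v by simp
    subgoal using c by simp
    subgoal using P by simp
    subgoal using P by simp
    subgoal for t1 s1 using cont[of t1 s1] by simp
    done
qed

text \<open>Induction over the labelled tree, whose addresses make the recursion of the
  specification match the iteration of the program. At a leaf without overflow only the label counts
  change, and the leaf condition survives since it refers to the old set.\<close>

lemma wp_LOOP:
  assumes L: "IB \<le> 2 ^ L" and pre: "dpre b i N N' Al Al' z s T e B c X"
  shows "wp z (LOOP b) (dpost b L Al' N' t s T e B c (chg b i X)) t s"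
  using pre
proof (induction T arbitrary: e B c X s t)
  case (SL v)
  note P = SL[unfolded dpre_def]
  show ?case
  proof (rule wp_LOOP_enter[OF SL refl], unfold root.simps)
    fix t1 s1
    assume s1: "t1 \<le> t + 205" "touched b v s s1" "fr (PRE b) s s1" "sc s1 37 = v"
      "0 < sc s1 35 \<longleftrightarrow> ar s 7 v = 0 \<and> \<epsilon> * real (ar s 8 v) < 8 * real (Suc (ar s 9 v))"
    define F where "F = sc s 4"
    note f = touched_frame[OF s1(2,3) F_def]
    show "wp z (Cond (WLess (Lit 0) (Var 35)) (sqn [SetV 32 (Var 37), REBUILD, SetV 36 (Lit 0)])
       (Cond (WLess (Arr 4 (Var 37)) (Lit 1)) (sqn [LEAFUPD b, SetV 36 (Lit 0)]) GO))
       (wp z (LOOP b) (dpost b L Al' N' t s (SL v) e B c (chg b i X))) t1 s1"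
    proof (cases "0 < sc s1 35")
      case True
      with s1(5) have o: "ar s 7 v = 0" "\<epsilon> * real (ar s 8 v) < 8 * real (Suc (ar s 9 v))" by auto
      have "wp z (Seq (sqn [SetV 32 (Var 37), REBUILD, SetV 36 (Lit 0)]) (LOOP b))
        (dpost b L Al' N' t s (SL v) e B c (chg b i X)) (t1 + 5) s1"
        using s1(1) by (intro wp_LOOP_rebuild[OF SL _ L o _ s1(2-4)]) auto
      with True show ?thesis by (simp del: sqn.simps)
    next
      case False
      have l: "ltn (ar s) Al N F v e B X" "quiet (ar s) v c" "ar s 4 v = 0" "ar s 5 v = c0 (rw s) X" "ar s 6 v = c1 (rw s) X"
        using P by (simp_all add: F_def)
      from P obtain X0 where X0: "near (ar s) N v c X X0" "leaf_cond (rw s) X0 e" by auto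
      have u: "upd b i N N' Al Al'" "sc s 5 = N'" and X: "X \<subseteq> {..<N}" "\<not> b \<Longrightarrow> i \<in> X" and finX: "finite X"
        using P finite_subset[of X "{..<N}"] by auto
      have biX: "b \<Longrightarrow> i \<notin> X" using u X by (auto simp: upd_def)
      have NN: "N \<le> N'" using u by (auto simp: upd_def split: if_splits)
      have vF: "v \<le> F" using l(1) by (simp add: ltn_def)
      have F1: "F \<le> sc s1 4" "sc s1 4 \<le> F + (if ar s 7 v = 0 then 1 else 0)" using f(6,7) by auto
      have tl: "ltn (ar s1) Al' N' (sc s1 4) v e B (chg b i X)"
        using touched_ltn[OF s1(2,3) F_def l(1) u vF X] by blast
      have q1: "8 * real (Suc (curc (ar s) v c)) \<le> \<epsilon> * real (ar s 8 v)"
      proof (cases "ar s 7 v = 0")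
        case True
        with False s1(5) show ?thesis by (simp add: curc_def)
      next
        case 7: False
        have "8 * real (Suc c) \<le> \<epsilon> * real B" using P 7 by simp
        with l(1) 7 show ?thesis by (simp add: curc_def ltn_def)
      qed
      have card: "card X \<le> N" using X(1) card_mono[of "{..<N}" X] by simp
      have bI: "2 * (F + 3 * N' + 11) \<le> IB" using P by (simp add: F_def)
      have cb: "c0 (rw s) X + 1 \<le> IB" "c1 (rw s) X + 1 \<le> IB" using c_sum[OF finX, of "rw s"] card NN bI by simp_all
      have y: "0 < rw s i d \<longleftrightarrow> snd z" using P by simp
      have e1: "ar s1 4 = ar s 4" "ar s1 5 = ar s 5" "ar s1 6 = ar s 6" "ar s1 7 = ar s 7" "ar s1 8 = ar s 8" "ar s1 11 = ar s 11" "ar s1 12 = ar s 12"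
        using f(2)[of 4] f(2)[of 5] f(2)[of 6] f(2)[of 7] f(2)[of 8] f(2)[of 11] f(2)[of 12] by simp_all
      define s2 where "s2 = setv (seta (seta s1 5 v (c0 (rw s) (chg b i X))) 6 v (c1 (rw s) (chg b i X))) 36 0"
      have cc: "curc (ar s2) v (Suc c) = Suc (curc (ar s) v c)"
      proof -
        have "curc (ar s2) v (Suc c) = curc (ar s1) v (Suc c)" by (simp add: s2_def curc_def)
        with f(9)[of c] show ?thesis by simp
      qed
      have mem: "members (ar s2) (sc s1 4) v xs = members (ar s1) (sc s1 4) v xs" for xs
        by (simp add: members_def s2_def)
      have "ltn (ar s2) Al' N' (sc s1 4) v e B (chg b i X) = ltn (ar s1) Al' N' (sc s1 4) v e B (chg b i X)"
        unfolding ltn_def mem by (simp add: s2_def)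
      then have "ltn (ar s2) Al' N' (sc s1 4) v e B (chg b i X)" using tl by simp
      moreover have "quiet (ar s2) v (Suc c)" using q1 by (simp add: quiet_def cc) (simp add: s2_def e1)
      moreover have "near (ar s2) N' v (Suc c) (chg b i X) X0"
      proof -
        have "finite X0" using X0(1) finite_subset[of X0 "{..<N}"] by (auto simp: near_def)
        then have "sd X0 (chg b i X) \<le> Suc (curc (ar s) v c)" using X0(1) sd_chg[of X0 X b i] finX by (auto simp: near_def)
        then show ?thesis using X0(1) NN by (auto simp: near_def cc) (auto simp: s2_def e1)
      qed
      ultimately have LT: "LT (ar s2) (rw s) Al' N' (sc s1 4) (SL v) e B (Suc c) (chg b i X)"
        using l(3) X0(2) by (auto simp: s2_def e1)
      have df: "dframe s (SL v) s2"
        unfolding dframe_def using f(1,3-5) F1 by (auto simp: s2_def F_def)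
      have "dpost b L Al' N' t s (SL v) e B c (chg b i X) u s2" if "u \<le> t + 300" for u
        unfolding dpost_def
        apply (rule exI[of _ "SL v"], rule exI[of _ 0], rule exI[of _ "if ar s 7 v = 0 then 1 else 0"], rule exI[of _ 0])
        using LT df that F1 f(4,5,8,10) e1 P by (auto simp: s2_def F_def)
      note D = this
      have cs: "c0 (rw s) (chg b i X) = (if b then c0 (rw s) X + of_bool (\<not> 0 < rw s i d) else c0 (rw s) X - of_bool (\<not> 0 < rw s i d))"
        "c1 (rw s) (chg b i X) = (if b then c1 (rw s) X + of_bool (0 < rw s i d) else c1 (rw s) X - of_bool (0 < rw s i d))"
        using c_chg[of X b i "rw s"] finX X(2) biX by blast+
      note D = D[unfolded s2_def cs]
      show ?thesis
        using False l(3) s1(1,4) cb y D by (cases b; cases "snd z")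
          (auto simp: e1 LEAFUPD_def l(4,5) intro!: finish)
    qed
  qed
next
  case (SN v l r)
  note P = SN.prems[unfolded dpre_def]
  show ?case
  proof (rule wp_LOOP_enter[OF SN.prems refl], unfold root.simps)
    fix t1 s1
    assume s1: "t1 \<le> t + 205" "touched b v s s1" "fr (PRE b) s s1" "sc s1 37 = v"
      "0 < sc s1 35 \<longleftrightarrow> ar s 7 v = 0 \<and> \<epsilon> * real (ar s 8 v) < 8 * real (Suc (ar s 9 v))"
    define F where "F = sc s 4"
    note f = touched_frame[OF s1(2,3) F_def]
    let ?Q = "dpost b L Al' N' t s (SN v l r) e B c (chg b i X)"
    show "wp z (Cond (WLess (Lit 0) (Var 35)) (sqn [SetV 32 (Var 37), REBUILD, SetV 36 (Lit 0)])
       (Cond (WLess (Arr 4 (Var 37)) (Lit 1)) (sqn [LEAFUPD b, SetV 36 (Lit 0)]) GO)) (wp z (LOOP b) ?Q) t1 s1"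
    proof (cases "0 < sc s1 35")
      case True
      with s1(5) have o: "ar s 7 v = 0" "\<epsilon> * real (ar s 8 v) < 8 * real (Suc (ar s 9 v))" by auto
      have "wp z (Seq (sqn [SetV 32 (Var 37), REBUILD, SetV 36 (Lit 0)]) (LOOP b)) ?Q (t1 + 5) s1"
        using s1(1) by (intro wp_LOOP_rebuild[OF SN.prems _ L o _ s1(2-4)]) auto
      with True show ?thesis by (simp del: sqn.simps)
    next
      case False
      with s1(5) have calm: "\<not> (ar s 7 v = 0 \<and> \<epsilon> * real (ar s 8 v) < 8 * real (Suc (ar s 9 v)))" by simp
      from P have LT: "LT (ar s) (rw s) Al N F (SN v l r) e B c X" by (simp add: F_def)
      obtain j where j: "ar s 4 v = Suc j" "j < d" and vF: "v \<le> F"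
        using LT by (rule LT_SN) (auto simp: split_cond_def ltn_def)
      have e1: "ar s1 4 = ar s 4" using f(2)[of 4] by simp
      have x: "fst z ! j = rw s i j" "length (fst z) = d" using P j by simp_all
      have vI: "v + v + 1 \<le> IB" using vF P by (simp add: F_def)
      have Gl: "wp z (LOOP b) ?Q t2 (setv s1 33 (2 * v))" if "t2 \<le> t + 300" "rw s i j \<le> rw s v (d + 2)" for t2
        using that(1) by (intro wp_LOOP_l[OF SN.prems s1(2-4) calm j(1) that(2) _ SN.IH(1)]) auto
      have Gr: "wp z (LOOP b) ?Q t2 (setv s1 33 (2 * v + 1))" if "t2 \<le> t + 300" "\<not> rw s i j \<le> rw s v (d + 2)" for t2
        using that(1) by (intro wp_LOOP_r[OF SN.prems s1(2-4) calm j(1) that(2) _ SN.IH(2)]) auto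
      show ?thesis
      proof (cases "rw s i j \<le> rw s v (d + 2)")
        case True
        have "wp z (LOOP b) ?Q (48 + t1) (setv s1 33 (v + v))" using Gl[OF _ True, of "48 + t1"] s1(1) by (simp add: mult_2)
        moreover have "\<not> rw s v (Suc (Suc d)) < rw s i j" using True by simp
        ultimately show ?thesis using False vI by (simp add: e1 GO_def j s1(4) x f(5))
      next
        case gt: False
        have "wp z (LOOP b) ?Q (50 + t1) (setv s1 33 (Suc (v + v)))" using Gr[OF _ gt, of "50 + t1"] s1(1) by (simp add: mult_2)
        moreover have "rw s v (Suc (Suc d)) < rw s i j" using gt by simp
        ultimately show ?thesis using False vI by (simp add: e1 GO_def j s1(4) x f(5))
      qed
    qed
  qed
qed

end

section \<open>A dictionary of rows in binary blocks\<close>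

text \<open>The dyadic blocks that correspond to the binary digits of \<open>N\<close>.\<close>

definition blk :: "nat \<Rightarrow> nat \<Rightarrow> nat \<Rightarrow> bool" where
  "blk N e w \<longleftrightarrow> (\<exists>z q. w = 2 ^ z \<and> e = w * (2 * q + 1)) \<and> e \<le> N \<and> N < e + w"

lemma blk_pos: "blk N e w \<Longrightarrow> 0 < w \<and> w \<le> e"
  by (auto simp: blk_def)

lemma pow_cases:
  fixes a b :: nat
  obtains "a = b" | m where "(2::nat) ^ b = 2 ^ a * (2 * m)" | m where "(2::nat) ^ a = 2 ^ b * (2 * m)"
proof (cases a b rule: linorder_cases)
  case less
  then obtain k where "b = a + Suc k" using less_iff_Suc_add by auto
  then show thesis using that(2)[of "2 ^ k"] by (simp add: power_add)
next
  case greater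
  then obtain k where "a = b + Suc k" using less_iff_Suc_add by auto
  then show thesis using that(3)[of "2 ^ k"] by (simp add: power_add)
qed (rule that(1))

lemma mult_window: "w * m < w * n + w \<Longrightarrow> m \<le> (n :: nat)"
proof -
  assume "w * m < w * n + w"
  then have "w * m < w * Suc n" by simp
  then show "m \<le> n" by (simp only: mult_less_cancel1) simp
qed

text \<open>If the widths agree, the window N - w < e \<le> N determines the odd multiple. If the
  width w' is a multiple of 2w, then so is e'; as e' \<le> N and N is below the next multiple of 2w
  after e - w, the wider block ends at or before e - w.\<close>

lemma blk_disjoint:
  assumes "blk N e w" "blk N e' w'" "e - w \<le> p" "p < e" "e' - w' \<le> p" "p < e'"
  shows "e = e' \<and> w = w'"
proof -
  have *: False if b: "blk N e w" "blk N e' w'" "e - w \<le> p" "p < e'" "w' = w * (2 * m)" for e w e' w' m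
  proof -
    from b obtain q q' where q: "e = w * (2 * q + 1)" "e' = w' * (2 * q' + 1)" "e' \<le> N" "N < e + w"
      by (auto simp: blk_def)
    have "(2 * w) * (m * (2 * q' + 1)) < (2 * w) * q + 2 * w" using q b(5) by (simp add: algebra_simps)
    then have "m * (2 * q' + 1) \<le> q" by (rule mult_window)
    then have "(2 * w) * (m * (2 * q' + 1)) \<le> (2 * w) * q" by (rule mult_le_mono2)
    then have "e' \<le> e - w" using q b(5) by (simp add: algebra_simps)
    with b(3,4) show False by simp
  qed
  from assms(1,2) obtain z z' where z: "w = 2 ^ z" "w' = 2 ^ z'" by (auto simp: blk_def)
  show ?thesis
  proof (cases rule: pow_cases[of z z'])
    case 1
    then have w: "w' = w" using z by simp
    from assms(1,2) obtain q q' where q: "e = w * (2 * q + 1)" "e' = w * (2 * q' + 1)" "e \<le> N" "e' \<le> N" "N < e + w" "N < e' + w"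
      unfolding w by (auto simp: blk_def)
    have "w * (2 * q + 1) < w * (2 * q' + 1) + w" "w * (2 * q' + 1) < w * (2 * q + 1) + w" using q by linarith+
    then have "2 * q + 1 \<le> 2 * q' + 1" "2 * q' + 1 \<le> 2 * q + 1" using mult_window by blast+
    then show ?thesis using q w by simp
  next
    case (2 m)
    then show ?thesis using *[OF assms(1,2,3,6), of m] z by simp
  next
    case (3 m)
    then show ?thesis using *[OF assms(2,1,5,4), of m] z by simp
  qed
qed

text \<open>Adding one is a carry in the binary counter: the trailing blocks are merged with the new
  entry into one block of width \<open>w0\<close>, and all earlier blocks remain.\<close>

lemma blk_Suc:
  assumes "blk (Suc N) e w" "blk (Suc N) (Suc N) w0"
  shows "e = Suc N \<and> w = w0 \<or> blk N e w \<and> e \<le> Suc N - w0"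
proof (cases "e = Suc N")
  case True
  have "e - w \<le> e - 1" "Suc N - w0 \<le> e - 1" "e - 1 < e" using blk_pos[OF assms(1)] blk_pos[OF assms(2)] True by auto
  then show ?thesis using blk_disjoint[OF assms] True by simp
next
  case False
  then have "blk N e w" using assms(1) by (auto simp: blk_def)
  moreover have "e \<le> Suc N - w0"
  proof (rule ccontr)
    assume "\<not> e \<le> Suc N - w0"
    moreover have "e - w \<le> e - 1" "0 < e" "0 < w" using blk_pos[OF assms(1)] by auto
    moreover have "e \<le> N" using \<open>blk N e w\<close> by (simp add: blk_def)
    ultimately have "Suc N - w0 \<le> e - 1" "e - 1 < Suc N" "e - w \<le> e - 1" "e - 1 < e" by linarith+
    then have "e = Suc N" using blk_disjoint[OF assms, of "e - 1"] by blast
    with \<open>e \<le> N\<close> show False by simp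
  qed
  ultimately show ?thesis by simp
qed

context params
begin

definition WROW :: com where
  "WROW = sqn [SetV 10 (Lit 0),
     While (WLess (Var 10) (Lit d)) (sqn [SetRow (Var 5) (Var 10) (Feature (Var 10)), Inc 10]),
     SetRow (Var 5) (Lit d) (OfWord Label), SetRow (Var 5) (Lit (d + 1)) (OfWord (Lit 0))]"

definition LOWB :: "nat \<Rightarrow> com" where
  "LOWB x = Seq (SetV 39 (Lit 1))
     (While (WLess (WMod (Var x) (WMul (Lit 2) (Var 39))) (Lit 1)) (SetV 39 (WMul (Lit 2) (Var 39))))"

text \<open>The lowest set bit of the new number of rows is the width of the block that the carry
  creates; that block is sorted afresh. Its cost is amortized by \<open>psi_Suc\<close>.\<close>

definition INSD :: com where
  "INSD = sqn [SetA 1 (Var 5) (Var 5), Inc 5, LOWB 5, SetV 18 (WSub (Var 5) (Var 39)), SetV 19 (Var 5),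
     SetV 8 (Lit 0), SetV 9 (Lit (d + 2)), SORT 1]"

definition BSEARCH :: com where
  "BSEARCH = While (WLess (Var 27) (Var 30)) (sqn [
     SetV 34 (WDiv (WAdd (Var 27) (Var 30)) (Lit 2)), SetV 6 (Arr 1 (Var 34)), SetV 7 (Var 5), CMP,
     Cond (WLess (Lit 0) (Var 11)) (SetV 27 (WAdd (Var 34) (Lit 1))) (SetV 30 (Var 34))])"

text \<open>Scalar 21 is the end of the current block. Subtracting its lowest set bit leads to the
  preceding block, so the blocks are searched from the last to the first. In each of them the last
  entry not above the pattern is tested for equality.\<close>

definition FIND :: com where
  "FIND = sqn [SetV 21 (Var 5), SetV 35 (Lit 0), SetV 8 (Lit 0), SetV 9 (Lit (d + 2)),
     While (And (WLess (Lit 0) (Var 21)) (WLess (Var 35) (Lit 1))) (sqn [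
       LOWB 21, SetV 21 (WSub (Var 21) (Var 39)), SetV 27 (Var 21), SetV 30 (WAdd (Var 21) (Var 39)), BSEARCH,
       Cond (WLess (Var 21) (Var 27)) (sqn [
         SetV 31 (Arr 1 (WSub (Var 27) (Lit 1))), SetV 6 (Var 5), SetV 7 (Var 31), CMP,
         Cond (WLess (Lit 0) (Var 11)) (SetV 35 (Lit 1)) Skip]) Skip])]"

abbreviation fullkey :: "(nat \<Rightarrow> nat \<Rightarrow> real) \<Rightarrow> nat \<Rightarrow> real list" where
  "fullkey G \<equiv> key G 0 (d + 2)"

text \<open>The key includes the dead flag as its last column: among equal examples the live rows
  precede the dead ones, and a pattern with flag 0 matches live rows only.\<close>

definition dict :: "(nat \<Rightarrow> nat) \<Rightarrow> (nat \<Rightarrow> nat \<Rightarrow> real) \<Rightarrow> nat \<Rightarrow> bool" where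
  "dict E G N \<longleftrightarrow> set (seg E 0 N) = {..<N} \<and> (\<forall>e w. blk N e w \<longrightarrow> sorted (map (fullkey G) (seg E (e - w) e)))"

end

context machine
begin

lemma WROW_writes [simp]:
  "x < 40 \<Longrightarrow> nv WROW x \<longleftrightarrow> x \<noteq> 10" "a < 16 \<Longrightarrow> na WROW a" "x < 8 \<Longrightarrow> nrv WROW x"
  by (auto simp: WROW_def)

lemma wp_WROW:
  assumes "length x = d"
  shows "wp (x, y) WROW (\<lambda>t' s'. t' \<le> t + 200 * d \<and> (\<forall>i. i \<noteq> sc s 5 \<longrightarrow> rw s' i = rw s i) \<and>
     (\<forall>c < d. rw s' (sc s 5) c = x ! c) \<and> rw s' (sc s 5) d = of_bool y \<and> rw s' (sc s 5) (d + 1) = 0 \<and>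
     rw s' (sc s 5) (d + 2) = rw s (sc s 5) (d + 2)) t s"
proof -
  define I where "I = (\<lambda>t' s'. sc s' 10 \<le> d \<and> t' \<le> t + 10 + 50 * sc s' 10 \<and> (\<forall>i. i \<noteq> sc s 5 \<longrightarrow> rw s' i = rw s i) \<and>
     (\<forall>c < sc s' 10. rw s' (sc s 5) c = x ! c) \<and> rw s' (sc s 5) (d + 2) = rw s (sc s 5) (d + 2))"
  show ?thesis unfolding WROW_def
    apply (simp split del: split_of_bool)
    apply (rule wp_while[where I = I and \<mu> = "\<lambda>s. d - sc s 10"])
  proof goal_cases
    case 1
    show ?case by (simp add: I_def)
  next
    case (2 t' s')
    note [simp] = frD[OF 2(2)]
    show ?case using 2(1,3) assms by (auto simp: I_def less_Suc_eq)
  next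
    case (3 t' s')
    note [simp] = frD[OF 3(2)]
    show ?case using 3(1,3) d1 by (auto simp: I_def)
  qed
qed

lemma LOWB_writes [simp]:
  "x < 40 \<Longrightarrow> nv (LOWB v) x \<longleftrightarrow> x \<noteq> 39" "a < 16 \<Longrightarrow> na (LOWB v) a" "nrv (LOWB v) x" "nrw (LOWB v)"
  by (auto simp: LOWB_def)

lemma wp_LOWB:
  assumes v: "v < 40" "v \<noteq> 39" "0 < sc s v" "sc s v \<le> IB" "sc s v \<le> 2 ^ L"
  shows "wp z (LOWB v) (\<lambda>t' s'. t' \<le> t + 60 * (L + 1) \<and> (\<exists>p q. sc s' 39 = 2 ^ p \<and> sc s v = 2 ^ p * (2 * q + 1))) t s"
proof -
  define m where "m = sc s v"
  define I where "I = (\<lambda>t' s'. \<exists>p \<le> L. sc s' 39 = 2 ^ p \<and> 2 ^ p dvd m \<and> t' \<le> t + 10 + 30 * p)"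
  show ?thesis unfolding LOWB_def
    apply simp
    apply (rule wp_while[where I = I and \<mu> = "\<lambda>s. m - sc s 39"])
  proof goal_cases
    case 1
    show ?case by (auto simp: I_def)
  next
    case (2 t' s')
    note [simp] = frD[OF 2(2)]
    from 2(1) obtain p where p: "p \<le> L" "sc s' 39 = 2 ^ p" "2 ^ p dvd m" "t' \<le> t + 10 + 30 * p" by (auto simp: I_def)
    have m: "sc s' v = m" using v by (simp add: m_def)
    have d': "2 ^ Suc p dvd m" using 2(3) p(2) m by (auto simp: mod_eq_0_iff_dvd)
    then have le: "2 ^ Suc p \<le> m" using v(3) by (intro dvd_imp_le) (auto simp: m_def)
    then have "(2::nat) ^ Suc p \<le> 2 ^ L" using v(5) unfolding m_def by (rule order_trans)
    then have pL: "Suc p \<le> L" by (rule power_le_imp_le_exp[rotated]) simp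
    have "0 < (2::nat) ^ p" by simp
    with le have "m - 2 * 2 ^ p < m - 2 ^ p" unfolding power_Suc by linarith
    then show ?case using p le v(4) d' pL m
      by (auto simp: I_def m_def[symmetric] intro!: exI[of _ "Suc p"])
  next
    case (3 t' s')
    note [simp] = frD[OF 3(2)]
    from 3(1) obtain p where p: "p \<le> L" "sc s' 39 = 2 ^ p" "2 ^ p dvd m" "t' \<le> t + 10 + 30 * p" by (auto simp: I_def)
    have m: "sc s' v = m" using v by (simp add: m_def)
    have nd: "\<not> 2 ^ Suc p dvd m" using 3(3) p(2) m by (auto simp: mod_eq_0_iff_dvd)
    from p(3) obtain r where r: "m = 2 ^ p * r" by (elim dvdE)
    with nd have "odd r" by auto
    then obtain q where "r = 2 * q + 1" by (elim oddE)
    then show ?case using p r by (auto simp: m_def[symmetric] intro!: exI[of _ p] exI[of _ q])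
  qed
qed

lemma INSD_writes [simp]:
  "x < 40 \<Longrightarrow> nv INSD x \<longleftrightarrow> x \<notin> {5, 6, 7, 8, 9, 10, 11, 12, 13, 14, 15, 16, 17, 18, 19, 20, 39}"
  "a < 16 \<Longrightarrow> na INSD a \<longleftrightarrow> a \<noteq> 1 \<and> a \<noteq> 2" "nrv INSD x" "nrw INSD"
  by (auto simp: INSD_def)

lemma wp_INSD:
  assumes N: "N = sc s 5" "2 * Suc N \<le> IB" "IB \<le> 2 ^ L" and dict: "dict (ar s 1) (rw s) N"
  shows "wp z INSD (\<lambda>t' s'. sc s' 5 = Suc N \<and> dict (ar s' 1) (rw s) (Suc N) \<and>
     (\<exists>w. blk (Suc N) (Suc N) w \<and> t' \<le> t + 20000 * (d * (L + 1)) * (w + 1))) t s"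
proof -
  note [simp] = N(1)[symmetric]
  show ?thesis unfolding INSD_def
    apply simp
    apply (intro conjI)
    subgoal using N by (simp add: disjI2)
    apply (rule wp_mono[OF wp_LOWB[where L = L]])
    using N apply (simp_all)[5]
    subgoal premises p for t1 s1
    proof -
      note [simp] = frD[OF p(2)]
      from p(1) obtain z' q where zq: "sc s1 39 = 2 ^ z'" "Suc N = 2 ^ z' * (2 * q + 1)" and t1: "t1 \<le> t + 20 + 60 * (L + 1)" by auto
      define w where "w = sc s1 39"
      note [simp] = w_def[symmetric]
      have b: "blk (Suc N) (Suc N) w" using zq by (auto simp: blk_def w_def[symmetric])
      have w: "0 < w" "w \<le> Suc N" using blk_pos[OF b] by auto
      show ?thesis
        apply simp
        apply (rule wp_mono[OF wp_SORT[where L = L]])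
        using N w apply (simp_all)[6]
        subgoal premises r for t2 s2
        proof -
          note [simp] = frD[OF r(2)]
          define E where "E = (ar s 1)(N := N)"
          have r1: "t2 \<le> t1 + 60 + 2000 * (d + 3) * (w + 1) * (L + 1)"
            using r(1) w by (simp add: algebra_simps)
          have r': "mset (seg (ar s2 1) (Suc N - w) (Suc N)) = mset (seg E (Suc N - w) (Suc N))"
            "sorted (map (fullkey (rw s)) (seg (ar s2 1) (Suc N - w) (Suc N)))"
            "\<And>i. i < Suc N - w \<or> Suc N \<le> i \<Longrightarrow> ar s2 1 i = E i"
            using r(1) w by (auto simp: E_def)
          have "mset (seg (ar s2 1) 0 (Suc N)) = mset (seg E 0 (Suc N))"
            by (rule mset_seg_change[OF r'(3,1)]) auto
          then have "set (seg (ar s2 1) 0 (Suc N)) = set (seg E 0 (Suc N))" by (rule mset_eq_setD)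
          also have "\<dots> = insert N (set (seg (ar s 1) 0 N))"
          proof -
            have "seg E 0 N = seg (ar s 1) 0 N" by (rule seg_cong) (simp add: E_def)
            then show ?thesis by (simp add: seg_Suc E_def)
          qed
          also have "\<dots> = {..<Suc N}" using dict by (auto simp: dict_def)
          finally have S: "set (seg (ar s2 1) 0 (Suc N)) = {..<Suc N}" .
          have B: "sorted (map (fullkey (rw s)) (seg (ar s2 1) (e - w') e))" if "blk (Suc N) e w'" for e w'
            using blk_Suc[OF that b]
          proof
            assume "e = Suc N \<and> w' = w"
            then show ?thesis using r'(2) by simp
          next
            assume o: "blk N e w' \<and> e \<le> Suc N - w"
            have "seg (ar s2 1) (e - w') e = seg (ar s 1) (e - w') e"
            proof (rule seg_cong)
              fix i assume "e - w' \<le> i" "i < e"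
              then show "ar s2 1 i = ar s 1 i" using r'(3)[of i] o w by (auto simp: E_def)
            qed
            then show ?thesis using dict o by (auto simp: dict_def)
          qed
          have "t2 \<le> t + 20000 * (d * (L + 1)) * (w + 1)"
          proof -
            define K where "K = (w + 1) * (L + 1)"
            have K: "1 \<le> K" "L + 1 \<le> K" by (simp_all add: K_def)
            have dK: "K \<le> d * K" using d1 by simp
            have "2000 * (d + 3) * (w + 1) * (L + 1) = 2000 * (d * K) + 6000 * K"
              by (simp add: K_def algebra_simps)
            moreover have "20000 * (d * (L + 1)) * (w + 1) = 20000 * (d * K)" by (simp add: K_def algebra_simps)
            moreover have "60 * (L + 1) \<le> 60 * K" using K(2) by (rule mult_le_mono2)
            moreover have "60 * K \<le> 60 * (d * K)" "6000 * K \<le> 6000 * (d * K)" "1 \<le> d * K" using dK K(1) by linarith+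
            ultimately show ?thesis using r1 t1 by linarith
          qed
          then show ?thesis using S B b by (auto simp: dict_def)
        qed
        done
    qed
    done
qed

lemma sorted_seg_iff:
  "sorted (map f (seg E a b)) \<longleftrightarrow> (\<forall>i j. a \<le> i \<longrightarrow> i \<le> j \<longrightarrow> j < b \<longrightarrow> f (E i) \<le> f (E j))"
proof -
  have "sorted (map f (seg E a b)) \<longleftrightarrow> (\<forall>i j. i \<le> j \<longrightarrow> j < b - a \<longrightarrow> f (E (a + i)) \<le> f (E (a + j)))"
    by (simp add: sorted_iff_nth_mono)
  also have "\<dots> \<longleftrightarrow> (\<forall>i j. a \<le> i \<longrightarrow> i \<le> j \<longrightarrow> j < b \<longrightarrow> f (E i) \<le> f (E j))"
  proof (intro iffI allI impI)
    fix i j assume *: "\<forall>i j. i \<le> j \<longrightarrow> j < b - a \<longrightarrow> f (E (a + i)) \<le> f (E (a + j))" "a \<le> i" "i \<le> j" "j < b"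
    then show "f (E i) \<le> f (E j)" using *(1)[rule_format, of "i - a" "j - a"] by simp
  qed simp
  finally show ?thesis .
qed

lemma BSEARCH_writes [simp]:
  "x < 40 \<Longrightarrow> nv BSEARCH x \<longleftrightarrow> x \<notin> {6, 7, 10, 11, 27, 30, 34}"
  "a < 16 \<Longrightarrow> na BSEARCH a" "nrv BSEARCH x" "nrw BSEARCH"
  by (auto simp: BSEARCH_def)

lemma wp_BSEARCH:
  assumes b: "b = sc s 27" "e = sc s 30" "N = sc s 5" "sc s 8 = 0" "sc s 9 = d + 2" "b \<le> e" "2 * e + 2 \<le> IB" "e - b \<le> 2 ^ L"
    and srt: "sorted (map (fullkey (rw s)) (seg (ar s 1) b e))"
  shows "wp z BSEARCH (\<lambda>t' s'. t' \<le> t + 2000 * (d * (L + 1)) \<and> b \<le> sc s' 27 \<and> sc s' 27 \<le> e \<and>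
     (\<forall>i. b \<le> i \<longrightarrow> i < sc s' 27 \<longrightarrow> fullkey (rw s) (ar s 1 i) \<le> fullkey (rw s) N) \<and>
     (\<forall>i. sc s' 27 \<le> i \<longrightarrow> i < e \<longrightarrow> \<not> fullkey (rw s) (ar s 1 i) \<le> fullkey (rw s) N)) t s"
proof -
  define E f where defs: "E = ar s (Suc 0)" "f = key (rw s) 0 (Suc (Suc d))"
  have srt': "f (E i) \<le> f (E j)" if "b \<le> i" "i \<le> j" "j < e" for i j
    using srt that by (simp add: sorted_seg_iff defs)
  \<comment> \<open>After \<open>j\<close> rounds the remaining length times \<open>2 ^ j\<close> is
    at most \<open>2 ^ L\<close>; as long as something remains, this forces \<open>j\<close> to be
    at most \<open>L\<close>.\<close>
  define I where "I = (\<lambda>t' s'. b \<le> sc s' 27 \<and> sc s' 27 \<le> sc s' 30 \<and> sc s' 30 \<le> e \<and>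
     (\<forall>i. b \<le> i \<longrightarrow> i < sc s' 27 \<longrightarrow> f (E i) \<le> f N) \<and> (\<forall>i. sc s' 30 \<le> i \<longrightarrow> i < e \<longrightarrow> \<not> f (E i) \<le> f N) \<and>
     (\<exists>j \<le> L + 1. (sc s' 30 - sc s' 27) * 2 ^ j \<le> 2 ^ L \<and> t' \<le> t + 1000 * (d * j)))"
  note [simp] = b(4,5) b(1-3)[symmetric] defs[symmetric]
  show ?thesis unfolding BSEARCH_def
    apply (rule wp_while[where I = I and \<mu> = "\<lambda>s. sc s 30 - sc s 27"])
  proof goal_cases
    case 1
    show ?case using b(6,8) by (auto simp: I_def intro!: exI[of _ 0])
  next
    case (2 t' s')
    note [simp] = frD[OF 2(2)]
    define l r m where lr: "l = sc s' 27" "r = sc s' 30" "m = (l + r) div 2"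
    note [simp] = lr[symmetric]
    from 2(1,3) obtain j where I: "b \<le> l" "l < r" "r \<le> e"
       "\<And>i. b \<le> i \<Longrightarrow> i < l \<Longrightarrow> f (E i) \<le> f N" "\<And>i. r \<le> i \<Longrightarrow> i < e \<Longrightarrow> \<not> f (E i) \<le> f N"
       "(r - l) * 2 ^ j \<le> 2 ^ L" "t' \<le> t + 1000 * (d * j)" by (auto simp: I_def)
    have m: "l \<le> m" "m < r" using I(2) unfolding lr(3) by arith+
    have "2 ^ j \<le> (r - l) * (2::nat) ^ j" using I(2) by simp
    also note I(6)
    finally have "(2::nat) ^ j \<le> 2 ^ L" .
    then have j: "j \<le> L" by (rule power_le_imp_le_exp[rotated]) simp
    have h: "len * 2 ^ Suc j \<le> 2 ^ L" if "len \<le> (r - l) div 2" for len :: nat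
    proof -
      have "len * 2 ^ Suc j = (len * 2) * 2 ^ j" by simp
      also have "\<dots> \<le> (r - l) * 2 ^ j" by (rule mult_le_mono1) (use that in linarith)
      also note I(6)
      finally show ?thesis .
    qed
    have mh: "r - Suc m \<le> (r - l) div 2" "m - l \<le> (r - l) div 2" using I(2) unfolding lr(3) by arith+
    have l1: "(r - Suc m) * 2 ^ Suc j \<le> 2 ^ L" "(m - l) * 2 ^ Suc j \<le> 2 ^ L"
      by (rule h, rule mh)+
    show ?case
      apply simp
      apply (intro conjI)
      subgoal using I m b(7) by simp
      apply (rule wp_mono[OF wp_CMP])
      apply simp_all[2]
      subgoal premises p for t1 s1
      proof -
        note [simp] = frD[OF p(2)]
        have c: "0 < sc s1 11 \<longleftrightarrow> f (E m) \<le> f N" "t1 \<le> t' + 700 + 200 * d" using p(1) by simp_all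
        have t1: "t1 + 50 \<le> t + 1000 * (d * Suc j)" using c(2) I(7) d1 by (simp add: algebra_simps)
        show ?thesis
        proof (cases "f (E m) \<le> f N")
          case True
          have "f (E i) \<le> f N" if "b \<le> i" "i < Suc m" for i
            using srt'[of i m] True that m I(3) by (meson less_Suc_eq_le order_trans order_le_less_trans less_le_trans)
          then show ?thesis using True c t1 I m j l1(1) b(7)
            by (auto simp: I_def intro!: exI[of _ "Suc j"])
        next
          case False
          have "\<not> f (E i) \<le> f N" if "m \<le> i" "i < e" for i
            using srt'[of m i] False that m I(1) by (meson order_trans)
          then show ?thesis using False c t1 I m j l1(2) b(7)
            by (auto simp: I_def intro!: exI[of _ "Suc j"])
        qed
      qed
      done
  next
    case (3 t' s')
    note [simp] = frD[OF 3(2)]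
    from 3(1) obtain j where j: "j \<le> L + 1" "t' \<le> t + 1000 * (d * j)" by (auto simp: I_def)
    have "d * j \<le> d * (L + 1)" using j(1) by (rule mult_le_mono2)
    moreover have "1 \<le> d * (L + 1)" using d1 by simp
    ultimately have "t' + 7 \<le> t + 2000 * (d * (L + 1))" using j(2) by linarith
    then show ?case using 3(1,3) by (auto simp: I_def)
  qed
qed

lemma FIND_writes [simp]:
  "x < 40 \<Longrightarrow> nv FIND x \<longleftrightarrow> x \<notin> {6, 7, 8, 9, 10, 11, 21, 27, 30, 31, 34, 35, 39}"
  "a < 16 \<Longrightarrow> na FIND a" "nrv FIND x" "nrw FIND"
  by (auto simp: FIND_def)

lemma wp_FIND:
  assumes N: "N = sc s 5" "2 * N + 2 \<le> IB" "IB \<le> 2 ^ L" and dict: "dict (ar s 1) (rw s) N"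
  shows "wp z FIND (\<lambda>t' s'. t' \<le> t + 10000 * (d * (L + 1) * (L + 1)) \<and>
     (if 0 < sc s' 35 then \<exists>e w p. blk N e w \<and> e - w \<le> p \<and> p < e \<and> sc s' 31 = ar s 1 p \<and>
          fullkey (rw s) (ar s 1 p) = fullkey (rw s) N \<and> (\<forall>i. p < i \<longrightarrow> i < e \<longrightarrow> \<not> fullkey (rw s) (ar s 1 i) \<le> fullkey (rw s) N)
      else \<forall>x < N. fullkey (rw s) x \<noteq> fullkey (rw s) N)) t s"
proof -
  define E f where defs: "E = ar s (Suc 0)" "f = key (rw s) 0 (Suc (Suc d))"
  define K where "K = d * (L + 1)"
  have K: "1 \<le> K" "L + 1 \<le> K" using d1 mult_le_mono1[of 1 d "L + 1"] by (simp_all add: K_def)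
  define found where "found = (\<lambda>x. \<exists>e w p. blk N e w \<and> e - w \<le> p \<and> p < e \<and> x = E p \<and>
          f (E p) = f N \<and> (\<forall>i. p < i \<longrightarrow> i < e \<longrightarrow> \<not> f (E i) \<le> f N))"
  have "N < 2 ^ L" using N IB by linarith
  \<comment> \<open>While nothing is found, the third conjunct says that scalar 21 is the end of a
    block, its lowest set bit being the width. That bit at least doubles with each round, so after
    \<open>j\<close> rounds \<open>2 ^ j\<close> divides scalar 21 and there are at most
    \<open>L + 1\<close> rounds.\<close>
  define I where "I = (\<lambda>t' s'. sc s' 8 = 0 \<and> sc s' 9 = d + 2 \<and>
     (if 0 < sc s' 35 then found (sc s' 31) \<and> (\<exists>j \<le> L + 1. t' \<le> t + 20 + 6000 * (K * j))
      else sc s' 21 \<le> N \<and> (\<forall>i. sc s' 21 \<le> i \<longrightarrow> i < N \<longrightarrow> f (E i) \<noteq> f N) \<and>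
        (\<forall>z q. sc s' 21 = 2 ^ z * (2 * q + 1) \<longrightarrow> N < sc s' 21 + 2 ^ z) \<and>
        (\<exists>j. 2 ^ j dvd sc s' 21 \<and> j \<le> L + 1 \<and> t' \<le> t + 20 + 6000 * (K * j))))"
  note [simp] = N(1)[symmetric] defs[symmetric]
  show ?thesis unfolding FIND_def
    apply simp
    apply (rule wp_while[where I = I and \<mu> = "\<lambda>s. (if 0 < sc s 35 then 0 else Suc (sc s 21))"])
  proof goal_cases
    case 1
    show ?case by (auto simp: I_def intro!: exI[of _ 0])
  next
    case (2 t' s')
    note [simp] = frD[OF 2(2)]
    define l where lr: "l = sc s' 21"
    note [simp] = lr[symmetric]
    from 2(1,3) obtain j where I: "sc s' 8 = 0" "sc s' 9 = d + 2" "0 < l" "sc s' 35 = 0" "l \<le> N"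
       "\<And>i. l \<le> i \<Longrightarrow> i < N \<Longrightarrow> f (E i) \<noteq> f N" "\<And>z q. l = 2 ^ z * (2 * q + 1) \<Longrightarrow> N < l + 2 ^ z"
       "2 ^ j dvd l" "t' \<le> t + 20 + 6000 * (K * j)" by (auto simp: I_def)
    note [simp] = I(1,2)
    have "2 ^ j \<le> l" using I(3,8) by (simp add: dvd_imp_le)
    then have "(2::nat) ^ j < 2 ^ L" using I(5) \<open>N < 2 ^ L\<close> by linarith
    then have j: "j \<le> L" by (simp add: power_strict_increasing_iff)
    show ?case
      apply (simp add: I(4))
      apply (rule wp_mono[OF wp_LOWB[where L = L]])
      using I(3,5) N(2,3) \<open>N < 2 ^ L\<close> apply (simp_all)[5]
      subgoal premises p for t1 s1
      proof -
        note [simp] = frD[OF p(2)]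
        from p(1) obtain zz q where zq: "sc s1 39 = 2 ^ zz" "l = 2 ^ zz * (2 * q + 1)" and t1: "t1 \<le> t' + 11 + 60 * (L + 1)" by auto
        define w b where wb: "w = sc s1 39" "b = l - w"
        note [simp] = wb[symmetric]
        have w2: "w = 2 ^ zz" unfolding wb(1) by (rule zq(1))
        have lw: "w \<le> l" "0 < w" using zq(2) w2 by simp_all
        have bl: "blk N l w" using zq(2) I(5) I(7)[OF zq(2)] w2 by (auto simp: blk_def)
        have "l = w + 2 * w * q" using zq(2) unfolding w2[symmetric] by (simp add: algebra_simps)
        then have bq: "b = 2 * w * q" using wb(2) by linarith
        have j1: "2 ^ Suc j dvd b"
        proof -
          have "2 ^ j dvd w"
          proof (cases "j \<le> zz")
            case True
            then show ?thesis using w2 by (simp add: le_imp_power_dvd)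
          next
            case False
            then have "(2::nat) ^ Suc zz dvd 2 ^ j" by (intro le_imp_power_dvd) simp
            then have "2 ^ zz * 2 dvd 2 ^ zz * (2 * q + 1)" using I(8) zq(2) by (metis dvd_trans power_Suc2)
            then have "2 dvd 2 * q + 1" by (simp only: nat_mult_dvd_cancel_disj) simp
            then show ?thesis by simp
          qed
          then show ?thesis using bq by (auto elim!: dvdE)
        qed
        have nx: "N < b + 2 ^ z'" if "b = 2 ^ z' * (2 * q' + 1)" for z' q'
        proof -
          have "Suc zz \<le> z'"
          proof (rule ccontr)
            assume "\<not> Suc zz \<le> z'"
            then obtain r where r: "Suc zz = z' + Suc r" by (metis add_Suc_right less_natE not_less)
            then have "b = 2 ^ z' * (2 * (2 ^ r * q))" using bq w2 by (metis mult.assoc power_Suc power_add)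
            with that have "2 ^ z' * (2 * q' + 1) = 2 ^ z' * (2 * (2 ^ r * q))" by metis
            then have "2 * q' + 1 = 2 * (2 ^ r * q)" by (simp only: mult_cancel1) simp
            then show False by presburger
          qed
          then have "(2::nat) ^ Suc zz \<le> 2 ^ z'" by (intro power_increasing) simp_all
          moreover have "N < l + w" using bl by (simp add: blk_def)
          ultimately show ?thesis using w2 wb(2) lw unfolding power_Suc by linarith
        qed
        have bw: "b + w = l" using wb(2) lw by linarith
        have "sorted (map (fullkey (rw s)) (seg (ar s 1) (l - w) l))" using dict bl unfolding dict_def by blast
        then have srt: "sorted (map f (seg E b l))" by simp
        have srt': "f (E i) \<le> f (E i')" if "b \<le> i" "i \<le> i'" "i' < l" for i i'
          using srt that by (simp add: sorted_seg_iff)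
        have lIB: "2 * l + 2 \<le> IB" "l \<le> 2 ^ L" using I(5) N by linarith+
        show ?thesis
          using I(4)
          apply (simp add: bw)
          apply (intro conjI)
          subgoal using lIB by (simp add: disjI2)
          apply (rule wp_mono[OF wp_BSEARCH[where L = L and b = b and e = l and N = N]])
          using lIB lw bw srt apply (simp_all)[9]
          subgoal premises r for t2 s2
          proof -
            note [simp] = frD[OF r(3)]
            define v where "v = sc s2 27"
            note [simp] = v_def[symmetric]
            have v: "b \<le> v" "v \<le> l" "\<And>i. b \<le> i \<Longrightarrow> i < v \<Longrightarrow> f (E i) \<le> f N" "\<And>i. v \<le> i \<Longrightarrow> i < l \<Longrightarrow> \<not> f (E i) \<le> f N"
              "t2 \<le> t1 + 50 + 2000 * K"
              using r(2) by (auto simp: K_def)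
            have KL: "200 * (d + 3) \<le> 800 * K" "60 * (L + 1) \<le> 60 * K" using d1 K unfolding K_def by (auto simp: algebra_simps)
            have t2: "t2 + 200 + 200 * (d + 3) \<le> t + 20 + 6000 * (K * Suc j)"
              using v(5) t1 I(9) KL K by simp
            show ?thesis
            proof (cases "b < v")
              case True
              define x where "x = E (v - Suc 0)"
              show ?thesis
                using True I(4)
                apply (simp add: x_def[symmetric])
                apply (rule wp_mono[OF wp_CMP])
                apply simp_all[2]
                subgoal premises u for t3 s3
                proof -
                  note [simp] = frD[OF u(4)]
                  have c: "0 < sc s3 11 \<longleftrightarrow> f N \<le> f x" "t3 \<le> t2 + 100 + 200 * (d + 3)" using u(3) by simp_all
                  have fx: "f x \<le> f N" using v(3)[of "v - 1"] True by (simp add: x_def)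
                  show ?thesis
                  proof (cases "f N \<le> f x")
                    case fn: True
                    have "found x" unfolding found_def
                      apply (rule exI[of _ l], rule exI[of _ w], rule exI[of _ "v - 1"])
                      using bl True v(1,2,4) order_antisym[OF fx fn] by (auto simp: x_def wb(2)[symmetric])
                    then show ?thesis using c fn t2 j by (auto simp: I_def intro!: exI[of _ "Suc j"])
                  next
                    case fn: False
                    have "f (E i) \<noteq> f N" if "b \<le> i" "i < N" for i
                    proof (cases "i < v")
                      case True
                      then have "f (E i) \<le> f x" unfolding x_def using that v(2) by (intro srt') auto
                      with fn show ?thesis by auto
                    next
                      case False
                      then show ?thesis using v(4)[of i] I(6)[of i] that by (cases "i < l") auto
                    qed
                    then show ?thesis using c fn t2 j I(4,5) lw bw j1 nx
                      by (auto simp: I_def intro!: exI[of _ "Suc j"])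
                  qed
                qed
                done
            next
              case False
              then have "f (E i) \<noteq> f N" if "b \<le> i" "i < N" for i
                using False v(1) v(4)[of i] I(6)[of i] that by (cases "i < l") auto
              then show ?thesis using False t2 j I(4,5) lw bw j1 nx
                by (auto simp: I_def intro!: exI[of _ "Suc j"])
            qed
          qed
          done
      qed
      done
  next
    case (3 t' s')
    note [simp] = frD[OF 3(2)]
    from 3(1) obtain j where j: "j \<le> L + 1" "t' \<le> t + 20 + 6000 * (K * j)" by (auto simp: I_def split: if_splits)
    have "K * j \<le> K * (L + 1)" using j(1) by (rule mult_le_mono2)
    moreover have "1 \<le> K * (L + 1)" using K by simp
    ultimately have t: "t' + 16 \<le> t + 10000 * (K * (L + 1))" using j(2) by linarith
    show ?case
    proof (cases "0 < sc s' 35")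
      case True
      then show ?thesis using 3(1) t by (simp add: I_def K_def found_def)
    next
      case False
      then have "f (E i) \<noteq> f N" if "i < N" for i using 3(1,3) that by (auto simp: I_def)
      moreover have "\<exists>i < N. x = E i" if "x < N" for x
      proof -
        have "x \<in> E ` {0..<N}" using dict that by (simp add: dict_def set_seg)
        then show ?thesis by auto
      qed
      ultimately have "\<forall>x < N. f x \<noteq> f N" by blast
      then show ?thesis using False t by (simp add: K_def)
    qed
  qed
qed

lemma dict_cong:
  assumes "dict E G N" "\<And>i c. i < N \<Longrightarrow> c < d + 2 \<Longrightarrow> G' i c = G i c"
  shows "dict E G' N"
proof -
  have "fullkey G' (E i) = fullkey G (E i)" if "i < N" for i
  proof -
    have "E i < N" using assms(1) that by (auto simp: dict_def set_seg)
    then show ?thesis using assms(2) unfolding key_def by (intro seg_cong) simp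
  qed
  moreover have "i < N" if "blk N e w" "i < e" for e w i using that by (auto simp: blk_def)
  ultimately show ?thesis using assms(1) unfolding dict_def sorted_seg_iff by (metis order_le_less_trans)
qed

lemma append_le_iff:
  "length us = length vs \<Longrightarrow> us @ [x] \<le> vs @ [y] \<longleftrightarrow> us < vs \<or> us = vs \<and> x \<le> (y :: 'a :: linorder)"
  by (induction us vs rule: list_induct2) auto

lemma fullkey_le_iff:
  "fullkey G a \<le> fullkey G b \<longleftrightarrow> key G 0 (d + 1) a < key G 0 (d + 1) b \<or>
     key G 0 (d + 1) a = key G 0 (d + 1) b \<and> G a (d + 1) \<le> G b (d + 1)"
  using append_le_iff[of "key G 0 (d + 1) a" "key G 0 (d + 1) b"]
  by (simp add: key_def seg_Suc)

text \<open>Setting the flag of the last one of several equal live rows keeps its block sorted.\<close>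

lemma dict_kill:
  assumes dict: "dict E G N" and b: "blk N e w" "e - w \<le> p" "p < e" "E p = x"
    and after: "\<forall>i. p < i \<longrightarrow> i < e \<longrightarrow> \<not> fullkey G (E i) \<le> fullkey G x"
    and live: "G x (d + 1) = 0" "\<And>i. i < N \<Longrightarrow> G i (d + 1) \<in> {0, 1}"
  shows "dict E (G(x := (G x)(d + 1 := 1))) N"
proof -
  define G' where "G' = G(x := (G x)(d + 1 := 1))"
  have ltN: "i < N" if "blk N e w" "i < e" for e w i using that by (auto simp: blk_def)
  have S: "E ` {..<N} = {..<N}" using dict by (auto simp: dict_def set_seg atLeast0LessThan)
  then have inj: "inj_on E {..<N}" by (intro eq_card_imp_inj_on) auto
  have k: "key G' 0 (d + 1) a = key G 0 (d + 1) a" for a unfolding key_def by (rule seg_cong) (simp add: G'_def)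
  have le: "fullkey G' (E i) \<le> fullkey G' (E j)"
    if B: "blk N e' w'" and ij: "e' - w' \<le> i" "i \<le> j" "j < e'" for e' w' i j
  proof -
    have N: "i < N" "j < N" "p < N" using ltN[OF B] ij ltN[OF b(1,3)] by auto
    have N': "E i < N" "E j < N" using S N by auto
    have o: "fullkey G (E i) \<le> fullkey G (E j)" using dict B ij by (auto simp: dict_def sorted_seg_iff)
    show ?thesis
    proof (cases "E i = x")
      case False
      then have "G' (E i) (d + 1) = G (E i) (d + 1)" "G (E j) (d + 1) \<le> G' (E j) (d + 1)"
        using live by (auto simp: G'_def)
      then show ?thesis using o unfolding fullkey_le_iff k by auto
    next
      case True
      then have "i = p" using inj N b(4) by (auto simp: inj_on_def)
      show ?thesis
      proof (cases "j = i")
        case jne: False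
        have "e' = e" using blk_disjoint[OF B b(1), of p] ij b \<open>i = p\<close> by auto
        \<comment> \<open>A later entry of the block has a strictly larger full key. If it agrees
          with \<open>x\<close> in the first \<open>d + 1\<close> columns, its flag must be 1
          already, and raising the flag of \<open>x\<close> to 1 does not break the order.\<close>
        then have "\<not> fullkey G (E j) \<le> fullkey G x" using after jne ij \<open>i = p\<close> by auto
        moreover have "G (E j) (d + 1) \<in> {0, 1}" using live N' by auto
        moreover have "E j \<noteq> x" using inj N b(4) jne \<open>i = p\<close> by (auto simp: inj_on_def)
        moreover have "G' x (d + 1) = 1" by (simp add: G'_def)
        moreover have "E j \<noteq> x \<Longrightarrow> G' (E j) (d + 1) = G (E j) (d + 1)" by (simp add: G'_def)
        ultimately show ?thesis using o live(1) True unfolding fullkey_le_iff k by auto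
      qed simp
    qed
  qed
  then show ?thesis using dict unfolding dict_def sorted_seg_iff G'_def by auto
qed

end

section \<open>Compaction, the three programs and the invariant between requests\<close>

context params
begin

text \<open>Live rows are moved to the front of the table; the target never overtakes the source, so
  nothing unread is overwritten. The dictionary is sorted as a whole, which makes all its blocks
  sorted. The tree is rebuilt from address 1 on, so all earlier segments, nodes and list cells are
  abandoned at once.\<close>

definition COMPACT :: com where
  "COMPACT = sqn [SetV 34 (Lit 0), SetV 27 (Lit 0),
     While (WLess (Var 27) (Var 5)) (sqn [
       Cond (Pos (Row (Var 27) (Lit (d + 1)))) Skip (sqn [SetV 10 (Lit 0),
         While (WLess (Var 10) (Lit (d + 2))) (sqn [SetRow (Var 34) (Var 10) (Row (Var 27) (Var 10)), Inc 10]),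
         SetA 1 (Var 34) (Var 34), Inc 34, SetA 0 (Var 34) (WSub (Var 34) (Lit 1))]),
       Inc 27]),
     SetV 5 (Var 34), SetV 18 (Lit 0), SetV 19 (Var 34), SetV 8 (Lit 0), SetV 9 (Lit (d + 2)), SORT 1,
     SetV 21 (Lit 1), SetV 33 (Lit 1), START (Lit 0)]"

text \<open>Garbage is recognised by comparing the last address in use with the reference size of
  the root, which is within a few percent of the number of live rows as the tree sees them
  (\<open>LT_root_size\<close>).\<close>

definition REST :: "bool \<Rightarrow> com" where
  "REST b = Cond (WLess (WAdd (WMul (Lit 8) (Arr 8 (Arr 3 (Lit 1)))) (Lit 8)) (Var 4)) COMPACT
       (sqn [SetV 33 (Lit 1), SetV 36 (Lit 1), LOOP b])"

text \<open>Slot 1 of array 3, which links to the root, is at the same time the right link of node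
  0. The initial tree is a leaf at address 0; the first update moves it to address 1, so that from
  then on no node owns that slot.\<close>

definition UPDATE :: "bool \<Rightarrow> com" where
  "UPDATE b = sqn [Cond (WLess (Var 4) (Lit 1)) (sqn [SetV 4 (Lit 1), SetA 3 (Lit 1) (Lit 1)]) Skip, REST b]"

definition INS :: com where "INS = sqn [WROW, INSD, UPDATE True]"

definition DEL :: com where
  "DEL = sqn [WROW, FIND, Cond (WLess (Lit 0) (Var 35))
     (sqn [SetRow (Var 31) (Lit (d + 1)) (OfWord (Lit 1)), UPDATE False]) Skip]"

definition LAB :: com where
  "LAB = sqn [SetV 37 (Arr 3 (Lit 1)),
     While (WLess (Lit 0) (Arr 4 (Var 37))) (sqn [GO, SetV 37 (Arr 3 (Var 33))]),
     Cond (WLess (Arr 5 (Var 37)) (Arr 6 (Var 37))) (SetV 0 (Lit 1)) (SetV 0 (Lit 0))]"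

definition al :: "state \<Rightarrow> nat set" where "al s = {i. i < sc s 5 \<and> \<not> 0 < rw s i (d + 1)}"

lemma al_finite [simp]: "finite (al s)"
  by (rule finite_subset[of _ "{..<sc s 5}"]) (auto simp: al_def)

primrec lab :: "(nat \<Rightarrow> nat \<Rightarrow> nat) \<Rightarrow> (nat \<Rightarrow> nat \<Rightarrow> real) \<Rightarrow> sk \<Rightarrow> point \<Rightarrow> bool" where
  "lab A G (SL v) x = (A 5 v < A 6 v)"
| "lab A G (SN v l r) x = (if x ! (A 4 v - 1) \<le> G v (d + 2) then lab A G l x else lab A G r x)"

lemma ms_insert: "finite X \<Longrightarrow> i \<notin> X \<Longrightarrow> ms G (insert i X) = add_mset (ex G i) (ms G X)"
  by (simp add: ms_def)

lemma ex_cong: "(\<And>c. c \<le> d \<Longrightarrow> G' i c = G j c) \<Longrightarrow> ex G' i = ex G j"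
  unfolding ex_def by (auto intro: seg_cong)

lemma ms_cong:
  assumes "\<And>i c. i \<in> X \<Longrightarrow> c \<le> d \<Longrightarrow> G' i c = G i c"
  shows "ms G' X = ms G X"
proof (cases "finite X")
  case True
  then show ?thesis unfolding ms_def
    by (intro image_mset_cong ex_cong) (use assms in auto)
qed (simp add: ms_def)

end

context machine
begin

lemma LAB_writes [simp]:
  "x < 40 \<Longrightarrow> nv LAB x \<longleftrightarrow> x \<noteq> 0 \<and> x \<noteq> 33 \<and> x \<noteq> 37" "a < 16 \<Longrightarrow> na LAB a" "nrv LAB x" "nrw LAB"
  by (auto simp: LAB_def GO_def)

lemma wp_GO:
  assumes "sc s 37 = v" "2 * v + 1 \<le> IB" "ar s 4 v = Suc j" "j < length (fst z)"
    "Q (t + (if fst z ! j \<le> rw s v (d + 2) then 32 else 34)) (setv s 33 (if fst z ! j \<le> rw s v (d + 2) then 2 * v else 2 * v + 1))"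
  shows "wp z GO Q t s"
  using assms by (auto simp: GO_def mult_2[symmetric] not_less disjI2 add.commute[of _ t])

lemma wp_LAB:
  assumes T: "LT (ar s) (rw s) Al N Fb T e B c X" and r: "ar s 3 1 = root T" and z: "length (fst z) = d" and F: "2 * Fb + 1 \<le> IB"
  shows "wp z LAB (\<lambda>t' s'. t' \<le> t + 100 * (sh T + 1) \<and> sc s' 0 = of_bool (lab (ar s) (rw s) T (fst z))) t s"
proof -
  define M where "M = While (WLess (Lit 0) (Arr 4 (Var 37))) (Seq GO (SetV 37 (Arr 3 (Var 33))))"
  define E where "E = Cond (WLess (Arr 5 (Var 37)) (Arr 6 (Var 37))) (SetV 0 (Lit 1)) (SetV 0 (Lit 0))"
  have Mu: "wp z M Q t s = (if 0 < ar s 4 (sc s 37) then wp z GO (wp z (SetV 37 (Arr 3 (Var 33))) (wp z M Q)) (t + 11) s else Q (t + 11) s)" for Q t s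
    unfolding M_def by (subst wp_While_unfold) simp
  have main: "wp z M (wp z E (\<lambda>t' s'. t' \<le> u \<and> sc s' 0 = of_bool (lab (ar s) (rw s) T (fst z)))) t s1"
    if "LT (ar s) (rw s) Al N Fb T e B c X" "ar s1 = ar s" "rw s1 = rw s" "sc s1 37 = root T" "t + 90 * (sh T + 1) \<le> u"
    for T e B c X t s1 u
    using that
  proof (induction T arbitrary: e B c X t s1)
    case (SL v)
    then show ?case by (subst Mu) (auto simp: E_def)
  next
    case (SN v l r)
    from SN.prems(1) obtain j X0 where v: "ar s 4 v = Suc j" "split_cond (rw s) X0 e j (rw s v (d + 2))" "v \<le> Fb"
      "ar s 3 (2 * v) = root l" "ar s 3 (2 * v + 1) = root r"
      and l: "LT (ar s) (rw s) Al N Fb l (Suc e) (ar s 8 v) (curc (ar s) v c) (lft (rw s) X j (rw s v (d + 2)))"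
      and rr: "LT (ar s) (rw s) Al N Fb r (Suc e) (ar s 8 v) (curc (ar s) v c) (rgt (rw s) X j (rw s v (d + 2)))"
      by (rule LT_SN) (auto simp: ltn_def)
    have j: "j < length (fst z)" using v(2) z by (simp add: split_cond_def)
    note c = SN.prems(2-5)
    have vI: "2 * v + 1 \<le> IB" using v(3) F by simp
    show ?case
    proof (cases "fst z ! j \<le> rw s v (d + 2)")
      case True
      have eq: "lab (ar s) (rw s) (SN v l r) (fst z) = lab (ar s) (rw s) l (fst z)" using True v(1) by simp
      have nx: "wp z M (wp z E (\<lambda>t' s'. t' \<le> u \<and> sc s' 0 = of_bool (lab (ar s) (rw s) l (fst z)))) (t + 54)
        (setv (setv s1 33 (2 * v)) 37 (root l))"
        by (rule SN.IH(1)[OF l]) (use c in simp_all)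
      show ?thesis
        unfolding eq
        apply (subst Mu)
        using c v(1) apply (simp split del: split_of_bool)
        apply (rule wp_GO[where v = v and j = j])
        using c v vI j True nx apply (simp_all add: ac_simps split del: split_of_bool)
        done
    next
      case False
      have eq: "lab (ar s) (rw s) (SN v l r) (fst z) = lab (ar s) (rw s) r (fst z)" using False v(1) by simp
      have nx: "wp z M (wp z E (\<lambda>t' s'. t' \<le> u \<and> sc s' 0 = of_bool (lab (ar s) (rw s) r (fst z)))) (t + 56)
        (setv (setv s1 33 (2 * v + 1)) 37 (root r))"
        by (rule SN.IH(2)[OF rr]) (use c in simp_all)
      show ?thesis
        unfolding eq
        apply (subst Mu)
        using c v(1) apply (simp split del: split_of_bool)
        apply (rule wp_GO[where v = v and j = j])
        using c v vI j False nx apply (simp_all add: ac_simps split del: split_of_bool)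
        done
    qed
  qed
  have "wp z M (wp z E (\<lambda>t' s'. t' \<le> t + 100 * (sh T + 1) \<and> sc s' 0 = of_bool (lab (ar s) (rw s) T (fst z)))) (9 + t) (setv s 37 (root T))"
    by (rule main[OF T]) simp_all
  then show ?thesis unfolding LAB_def sqn.simps M_def[symmetric] E_def[symmetric] using r by (simp split del: split_of_bool)
qed

lemma COMPACT_writes [simp]:
  "x < 40 \<Longrightarrow> 1 \<le> x \<Longrightarrow> x < 4 \<Longrightarrow> nv COMPACT x" "x < 8 \<Longrightarrow> nrv COMPACT x \<longleftrightarrow> nrv (START (Lit 0)) x"
  by (auto simp: COMPACT_def START_def)

text \<open>Initially all relevant cells are zero, and this already represents the one-leaf tree at
  address 0. The value \<open>4 * IB\<close> is a fictitious reference size above the root, large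
  enough for every size that occurs.\<close>

definition Inv :: "state \<Rightarrow> sk \<Rightarrow> bool" where
  "Inv s T \<longleftrightarrow> LT (ar s) (rw s) (al s) (sc s 5) (sc s 4) T 0 (4 * IB) 0 (al s) \<and> distinct (adrs T) \<and> ar s 3 1 = root T \<and>
     ar s 7 (root T) = 0 \<and> (\<forall>i < sc s 5. rw s i (d + 1) \<in> {0, 1} \<and> rw s i d \<in> {0, 1}) \<and> dict (ar s 1) (rw s) (sc s 5) \<and>
     (if sc s 4 = 0 then T = SL 0 \<and> (\<forall>a i. 3 \<le> a \<longrightarrow> a < 16 \<longrightarrow> ar s a i = 0) else 0 \<notin> set (adrs T)) \<and>
     rv s 2 = \<epsilon> \<and> sc s 5 \<le> sc s 4"

lemma sorted_key_dict: 
  assumes "set (seg E 0 N) = {..<N}" "sorted (map (fullkey G) (seg E 0 N))"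
  shows "dict E G N"
proof -
  have "i < N" if "blk N e w" "i < e" for e w i using that by (auto simp: blk_def)
  then show ?thesis using assms unfolding dict_def sorted_seg_iff by blast
qed

lemma wp_COMPACT:
  assumes N: "N = sc s 5" "3 * N + 6 \<le> IB" "IB \<le> 2 ^ L" and lb: "\<forall>i < N. rw s i (d + 1) \<in> {0, 1} \<and> rw s i d \<in> {0, 1}" and eps: "rv s 2 = \<epsilon>"
  shows "wp z COMPACT (\<lambda>t' s'. \<exists>T. Inv s' T \<and> ms (rw s') (al s') = ms (rw s) (al s) \<and> csum (ar s') T = 0 \<and> sc s' 5 = card (al s) \<and>
     sc s' 4 \<le> 3 * card (al s) + 1 \<and> t' \<le> t + 60000 * (d * (L + 1)) * ((sh T + 3) * (N + 1))) t s"
proof -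
  define G where "G = rw s"
  have als: "al s = {i. i < N \<and> \<not> 0 < G i (d + 1)}" by (simp add: al_def G_def N)
  define alx where "alx x = {i. i < x \<and> \<not> 0 < G i (d + 1)}" for x
  have ax: "finite (alx x)" "card (alx x) \<le> x" for x
  proof -
    have s: "alx x \<subseteq> {..<x}" by (auto simp: alx_def)
    show "finite (alx x)" using s by (rule finite_subset) simp
    show "card (alx x) \<le> x" using card_mono[OF _ s] by simp
  qed
  have aS: "alx (Suc x) = (if 0 < G x (d + 1) then alx x else insert x (alx x))" "x \<notin> alx x" for x
    by (auto simp: alx_def less_Suc_eq)
  \<comment> \<open>Rows from \<open>x\<close> on are still as they were, because only rows below
    the number of live ones seen so far, which is at most \<open>x\<close>, have been written. Array
    1 receives the identity from index 0 and array 0 from index 1, where the tree will expect its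
    segment.\<close>
  define I where "I = (\<lambda>t' s'. \<exists>x n. sc s' 27 = x \<and> x \<le> N \<and> sc s' 34 = n \<and> n = card (alx x) \<and> t' \<le> t + 20 + (200 * d + 300) * x \<and>
     ms (rw s') {..<n} = ms G (alx x) \<and> (\<forall>i c. x \<le> i \<longrightarrow> rw s' i c = G i c) \<and>
     (\<forall>i < n. rw s' i (d + 1) = 0 \<and> rw s' i d \<in> {0, 1} \<and> ar s' 1 i = i \<and> ar s' 0 (Suc i) = i))"
  note [simp] = N(1)[symmetric]
  show ?thesis unfolding COMPACT_def
    apply simp
    apply (rule wp_while[where I = I and \<mu> = "\<lambda>s. N - sc s 27"])
  proof goal_cases
    case 1
    show ?case by (auto simp: I_def ms_def alx_def G_def)
  next
    case (2 t' s')
    note [simp] = frD[OF 2(2)]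
    define x n where xn: "x = sc s' 27" "n = sc s' 34"
    note [simp] = xn[symmetric]
    from 2(1,3) have I: "x < N" "n = card (alx x)" "t' \<le> t + 20 + (200 * d + 300) * x" "ms (rw s') {..<n} = ms G (alx x)"
      "\<And>i c. x \<le> i \<Longrightarrow> rw s' i c = G i c"
      "\<And>i. i < n \<Longrightarrow> rw s' i (d + 1) = 0 \<and> rw s' i d \<in> {0, 1} \<and> ar s' 1 i = i \<and> ar s' 0 (Suc i) = i"
      by (auto simp: I_def)
    have nx: "n \<le> x" using I(2) ax by simp
    have xI: "x + 4 \<le> IB" "n + 4 \<le> IB" using I(1) nx N by linarith+
    have t1: "t' + 300 + 200 * d \<le> t + 20 + (200 * d + 300) * Suc x" using I(3) by simp
    show ?case
    proof (cases "0 < G x (d + 1)")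
      case True
      then show ?thesis using I xI aS(1)[of x] t1 by (auto simp: I_def Inc_def disjI2)
    next
      case False
      have row: "\<not> 0 < rw s' x (Suc d)" using False I(5)[of x "Suc d"] by simp
      define J where "J = (\<lambda>t2 s2. \<exists>c0. sc s2 10 = c0 \<and> c0 \<le> d + 2 \<and> t2 \<le> t' + 60 + 60 * c0 \<and>
        (\<forall>i c. rw s2 i c = (if i = n \<and> c < c0 then G x c else rw s' i c)))"
      show ?thesis
        using row
        apply simp
        apply (rule wp_while[where I = J and \<mu> = "\<lambda>s. d + 2 - sc s 10"])
        subgoal by (auto simp: J_def)
        subgoal premises p for t2 s2
        proof -
          note [simp] = frD[OF p(3)]
          from p(2) obtain c0 where c0: "sc s2 10 = c0" "c0 \<le> d + 2" "t2 \<le> t' + 60 + 60 * c0"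
            "\<And>i c. rw s2 i c = (if i = n \<and> c < c0 then G x c else rw s' i c)" by (auto simp: J_def)
          have lt: "c0 < d + 2" using p(4) c0 by simp
          have v: "rw s2 x c0 = G x c0" using c0(4)[of x c0] I(5) by simp
          have rw3: "rw (setv (setrw s2 n c0 (G x c0)) 10 (Suc c0)) i c = (if i = n \<and> c < Suc c0 then G x c else rw s' i c)" for i c
            using lt by (cases "i = n"; cases "c = c0") (simp_all add: c0(4))
          have "J t3 (setv (setrw s2 n c0 (G x c0)) 10 (Suc c0))" if "t3 \<le> t2 + 60" for t3
            unfolding J_def using rw3 lt c0(3) that by (intro exI[of _ "Suc c0"]) simp
          then show ?thesis using lt c0(1) v by (simp add: Inc_def disjI2)
        qed
        subgoal premises p for t2 s2
        proof -
          note [simp] = frD[OF p(3)]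
          from p(2,4) have c0: "t2 \<le> t' + 60 + 60 * (d + 2)"
            "\<And>i c. rw s2 i c = (if i = n \<and> c < d + 2 then G x c else rw s' i c)" by (auto simp: J_def)
          have "ms (rw s2) {..<Suc n} = add_mset (ex (rw s2) n) (ms (rw s2) {..<n})"
            unfolding lessThan_Suc by (rule ms_insert) auto
          also have "ms (rw s2) {..<n} = ms (rw s') {..<n}" by (rule ms_cong) (simp add: c0(2))
          also have "ex (rw s2) n = ex G x" by (rule ex_cong) (simp add: c0(2))
          also have "add_mset (ex G x) (ms (rw s') {..<n}) = ms G (alx (Suc x))"
            using False aS[of x] ax by (simp add: I(4) ms_insert)
          finally have m: "ms (rw s2) {..<Suc n} = ms G (alx (Suc x))" .
          have cS: "Suc n = card (alx (Suc x))" using False aS[of x] ax I(2) by simp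
          have g: "G x (d + 1) = 0" "G x d \<in> {0, 1}" using lb False I(1) by (auto simp: G_def)
          show ?thesis using xI c0(1) t1 m cS nx I(1,5,6) g
            by (auto simp: I_def Inc_def c0(2) less_Suc_eq disjI2)
        qed
        done
    qed
  next
    case (3 t' s')
    note [simp] = frD[OF 3(2)]
    define n where "n = card (al s)"
    have "alx N = al s" by (simp add: alx_def als)
    with 3(1,3) have I: "sc s' 34 = n" "t' \<le> t + 20 + (200 * d + 300) * N" "ms (rw s') {..<n} = ms G (al s)"
      "\<And>i. i < n \<Longrightarrow> rw s' i (d + 1) = 0 \<and> rw s' i d \<in> {0, 1} \<and> ar s' 1 i = i \<and> ar s' 0 (Suc i) = i"
      by (auto simp: I_def n_def)
    have nN: "n \<le> N" using ax[of N] \<open>alx N = al s\<close> by (simp add: n_def)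
    have nI: "3 * n + 6 \<le> IB" "n \<le> 2 ^ L" using nN N by linarith+
    show ?case
      using I(1)
      apply simp
      apply (rule wp_mono[OF wp_SORT[where L = L]])
      using nI apply (simp_all)[6]
      subgoal premises p for t2 s2
      proof -
        note [simp] = frD[OF p(3)]
        have t2: "t2 \<le> t' + 50 + 2000 * (d + 3) * (n + 1) * (L + 1)" using p(2) by (simp add: algebra_simps)
        have id: "seg (ar s' 1) 0 n = [0..<n]" "seg (ar s' 0) 1 (Suc n) = [0..<n]"
          using I(4) by (auto simp: list_eq_iff_nth_eq)
        have "mset (seg (ar s2 1) 0 n) = mset [0..<n]" using p(2) id(1) by simp
        then have "set (seg (ar s2 1) 0 n) = {..<n}" by (metis mset_eq_setD set_upt atLeast0LessThan)
        moreover have "sorted (map (fullkey (rw s')) (seg (ar s2 1) 0 n))" using p(2) by simp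
        ultimately have D: "dict (ar s2 1) (rw s') n" by (rule sorted_key_dict)
        define s3 where "s3 = setv (setv s2 21 (Suc 0)) 33 (Suc 0)"
        have W: "wp z (START (Lit 0)) (\<lambda>t' s'. \<exists>T. BT (ar s') (rw s') (Suc (sc s' 4)) T 0 (2 * (Suc n - 1)) {..<n} 1 (Suc n) \<and> root T = Suc n \<and>
         ar s' 3 (sc s3 33) = Suc n \<and> ar s' 7 (Suc n) = 0 \<and>
         distinct (adrs T) \<and> set (adrs T) = {Suc n..sc s' 4} \<and> sc s' 4 + 2 \<le> Suc n + 2 * max 1 (Suc n - 1) \<and>
         t' \<le> Suc (Suc (Suc (Suc (Suc (Suc t2))))) + 100 + wlen (Lit 0) + 30000 * (d * (L + 1)) * ((sh T + 3) * (Suc n - 1 + 1)) \<and>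
         (\<forall>a v. v < Suc n \<longrightarrow> 4 \<le> a \<longrightarrow> a \<le> 13 \<longrightarrow> ar s' a v = ar s3 a v) \<and> (\<forall>i < 2 * Suc n. i \<noteq> sc s3 33 \<longrightarrow> ar s' 3 i = ar s3 3 i) \<and>
         (\<forall>i. i < 1 \<or> Suc n \<le> i \<longrightarrow> ar s' 0 i = ar s3 0 i) \<and> (\<forall>i c. i < Suc n \<or> c \<noteq> d + 2 \<longrightarrow> rw s' i c = rw s3 i c)) (Suc (Suc (Suc (Suc (Suc (Suc t2)))))) s3"
          by (rule wp_START) (use nI id I eps in \<open>auto simp: s3_def atLeast0LessThan\<close>)
        show ?thesis
          apply (simp add: s3_def[symmetric])
          apply (rule wp_mono[OF W])
          subgoal premises q for t4 s4
          proof -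
            note [simp] = frD[OF q(2)]
            from q(1) obtain T where T: "BT (ar s4) (rw s4) (Suc (sc s4 4)) T 0 (2 * n) {..<n} 1 (Suc n)" "root T = Suc n"
              "ar s4 3 1 = Suc n" "ar s4 7 (Suc n) = 0" "distinct (adrs T)" "set (adrs T) = {Suc n..sc s4 4}"
              "sc s4 4 + 2 \<le> Suc n + 2 * max 1 n" "t4 \<le> t2 + 120 + 30000 * (d * (L + 1)) * ((sh T + 3) * (n + 1))"
              and rw4: "\<And>i c. c \<noteq> d + 2 \<Longrightarrow> rw s4 i c = rw s' i c"
              by (auto simp: s3_def)
            have s45: "sc s4 5 = n" by (simp add: s3_def START_def)
            have al4: "al s4 = {..<n}" using I(4) rw4 s45 by (auto simp: al_def)
            have F4: "Suc n \<le> sc s4 4" using root_in_adrs[of T] T(2,6) by simp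
            have LT0: "LT (ar s4) (rw s4) (al s4) n (sc s4 4) T 0 (2 * n) 0 {..<n} \<and> csum (ar s4) T = 0"
              by (rule BT_LT[OF T(1)]) (use T(6) al4 F4 in auto)
            have b: "bnode (ar s4) (Suc n) 0 (2 * n) {..<n} 1 (Suc n)" using BT_root[OF T(1)] T(2) by simp
            have LT: "LT (ar s4) (rw s4) (al s4) (sc s4 5) (sc s4 4) T 0 (4 * IB) 0 (al s4)"
              unfolding al4 s45 by (rule LT_top[OF LT0[THEN conjunct1, unfolded al4]]) (use T b nI in \<open>auto simp: bnode_def\<close>)
            have D4: "dict (ar s4 1) (rw s4) n"
              by (rule dict_cong[where G = "rw s'"]) (use D rw4 in \<open>auto simp: s3_def START_def\<close>)
            have "Inv s4 T" unfolding Inv_def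
              using LT T F4 s45 D4 rw4 I(4) eps by (auto simp: s3_def START_def)
            moreover have "ms (rw s4) (al s4) = ms (rw s) (al s)"
              unfolding al4 using I(3) by (subst ms_cong[where G = "rw s'"]) (auto simp: rw4 G_def)
            moreover have "sc s4 4 \<le> 3 * n + 1" using T(7) by (cases n) auto
            moreover have "t4 \<le> t + 60000 * (d * (L + 1)) * ((sh T + 3) * (N + 1))"
            proof -
              define K where "K = d * (L + 1)"
              have K: "d \<le> K" "1 \<le> K" "(d + 3) * (L + 1) \<le> 4 * K"
                using d1 mult_le_mono1[of 3 "3 * d" "L + 1"] by (auto simp: K_def algebra_simps)
              have a: "(200 * d + 300) * N \<le> 500 * (K * (N + 1))"
              proof -
                have "(200 * d + 300) * N \<le> (500 * K) * (N + 1)" by (rule mult_le_mono) (use K in simp_all)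
                then show ?thesis by simp
              qed
              have b: "2000 * (d + 3) * (n + 1) * (L + 1) \<le> 8000 * (K * (N + 1))"
              proof -
                have "((d + 3) * (L + 1)) * (n + 1) \<le> (4 * K) * (N + 1)" by (rule mult_le_mono[OF K(3)]) (use nN in simp)
                then have "2000 * (((d + 3) * (L + 1)) * (n + 1)) \<le> 2000 * ((4 * K) * (N + 1))" by (rule mult_le_mono2)
                moreover have "2000 * (d + 3) * (n + 1) * (L + 1) = 2000 * (((d + 3) * (L + 1)) * (n + 1))"
                  by (simp only: mult.assoc mult.commute[of "n + 1" "L + 1"])
                ultimately show ?thesis by simp
              qed
              have c: "30000 * K * ((sh T + 3) * (n + 1)) \<le> 30000 * (K * ((sh T + 3) * (N + 1)))"
                using mult_le_mono2[of "n + 1" "N + 1"] nN by (simp only: mult.assoc) (intro mult_le_mono2, simp)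
              have e: "K * (N + 1) \<le> K * ((sh T + 3) * (N + 1))" "1 \<le> K * (N + 1)"
                using K(2) mult_le_mono1[of 1 "sh T + 3" "N + 1"] by (intro mult_le_mono2, simp, simp add: add_mult_distrib2 trans_le_add1)
              have "t4 \<le> t + 60000 * (K * ((sh T + 3) * (N + 1)))"
                using T(8)[folded K_def] t2 I(2) a b c e by linarith
              then show ?thesis by (simp only: K_def mult.assoc)
            qed
            ultimately show ?thesis using s45 LT0 by (auto simp: n_def)
          qed
          done
      qed
      done
  qed
qed

text \<open>An update ends in one of two ways: a walk with at most one rebuild, paid for by the
  counters it discards, or a compaction, paid for by releasing at least half of the memory in
  use.\<close>

definition ucost :: "nat \<Rightarrow> nat \<Rightarrow> nat \<Rightarrow> nat \<Rightarrow> nat \<Rightarrow> nat \<Rightarrow> nat \<Rightarrow> nat \<Rightarrow> state \<Rightarrow> sk \<Rightarrow> bool" where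
  "ucost L t N F S P H t' s' T' \<longleftrightarrow>
     (\<exists>\<rho> \<tau> \<chi> :: nat. t' \<le> t + 1000 * (H + 1) + 40000 * (d * (L + 1)) * ((sh T' + 3) * \<rho>) \<and> sc s' 4 \<le> F + \<tau> + 3 * \<rho> \<and>
        csum (ar s') T' + \<chi> \<le> S + \<tau> \<and> \<epsilon> * real \<rho> \<le> 20 * real \<chi> \<and> \<tau> \<le> P \<and> sc s' 5 = N) \<or>
     8 \<le> F \<and> t' \<le> t + 200000 * (d * (L + 1)) * ((sh T' + 3) * (F + 1)) \<and> csum (ar s') T' = 0 \<and> 2 * sc s' 4 \<le> F \<and> sc s' 5 \<le> F"

text \<open>The state after the table of rows has changed and before the tree has: \<open>N\<close>
  and \<open>Al\<close> describe the rows that the tree still represents, \<open>sc s 5\<close> and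
  \<open>al s\<close> those that it should represent.\<close>

definition mid :: "bool \<Rightarrow> example \<Rightarrow> nat \<Rightarrow> nat \<Rightarrow> nat set \<Rightarrow> nat \<Rightarrow> state \<Rightarrow> sk \<Rightarrow> bool" where
  "mid b z i N Al n s T \<longleftrightarrow> LT (ar s) (rw s) Al N (sc s 4) T 0 (4 * IB) 0 Al \<and> distinct (adrs T) \<and> ar s 3 1 = root T \<and>
     ar s 7 (root T) = 0 \<and> Al \<subseteq> {..<N} \<and> N \<le> sc s 4 \<and> upd b i N (sc s 5) Al (al s) \<and>
     (\<forall>i < sc s 5. rw s i (d + 1) \<in> {0, 1} \<and> rw s i d \<in> {0, 1}) \<and> dict (ar s 1) (rw s) (sc s 5) \<and>
     (if sc s 4 = 0 then T = SL 0 \<and> (\<forall>a i. 3 \<le> a \<longrightarrow> a < 16 \<longrightarrow> ar s a i = 0) else 0 \<notin> set (adrs T)) \<and> rv s 2 = \<epsilon> \<and>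
     (\<forall>c < d. rw s i c = fst z ! c) \<and> (0 < rw s i d \<longleftrightarrow> snd z) \<and> length (fst z) = d \<and>
     sc s 4 \<le> 128 * n + 71 \<and> card Al \<le> n \<and> card (al s) \<le> n \<and> 400 * (n + 1) \<le> IB"

lemma LT_near: "LT A G Al N Fb T e B c X \<Longrightarrow> \<exists>X0. near A N (root T) c X X0"
  by (cases T) auto

text \<open>A quiet counter is at most \<epsilon>/8 < 1/96 of the reference size, and the root's
  current set differs from the one at build time by at most the counter.\<close>

lemma LT_root_size:
  assumes "LT A G Al N Fb T e B c X" "A 7 (root T) = 0" "finite X"
  shows "95 * A 8 (root T) \<le> 96 * card X" "95 * card X \<le> 97 * A 8 (root T)"
proof -
  let ?v = "root T"
  from LT_near[OF assms(1)] obtain X0 where X0: "X0 \<subseteq> {..<N}" "card X0 = sz A ?v" "sd X0 X \<le> A 9 ?v"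
    using assms(2) by (auto simp: near_def curc_def)
  have q: "8 * real (A 9 ?v) \<le> \<epsilon> * real (A 8 ?v)" and v: "A 8 ?v = sz A ?v"
    using LT_root[OF assms(1)] assms(2) by (auto simp: quiet_def curc_def ltn_def)
  have "\<epsilon> * real (A 8 ?v) \<le> 1 / 12 * real (A 8 ?v)" using eps2 by (intro mult_right_mono) auto
  then have q': "96 * A 9 ?v \<le> A 8 ?v" using q by linarith
  have "finite X0" using X0(1) by (rule finite_subset) simp
  then have "\<bar>real (card X0) - real (card X)\<bar> \<le> real (sd X0 X)" using assms(3) by (rule card_diff_sd)
  then show "95 * A 8 ?v \<le> 96 * card X" "95 * card X \<le> 97 * A 8 ?v" using X0(2,3) v q' by linarith+
qed

lemma sh_less_length: "sh T < length (adrs T)"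
  by (induction T) (auto simp: max_def)

lemma tp_le_sh: "tp A T \<le> sh T + 1"
  by (induction T) auto

lemma LOOP_writes [simp]:
  "nv (LOOP b) 5" "na (LOOP b) (Suc 0)" "nrv (LOOP b) 2"
  by (auto simp: LOOP_def REBUILD_def COLLECT_def COPY_def LEAFUPD_def GO_def START_def)

text \<open>If more than 8v + 8 addresses are in use, v being the root's reference size, compaction
  needs only three addresses per live row, and hence at most half of the present memory. Otherwise
  the memory in use is at most 16n + 8, which provides the room that the walk requires.\<close>

lemma wp_UPDATE_rest:
  assumes L: "IB \<le> 2 ^ L" and m: "mid b z i N Al n s T" and F0: "0 < sc s 4"
  shows "wp z (REST b) (\<lambda>t' s'. \<exists>T'. Inv s' T' \<and> ms (rw s') (al s') = ms (rw s) (al s) \<and> sc s' 4 \<le> 128 * n + 71 \<and>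
       ucost L (t + 100) (sc s 5) (sc s 4) (csum (ar s) T) (tp (ar s) T) (sh T) t' s' T') t s"
proof -
  define F N' where FN: "F = sc s 4" "N' = sc s 5"
  note [simp] = FN[symmetric]
  have M: "LT (ar s) (rw s) Al N F T 0 (4 * IB) 0 Al" "distinct (adrs T)" "ar s 3 1 = root T" "ar s 7 (root T) = 0"
     "Al \<subseteq> {..<N}" "N \<le> F" "upd b i N N' Al (al s)" "\<forall>i < N'. rw s i (d + 1) \<in> {0, 1} \<and> rw s i d \<in> {0, 1}"
     "dict (ar s 1) (rw s) N'" "0 \<notin> set (adrs T)" "rv s 2 = \<epsilon>"
     "\<forall>c < d. rw s i c = fst z ! c" "0 < rw s i d \<longleftrightarrow> snd z" "length (fst z) = d"
     "F \<le> 128 * n + 71" "card Al \<le> n" "card (al s) \<le> n" "400 * (n + 1) \<le> IB"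
    using m F0 by (auto simp: mid_def)
  have N': "N' \<le> Suc N" using M(7) by (auto simp: upd_def split: if_splits)
  have fAl: "finite Al" using M(5) by (rule finite_subset) simp
  define v where "v = ar s 8 (root T)"
  have v: "95 * v \<le> 96 * card Al" "95 * card Al \<le> 97 * v"
    unfolding v_def by (rule LT_root_size[OF M(1,4) fAl])+
  have ch: "chg b i Al = al s" using M(7) by (auto simp: upd_def chg_def split: if_splits)
  have cal: "card (al s) \<le> card Al + 1"
    unfolding ch[symmetric] using fAl by (auto simp: chg_def card_insert_if card_Diff_subset_Int intro: le_trans[OF card_mono[OF fAl]])
  have lenT: "length (adrs T) \<le> F"
  proof -
    have s: "set (adrs T) \<subseteq> {1..F}" using LT_adrs[OF M(1)] M(10) by (auto simp: Suc_le_eq intro: gr0I)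
    show ?thesis using card_mono[OF _ s] distinct_card[OF M(2)] by simp
  qed
  have T: "sh T < F" "tp (ar s) T \<le> F" using sh_less_length[of T] tp_le_sh[of "ar s" T] lenT by linarith+
  show ?thesis
  proof (cases "8 * v + 8 < F")
    case True
    have "3 * N' + 6 \<le> IB" using N' M(6,15,18) by simp
    show ?thesis
      using True M(3)
      apply (simp add: REST_def v_def)
      apply (rule wp_mono[OF wp_COMPACT[where L = L and N = N']])
      using \<open>3 * N' + 6 \<le> IB\<close> L M(8,11) apply (simp_all)[5]
      subgoal premises p for t1 s1
      proof -
        from p(3) obtain T' where T': "Inv s1 T'" "ms (rw s1) (al s1) = ms (rw s) (al s)" "csum (ar s1) T' = 0" "sc s1 5 = card (al s)"
         "sc s1 4 \<le> 3 * card (al s) + 1" "t1 \<le> t + 100 + 60000 * (d * (L + 1)) * ((sh T' + 3) * (N' + 1))" by auto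
        have "60000 * (d * (L + 1)) * ((sh T' + 3) * (N' + 1)) \<le> 200000 * (d * (L + 1)) * ((sh T' + 3) * (F + 1))"
        proof -
          have "(sh T' + 3) * (N' + 1) \<le> (sh T' + 3) * (2 * (F + 1))" using N' M(6) by (intro mult_le_mono2) simp
          then have "60000 * (d * (L + 1)) * ((sh T' + 3) * (N' + 1)) \<le> 60000 * (d * (L + 1)) * ((sh T' + 3) * (2 * (F + 1)))" by (rule mult_le_mono2)
          also have "\<dots> = 120000 * ((d * (L + 1)) * ((sh T' + 3) * (F + 1)))" by (simp only: mult_ac)
          also have "\<dots> \<le> 200000 * ((d * (L + 1)) * ((sh T' + 3) * (F + 1)))" by simp
          finally show ?thesis by (simp only: mult.assoc)
        qed
        moreover have "2 * sc s1 4 \<le> F" "card (al s) \<le> F" "8 \<le> F" using T'(5) cal v(2) True by linarith+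
        ultimately have "ucost L (t + 100) N' F (csum (ar s) T) (tp (ar s) T) (sh T) t1 s1 T'"
          using T' unfolding ucost_def by (intro disjI2) linarith
        moreover have "sc s1 4 \<le> 128 * n + 71" using T'(5) M(17) by simp
        ultimately show ?thesis using T' by (auto simp: add.commute)
      qed
      done
  next
    case False
    have F16: "F \<le> 16 * n + 8" using False v(1) M(16) by linarith
    define s2 where "s2 = setv (setv s 33 (Suc 0)) 36 (Suc 0)"
    have s2s: "sc s2 4 = F" "sc s2 5 = N'" "sc s2 33 = Suc 0" "sc s2 36 = Suc 0" "ar s2 = ar s" "rw s2 = rw s" "rv s2 = rv s"
      by (simp_all add: s2_def)
    have al: "\<forall>i < N'. \<not> 0 < rw s i (d + 1) \<longleftrightarrow> i \<in> al s" by (simp add: al_def)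
    have dp: "dpre b i N N' Al (al s) z s2 T 0 (4 * IB) 0 Al"
      unfolding dpre_def ch using M(1-7) M(10-14) M(17,18) F16 N' T al
      by (auto simp: s2_def upd_def)
    show ?thesis
      using False M(3)
      apply (simp add: REST_def v_def s2_def[symmetric])
      apply (rule wp_mono[OF wp_LOOP[OF L dp]])
      subgoal premises p for t1 s1
      proof -
        note [simp] = frD[OF p(4)]
        show ?thesis using p(3)[unfolded dpost_def ch s2s]
        proof (elim exE conjE, goal_cases)
        case (1 T' \<rho> \<tau> \<chi>)
        have P: "LT (ar s1) (rw s1) (al s) N' (sc s1 4) T' 0 (4 * IB) (Suc 0) (al s)" "distinct (adrs T')"
            "set (adrs T') \<subseteq> set (adrs T) \<union> {F<..sc s1 4}" "ar s1 3 (Suc 0) = root T'" "ar s1 7 (root T') = 0"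
            "t1 \<le> t + 60 + 500 * (sh T + 1) + 40000 * (d * (L + 1)) * ((sh T' + 3) * \<rho>)" "sc s1 4 \<le> F + \<tau> + 3 * \<rho>" "F \<le> sc s1 4"
            "csum (ar s1) T' + \<chi> \<le> csum (ar s) T + \<tau>" "\<epsilon> * real \<rho> \<le> 20 * real \<chi>" "\<tau> \<le> tp (ar s) T" "b \<longrightarrow> F < sc s1 4"
            "\<rho> \<le> 2 * N'" and df: "dframe s2 T s1"
          by (fact 1(1), fact 1(2), fact 1(3), fact 1(4), use 1(5) M(4) in \<open>elim disjE; simp\<close>, use 1(6) in linarith, fact 1(7), fact 1(8),
            fact 1(9), fact 1(10), fact 1(11), use 1(12) M(4) in blast, fact 1(13), fact 1(14))
        have rw1: "rw s1 i c = rw s i c" if "c \<noteq> d + 2" for i c using df that by (auto simp: dframe_def s2_def)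
        have s15: "sc s1 5 = N'" by (simp add: s2_def)
        have al1: "al s1 = al s" unfolding al_def s15 using rw1 by simp
        have "4 * ar s1 8 (root T') \<le> 3 * (4 * IB)" using LT_root[OF P(1)] P(5) by (auto simp: ltn_def)
        then have "LT (ar s1) (rw s1) (al s1) (sc s1 5) (sc s1 4) T' 0 (4 * IB) 0 (al s1)"
          unfolding al1 s15 by (rule LT_top[OF P(1,5)])
        moreover have "dict (ar s1 1) (rw s1) N'" by (rule dict_cong[where G = "rw s"]) (use M(9) rw1 in \<open>auto simp: s2_def\<close>)
        moreover have "0 \<notin> set (adrs T')" "0 < sc s1 4" using P(3,8) M(10) F0 by auto
        moreover have "sc s1 5 \<le> sc s1 4" using M(7) M(6) P(8,12) s15 by (auto simp: upd_def split: if_splits)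
        ultimately have "Inv s1 T'" unfolding Inv_def using P s15 M(8,11) rw1 by (auto simp: s2_def)
        moreover have "ms (rw s1) (al s1) = ms (rw s) (al s)" unfolding al1 by (rule ms_cong) (simp add: rw1)
        moreover have "ucost L (t + 100) N' F (csum (ar s) T) (tp (ar s) T) (sh T) t1 s1 T'"
          unfolding ucost_def
          by (rule disjI1, rule exI[of _ \<rho>], rule exI[of _ \<tau>], rule exI[of _ \<chi>]) (use P(6,7,9,10,11) s15 in simp)
        \<comment> \<open>With F addresses in use before, at most F list cells and a rebuild of at
          most 6(F+1) addresses are added, so the total is at most 8F + 6 with F \<le> 16n +
          8.\<close>
        moreover have "sc s1 4 \<le> 128 * n + 71" using P(7,11,13) T N' M(6) F16 by linarith
        ultimately show ?thesis by (auto simp: add.commute)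
        qed
      qed
      done
  qed
qed

lemma wp_UPDATE:
  assumes L: "IB \<le> 2 ^ L" and m: "mid b z i N Al n s T"
  shows "wp z (UPDATE b) (\<lambda>t' s'. \<exists>T'. Inv s' T' \<and> ms (rw s') (al s') = ms (rw s) (al s) \<and> sc s' 4 \<le> 128 * n + 71 \<and>
       ucost L (t + 150) (sc s 5) (max 1 (sc s 4)) (csum (ar s) T) (tp (ar s) T) (sh T) t' s' T') t s"
proof -
  define Q where "Q = (\<lambda>t' s'. \<exists>T'. Inv s' T' \<and> ms (rw s') (al s') = ms (rw s) (al s) \<and> sc s' 4 \<le> 128 * n + 71 \<and>
       ucost L (t + 150) (sc s 5) (max 1 (sc s 4)) (csum (ar s) T) (tp (ar s) T) (sh T) t' s' T')"
  have uc: "ucost L t' N F S P H t'' s'' T''" if "ucost L (t0 + 100) N F S P H t'' s'' T''" "t0 + 100 \<le> t'" for t0 t' N F S P H t'' s'' T''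
  proof -
    have "x \<le> t' + y + z" if "x \<le> t0 + 100 + y + z" for x y z using that \<open>t0 + 100 \<le> t'\<close> by linarith
    moreover have "x \<le> t' + y" if "x \<le> t0 + 100 + y" for x y using that \<open>t0 + 100 \<le> t'\<close> by linarith
    ultimately show ?thesis using that(1) unfolding ucost_def by blast
  qed
  have "wp z (UPDATE b) Q t s"
  proof (cases "sc s 4 = 0")
    case False
    have "wp z (REST b) Q (6 + t) s"
    proof (rule wp_mono[OF wp_UPDATE_rest[OF L m]], goal_cases)
      case (2 t' s')
      have "max 1 (sc s 4) = sc s 4" using False by simp
      then show ?case using 2(1) unfolding Q_def by (elim exE conjE) (intro exI conjI, assumption+, simp only:, erule uc, simp)
    qed (use False in simp)
    then show ?thesis using False by (simp add: UPDATE_def)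
  next
    case True
    \<comment> \<open>Address 1 is as empty as address 0, so redirecting the root link suffices to
      move the empty leaf there.\<close>
    define s1 where "s1 = seta (setv s 4 (Suc 0)) 3 (Suc 0) (Suc 0)"
    have T: "T = SL 0" and z: "\<And>a i. 3 \<le> a \<Longrightarrow> a < 16 \<Longrightarrow> ar s a i = 0" using m True by (auto simp: mid_def)
    have al1: "al s1 = al s" by (simp add: al_def s1_def)
    have N0: "N = 0" using m True by (simp add: mid_def)
    have "LT (ar s) (rw s) Al N (sc s 4) T 0 (4 * IB) 0 Al" using m unfolding mid_def by blast
    then have LT: "LT (ar s) (rw s) Al N 0 (SL 0) 0 (4 * IB) 0 Al" unfolding True T .
    have LT1: "LT (ar s1) (rw s1) Al N 1 (SL 1) 0 (4 * IB) 0 Al"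
      using LT by (auto simp: s1_def ltn_def quiet_def curc_def near_def members_def z)
    have m1: "mid b z i N Al n s1 (SL 1)"
      using m[unfolded N0] LT1[unfolded N0] unfolding mid_def al1 N0 by (auto simp: s1_def z True simp del: LT.simps)
    have F1: "sc s1 4 = 1" by (simp add: s1_def)
    have e: "csum (ar s1) (SL 1) = csum (ar s) T" "tp (ar s1) (SL 1) = tp (ar s) T" "sh (SL 1) = sh T" "sc s1 5 = sc s 5" "max 1 (sc s 4) = 1"
      "rw s1 = rw s"
      using T True by (simp_all add: s1_def z)
    have "wp z (REST b) Q (15 + t) s1"
    proof (rule wp_mono[OF wp_UPDATE_rest[OF L m1]], goal_cases)
      case (2 t' s')
      then show ?case unfolding Q_def e F1 al1 by (elim exE conjE) (intro exI conjI, assumption+, erule uc, simp)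
    qed (simp add: F1)
    then show ?thesis using True by (simp add: UPDATE_def s1_def[symmetric])
  qed
  then show ?thesis by (simp only: Q_def)
qed

lemma LT_pre:
  assumes "Inv s T" "\<And>a. a < 16 \<Longrightarrow> a \<noteq> 1 \<Longrightarrow> a \<noteq> 2 \<Longrightarrow> ar s' a = ar s a" "sc s' 4 = sc s 4"
    and G: "\<And>i c. i < sc s 5 \<Longrightarrow> c \<le> d \<Longrightarrow> rw s' i c = rw s i c" "\<And>i. rw s' i (d + 2) = rw s i (d + 2)"
  shows "LT (ar s') (rw s') (al s) (sc s 5) (sc s 4) T 0 (4 * IB) 0 (al s)" "csum (ar s') T = csum (ar s) T" "tp (ar s') T = tp (ar s) T"
proof -
  have LT0: "LT (ar s) (rw s) (al s) (sc s 5) (sc s 4) T 0 (4 * IB) 0 (al s)" and top: "ar s 7 (root T) = 0"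
    using assms(1) by (simp_all add: Inv_def)
  show "LT (ar s') (rw s') (al s) (sc s 5) (sc s 4) T 0 (4 * IB) 0 (al s)"
    by (rule LT_frame[OF LT0, where ?i0.0 = "sc s 5"]) (use assms top in \<open>auto simp: al_def\<close>)
  show "csum (ar s') T = csum (ar s) T" "tp (ar s') T = tp (ar s) T"
    by (rule csum_cong tp_cong, simp add: assms(2))+
qed

lemma wp_INS:
  assumes inv: "Inv s T" and x: "length x = d" and n: "Suc (card (al s)) \<le> n" "sc s 4 \<le> 128 * n + 71" "400 * (n + 1) \<le> IB" "IB \<le> 2 ^ L"
  shows "wp (x, y) INS (\<lambda>t' s'. \<exists>T' w. blk (Suc (sc s 5)) (Suc (sc s 5)) w \<and> Inv s' T' \<and> sc s' 4 \<le> 128 * n + 71 \<and>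
     ms (rw s') (al s') = add_mset (x, y) (ms (rw s) (al s)) \<and>
     ucost L (t + 200 * d + 20000 * (d * (L + 1)) * (w + 1) + 150) (Suc (sc s 5)) (max 1 (sc s 4)) (csum (ar s) T) (tp (ar s) T) (sh T) t' s' T') t s"
proof -
  define N where "N = sc s 5"
  note [simp] = N_def[symmetric]
  have N: "2 * Suc N \<le> IB" "N \<le> sc s 4" using inv n by (auto simp: Inv_def)
  show ?thesis unfolding INS_def sqn.simps wp_Seq
    apply (rule wp_mono[OF wp_WROW[OF x]])
    subgoal premises p for t1 s1
    proof -
      note [simp] = frD[OF p(2)]
      have R: "t1 \<le> t + 200 * d" "\<And>i. i \<noteq> N \<Longrightarrow> rw s1 i = rw s i" "\<And>c. c < d \<Longrightarrow> rw s1 N c = x ! c" "rw s1 N d = of_bool y" "rw s1 N (d + 1) = 0"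
        using p(1)[folded N_def] by blast+
      have R6: "rw s1 i (d + 2) = rw s i (d + 2)" for i using p(1)[folded N_def] by (cases "i = N") metis+
      have D: "dict (ar s1 1) (rw s1) N" 
      proof (rule dict_cong)
        show "dict (ar s1 1) (rw s) N" using inv by (simp add: Inv_def)
      qed (simp add: R(2))
      show ?thesis
        apply (rule wp_mono[OF wp_INSD[where N = N and L = L]])
        using N n D apply (simp_all)[4]
        subgoal premises q for t2 s2
        proof -
          note [simp] = frD[OF q(2)]
          from q(1) obtain w where w: "sc s2 5 = Suc N" "dict (ar s2 1) (rw s1) (Suc N)" "blk (Suc N) (Suc N) w"
            "t2 \<le> t1 + 20000 * (d * (L + 1)) * (w + 1)" by auto
          have LT: "LT (ar s2) (rw s2) (al s) N (sc s 4) T 0 (4 * IB) 0 (al s)" "csum (ar s2) T = csum (ar s) T" "tp (ar s2) T = tp (ar s) T"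
            using LT_pre[OF inv, of s2] R R6 by simp_all
          have al2: "al s2 = insert N (al s)" using R(2,5) by (auto simp: al_def w(1) less_Suc_eq)
          have Nal: "N \<notin> al s" by (simp add: al_def)
          have m: "mid True (x, y) N N (al s) n s2 T"
            using inv LT R w(2) n N x unfolding mid_def Inv_def al2
            by (auto simp: w(1) upd_def less_Suc_eq card_insert_if al_def R(2))
          have "ms (rw s2) (al s2) = add_mset (ex (rw s2) N) (ms (rw s2) (al s))" unfolding al2 by (rule ms_insert) (simp_all add: Nal)
          also have "ms (rw s2) (al s) = ms (rw s) (al s)" by (rule ms_cong) (auto simp: al_def R(2))
          also have "ex (rw s2) N = (x, y)" using R(3,4) x by (auto simp: ex_def list_eq_iff_nth_eq)
          finally have ms: "ms (rw s2) (al s2) = add_mset (x, y) (ms (rw s) (al s))" .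
          have uc: "ucost L u' A F S P H t' s' T'" if "ucost L u A F S P H t' s' T'" "u \<le> u'" for u u' A F S P H t' s' T'
          proof -
            have "a \<le> u' + b + c" if "a \<le> u + b + c" for a b c using that \<open>u \<le> u'\<close> by linarith
            moreover have "a \<le> u' + b" if "a \<le> u + b" for a b using that \<open>u \<le> u'\<close> by linarith
            ultimately show ?thesis using that(1) unfolding ucost_def by blast
          qed
          show ?thesis
          proof (rule wp_mono[OF wp_UPDATE[OF n(4) m]], goal_cases)
            case (1 t' s')
            then obtain T' where T': "Inv s' T'" "ms (rw s') (al s') = ms (rw s2) (al s2)" "sc s' 4 \<le> 128 * n + 71"
              "ucost L (t2 + 150) (Suc N) (max 1 (sc s 4)) (csum (ar s) T) (tp (ar s) T) (sh T) t' s' T'"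
              using LT(2,3) w(1) by auto
            have "ucost L (t + 200 * d + 20000 * (d * (L + 1)) * (w + 1) + 150) (Suc N) (max 1 (sc s 4)) (csum (ar s) T) (tp (ar s) T) (sh T) t' s' T'"
              by (rule uc[OF T'(4)]) (use w(4) R(1) in linarith)
            then show ?case using T' ms w(3) by (auto simp only: N_def)
          qed
        qed
        done
    qed
    done
qed

lemma fullkey_eqD: "fullkey G a = fullkey G b \<Longrightarrow> c < d + 2 \<Longrightarrow> G a c = G b c"
proof -
  assume e: "fullkey G a = fullkey G b" and c: "c < d + 2"
  have "fullkey G a ! c = fullkey G b ! c" using e by simp
  then show "G a c = G b c" using c by (simp add: key_def)
qed

text \<open>The pattern row lies beyond the table, so searching changes nothing that the invariant
  speaks about. On success the last matching entry of its block is flagged, as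
  \<open>dict_kill\<close> requires, and the tree is updated with the flagged row.\<close>

lemma wp_DEL:
  assumes inv: "Inv s T" and x: "length x = d" and n: "card (al s) \<le> n" "sc s 4 \<le> 128 * n + 71" "400 * (n + 1) \<le> IB" "IB \<le> 2 ^ L"
  shows "wp (x, y) DEL (\<lambda>t' s'. \<exists>T'. Inv s' T' \<and> sc s' 4 \<le> 128 * n + 71 \<and>
     ms (rw s') (al s') = ms (rw s) (al s) - {#(x, y)#} \<and>
     ucost L (t + 200 * d + 10000 * (d * (L + 1) * (L + 1)) + 200) (sc s 5) (max 1 (sc s 4)) (csum (ar s) T) (tp (ar s) T) (sh T) t' s' T') t s"
proof -
  define N where "N = sc s 5"
  note [simp] = N_def[symmetric]
  have N: "2 * N + 2 \<le> IB" "N \<le> sc s 4" using inv n by (auto simp: Inv_def)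
  show ?thesis unfolding DEL_def sqn.simps wp_Seq
    apply (rule wp_mono[OF wp_WROW[OF x]])
    subgoal premises p for t1 s1
    proof -
      note [simp] = frD[OF p(2)]
      have R: "t1 \<le> t + 200 * d" "\<And>i. i \<noteq> N \<Longrightarrow> rw s1 i = rw s i" "\<And>c. c < d \<Longrightarrow> rw s1 N c = x ! c" "rw s1 N d = of_bool y" "rw s1 N (d + 1) = 0"
        using p(1)[folded N_def] by blast+
      have R6: "rw s1 i (d + 2) = rw s i (d + 2)" for i using p(1)[folded N_def] by (cases "i = N") metis+
      have D: "dict (ar s1 1) (rw s1) N" 
      proof (rule dict_cong)
        show "dict (ar s1 1) (rw s) N" using inv by (simp add: Inv_def)
      qed (simp add: R(2))
      have exN: "ex (rw s1) N = (x, y)" using R(3,4) x by (auto simp: ex_def list_eq_iff_nth_eq)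
      have lb: "rw s1 i (d + 1) \<in> {0, 1} \<and> rw s1 i d \<in> {0, 1}" if "i < N" for i
        using inv that by (auto simp: Inv_def R(2))
      show ?thesis
        apply (rule wp_mono[OF wp_FIND[where N = N and L = L]])
        using N n D apply (simp_all)[4]
        subgoal premises q for t2 s2
        proof -
          note [simp] = frD[OF q(2)]
          have t2: "t2 \<le> t1 + 10000 * (d * (L + 1) * (L + 1))" using q(1) by simp
          show ?thesis
          proof (cases "0 < sc s2 35")
            case False
            then have nf: "\<forall>i < N. fullkey (rw s1) i \<noteq> fullkey (rw s1) N" using q(1) by simp
            \<comment> \<open>A live row with this example would agree with the pattern in all
              columns of the full key, because labels are stored as 0 or 1 and both flags are 0. So
              a failed search means that the deletion has no effect on the active multiset.\<close>
            have "(x, y) \<notin># ms (rw s) (al s)"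
            proof
              assume "(x, y) \<in># ms (rw s) (al s)"
              then obtain i where i: "i \<in> al s" "ex (rw s) i = (x, y)" by (auto simp: ms_def)
              then have iN: "i < N" by (simp add: al_def)
              have "seg (rw s1 i) 0 d = seg (rw s1 N) 0 d \<and> (0 < rw s1 i d \<longleftrightarrow> 0 < rw s1 N d)"
                using i(2) exN iN by (auto simp: ex_def R(2))
              moreover have "rw s1 i d = rw s1 N d" using calculation lb[OF iN] R(4) by (auto split: if_splits)
              moreover have "rw s1 i (d + 1) = 0" using i(1) lb[OF iN] iN by (auto simp: al_def R(2))
              ultimately have "fullkey (rw s1) i = fullkey (rw s1) N" using R(5) by (simp add: key_def seg_Suc)
              with nf iN show False by blast
            qed
            moreover have al2: "al s2 = al s" by (auto simp: al_def R(2))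
            moreover have "ms (rw s2) (al s) = ms (rw s) (al s)" by (rule ms_cong) (auto simp: al_def R(2))
            moreover have "Inv s2 T"
              using inv LT_pre[OF inv, of s2] D R(2) R6 unfolding Inv_def al2 by simp
            moreover have "ucost L (t + 200 * d + 10000 * (d * (L + 1) * (L + 1)) + 200) N (max 1 (sc s 4)) (csum (ar s) T) (tp (ar s) T) (sh T) (t2 + 6) s2 T"
              unfolding ucost_def
              by (rule disjI1, rule exI[of _ 0], rule exI[of _ 0], rule exI[of _ 0]) (use t2 R(1) R6 LT_pre(2)[OF inv, of s2] in \<open>auto simp: R(2)\<close>)
            ultimately show ?thesis using False n(2) by (auto simp: add.commute intro!: exI[of _ T])
          next
            case True
            then obtain e w p' where fd: "blk N e w" "e - w \<le> p'" "p' < e" "sc s2 31 = ar s1 1 p'" "fullkey (rw s1) (ar s1 1 p') = fullkey (rw s1) N"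
              "\<forall>i. p' < i \<longrightarrow> i < e \<longrightarrow> \<not> fullkey (rw s1) (ar s1 1 i) \<le> fullkey (rw s1) N" using q(1) by auto
            define i where "i = sc s2 31"
            have "p' < N" using fd(1,3) by (auto simp: blk_def)
            then have iN: "i < N" using D fd(4) by (auto simp: dict_def set_seg i_def)
            have eq: "rw s1 i c = rw s1 N c" if "c < d + 2" for c using fullkey_eqD[OF fd(5) that] fd(4) by (simp add: i_def)
            define s3 where "s3 = setrw s2 i (d + 1) 1"
            have rw3: "rw s3 = (rw s1)(i := (rw s1 i)(d + 1 := 1))" by (simp add: s3_def)
            have ial: "i \<in> al s" using iN eq[of "d + 1"] R(2,5) by (auto simp: al_def)
            have al3: "al s3 = al s - {i}" using iN by (auto simp: al_def s3_def R(2))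
            have D3: "dict (ar s1 1) (rw s3) N" unfolding rw3
              by (rule dict_kill[OF D fd(1-3)]) (use fd(4-6) lb eq[of "d + 1"] R(5) in \<open>auto simp: i_def\<close>)
            have LT: "LT (ar s3) (rw s3) (al s) N (sc s 4) T 0 (4 * IB) 0 (al s)" "csum (ar s3) T = csum (ar s) T" "tp (ar s3) T = tp (ar s) T"
              using LT_pre[OF inv, of s3] R R6 iN by (simp_all add: s3_def)
            have m: "mid False (x, y) i N (al s) n s3 T"
              using inv LT lb eq D3 R x n N iN ial card_Diff1_le[of "al s" i] unfolding mid_def Inv_def al3
              by (auto simp: upd_def al_def s3_def)
            have "ms (rw s) (al s) = add_mset (ex (rw s) i) (ms (rw s) (al s - {i}))"
              using ms_insert[of "al s - {i}" i "rw s"] ial by (simp add: insert_absorb)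
            moreover have "ex (rw s) i = (x, y)"
              unfolding exN[symmetric] using eq iN by (intro ex_cong) (simp add: R(2)[symmetric])
            moreover have "ms (rw s3) (al s3) = ms (rw s) (al s - {i})"
              unfolding al3 by (rule ms_cong) (auto simp: al_def s3_def R(2))
            ultimately have ms: "ms (rw s3) (al s3) = ms (rw s) (al s) - {#(x, y)#}" by simp
            have uc: "ucost L u' A F S P H t' s' T'" if "ucost L u A F S P H t' s' T'" "u \<le> u'" for u u' A F S P H t' s' T'
            proof -
              have "a \<le> u' + b + c" if "a \<le> u + b + c" for a b c using that \<open>u \<le> u'\<close> by linarith
              moreover have "a \<le> u' + b" if "a \<le> u + b" for a b using that \<open>u \<le> u'\<close> by linarith
              ultimately show ?thesis using that(1) unfolding ucost_def by blast
            qed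
            have "wp (x, y) (UPDATE False) (\<lambda>t' s'. \<exists>T'. Inv s' T' \<and> sc s' 4 \<le> 128 * n + 71 \<and>
              ms (rw s') (al s') = ms (rw s) (al s) - {#(x, y)#} \<and>
              ucost L (t + 200 * d + 10000 * (d * (L + 1) * (L + 1)) + 200) N (max 1 (sc s 4)) (csum (ar s) T) (tp (ar s) T) (sh T) t' s' T') (t2 + 17) s3"
            proof (rule wp_mono[OF wp_UPDATE[OF n(4) m]], goal_cases)
              case (1 t' s')
              then obtain T' where T': "Inv s' T'" "ms (rw s') (al s') = ms (rw s3) (al s3)" "sc s' 4 \<le> 128 * n + 71"
                "ucost L (t2 + 17 + 150) N (max 1 (sc s 4)) (csum (ar s) T) (tp (ar s) T) (sh T) t' s' T'"
                using LT(2,3) by (auto simp: s3_def)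
              have "ucost L (t + 200 * d + 10000 * (d * (L + 1) * (L + 1)) + 200) N (max 1 (sc s 4)) (csum (ar s) T) (tp (ar s) T) (sh T) t' s' T'"
                by (rule uc[OF T'(4)]) (use t2 R(1) in linarith)
              then show ?case using T' ms by auto
            qed
            then show ?thesis using True by (simp add: s3_def i_def add.commute[of _ t2])
          qed
        qed
        done
    qed
    done
qed

end

section \<open>Static safety of the programs\<close>

context machine
begin

lemma aokw_Adr:
  assumes "a < 16" "wub e (2 * IB + 3)"
  shows "aokw (Adr a e)"
  unfolding aokw_def
proof (intro allI impI)
  fix z s assume "bounded s"
  then have "wval z s e \<le> 2 * IB + 3" using assms(2) by (simp add: wub_def)
  then show "wval z s (Adr a e) < AW" using assms(1) by (simp add: AW_def adr_def)
qed

lemma static_exprs [simp]: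
  "x < 40 \<Longrightarrow> wst (Var x)" "deg (Var x) = 1" "deg (Arr a e) = 1"
  "a < 16 \<Longrightarrow> wst e \<Longrightarrow> deg e \<le> 10 \<Longrightarrow> wub e (2 * IB + 3) \<Longrightarrow> wst (Arr a e)"
  using aokw_Adr[of a e] by (auto simp: Var_def Arr_def Adr_def U_def aokw_def AW_def)

lemma wub_offsets [simp]:
  "c \<le> u \<Longrightarrow> wub e (u - c) \<Longrightarrow> wub (WAdd e (Lit c)) u"
  "x < 40 \<Longrightarrow> y < 40 \<Longrightarrow> bdv x + bdv y \<le> u \<Longrightarrow> wub (WAdd (Var x) (Var y)) u"
  "wub e (u div 2) \<Longrightarrow> wub (WMul (Lit 2) e) u"
proof -
  show "c \<le> u \<Longrightarrow> wub e (u - c) \<Longrightarrow> wub (WAdd e (Lit c)) u" by (erule wub_add[where v = c]) simp_all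
  show "x < 40 \<Longrightarrow> y < 40 \<Longrightarrow> bdv x + bdv y \<le> u \<Longrightarrow> wub (WAdd (Var x) (Var y)) u"
    by (rule wub_add[where u = "bdv x" and v = "bdv y"]) simp_all
  show "wub e (u div 2) \<Longrightarrow> wub (WMul (Lit 2) e) u" by (erule wub_mul) simp
qed

lemma csafe_writes [simp]:
  "x < 40 \<Longrightarrow> csafe (SetV x f) \<longleftrightarrow> ww f"
  "a < 16 \<Longrightarrow> wst e \<Longrightarrow> deg e \<le> 10 \<Longrightarrow> wub e (2 * IB + 3) \<Longrightarrow> csafe (SetA a e f) \<longleftrightarrow> ww f"
  "x < 8 \<Longrightarrow> csafe (SetRV x g) \<longleftrightarrow> rst g"
proof -
  show "csafe (SetV x f) \<longleftrightarrow> ww f" if "x < 40"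
    using that by (simp add: SetV_def ww_def U_def aokw_def AW_def)
  show "csafe (SetA a e f) \<longleftrightarrow> ww f" if "a < 16" "wst e" "deg e \<le> 10" "wub e (2 * IB + 3)"
    using that aokw_Adr[of a e] by (auto simp: SetA_def ww_def Adr_def U_def)
  show "csafe (SetRV x g) \<longleftrightarrow> rst g" if "x < 8"
    using that by (simp add: SetRV_def ww_def U_def aokr_def AR_def)
qed

lemma aokr_Radr:
  assumes "wub e (2 * IB + 2)" "wub c (d + 3)"
  shows "aokr (Radr e c)"
  unfolding aokr_def
proof (intro allI impI)
  fix z s assume "bounded s"
  then have le: "wval z s e \<le> 2 * IB + 2" "wval z s c \<le> d + 3" using assms by (auto simp: wub_def)
  have "(d + 3) * wval z s e + wval z s c \<le> (d + 3) * (2 * IB + 2) + (d + 3)"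
    using le by (intro add_mono mult_le_mono2)
  also have "\<dots> < (d + 3) * (2 * IB + 4)" by (simp add: algebra_simps)
  finally show "wval z s (Radr e c) < AR" by (simp add: radr_def AR_def)
qed

lemma csafe_rows [simp]:
  "wst e \<Longrightarrow> deg e \<le> 5 \<Longrightarrow> wst c \<Longrightarrow> deg c \<le> 5 \<Longrightarrow> wub e (2 * IB + 2) \<Longrightarrow> wub c (d + 3) \<Longrightarrow> rst (Row e c)"
  "wst e \<Longrightarrow> deg e \<le> 5 \<Longrightarrow> wst c \<Longrightarrow> deg c \<le> 5 \<Longrightarrow> wub e (2 * IB + 2) \<Longrightarrow> wub c (d + 3) \<Longrightarrow> csafe (SetRow e c g) \<longleftrightarrow> rst g"
  using aokr_Radr[of e c] by (auto simp: Row_def SetRow_def Radr_def ww_def U_def)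

lemma tst_Pos [simp]: "tst (Pos e) \<longleftrightarrow> rst e"
  by (simp add: Pos_def ww_def)

lemma rst_Wfe [simp]: "ww e \<Longrightarrow> ww f \<Longrightarrow> rst (Wfe e f)"
  by (simp add: Wfe_def ww_def U_def)

lemma Lit_U [simp]: "Suc d \<le> U" "Suc (Suc d) \<le> U" "Suc (Suc (Suc d)) \<le> U" "d \<le> U" "k \<le> U" "h \<le> U" "c \<le> 60 \<Longrightarrow> c \<le> U"
  by (auto simp: U_def)

lemma csafe_SORT [simp]: "Z < 2 \<Longrightarrow> csafe (SORT Z)" "csafe CMP"
  by (auto simp: SORT_def MERGE_def CMP_def ww_def)

lemma csafe_NODE [simp]: "csafe NODE"
  by (auto simp: NODE_def COUNT_def CAND_def FEAT_def NEWCH_def Inc_def ww_def)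

lemma csafe_START [simp]: "ww e \<Longrightarrow> csafe (START e)"
  by (auto simp: START_def BUILD_def Inc_def ww_def)

lemma csafe_LOOP [simp]: "csafe (LOOP b)"
  by (auto simp: LOOP_def PRE_def TOP_def LEAFUPD_def GO_def REBUILD_def COLLECT_def COPY_def Inc_def ww_def)

lemma csafe_UPDATE [simp]: "csafe (UPDATE b)"
  by (auto simp: UPDATE_def REST_def COMPACT_def Inc_def ww_def)

text \<open>Pure syntax checking: every expression has degree at most 12, and every address is built
  from cells whose bounds are known in all bounded states.\<close>

lemma csafe_programs: "csafe INS" "csafe DEL" "csafe LAB"
  by (auto simp: INS_def DEL_def LAB_def WROW_def INSD_def LOWB_def FIND_def BSEARCH_def GO_def Inc_def ww_def)

end

section \<open>The witnessing decision tree and its feasibility\<close>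

primrec chain :: "nat \<Rightarrow> real \<Rightarrow> bool \<Rightarrow> dtree" where
  "chain 0 t b = Leaf b"
| "chain (Suc m) t b = Split 0 t (chain m t b) (Leaf b)"

lemma chain_simps [simp]: "height (chain m t b) = m" "classify (chain m t b) x = b"
  by (induction m) auto

text \<open>Just enough of the memory image to recover the labelled tree from the address of its
  root.\<close>

primrec skel :: "(nat \<Rightarrow> nat \<Rightarrow> nat) \<Rightarrow> sk \<Rightarrow> bool" where
  "skel A (SL v) \<longleftrightarrow> A 4 v = 0"
| "skel A (SN v l r) \<longleftrightarrow> A 4 v \<noteq> 0 \<and> A 3 (2 * v) = root l \<and> A 3 (2 * v + 1) = root r \<and> skel A l \<and> skel A r"

lemma skel_unique: "skel A T \<Longrightarrow> skel A T' \<Longrightarrow> root T = root T' \<Longrightarrow> T = T'"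
proof (induction T arbitrary: T')
  case (SL v)
  then show ?case by (cases T') auto
next
  case (SN v l r)
  then show ?case by (cases T') auto
qed

context params
begin

text \<open>
  A leaf of the maintained tree may stand for a large set with high Gini index all of whose
  splits have negligible gain. Feasibility demands internal nodes there, hence the chains of
  splits that send everything to the left.
\<close>

primrec dt :: "(nat \<Rightarrow> nat \<Rightarrow> nat) \<Rightarrow> (nat \<Rightarrow> nat \<Rightarrow> real) \<Rightarrow> real \<Rightarrow> sk \<Rightarrow> nat \<Rightarrow> nat set \<Rightarrow> dtree" where
  "dt A G \<alpha> (SL v) e X = (if card X \<le> k \<or> Wt G X = 0 \<or> h \<le> e \<or> gini (ms G X) < \<alpha> then Leaf (A 5 v < A 6 v)
     else chain (h - e) (Max ((\<lambda>i. G i 0) ` X)) (A 5 v < A 6 v))"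
| "dt A G \<alpha> (SN v l r) e X = Split (A 4 v - 1) (G v (d + 2))
     (dt A G \<alpha> l (Suc e) (lft G X (A 4 v - 1) (G v (d + 2)))) (dt A G \<alpha> r (Suc e) (rgt G X (A 4 v - 1) (G v (d + 2))))"

lemma classify_dt [simp]: "classify (dt A G \<alpha> T e X) x = lab A G T x"
  by (induction T arbitrary: e X) auto

definition nok :: "real \<Rightarrow> real \<Rightarrow> (nat \<times> example multiset \<times> dtree) set" where
  "nok \<alpha> \<beta> = {(e, S, v). (if size S \<le> k \<or> gini S = 0 \<or> e = h then is_Leaf v else gini S \<ge> \<alpha> \<longrightarrow> \<not> is_Leaf v) \<and>
        (\<forall>j a l r. v = Split j a l r \<longrightarrow> j < d \<and> (\<forall>j' < d. \<forall>a'. gini_gain S j a \<ge> gini_gain S j' a' - \<beta>)) \<and>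
        (\<forall>b. v = Leaf b \<longrightarrow> majority_label S b)}"

lemma feasible_nok: "feasible d \<alpha> \<beta> k h S T \<longleftrightarrow> nodes T 0 S \<subseteq> nok \<alpha> \<beta>"
  unfolding feasible_def nok_def subset_eq mem_Collect_eq ..

text \<open>A threshold not below any first feature sends the whole set to the left. Its gain is 0,
  which is within \<beta> of the best gain because no gain exceeds \<beta>. The right children are
  leaves for the empty multiset, and the chain may end at depth \<open>h\<close>, where a leaf is
  mandatory.\<close>

lemma nodes_chain:
  assumes X: "finite X" "k < card X" "\<And>i. i \<in> X \<Longrightarrow> G i 0 \<le> t" "gini (ms G X) \<noteq> 0"
    and gain: "\<And>j' a'. j' < d \<Longrightarrow> gini_gain (ms G X) j' a' \<le> \<beta>" and b: "majority_label (ms G X) b"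
  shows "e + m = h \<Longrightarrow> nodes (chain m t b) e (ms G X) \<subseteq> nok \<alpha> \<beta>"
proof (induction m arbitrary: e)
  case 0
  then show ?case using b by (auto simp: nok_def)
next
  case (Suc m)
  have d0: "0 < d" using d1 by simp
  have lr: "lft G X 0 t = X" "rgt G X 0 t = {}" using X(3) by (auto simp: lft_def rgt_def)
  have "real (card X) * gini_gain (ms G X) 0 t = 0"
    unfolding gini_gain_ms[OF X(1) d0] by (rule sco_trivial) (simp add: lr)
  then have g0: "gini_gain (ms G X) 0 t = 0" using X(2) by auto
  have "nodes (chain m t b) (Suc e) (ms G X) \<subseteq> nok \<alpha> \<beta>" using Suc by simp
  moreover have "(Suc e, ms G {}, Leaf b) \<in> nok \<alpha> \<beta>" by (simp add: nok_def size_ms majority_label_def) (simp add: ms_def)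
  moreover have "(e, ms G X, chain (Suc m) t b) \<in> nok \<alpha> \<beta>"
    using Suc.prems X(2,4) g0 gain d0 by (auto simp: nok_def size_ms)
  ultimately show ?case using X(1) d0 by (simp add: below_ms above_ms lr)
qed

end

context machine
begin

lemma LT_skel: "LT A G Al N Fb T e B c X \<Longrightarrow> skel A T"
proof (induction T arbitrary: e B c X)
  case (SN v l r)
  from SN.prems show ?case by (rule LT_SN) (auto dest: SN.IH)
qed simp

lemma node_near:
  assumes "ltn A Al N Fb v e B X" "quiet A v c" "near A N v c X X0"
  shows "finite X0" "4 * real (sd X0 X) \<le> \<epsilon> * real (card X0)"
proof -
  show "finite X0" using assms(3) by (auto simp: near_def intro: finite_subset)
  have "real (A 8 v) \<le> 2 * real (card X0)" "real (sd X0 X) \<le> real (curc A v c)"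
    using assms(1,3) by (auto simp: ltn_def near_def)
  moreover have "\<epsilon> * real (A 8 v) \<le> \<epsilon> * (2 * real (card X0))" using eps0 calculation(1) by (intro mult_left_mono) auto
  ultimately show "4 * real (sd X0 X) \<le> \<epsilon> * real (card X0)" using assms(2) by (simp add: quiet_def)
qed

text \<open>The drift is at most \<epsilon>/4 of the old size. If the old size is at most k, this is
  less than 1, so nothing has changed at all; if it is at least k+1, at least k+1 -
  \<epsilon>(k+1)/4 > k examples remain.\<close>

lemma near_card:
  assumes "finite X" "finite X0" "4 * real (sd X0 X) \<le> \<epsilon> * real (card X0)"
  shows "47 * real (card X0) \<le> 48 * real (card X)" "k < card X0 \<Longrightarrow> k < card X" "card X0 \<le> k \<Longrightarrow> X = X0"
proof -
  have sd: "\<bar>real (card X0) - real (card X)\<bar> \<le> real (sd X0 X)" by (rule card_diff_sd) fact+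
  have "\<epsilon> * real (card X0) \<le> 1 / 12 * real (card X0)" using eps2 by (intro mult_right_mono) auto
  then show "47 * real (card X0) \<le> 48 * real (card X)" using sd assms(3) by linarith
  have ek: "\<epsilon> * (real k + 1) < 1" using eps1 by (simp add: field_simps)
  show "k < card X" if "k < card X0"
  proof -
    have "(1 - \<epsilon> / 4) * (real k + 1) \<le> (1 - \<epsilon> / 4) * real (card X0)" using that eps2 by (intro mult_left_mono) auto
    moreover have "(1 - \<epsilon> / 4) * (real k + 1) = real k + 1 - \<epsilon> * (real k + 1) / 4"
      "(1 - \<epsilon> / 4) * real (card X0) = real (card X0) - \<epsilon> * real (card X0) / 4" by (simp_all add: algebra_simps)
    ultimately have "real k < real (card X)" using sd assms(3) ek by linarith
    then show ?thesis by simp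
  qed
  show "X = X0" if "card X0 \<le> k"
  proof -
    have "\<epsilon> * real (card X0) \<le> \<epsilon> * (real k + 1)" using that eps0 by (intro mult_left_mono) auto
    then have "sd X0 X = 0" using ek assms(3) by simp
    then show ?thesis using assms(1,2) by (auto simp: sd_def)
  qed
qed

text \<open>At a leaf for lack of gain, every score on the old set is at most 4\<epsilon>|X0|, and
  the drift adds at most \<epsilon>|X0|; since |X0| \<le> 48/47 |X|, every gain is below \<beta>. At
  a split the old choice was optimal, and the drift acts on both scores of a comparison, so at most
  2\<epsilon>|X0| is lost. The score of the chosen split remains positive, so the Gini index there
  is not 0. Chains only lengthen paths, hence the stored tree is no higher than the witness.\<close>

lemma dt_feasible:
  assumes "LT A G Al N Fb T e B c X" "finite X" "e \<le> h" and ab: "\<epsilon> < \<beta> / 12.5"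
  shows "nodes (dt A G \<alpha> T e X) e (ms G X) \<subseteq> nok \<alpha> \<beta> \<and> height (dt A G \<alpha> T e X) + e \<le> h \<and> sh T \<le> height (dt A G \<alpha> T e X)"
  using assms(1-3)
proof (induction T arbitrary: e B c X)
  case (SL v)
  from SL.prems(1) obtain X0 where v: "ltn A Al N Fb v e B X" "quiet A v c" "A 5 v = c0 G X" "A 6 v = c1 G X" "near A N v c X X0" "leaf_cond G X0 e"
    by auto
  note n = node_near[OF v(1,2,5)]
  note nc = near_card[OF SL.prems(2) n]
  have maj: "majority_label (ms G X) (A 5 v < A 6 v)" unfolding majority_ms[OF SL.prems(2)] v(3,4) by simp
  have g: "real (card X) * gini (ms G X) = Wt G X" by (rule gini_ms) fact
  show ?case
  proof (cases "card X \<le> k \<or> Wt G X = 0 \<or> h \<le> e \<or> gini (ms G X) < \<alpha>")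
    case True
    then have "dt A G \<alpha> (SL v) e X = Leaf (A 5 v < A 6 v)" by simp
    moreover have "(e, ms G X, Leaf (A 5 v < A 6 v)) \<in> nok \<alpha> \<beta>"
      using True maj g SL.prems(3) by (auto simp: nok_def size_ms)
    ultimately show ?thesis using SL.prems(3) by simp
  next
    case False
    have pos: "0 < real (card X)" using False by simp
    have m: "sco G X0 j t \<le> 4 * \<epsilon> * real (card X0)" if "j < d" for j t
      using v(6) False nc(3) that by (auto simp: leaf_cond_def)
    have gain: "gini_gain (ms G X) j' a' \<le> \<beta>" if j: "j' < d" for j' a'
    proof -
      have "sco G X j' a' \<le> sco G X0 j' a' + 4 * real (sd X X0)" by (rule sco_lipschitz) (use SL.prems n in auto)
      moreover have "sd X X0 = sd X0 X" by (simp add: sd_def)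
      ultimately have "sco G X j' a' \<le> 5 * (\<epsilon> * real (card X0))" using m[OF j, of a'] n(2) by simp
      also have "\<dots> \<le> 5 * (\<epsilon> * (48 / 47 * real (card X)))" using nc(1) eps0 by (intro mult_left_mono) auto
      also have "\<dots> \<le> \<beta> * real (card X)"
      proof -
        have "5 * \<epsilon> * 48 / 47 \<le> \<beta>" using ab eps0 by simp
        then have "5 * \<epsilon> * 48 / 47 * real (card X) \<le> \<beta> * real (card X)" by (rule mult_right_mono) simp
        then show ?thesis by simp
      qed
      finally have "real (card X) * gini_gain (ms G X) j' a' \<le> real (card X) * \<beta>"
        unfolding gini_gain_ms[OF SL.prems(2) j] by (simp add: mult.commute)
      then show ?thesis using pos by simp
    qed
    have "nodes (chain (h - e) (Max ((\<lambda>i. G i 0) ` X)) (A 5 v < A 6 v)) e (ms G X) \<subseteq> nok \<alpha> \<beta>"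
      by (rule nodes_chain) (use False g maj gain SL.prems in auto)
    then show ?thesis using False SL.prems(3) by simp
  qed
next
  case (SN v l r)
  from SN.prems(1) obtain j X0 where v: "ltn A Al N Fb v e B X" "quiet A v c" "A 4 v = Suc j" "near A N v c X X0" "split_cond G X0 e j (G v (d + 2))"
    and l: "LT A G Al N Fb l (Suc e) (A 8 v) (curc A v c) (lft G X j (G v (d + 2)))"
    and r: "LT A G Al N Fb r (Suc e) (A 8 v) (curc A v c) (rgt G X j (G v (d + 2)))"
    by (rule LT_SN)
  define t where "t = G v (d + 2)"
  have fX: "finite X" by fact
  note n = node_near[OF v(1,2,4)]
  note nc = near_card[OF fX n]
  have sp: "k < card X0" "e < h" "j < d" "4 * \<epsilon> * real (card X0) < sco G X0 j t" "\<And>j' t'. j' < d \<Longrightarrow> sco G X0 j' t' \<le> sco G X0 j t"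
    using v(5) by (auto simp: split_cond_def t_def)
  have s: "sd X X0 = sd X0 X" by (simp add: sd_def)
  have lip: "sco G X0 j t \<le> sco G X j t + 4 * real (sd X0 X)" by (rule sco_lipschitz) (use fX n in auto)
  have kX: "k < card X" by (rule nc(2)[OF sp(1)])
  have pos: "0 < real (card X)" "0 < \<epsilon> * real (card X0)" using kX sp(1) eps0 by auto
  have "0 < sco G X j t" using lip n(2) sp(4) pos(2) by linarith
  then have "0 < Wt G X" using sco_le_Wt[of G X j t] by linarith
  then have g: "gini (ms G X) \<noteq> 0" using gini_ms[OF fX, of G] by auto
  have gain: "gini_gain (ms G X) j t \<ge> gini_gain (ms G X) j' a' - \<beta>" if j: "j' < d" for j' a'
  proof -
    have "sco G X j' a' \<le> sco G X0 j' a' + 4 * real (sd X X0)" by (rule sco_lipschitz) (use fX n in auto)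
    then have "sco G X j' a' - sco G X j t \<le> 2 * (\<epsilon> * real (card X0))" using sp(5)[OF j, of a'] lip n(2) s by simp
    also have "\<dots> \<le> 2 * (\<epsilon> * (48 / 47 * real (card X)))" using nc(1) eps0 by (intro mult_left_mono) auto
    also have "\<dots> \<le> \<beta> * real (card X)"
    proof -
      have "2 * \<epsilon> * 48 / 47 \<le> \<beta>" using ab eps0 by simp
      then have "2 * \<epsilon> * 48 / 47 * real (card X) \<le> \<beta> * real (card X)" by (rule mult_right_mono) simp
      then show ?thesis by simp
    qed
    finally have "real (card X) * gini_gain (ms G X) j' a' - real (card X) * gini_gain (ms G X) j t \<le> real (card X) * \<beta>"
      unfolding gini_gain_ms[OF fX j] gini_gain_ms[OF fX sp(3)] by (simp add: mult.commute)
    then have "real (card X) * (gini_gain (ms G X) j' a' - gini_gain (ms G X) j t) \<le> real (card X) * \<beta>" by (simp add: right_diff_distrib)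
    then show ?thesis using pos by (simp add: mult_le_cancel_left)
  qed
  let ?l = "dt A G \<alpha> l (Suc e) (lft G X j t)" and ?r = "dt A G \<alpha> r (Suc e) (rgt G X j t)"
  have D: "dt A G \<alpha> (SN v l r) e X = Split j t ?l ?r" by (simp add: v(3) t_def)
  have "nodes ?l (Suc e) (ms G (lft G X j t)) \<subseteq> nok \<alpha> \<beta> \<and> height ?l + Suc e \<le> h \<and> sh l \<le> height ?l"
    by (rule SN.IH(1)[OF l[folded t_def]]) (use fX sp(2) in auto)
  moreover have "nodes ?r (Suc e) (ms G (rgt G X j t)) \<subseteq> nok \<alpha> \<beta> \<and> height ?r + Suc e \<le> h \<and> sh r \<le> height ?r"
    by (rule SN.IH(2)[OF r[folded t_def]]) (use fX sp(2) in auto)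
  moreover have "(e, ms G X, Split j t ?l ?r) \<in> nok \<alpha> \<beta>"
    using kX g sp(2,3) gain by (auto simp: nok_def size_ms)
  ultimately show ?case unfolding D using fX sp(3) by (auto simp: below_ms above_ms)
qed

section \<open>Logarithmic bounds on height and on counters per path\<close>

text \<open>By \<open>chld\<close>, sizes shrink by the factor 1-\<epsilon> on the way down, and an
  internal node has size at least 1. The deepest internal node has depth \<open>sh T - 1\<close>;
  leaves below it may be empty.\<close>

lemma sh_power:
  "LT A G Al N Fb T e B c X \<Longrightarrow> 0 < sh T \<Longrightarrow> 1 \<le> (1 - \<epsilon>) ^ (sh T - 1) * real (sz A (root T))"
proof (induction T arbitrary: e B c X)
  case (SN v l r)
  from SN.prems(1) obtain j X0 where v: "near A N v c X X0" "split_cond G X0 e j (G v (d + 2))"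
    and c: "chld A v (root l) (lft G X0 j (G v (d + 2)))" "chld A v (root r) (rgt G X0 j (G v (d + 2)))"
    and l: "LT A G Al N Fb l (Suc e) (A 8 v) (curc A v c) (lft G X j (G v (d + 2)))"
    and r: "LT A G Al N Fb r (Suc e) (A 8 v) (curc A v c) (rgt G X j (G v (d + 2)))"
    by (rule LT_SN)
  have *: "1 \<le> (1 - \<epsilon>) ^ sh u * real (sz A v)"
    if "0 < sh u" "1 \<le> (1 - \<epsilon>) ^ (sh u - 1) * real (sz A (root u))" "real (sz A (root u)) \<le> (1 - \<epsilon>) * real (sz A v)" for u
  proof -
    have "1 \<le> (1 - \<epsilon>) ^ (sh u - 1) * ((1 - \<epsilon>) * real (sz A v))"
      by (rule order_trans[OF that(2) mult_left_mono[OF that(3)]]) (use eps2 in simp)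
    also have "\<dots> = (1 - \<epsilon>) ^ sh u * real (sz A v)" using that(1) by (cases "sh u") auto
    finally show ?thesis .
  qed
  have z: "1 \<le> real (sz A v)" using v by (auto simp: near_def split_cond_def)
  have lr: "1 \<le> (1 - \<epsilon>) ^ sh l * real (sz A v)" "1 \<le> (1 - \<epsilon>) ^ sh r * real (sz A v)"
    using *[of l] *[of r] SN.IH(1)[OF l] SN.IH(2)[OF r] c z by (cases "sh l"; cases "sh r"; simp add: chld_def)+
  show ?case
  proof (cases "sh l \<le> sh r")
    case True
    then have "sh (SN v l r) - 1 = sh r" by simp
    then show ?thesis using lr(2) by (simp only: root.simps)
  next
    case False
    then have "sh (SN v l r) - 1 = sh l" by simp
    then show ?thesis using lr(1) by (simp only: root.simps)
  qed
qed simp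

lemma sh_bound:
  assumes "LT A G Al N Fb T e B c X" "sz A (root T) \<le> 2 ^ L"
  shows "\<epsilon> * real (sh T) \<le> real L + 1"
proof (cases "0 < sh T")
  case True
  define m where "m = sh T - 1"
  have "1 - \<epsilon> \<le> exp (- \<epsilon>)" using exp_ge_add_one_self[of "- \<epsilon>"] by simp
  then have "(1 - \<epsilon>) ^ m \<le> exp (- \<epsilon>) ^ m" using eps2 by (intro power_mono) auto
  also have "\<dots> = exp (- (\<epsilon> * real m))" by (simp add: exp_of_nat_mult[symmetric] mult.commute)
  finally have "1 \<le> exp (- (\<epsilon> * real m)) * real (sz A (root T))"
    using sh_power[OF assms(1) True] by (smt (verit) m_def mult_right_mono of_nat_0_le_iff)
  also have "\<dots> \<le> exp (- (\<epsilon> * real m)) * 2 ^ L" using assms(2) by (intro mult_left_mono) (auto simp flip: of_nat_le_iff)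
  also have "(2::real) ^ L \<le> exp 1 ^ L" using exp_ge_add_one_self[of 1] by (intro power_mono) auto
  finally have "1 \<le> exp (- (\<epsilon> * real m)) * exp 1 ^ L" by simp
  also have "exp 1 ^ L = exp (real L)" by (simp add: exp_of_nat_mult[symmetric])
  finally have "0 \<le> real L - \<epsilon> * real m" by (simp add: exp_add[symmetric])
  moreover have "real (sh T) = real m + 1" using True by (simp add: m_def)
  ultimately show ?thesis using eps2 by (simp add: algebra_simps)
qed simp

text \<open>A node with its own counter has at most three quarters of the reference size handed down
  to it, and other nodes pass that size on unchanged. The maximum with 1 allows for an empty leaf
  that has a counter.\<close>

lemma tp_power:
  "LT A G Al N Fb T e B c X \<Longrightarrow> 0 < tp A T \<Longrightarrow> (4 / 3) ^ (tp A T - 1) \<le> max 1 (real B)"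
proof (induction T arbitrary: e B c X)
  case (SN v l r)
  from SN.prems(1) obtain j X0 where v: "ltn A Al N Fb v e B X" "near A N v c X X0" "split_cond G X0 e j (G v (d + 2))"
    and l: "LT A G Al N Fb l (Suc e) (A 8 v) (curc A v c) (lft G X j (G v (d + 2)))"
    and r: "LT A G Al N Fb r (Suc e) (A 8 v) (curc A v c) (rgt G X j (G v (d + 2)))"
    by (rule LT_SN)
  have z: "1 \<le> A 8 v" using v by (auto simp: near_def split_cond_def ltn_def)
  then have mx: "max 1 (real (A 8 v)) = real (A 8 v)" by simp
  define m where "m = max (tp A l) (tp A r)"
  have m: "(4 / 3) ^ (m - 1) \<le> real (A 8 v)" if "0 < m"
    using SN.IH(1)[OF l] SN.IH(2)[OF r] that unfolding mx m_def by (auto simp: max_def split: if_splits)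
  show ?case
  proof (cases "A 7 v = 0")
    case True
    then have t: "tp A (SN v l r) - 1 = m" by (simp add: m_def)
    have "4 * A 8 v \<le> 3 * B" using v(1) True by (simp add: ltn_def)
    then have "real (4 * A 8 v) \<le> real (3 * B)" by (simp only: of_nat_le_iff)
    then have B: "4 * real (A 8 v) \<le> 3 * real B" by simp
    show ?thesis
    proof (cases m)
      case (Suc m')
      then show ?thesis using m B unfolding t by simp
    qed (simp add: t[simplified] m_def[symmetric] True)
  next
    case False
    then have t: "tp A (SN v l r) = m" "A 8 v = B" using v(1) by (auto simp: m_def ltn_def)
    then show ?thesis using m SN.prems(2) by simp
  qed
qed (auto split: if_splits)

lemma tp_bound:
  assumes "LT A G Al N Fb T e (4 * IB) c X" "IB \<le> 2 ^ L"
  shows "tp A T \<le> 3 * L + 7"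
proof (rule ccontr)
  assume "\<not> tp A T \<le> 3 * L + 7"
  then have t: "3 * (L + 2) + 1 \<le> tp A T - 1" "0 < tp A T" by simp_all
  \<comment> \<open>Three counters on a path cost more than a factor of two, as (4/3)^3 =
    64/27.\<close>
  have "(2::real) ^ (L + 2) \<le> ((4 / 3) ^ 3) ^ (L + 2)" by (rule power_mono) (simp_all add: power3_eq_cube)
  also have "\<dots> = (4 / 3) ^ (3 * (L + 2))" by (rule power_mult[symmetric])
  also have "\<dots> < (4 / 3) ^ (tp A T - 1)" using t by (intro power_strict_increasing) auto
  also have "\<dots> \<le> max 1 (real (4 * IB))" by (rule tp_power) fact+
  also have "\<dots> \<le> (2::real) ^ (L + 2)"
  proof -
    have "4 * IB \<le> 2 ^ (L + 2)" "1 \<le> (2::nat) ^ (L + 2)" using assms(2) by simp_all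
    then have "real (4 * IB) \<le> real (2 ^ (L + 2))" "real 1 \<le> real (2 ^ (L + 2))" by (simp_all only: of_nat_le_iff)
    then show ?thesis by simp
  qed
  finally show False by simp
qed

end

section \<open>Amortized analysis of updates\<close>

text \<open>The number of entries added since the last multiple of \<open>2 ^ i\<close>. Levels
  wider than the table count nothing, which keeps the sum over all levels below \<open>2 * N\<close>
  (\<open>psi_le\<close>).\<close>

definition lev :: "nat \<Rightarrow> nat \<Rightarrow> nat" where "lev i N = (if 2 ^ i \<le> N then N mod 2 ^ i else 0)"

text \<open>Pays for the sorting of blocks: every second block on each level is a merge.\<close>

definition psi :: "nat \<Rightarrow> nat \<Rightarrow> nat" where "psi L N = (\<Sum>i\<le>L. lev i N)"

lemma psi_le: "psi L N \<le> 2 * N"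
proof -
  define f :: "nat \<Rightarrow> nat" where "f L = (\<Sum>i\<le>L. if (2::nat) ^ i \<le> N then 2 ^ i else (0::nat))" for L
  have f1: "f L < 2 ^ (L + 1)" for L
  proof (induction L)
    case 0
    show ?case unfolding f_def atMost_0 by simp
  next
    case (Suc L)
    have "f (Suc L) \<le> f L + 2 ^ Suc L" by (simp add: f_def)
    with Suc show ?case by simp
  qed
  have "f L \<le> 2 * N"
  proof (induction L)
    case (Suc L)
    show ?case
    proof (cases "2 ^ Suc L \<le> N")
      case True
      then show ?thesis using f1[of "Suc L"] by simp
    next
      case False
      then show ?thesis using Suc by (simp add: f_def)
    qed
  next
    case 0
    show ?case unfolding f_def atMost_0 by simp
  qed
  moreover have "psi L N \<le> f L" unfolding psi_def f_def
    by (rule sum_mono) (auto simp: lev_def intro: less_imp_le)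
  ultimately show ?thesis by linarith
qed

lemma lev_Suc: "lev i (Suc N) \<le> lev i N + 1"
proof (cases "2 ^ i \<le> N")
  case True
  then show ?thesis by (simp add: lev_def mod_Suc)
next
  case False
  then show ?thesis by (cases "2 ^ i = Suc N") (simp_all add: lev_def)
qed

lemma lev_dvd: "2 ^ i dvd Suc N \<Longrightarrow> lev i (Suc N) = 0 \<and> (2 ^ i \<le> N \<longrightarrow> lev i N + 1 = 2 ^ i)"
  by (auto simp: lev_def mod_Suc dvd_eq_mod_eq_0 split: if_splits)

text \<open>Every level rises by at most 1. If the new block of width w = 2^z does not span the
  whole table, level z falls from w - 1 to 0. If it does, then N + 1 = 2^z, all levels become 0, and
  the levels below z release 2^z - 1 up to one unit each.\<close>

lemma psi_Suc:
  assumes b: "blk (Suc N) (Suc N) w" and L: "Suc N \<le> 2 ^ L"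
  shows "psi L (Suc N) + w \<le> psi L N + L + 2"
proof -
  from b obtain z q where z: "w = 2 ^ z" "Suc N = 2 ^ z * (2 * q + 1)" by (auto simp: blk_def)
  have "2 ^ z dvd Suc N" unfolding z(2) by simp
  then have "2 ^ z \<le> Suc N" by (rule dvd_imp_le) simp
  then have "(2::nat) ^ z \<le> 2 ^ L" using L by linarith
  then have zL: "z \<le> L" by (rule power_le_imp_le_exp[rotated]) simp
  have dv: "2 ^ i dvd Suc N" if "i \<le> z" for i
    using le_imp_power_dvd[OF that, of "2::nat"] \<open>2 ^ z dvd Suc N\<close> by (rule dvd_trans)
  show ?thesis
  proof (cases "2 ^ z \<le> N")
    case True
    define g where "g i = (if i = z then w else 0)" for i
    have "(\<Sum>i\<le>L. lev i (Suc N) + g i) \<le> (\<Sum>i\<le>L. lev i N + 1)"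
    proof (rule sum_mono)
      fix i
      show "lev i (Suc N) + g i \<le> lev i N + 1"
        using lev_Suc[of i N] lev_dvd[OF dv[of z]] True z(1) by (auto simp: g_def)
    qed
    moreover have "(\<Sum>i\<le>L. g i) = w" using zL by (simp add: g_def sum.delta)
    ultimately show ?thesis by (simp add: psi_def sum.distrib sum_Suc)
  next
    case False
    then have N: "Suc N = 2 ^ z" using \<open>2 ^ z \<le> Suc N\<close> by linarith
    have "lev i (Suc N) = 0" for i
    proof (cases "i \<le> z")
      case False
      then have "(2::nat) ^ z < 2 ^ i" by (intro power_strict_increasing) auto
      then show ?thesis using N by (simp add: lev_def)
    qed (use dv lev_dvd in blast)
    then have 0: "psi L (Suc N) = 0" by (simp add: psi_def)
    define g where "g i = (if i < z then 2 ^ i else 0 :: nat)" for i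
    have "(\<Sum>i\<le>L. g i) \<le> (\<Sum>i\<le>L. lev i N + 1)"
    proof (rule sum_mono)
      fix i
      show "g i \<le> lev i N + 1"
      proof (cases "i < z")
        case True
        then have "(2::nat) ^ i < 2 ^ z" by (intro power_strict_increasing) auto
        then have "2 ^ i \<le> N" using N by linarith
        then show ?thesis using True lev_dvd[OF dv[of i]] by (simp add: g_def)
      qed (simp add: g_def)
    qed
    moreover have "(\<Sum>i\<le>L. g i) = (\<Sum>i<z. 2 ^ i)"
    proof -
      have "{..L} \<inter> {i. i < z} = {..<z}" using zL by auto
      then show ?thesis unfolding g_def by (subst sum.If_cases) auto
    qed
    moreover have "(\<Sum>i<z. (2::nat) ^ i) + 1 = 2 ^ z" by (induction z) auto
    ultimately show ?thesis using 0 z(1) by (simp add: psi_def sum.distrib sum_Suc)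
  qed
qed

context params
begin

definition alg :: algorithm where "alg = \<lparr>ins_code = INS, del_code = DEL, lab_code = LAB\<rparr>"

text \<open>The tree read back from the memory, well defined by \<open>skel_unique\<close>. It does
  not refer to \<open>IB\<close>, so that one tree function serves request sequences of all peak
  sizes.\<close>

definition Tof :: "state \<Rightarrow> sk" where "Tof s = (THE T. skel (ar s) T \<and> root T = ar s 3 1)"

definition QQ :: "nat \<Rightarrow> nat \<Rightarrow> nat" where "QQ L H = d * (L + 1) * (H + 3)"

text \<open>With Q = \<open>QQ L H\<close>, a rebuild of \<rho> rows takes time 40000 Q\<rho> and
  consumes 3\<rho> addresses worth 3000000 Q\<rho>. Its counter, at least \<epsilon>\<rho>/20,
  releases 61000000/20 = 3050000 times Q\<rho>, which covers both. A compaction releases 500000 QF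
  by halving the memory F, enough for its own time and for the new value of the dictionary term.
  That third term pays for sorting blocks.\<close>

definition pot :: "nat \<Rightarrow> nat \<Rightarrow> nat \<Rightarrow> nat \<Rightarrow> nat \<Rightarrow> real" where
  "pot L H S F N = 61000000 * real (QQ L H) / \<epsilon> * real S + 1000000 * real (QQ L H) * real F + 20000 * real (d * (L + 1)) * real (psi L N)"

definition KK :: "nat \<Rightarrow> nat \<Rightarrow> real" where "KK L H = 600000000 * (real (QQ L H) * real (L + 1) / \<epsilon>)"

lemma pot_nonneg: "0 \<le> pot L H S F N"
  unfolding pot_def using eps0 by (intro add_nonneg_nonneg mult_nonneg_nonneg divide_nonneg_nonneg) auto

end

context machine
begin

lemma Tof_eq: "Inv s T \<Longrightarrow> Tof s = T"
  unfolding Tof_def Inv_def using LT_skel skel_unique by (intro the_equality) metis+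

text \<open>\<open>t0\<close> is the time spent on the dictionary before the tree is touched. Its
  first bound telescopes with \<open>psi\<close> as long as the table persists. A compaction
  renumbers the rows and breaks this, and then the second bound, linear in the memory in use, is
  paid from the memory term.\<close>

lemma amortized:
  assumes uc: "ucost L t0 N' (max 1 F) S P Hs t' s' T'" and H: "Hs \<le> H" "sh T' \<le> H" and P: "P \<le> 3 * L + 7"
    and t0: "real t0 + 20000 * real (d * (L + 1)) * real (psi L N') \<le> 20000 * real (d * (L + 1)) * real (psi L N) + E"
      "real t0 \<le> E + 20000 * real (d * (L + 1)) * (real F + 2)" and E: "E \<le> 100000 * real (d * (L + 1)) * real (L + 1)"
  shows "real t' + pot L H (csum (ar s') T') (sc s' 4) (sc s' 5) \<le> pot L H S F N + KK L H"
proof -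
  define M Q where MQ: "M = real (d * (L + 1))" "Q = real (QQ L H)"
  have Q: "3 * M \<le> Q" "0 \<le> M" "real H + 1 \<le> Q"
  proof -
    have "d * (L + 1) * 3 \<le> d * (L + 1) * (H + 3)" by (rule mult_le_mono2) simp
    then have "real (3 * (d * (L + 1))) \<le> real (QQ L H)" unfolding QQ_def by (simp only: of_nat_le_iff mult.commute)
    then show "3 * M \<le> Q" by (simp add: MQ)
    have "1 * (H + 3) \<le> d * (L + 1) * (H + 3)" using d1 by (intro mult_le_mono1) simp
    then have "H + 3 \<le> QQ L H" by (simp add: QQ_def)
    then have "real (H + 3) \<le> real (QQ L H)" by (simp only: of_nat_le_iff)
    then show "real H + 1 \<le> Q" by (simp add: MQ)
  qed (simp add: MQ)
  have M: "real (d * (L + 1)) * real ((sh T' + 3) * x) \<le> Q * real x" for x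
  proof -
    have "d * (L + 1) * ((sh T' + 3) * x) \<le> d * (L + 1) * ((H + 3) * x)" using H(2) by (intro mult_le_mono2 mult_le_mono1) simp
    also have "\<dots> = QQ L H * x" by (simp only: QQ_def mult.assoc)
    finally show ?thesis unfolding MQ(2) by (simp only: of_nat_mult[symmetric] of_nat_le_iff)
  qed
  define Y where "Y = Q * real (L + 1) / \<epsilon>"
  have QY: "12 * (Q * real (L + 1)) \<le> Y"
  proof -
    have "12 * (Q * real (L + 1)) * \<epsilon> \<le> Q * real (L + 1)"
      using mult_left_mono[of "12 * \<epsilon>" 1 "Q * real (L + 1)"] eps2 Q by (simp add: mult_ac)
    then show ?thesis unfolding Y_def using eps0 by (simp add: pos_le_divide_eq)
  qed
  have L1: "Q \<le> Q * real (L + 1)" "M * real (L + 1) \<le> Q * real (L + 1)" "0 \<le> Q"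
  proof -
    show nn: "0 \<le> Q" using Q by linarith
    show "Q \<le> Q * real (L + 1)" using mult_left_mono[OF _ nn, of 1 "real (L + 1)"] by simp
    show "M * real (L + 1) \<le> Q * real (L + 1)" by (rule mult_right_mono) (use Q in linarith, simp)
  qed
  have EY: "E \<le> 10000 * Y" using E L1 QY unfolding MQ(1)[symmetric] by linarith
  have p2: "real (psi L x) \<le> 2 * real x" for x using psi_le[of L x] by linarith
  from uc show ?thesis unfolding ucost_def
  proof (elim disjE exE conjE)
    fix \<rho> \<tau> \<chi> :: nat
    assume u: "t' \<le> t0 + 1000 * (Hs + 1) + 40000 * (d * (L + 1)) * ((sh T' + 3) * \<rho>)" "sc s' 4 \<le> max 1 F + \<tau> + 3 * \<rho>"
      "csum (ar s') T' + \<chi> \<le> S + \<tau>" "\<epsilon> * real \<rho> \<le> 20 * real \<chi>" "\<tau> \<le> P" "sc s' 5 = N'"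
    have "real t' \<le> real (t0 + 1000 * (Hs + 1) + 40000 * (d * (L + 1)) * ((sh T' + 3) * \<rho>))" using u(1) by (simp only: of_nat_le_iff)
    also have "\<dots> = real t0 + 1000 * (real Hs + 1) + 40000 * (real (d * (L + 1)) * real ((sh T' + 3) * \<rho>))" by (simp add: mult.assoc)
    finally have tt: "real t' \<le> real t0 + 1000 * (real Hs + 1) + 40000 * (real (d * (L + 1)) * real ((sh T' + 3) * \<rho>))" .
    have "real t' \<le> real t0 + 1000 * Q + 40000 * Z"
      if "real t' \<le> real t0 + 1000 * (real Hs + 1) + 40000 * X" "X \<le> Z" for X Z
    proof -
      have "real Hs \<le> real H" using H(1) by simp
      then have "real Hs + 1 \<le> Q" using Q(3) by linarith
      then have "1000 * (real Hs + 1) \<le> 1000 * Q" by simp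
      then show ?thesis using that by linarith
    qed
    from this[OF tt M[of \<rho>]] have t: "real t' \<le> real t0 + 1000 * Q + 40000 * (Q * real \<rho>)" .
    \<comment> \<open>The O(log n) increments per update are charged here; at 61000000 Q/\<epsilon>
      each they account for most of \<open>KK\<close>.\<close>
    have tau: "real \<tau> \<le> 7 * real (L + 1)" using u(5) P by simp
    have F: "real (sc s' 4) \<le> real F + 1 + 7 * real (L + 1) + 3 * real \<rho>" using u(2) tau by linarith
    have b: "Q * real (sc s' 4) \<le> Q * real F + Q + 7 * (Q * real (L + 1)) + 3 * (Q * real \<rho>)"
      using mult_left_mono[OF F L1(3)] by (simp add: algebra_simps)
    have a: "Q / \<epsilon> * real (csum (ar s') T') \<le> Q / \<epsilon> * real S + 7 * Y - Q * real \<rho> / 20"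
    proof -
      have "real (csum (ar s') T') \<le> real S + 7 * real (L + 1) - \<epsilon> * real \<rho> / 20" using u(3,4) tau by linarith
      then have "Q / \<epsilon> * real (csum (ar s') T') \<le> Q / \<epsilon> * (real S + 7 * real (L + 1) - \<epsilon> * real \<rho> / 20)"
        using L1(3) eps0 by (intro mult_left_mono) auto
      also have "\<dots> = Q / \<epsilon> * real S + 7 * Y - Q * real \<rho> / 20" using eps0 by (simp add: Y_def field_simps)
      finally show ?thesis .
    qed
    have c: "real t0 + 20000 * M * real (psi L N') \<le> 20000 * M * real (psi L N) + E" using t0(1) by (simp only: MQ(1))
    have pe: "pot L H A B C = 61000000 * (Q / \<epsilon> * real A) + 1000000 * (Q * real B) + 20000 * M * real (psi L C)" for A B C
      by (simp add: pot_def MQ)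
    have k: "KK L H = 600000000 * Y" by (simp add: KK_def Y_def MQ)
    have qr: "0 \<le> Q * real \<rho>" using L1(3) by simp
    show ?thesis unfolding pe k u(6) using t b a c EY QY L1 qr by linarith
  next
    assume u: "8 \<le> max 1 F" "t' \<le> t0 + 200000 * (d * (L + 1)) * ((sh T' + 3) * (max 1 F + 1))" "csum (ar s') T' = 0"
      "2 * sc s' 4 \<le> max 1 F" "sc s' 5 \<le> max 1 F"
    have mF: "max 1 F = F" "8 \<le> F" using u(1) by auto
    have "real t' \<le> real (t0 + 200000 * (d * (L + 1)) * ((sh T' + 3) * (F + 1)))" using u(2) unfolding mF by (simp only: of_nat_le_iff)
    also have "\<dots> = real t0 + 200000 * (real (d * (L + 1)) * real ((sh T' + 3) * (F + 1)))" by (simp add: mult.assoc)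
    finally have tt: "real t' \<le> real t0 + 200000 * (real (d * (L + 1)) * real ((sh T' + 3) * (F + 1)))" .
    have "real t' \<le> real t0 + 200000 * Z" if "real t' \<le> real t0 + 200000 * X" "X \<le> Z" for X Z using that by linarith
    from this[OF tt M[of "F + 1"]] have t: "real t' \<le> real t0 + 200000 * (Q * real (F + 1))" .
    have f: "real (F + 1) \<le> 2 * real F" "real F + 2 \<le> 2 * real F" "real (sc s' 4) \<le> real F / 2" "real (psi L (sc s' 5)) \<le> 2 * real F"
      using mF u(4,5) p2[of "sc s' 5"] by auto
    have q1: "Q * real (F + 1) \<le> Q * (2 * real F)" "M * (real F + 2) \<le> M * (2 * real F)" "Q * real (sc s' 4) \<le> Q * (real F / 2)"
      "M * real (psi L (sc s' 5)) \<le> M * (2 * real F)" "3 * (M * real F) \<le> Q * real F"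
      by (rule mult_left_mono[OF f(1) L1(3)], rule mult_left_mono[OF f(2) Q(2)], rule mult_left_mono[OF f(3) L1(3)],
          rule mult_left_mono[OF f(4) Q(2)], use mult_right_mono[OF Q(1), of "real F"] in simp)
    have q2: "Q * (2 * real F) = 2 * (Q * real F)" "M * (2 * real F) = 2 * (M * real F)" "Q * (real F / 2) = Q * real F / 2" "Q / \<epsilon> * real 0 = 0" by simp_all
    have c: "real t0 \<le> E + 20000 * (M * (real F + 2))" using t0(2) by (simp only: MQ(1) mult.assoc)
    have pe: "pot L H A B C = 61000000 * (Q / \<epsilon> * real A) + 1000000 * (Q * real B) + 20000 * (M * real (psi L C))" for A B C
      unfolding pot_def MQ[symmetric] by (simp add: mult.assoc)
    have k: "KK L H = 600000000 * Y" by (simp add: KK_def Y_def MQ)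
    have nn: "0 \<le> Q / \<epsilon> * real S" "0 \<le> M * real (psi L N)" using L1(3) Q(2) eps0 by auto
    have gen: "rt + (61000000 * A0 + 1000000 * b' + 20000 * p') \<le> (61000000 * r + 1000000 * b + 20000 * p) + 600000000 * y"
      if "rt \<le> r0 + 200000 * g" "g \<le> 2 * b" "r0 \<le> E + 20000 * m2" "m2 \<le> 2 * mf" "b' \<le> b / 2" "p' \<le> 2 * mf" "3 * mf \<le> b"
        "E \<le> 10000 * y" "0 \<le> r" "0 \<le> p" "0 \<le> y" "A0 = 0" "0 \<le> b" for rt A0 b' p' r b p y r0 g m2 mf :: real
      using that by linarith
    have "0 \<le> Y" "0 \<le> Q * real F" using L1(3) eps0 by (simp_all add: Y_def)
    then show ?thesis unfolding pe k u(3)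
      by (intro gen[OF t q1(1)[unfolded q2] c q1(2)[unfolded q2] q1(3)[unfolded q2] q1(4)[unfolded q2] q1(5) EY nn _ q2(4)])
  qed
qed

definition St :: "nat \<Rightarrow> state \<Rightarrow> example multiset \<Rightarrow> bool" where
  "St n s S \<longleftrightarrow> Inv s (Tof s) \<and> bounded s \<and> sc s 4 \<le> 128 * n + 71 \<and> ms (rw s) (al s) = S"

abbreviation spot :: "nat \<Rightarrow> nat \<Rightarrow> state \<Rightarrow> real" where
  "spot L H s \<equiv> pot L H (csum (ar s) (Tof s)) (sc s 4) (sc s 5)"

lemma step_update:
  assumes s: "St n s S" and W: "wp z c (\<lambda>t' s'. \<exists>T' t0 N'. Inv s' T' \<and> sc s' 4 \<le> 128 * n + 71 \<and> ms (rw s') (al s') = S' \<and>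
       real t0 + 20000 * real (d * (L + 1)) * real (psi L N') \<le> 20000 * real (d * (L + 1)) * real (psi L (sc s 5)) + 100000 * real (d * (L + 1)) * real (L + 1) \<and>
       real t0 \<le> 100000 * real (d * (L + 1)) * real (L + 1) + 20000 * real (d * (L + 1)) * (real (sc s 4) + 2) \<and>
       ucost L t0 N' (max 1 (sc s 4)) (csum (ar s) (Tof s)) (tp (ar s) (Tof s)) (sh (Tof s)) t' s' T') 0 s"
    and c: "csafe c" and L: "IB \<le> 2 ^ L"
  shows "\<exists>tr s'. exec z c s tr s' \<and> St n s' S' \<and> (\<forall>ev \<in> set tr. good ev) \<and>
    (\<forall>H. sh (Tof s) \<le> H \<longrightarrow> sh (Tof s') \<le> H \<longrightarrow> real (length tr) + spot L H s' \<le> spot L H s + KK L H)"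
proof -
  have b: "bounded s" using s by (simp add: St_def)
  have "LT (ar s) (rw s) (al s) (sc s 5) (sc s 4) (Tof s) 0 (4 * IB) 0 (al s)" using s by (simp add: St_def Inv_def)
  then have P: "tp (ar s) (Tof s) \<le> 3 * L + 7" using L by (rule tp_bound)
  from wp_exec[OF W c b] obtain tr s' T' t0 N' where x: "exec z c s tr s'" "bounded s'" "\<forall>ev \<in> set tr. good ev"
    "Inv s' T'" "sc s' 4 \<le> 128 * n + 71" "ms (rw s') (al s') = S'"
    "real t0 + 20000 * real (d * (L + 1)) * real (psi L N') \<le> 20000 * real (d * (L + 1)) * real (psi L (sc s 5)) + 100000 * real (d * (L + 1)) * real (L + 1)"
    "real t0 \<le> 100000 * real (d * (L + 1)) * real (L + 1) + 20000 * real (d * (L + 1)) * (real (sc s 4) + 2)"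
    "ucost L t0 N' (max 1 (sc s 4)) (csum (ar s) (Tof s)) (tp (ar s) (Tof s)) (sh (Tof s)) (length tr) s' T'" by metis
  have T': "Tof s' = T'" by (rule Tof_eq) fact
  have "real (length tr) + spot L H s' \<le> spot L H s + KK L H" if "sh (Tof s) \<le> H" "sh (Tof s') \<le> H" for H
    unfolding T' by (rule amortized[OF x(9) that(1) that(2)[unfolded T'] P x(7,8)]) simp
  then show ?thesis using x T' by (auto simp: St_def)
qed

lemma step_lab:
  assumes s: "St n s S" and x: "length x = d" and n: "400 * (n + 1) \<le> IB"
  shows "\<exists>tr s'. exec (x, y) LAB s tr s' \<and> St n s' S \<and> (\<forall>ev \<in> set tr. good ev) \<and> length tr \<le> 100 * (sh (Tof s) + 1) \<and>
     Tof s' = Tof s \<and> spot L H s' = spot L H s \<and> words s' 0 = of_bool (lab (ar s) (rw s) (Tof s) x)"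
proof -
  have inv: "Inv s (Tof s)" and b: "bounded s" and F: "sc s 4 \<le> 128 * n + 71" using s by (simp_all add: St_def)
  have LT: "LT (ar s) (rw s) (al s) (sc s 5) (sc s 4) (Tof s) 0 (4 * IB) 0 (al s)" "ar s 3 1 = root (Tof s)" using inv by (simp_all add: Inv_def)
  have "wp (x, y) LAB (\<lambda>t' s'. t' \<le> 0 + 100 * (sh (Tof s) + 1) \<and> sc s' 0 = of_bool (lab (ar s) (rw s) (Tof s) (fst (x, y))) \<and> fr LAB s s') 0 s"
    by (rule wp_mono[OF wp_LAB[OF LT, where t = 0]]) (use x n F in auto)
  then obtain tr s' where e0: "exec (x, y) LAB s tr s'"
    "length tr \<le> 0 + 100 * (sh (Tof s) + 1) \<and> sc s' 0 = of_bool (lab (ar s) (rw s) (Tof s) (fst (x, y))) \<and> fr LAB s s'"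
    "bounded s'" "\<forall>ev \<in> set tr. good ev"
    by (rule wp_exec[OF _ csafe_programs(3) b])
  then have e: "exec (x, y) LAB s tr s'" "bounded s'" "\<forall>ev \<in> set tr. good ev"
    "length tr \<le> 100 * (sh (Tof s) + 1)" "sc s' 0 = of_bool (lab (ar s) (rw s) (Tof s) x)" "fr LAB s s'" by simp_all
  note [simp] = frD[OF e(6)]
  have a: "ar s' a = ar s a" if "a < 16" for a using that by simp
  have al: "al s' = al s" by (simp add: al_def)
  have LT': "LT (ar s') (rw s') (al s) (sc s 5) (sc s 4) (Tof s) 0 (4 * IB) 0 (al s)" "csum (ar s') (Tof s) = csum (ar s) (Tof s)"
    using LT_pre[OF inv, of s'] by simp_all
  have I: "Inv s' (Tof s)" using inv LT' unfolding Inv_def al by simp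
  then have T: "Tof s' = Tof s" by (rule Tof_eq)
  have "St n s' S" using s I T e(2) al by (simp add: St_def)
  moreover have "spot L H s' = spot L H s" using LT'(2) T by simp
  moreover have "words s' 0 = of_bool (lab (ar s) (rw s) (Tof s) x)" using e(5) by (simp only: sc_def)
  ultimately show ?thesis using e(1,3,4) T by blast
qed

lemma step:
  assumes s: "St n s S" and x: "length (req_point r) = d" and n: "size S \<le> n" "size (apply_request r S) \<le> n" "400 * (n + 1) \<le> IB" and L: "IB \<le> 2 ^ L"
  shows "\<exists>tr s'. exec_request alg r s tr s' \<and> St n s' (apply_request r S) \<and> (\<forall>ev \<in> set tr. good ev) \<and>
    (\<not> is_update r \<longrightarrow> length tr \<le> 100 * (sh (Tof s) + 1)) \<and>
    (\<forall>H. sh (Tof s) \<le> H \<longrightarrow> sh (Tof s') \<le> H \<longrightarrow>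
       (if is_update r then real (length tr) else 0) + spot L H s' \<le> spot L H s + (if is_update r then KK L H else 0))"
proof -
  have inv: "Inv s (Tof s)" and F: "sc s 4 \<le> 128 * n + 71" and S: "ms (rw s) (al s) = S" using s by (simp_all add: St_def)
  have cS: "card (al s) = size S" unfolding S[symmetric] by (simp add: size_ms)
  have NF: "sc s 5 \<le> sc s 4" using inv by (simp add: Inv_def)
  define M where "M = d * (L + 1)"
  have M: "d \<le> M" "1 \<le> M" "M \<le> M * (L + 1)" using d1 by (auto simp: M_def)
  show ?thesis
  proof (cases r)
    case (Ins x y)
    have x': "length x = d" "Suc (card (al s)) \<le> n" using x n Ins cS by simp_all
    have "wp (x, y) INS (\<lambda>t' s'. \<exists>T' t0 N'. Inv s' T' \<and> sc s' 4 \<le> 128 * n + 71 \<and> ms (rw s') (al s') = apply_request r S \<and>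
       real t0 + 20000 * real (d * (L + 1)) * real (psi L N') \<le> 20000 * real (d * (L + 1)) * real (psi L (sc s 5)) + 100000 * real (d * (L + 1)) * real (L + 1) \<and>
       real t0 \<le> 100000 * real (d * (L + 1)) * real (L + 1) + 20000 * real (d * (L + 1)) * (real (sc s 4) + 2) \<and>
       ucost L t0 N' (max 1 (sc s 4)) (csum (ar s) (Tof s)) (tp (ar s) (Tof s)) (sh (Tof s)) t' s' T') 0 s"
    proof (rule wp_mono[OF wp_INS[OF inv x' F n(3) L]], goal_cases)
      case (1 t' s')
      then obtain T' w where w: "blk (Suc (sc s 5)) (Suc (sc s 5)) w" "Inv s' T'" "sc s' 4 \<le> 128 * n + 71"
        "ms (rw s') (al s') = add_mset (x, y) (ms (rw s) (al s))"
        "ucost L (0 + 200 * d + 20000 * (d * (L + 1)) * (w + 1) + 150) (Suc (sc s 5)) (max 1 (sc s 4)) (csum (ar s) (Tof s)) (tp (ar s) (Tof s)) (sh (Tof s)) t' s' T'"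
        by blast
      define t0 where "t0 = 0 + 200 * d + 20000 * (d * (L + 1)) * (w + 1) + 150"
      have t0: "t0 \<le> 350 * M + 20000 * (M * w) + 20000 * M" using M unfolding t0_def M_def[symmetric] by (simp add: algebra_simps)
      have "128 * n + 72 \<le> IB" using n(3) by simp
      then have "Suc (sc s 5) \<le> 2 ^ L" using NF F L by linarith
      then have ps: "psi L (Suc (sc s 5)) + w \<le> psi L (sc s 5) + L + 2" by (rule psi_Suc[OF w(1)])
      have "M * (psi L (Suc (sc s 5)) + w) \<le> M * (psi L (sc s 5) + L + 2)" using ps by (rule mult_le_mono2)
      then have "t0 + 20000 * (M * psi L (Suc (sc s 5))) \<le> 20000 * (M * psi L (sc s 5)) + 100000 * (M * (L + 1))"
        using t0 M by (simp add: algebra_simps)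
      then have r1: "real (t0 + 20000 * (M * psi L (Suc (sc s 5)))) \<le> real (20000 * (M * psi L (sc s 5)) + 100000 * (M * (L + 1)))"
        by (simp only: of_nat_le_iff)
      have "w \<le> sc s 4 + 1" using blk_pos[OF w(1)] NF by simp
      then have "M * w \<le> M * (sc s 4 + 1)" by (rule mult_le_mono2)
      then have "t0 \<le> 100000 * (M * (L + 1)) + 20000 * (M * (sc s 4 + 2))" using t0 M by (simp add: algebra_simps)
      then have r2: "real t0 \<le> real (100000 * (M * (L + 1)) + 20000 * (M * (sc s 4 + 2)))" by (simp only: of_nat_le_iff)
      show ?case unfolding M_def[symmetric]
        using w(2-5)[folded t0_def] r1 r2 S Ins
        by (rule_tac exI[of _ T'], rule_tac exI[of _ t0], rule_tac exI[of _ "Suc (sc s 5)"]) (simp add: algebra_simps)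
    qed
    from step_update[OF s this csafe_programs(1) L] show ?thesis using Ins by (auto simp: alg_def)
  next
    case (Del x y)
    have x': "length x = d" "card (al s) \<le> n" using x n Del cS by simp_all
    have "wp (x, y) DEL (\<lambda>t' s'. \<exists>T' t0 N'. Inv s' T' \<and> sc s' 4 \<le> 128 * n + 71 \<and> ms (rw s') (al s') = apply_request r S \<and>
       real t0 + 20000 * real (d * (L + 1)) * real (psi L N') \<le> 20000 * real (d * (L + 1)) * real (psi L (sc s 5)) + 100000 * real (d * (L + 1)) * real (L + 1) \<and>
       real t0 \<le> 100000 * real (d * (L + 1)) * real (L + 1) + 20000 * real (d * (L + 1)) * (real (sc s 4) + 2) \<and>
       ucost L t0 N' (max 1 (sc s 4)) (csum (ar s) (Tof s)) (tp (ar s) (Tof s)) (sh (Tof s)) t' s' T') 0 s"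
    proof (rule wp_mono[OF wp_DEL[OF inv x' F n(3) L]], goal_cases)
      case (1 t' s')
      then obtain T' where w: "Inv s' T'" "sc s' 4 \<le> 128 * n + 71" "ms (rw s') (al s') = ms (rw s) (al s) - {#(x, y)#}"
        "ucost L (0 + 200 * d + 10000 * (d * (L + 1) * (L + 1)) + 200) (sc s 5) (max 1 (sc s 4)) (csum (ar s) (Tof s)) (tp (ar s) (Tof s)) (sh (Tof s)) t' s' T'"
        by blast
      define t0 where "t0 = 0 + 200 * d + 10000 * (d * (L + 1) * (L + 1)) + 200"
      have "t0 \<le> 100000 * (M * (L + 1))" using M unfolding t0_def M_def[symmetric] by linarith
      then have r1: "real t0 \<le> real (100000 * (M * (L + 1)))" by (simp only: of_nat_le_iff)
      then have r2: "real t0 \<le> 100000 * real M * real (L + 1) + 20000 * real M * (real (sc s 4) + 2)"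
      proof -
        have "real (100000 * (M * (L + 1))) = 100000 * real M * real (L + 1)" by (simp add: algebra_simps)
        moreover have "0 \<le> 20000 * real M * (real (sc s 4) + 2)" by simp
        ultimately show ?thesis using r1 by linarith
      qed
      show ?case unfolding M_def[symmetric]
        using w[folded t0_def] r1 r2 S Del
        by (rule_tac exI[of _ T'], rule_tac exI[of _ t0], rule_tac exI[of _ "sc s 5"]) (simp add: algebra_simps)
    qed
    from step_update[OF s this csafe_programs(2) L] show ?thesis using Del by (auto simp: alg_def)
  next
    case (Lab x)
    then have "length x = d" using x by simp
    from step_lab[OF s this n(3), where y = False and L = L] obtain tr s' where e: "exec (x, False) LAB s tr s'" "St n s' S"
      "\<forall>ev \<in> set tr. good ev" "length tr \<le> 100 * (sh (Tof s) + 1)" "Tof s' = Tof s" and "words s' 0 = of_bool (lab (ar s) (rw s) (Tof s) x)"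
      by blast
    from step_lab[OF s \<open>length x = d\<close> n(3), where y = False and L = L] have sp: "spot L H s' = spot L H s" for H
      using e(1) exec_deterministic by blast
    show ?thesis using e(1-4) sp Lab by (intro exI[of _ tr] exI[of _ s']) (simp add: alg_def)
  qed
qed

end

section \<open>Sequences of requests\<close>

lemma exec_request_deterministic: "exec_request A r s tr s' \<Longrightarrow> exec_request A r s tr' s'' \<Longrightarrow> tr' = tr \<and> s'' = s'"
  by (cases r) (auto dest: exec_deterministic)

lemma run_deterministic: "run A s rs trs s' \<Longrightarrow> run A s rs trs' s'' \<Longrightarrow> trs' = trs \<and> s'' = s'"
proof (induction arbitrary: trs' s'' rule: run.induct)
  case (Nil s)
  then show ?case by (auto elim: run.cases)
next
  case (Cons r s tr s2 rs trs s3)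
  from Cons.prems obtain tr' s2' trs2 where c: "trs' = tr' # trs2" "exec_request A r s tr' s2'" "run A s2' rs trs2 s''"
    by (auto elim: run.cases)
  with exec_request_deterministic[OF Cons.hyps(1)] Cons.IH show ?case by blast
qed

lemma run_snoc: "run A s rs trs s' \<Longrightarrow> exec_request A r s' tr s'' \<Longrightarrow> run A s (rs @ [r]) (trs @ [tr]) s''"
  by (induction rule: run.induct) (auto intro: run.intros)

lemma update_time_snoc:
  assumes "length trs = length rs"
  shows "update_time (rs @ [r]) (trs @ [tr]) = update_time rs trs + (if is_update r then length tr else 0)"
proof -
  let ?n = "length rs"
  have "{i. i < length (rs @ [r]) \<and> is_update ((rs @ [r]) ! i)} =
    {i. i < ?n \<and> is_update (rs ! i)} \<union> (if is_update r then {?n} else {})"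
    by (auto simp: nth_append less_Suc_eq)
  then have "update_time (rs @ [r]) (trs @ [tr]) =
    (\<Sum>i | i < ?n \<and> is_update (rs ! i). length ((trs @ [tr]) ! i)) + (if is_update r then length tr else 0)"
    unfolding update_time_def using assms by (simp add: sum.union_disjoint nth_append)
  also have "(\<Sum>i | i < ?n \<and> is_update (rs ! i). length ((trs @ [tr]) ! i)) = update_time rs trs"
    unfolding update_time_def by (rule sum.cong) (use assms in \<open>auto simp: nth_append\<close>)
  finally show ?thesis .
qed

lemma active_snoc: "active (rs @ [r]) = apply_request r (active rs)"
  by (simp add: active_def)

text \<open>Runs are deterministic, so the choice is forced (\<open>stof\<close>). This makes the
  final state, and with it the witnessing tree, a function of the list of requests.\<close>

definition stof :: "algorithm \<Rightarrow> state \<Rightarrow> request list \<Rightarrow> state" where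
  "stof A s rs = (SOME s'. \<exists>trs. run A s rs trs s')"

lemma stof: "run A s rs trs s' \<Longrightarrow> stof A s rs = s'"
  unfolding stof_def by (rule some_equality) (auto dest: run_deterministic)

context machine
begin

lemma St_start:
  assumes n: "400 * (n + 1) \<le> IB"
  shows "St n (start d k h \<alpha> \<beta> \<epsilon>) {#} \<and> Tof (start d k h \<alpha> \<beta> \<epsilon>) = SL 0 \<and> spot L H (start d k h \<alpha> \<beta> \<epsilon>) = 0"
proof -
  define s where "s = start d k h \<alpha> \<beta> \<epsilon>"
  have a: "ar s a i = 0" for a i by (simp add: s_def start_def ar_def adr_def)
  have c: "sc s 4 = 0" "sc s 5 = 0" "rv s 2 = \<epsilon>" by (simp_all add: s_def start_def sc_def rv_def)
  have al: "al s = {}" by (simp add: al_def c)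
  have "leaf_cond (rw s) {} 0" by (simp add: leaf_cond_def)
  moreover have "lst (ar s 14) (ar s 15) 0 []" by simp
  ultimately have "LT (ar s) (rw s) {} 0 0 (SL 0) 0 (4 * IB) 0 {}"
    by (auto simp: ltn_def quiet_def curc_def near_def members_def a)
  moreover have "dict (ar s 1) (rw s) 0" by (auto simp: dict_def blk_def)
  ultimately have I: "Inv s (SL 0)" by (simp add: Inv_def a c al del: LT.simps)
  then have T: "Tof s = SL 0" by (rule Tof_eq)
  have "bounded s" unfolding bounded_def
    by (auto simp: s_def start_def bd_def bdv_def)
  then show ?thesis using I T by (simp add: St_def c al ms_def pot_def psi_def lev_def a flip: s_def)
qed

text \<open>Extending the list at its end lets the potential telescope. The height bound
  \<open>H\<close> is quantified inside, for a fixed run, because it will be instantiated both with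
  the height of the witnessing tree and with the logarithmic bound.\<close>

lemma run_exists:
  fixes \<alpha> \<beta> :: real
  assumes n: "400 * (n + 1) \<le> IB" and L: "IB \<le> 2 ^ L"
  defines "s0 \<equiv> start d k h \<alpha> \<beta> \<epsilon>"
  shows "valid_requests d rs \<Longrightarrow> (\<And>i. i \<le> length rs \<Longrightarrow> size (active (take i rs)) \<le> n) \<Longrightarrow>
    \<exists>trs s. run alg s0 rs trs s \<and> St n s (active rs) \<and> length trs = length rs \<and> (\<forall>tr \<in> set trs. \<forall>ev \<in> set tr. good ev) \<and>
      (\<forall>i < length rs. \<not> is_update (rs ! i) \<longrightarrow> length (trs ! i) \<le> 100 * (sh (Tof (stof alg s0 (take i rs))) + 1)) \<and>
      (\<forall>H. (\<forall>i \<le> length rs. sh (Tof (stof alg s0 (take i rs))) \<le> H) \<longrightarrow>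
        real (update_time rs trs) + spot L H s \<le> real (num_updates rs) * KK L H)"
proof (induction rs rule: rev_induct)
  case Nil
  have "run alg s0 [] [] s0" by (rule run.Nil)
  moreover have "St n s0 (active [])" using St_start[OF n, of \<alpha> \<beta>] by (simp add: active_def s0_def)
  moreover have "real (update_time [] []) + spot L H s0 \<le> real (num_updates []) * KK L H" for H
  proof -
    have sp: "spot L H s0 = 0" using St_start[OF n, of \<alpha> \<beta> L H] unfolding s0_def by blast
    show ?thesis unfolding sp by (simp add: update_time_def num_updates_def)
  qed
  ultimately show ?case by (intro exI[of _ "[]"] exI[of _ s0]) simp
next
  case (snoc r rs)
  have v: "valid_requests d rs" "length (req_point r) = d" using snoc.prems(1) by (auto simp: valid_requests_def)
  have sz: "size (active (take i rs)) \<le> n" if "i \<le> length rs" for i using snoc.prems(2)[of i] that by simp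
  from snoc.IH[OF v(1) sz] obtain trs s where R: "run alg s0 rs trs s" "St n s (active rs)" "length trs = length rs"
    "\<forall>tr \<in> set trs. \<forall>ev \<in> set tr. good ev"
    "\<forall>i < length rs. \<not> is_update (rs ! i) \<longrightarrow> length (trs ! i) \<le> 100 * (sh (Tof (stof alg s0 (take i rs))) + 1)"
    "\<And>H. (\<And>i. i \<le> length rs \<Longrightarrow> sh (Tof (stof alg s0 (take i rs))) \<le> H) \<Longrightarrow>
        real (update_time rs trs) + spot L H s \<le> real (num_updates rs) * KK L H" by blast
  have sz': "size (active rs) \<le> n" "size (apply_request r (active rs)) \<le> n"
    using sz[of "length rs"] snoc.prems(2)[of "Suc (length rs)"] by (simp_all add: active_snoc)
  from step[OF R(2) v(2) sz' n L] obtain tr s' where T: "exec_request alg r s tr s'" "St n s' (apply_request r (active rs))"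
    "\<forall>ev \<in> set tr. good ev" "\<not> is_update r \<Longrightarrow> length tr \<le> 100 * (sh (Tof s) + 1)"
    "\<And>H. sh (Tof s) \<le> H \<Longrightarrow> sh (Tof s') \<le> H \<Longrightarrow>
       (if is_update r then real (length tr) else 0) + spot L H s' \<le> spot L H s + (if is_update r then KK L H else 0)" by blast
  have run: "run alg s0 (rs @ [r]) (trs @ [tr]) s'" by (rule run_snoc[OF R(1) T(1)])
  have st: "stof alg s0 rs = s" "stof alg s0 (rs @ [r]) = s'" using stof[OF R(1)] stof[OF run] by simp_all
  have q: "length ((trs @ [tr]) ! i) \<le> 100 * (sh (Tof (stof alg s0 (take i (rs @ [r])))) + 1)"
    if "i < length (rs @ [r])" "\<not> is_update ((rs @ [r]) ! i)" for i
  proof (cases "i < length rs")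
    case True
    then show ?thesis using R(3,5) that by (simp add: nth_append)
  next
    case False
    then have "i = length rs" using that by simp
    then show ?thesis using R(3) T(4) that st(1) by (simp add: nth_append)
  qed
  have c: "real (update_time (rs @ [r]) (trs @ [tr])) + spot L H s' \<le> real (num_updates (rs @ [r])) * KK L H"
    if H: "\<forall>i \<le> length (rs @ [r]). sh (Tof (stof alg s0 (take i (rs @ [r])))) \<le> H" for H
  proof -
    have "sh (Tof (stof alg s0 (take i rs))) \<le> H" if "i \<le> length rs" for i using H[rule_format, of i] that by simp
    then have 1: "real (update_time rs trs) + spot L H s \<le> real (num_updates rs) * KK L H" by (rule R(6))
    have "sh (Tof s) \<le> H" "sh (Tof s') \<le> H"
      using H[rule_format, of "length rs"] H[rule_format, of "Suc (length rs)"] st by simp_all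
    from T(5)[OF this] 1 show ?thesis
      by (cases "is_update r") (simp_all add: update_time_snoc[OF R(3)] num_updates_def algebra_simps)
  qed
  show ?case
    by (rule exI[of _ "trs @ [tr]"], rule exI[of _ s'])
      (use run T(2,3) R(3,4) q c in \<open>auto simp: active_snoc\<close>)
qed

end

section \<open>From the internal constants to the stated bounds\<close>

text \<open>With m = max(2, n), 400(n+1) is at most 600m < 2^10 m, hence \<open>L\<close> is 10 plus
  the rounded-up logarithm of m. Rounding and the two additive terms are absorbed into the factor
  13, as log m \<ge> 1.\<close>

lemma log_length:
  "\<exists>L. 400 * (n + 1) \<le> 2 ^ L \<and> real L + 1 \<le> 13 * log 2 (real (max 2 n))"
proof -
  define m where "m = max 2 n"
  define L where "L = 10 + nat \<lceil>log 2 (real m)\<rceil>"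
  have m: "2 \<le> m" "n \<le> m" by (simp_all add: m_def)
  have lg: "1 \<le> log 2 (real m)" using m(1) by (simp add: le_log_iff)
  have "real m = 2 powr (log 2 (real m))" using m(1) by simp
  also have "\<dots> \<le> 2 powr real (nat \<lceil>log 2 (real m)\<rceil>)" using lg by (intro powr_mono) linarith+
  also have "\<dots> = 2 ^ nat \<lceil>log 2 (real m)\<rceil>" by (simp add: powr_realpow)
  finally have "real m \<le> real (2 ^ nat \<lceil>log 2 (real m)\<rceil>)" by simp
  then have "m \<le> 2 ^ nat \<lceil>log 2 (real m)\<rceil>" by (simp only: of_nat_le_iff)
  then have "400 * (n + 1) \<le> 2 ^ L" using m by (simp add: L_def power_add)
  moreover have "real L + 1 \<le> 13 * log 2 (real m)" using lg unfolding L_def by linarith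
  ultimately show ?thesis unfolding m_def by blast
qed

context params
begin

definition tree :: "real \<Rightarrow> state \<Rightarrow> request list \<Rightarrow> dtree" where
  "tree \<alpha> s0 rs = (let s = stof alg s0 rs in dt (ar s) (rw s) \<alpha> (Tof s) 0 (al s))"

lemma KK_le:
  assumes "real L + 1 \<le> x" "real H + 3 \<le> y"
  shows "KK L H \<le> 600000000 * (real d * (x * x * y) / \<epsilon>)"
proof -
  have "(real L + 1) * (real L + 1) * (real H + 3) \<le> x * x * y"
    using assms by (intro mult_mono mult_nonneg_nonneg) auto
  then have "real d * ((real L + 1) * (real L + 1) * (real H + 3)) / \<epsilon> \<le> real d * (x * x * y) / \<epsilon>"
    using eps0 by (intro divide_right_mono mult_left_mono) auto
  moreover have "real (QQ L H) * real (L + 1) = real d * ((real L + 1) * (real L + 1) * (real H + 3))"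
    by (simp add: QQ_def algebra_simps)
  ultimately show ?thesis unfolding KK_def by simp
qed

text \<open>The program knows nothing of \<open>IB\<close>; only the analysis does. For each request
  sequence it is carried out with \<open>IB\<close> = 400(n+1), where n is the peak size of that
  sequence, which leaves room above the 128n + 71 addresses in use.\<close>

lemma correct:
  fixes C :: nat and \<alpha> \<beta> :: real
  assumes v: "valid_requests d rs" and b: "\<epsilon> < \<beta> / 12.5" and C: "10000000000000 \<le> C"
  defines "s0 \<equiv> start d k h \<alpha> \<beta> \<epsilon>" and "n \<equiv> peak_size rs" and "hs \<equiv> peak_height (tree \<alpha> (start d k h \<alpha> \<beta> \<epsilon>)) rs"
    and "lg \<equiv> log 2 (real (max 2 (peak_size rs)))"
  shows "\<exists>trs s. run alg s0 rs trs s \<and> coherent d alg s (tree \<alpha> s0 rs) \<and> feasible d \<alpha> \<beta> k h (active rs) (tree \<alpha> s0 rs) \<and>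
    hs \<le> h \<and> (\<forall>i < length rs. \<not> is_update (rs ! i) \<longrightarrow> length (trs ! i) \<le> C * max 1 hs) \<and>
    space_used (concat trs) \<le> C * (max 1 n * d) \<and> words_bounded ((n + d + k + h + 2) ^ C) (concat trs) \<and>
    real (update_time rs trs) \<le> real C * real (num_updates rs) * (real d * real (max 1 hs) * lg ^ 2 / \<epsilon>) \<and>
    real (update_time rs trs) \<le> real C * real (num_updates rs) * (real d * lg ^ 3 / \<epsilon> ^ 2)"
proof -
  define IB where "IB = 400 * (n + 1)"
  interpret machine d k h \<epsilon> IB by unfold_locales (simp add: IB_def)
  obtain L where L: "IB \<le> 2 ^ L" "real L + 1 \<le> 13 * lg" using log_length[of n] unfolding IB_def lg_def n_def by blast
  have lg1: "1 \<le> lg" by (simp add: lg_def le_log_iff)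
  have nI: "400 * (n + 1) \<le> IB" by (simp add: IB_def)
  have sz: "size (active (take i rs)) \<le> n" if "i \<le> length rs" for i
    unfolding n_def peak_size_def by (rule Max_ge) (use that in auto)
  let ?st = "\<lambda>i. stof alg s0 (take i rs)"
  have at: "St n (?st i) (active (take i rs))" if i: "i \<le> length rs" for i
  proof -
    have "valid_requests d (take i rs)" using v by (auto simp: valid_requests_def dest: in_set_takeD)
    then obtain trs s where "run alg s0 (take i rs) trs s" "St n s (active (take i rs))"
      using run_exists[OF nI L(1), of "take i rs" \<alpha> \<beta>] sz i unfolding s0_def by (auto simp: min_def)
    then show ?thesis using stof by metis
  qed
  have fs: "feasible d \<alpha> \<beta> k h (active (take i rs)) (tree \<alpha> s0 (take i rs)) \<and> height (tree \<alpha> s0 (take i rs)) \<le> h \<and>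
     sh (Tof (?st i)) \<le> height (tree \<alpha> s0 (take i rs)) \<and> \<epsilon> * real (sh (Tof (?st i))) \<le> real L + 1" if i: "i \<le> length rs" for i
  proof -
    define s where "s = ?st i"
    have inv: "Inv s (Tof s)" and S: "ms (rw s) (al s) = active (take i rs)" and bd: "bounded s" using at[OF i] by (simp_all add: St_def s_def)
    have LT: "LT (ar s) (rw s) (al s) (sc s 5) (sc s 4) (Tof s) 0 (4 * IB) 0 (al s)" using inv by (simp add: Inv_def)
    have "ar s 8 (root (Tof s)) \<le> bda 8" using bd by (rule bounded_ar) simp
    then have "sz (ar s) (root (Tof s)) \<le> 2 ^ L" using LT_root[OF LT] L(1) by (auto simp: ltn_def)
    from sh_bound[OF LT this] dt_feasible[OF LT al_finite _ b, of \<alpha>] show ?thesis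
      unfolding tree_def Let_def s_def[symmetric] feasible_nok S[symmetric] by auto
  qed
  have hts: "finite {height (tree \<alpha> s0 (take i rs)) | i. i \<le> length rs}" "{height (tree \<alpha> s0 (take i rs)) | i. i \<le> length rs} \<noteq> {}" by auto
  have hs: "hs = Max {height (tree \<alpha> s0 (take i rs)) | i. i \<le> length rs}" by (simp add: hs_def peak_height_def s0_def)
  have hsh: "hs \<le> h" unfolding hs using hts fs by (auto simp: Max_le_iff)
  have shs: "sh (Tof (?st i)) \<le> hs" if "i \<le> length rs" for i
  proof -
    have "height (tree \<alpha> s0 (take i rs)) \<le> hs" unfolding hs by (rule Max_ge) (use that hts in auto)
    then show ?thesis using fs[OF that] by linarith
  qed
  from run_exists[OF nI L(1) v sz, of \<alpha> \<beta>] obtain trs s where R: "run alg s0 rs trs s" "St n s (active rs)" "length trs = length rs"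
    "\<forall>tr \<in> set trs. \<forall>ev \<in> set tr. good ev"
    "\<forall>i < length rs. \<not> is_update (rs ! i) \<longrightarrow> length (trs ! i) \<le> 100 * (sh (Tof (?st i)) + 1)"
    "\<And>H. (\<And>i. i \<le> length rs \<Longrightarrow> sh (Tof (?st i)) \<le> H) \<Longrightarrow> real (update_time rs trs) + spot L H s \<le> real (num_updates rs) * KK L H"
    unfolding s0_def by blast
  have st: "stof alg s0 rs = s" by (rule stof[OF R(1)])
  have coh: "coherent d alg s (tree \<alpha> s0 rs)"
    unfolding coherent_def
  proof (intro allI impI)
    fix x :: point assume "length x = d"
    from step_lab[OF R(2) this nI, where y = False] obtain tr s' where e: "exec (x, False) LAB s tr s'"
      "words s' 0 = of_bool (lab (ar s) (rw s) (Tof s) x)" by blast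
    have cl: "classify (tree \<alpha> s0 rs) x = lab (ar s) (rw s) (Tof s) x" by (simp add: tree_def st Let_def)
    have "words s' 0 = of_bool (classify (tree \<alpha> s0 rs) x)" unfolding cl by (rule e(2))
    moreover have "exec_request alg (Lab x) s tr s'" using e(1) by (simp add: alg_def)
    ultimately show "\<exists>tr s'. exec_request alg (Lab x) s tr s' \<and> words s' 0 = of_bool (classify (tree \<alpha> s0 rs) x)"
      by blast
  qed
  have q: "length (trs ! i) \<le> C * max 1 hs" if "i < length rs" "\<not> is_update (rs ! i)" for i
  proof -
    have "length (trs ! i) \<le> 100 * (sh (Tof (?st i)) + 1)" using R(5) that by blast
    also have "\<dots> \<le> 200 * max 1 hs" using shs[of i] that by simp
    also have "\<dots> \<le> C * max 1 hs" using C by (intro mult_le_mono1) simp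
    finally show ?thesis .
  qed
  have gd: "\<forall>ev \<in> set (concat trs). good ev" using R(4) by auto
  have sp: "space_used (concat trs) \<le> C * (max 1 n * d)"
  proof -
    define m where "m = max 1 n"
    have m: "1 \<le> m" "n \<le> m" by (simp_all add: m_def)
    have i: "2 * IB + 4 \<le> 1604 * m" using m by (simp add: IB_def)
    have md: "m \<le> m * d" "1 \<le> m * d" using m d1 by auto
    have "(d + 3) * (2 * IB + 4) \<le> (4 * d) * (1604 * m)" by (rule mult_le_mono) (use d1 i in auto)
    then have "(d + 3) * (2 * IB + 4) \<le> 6416 * (m * d)" by (simp add: mult_ac)
    moreover have "40 + 16 * x + (8 + y) \<le> 100000 * u" if "y \<le> 6416 * u" "x \<le> 1604 * m" "m \<le> u" "1 \<le> u" for x y u :: nat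
      using that by linarith
    ultimately have "AW + AR \<le> 100000 * (m * d)" using i md unfolding AW_def AR_def by blast
    also have "\<dots> \<le> C * (m * d)" using C by (intro mult_le_mono1) simp
    finally show ?thesis using space_used_good[OF gd] by (simp add: m_def)
  qed
  have wb: "words_bounded ((n + d + k + h + 2) ^ C) (concat trs)"
  proof -
    define B where "B = n + d + k + h + 2"
    have B: "5 \<le> B" using d1 k1 h1 by (simp add: B_def)
    \<comment> \<open>The base is at least 5 and 5^4 = 625 \<ge> 500, so \<open>U\<close> is at most
      its fifth power and \<open>U ^ 12\<close> its sixtieth.\<close>
    have "U \<le> 500 * B" unfolding U_def unfolding IB_def B_def by simp
    also have "500 * B \<le> B ^ 4 * B" using power_mono[OF B, of 4] by (intro mult_le_mono1) simp
    also have "B ^ 4 * B = B ^ 5" by (simp add: eval_nat_numeral)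
    finally have "U ^ 12 \<le> (B ^ 5) ^ 12" by (rule power_mono) simp
    also have "\<dots> = B ^ 60" by (simp flip: power_mult)
    also have "\<dots> \<le> B ^ C" using B C by (intro power_increasing) auto
    finally have "U ^ 12 \<le> B ^ C" .
    then show ?thesis unfolding words_bounded_def B_def[symmetric] using gd by (auto dest!: bspec)
  qed
  have pn: "0 \<le> spot L H s" for H by (rule pot_nonneg)
  have t1: "real (update_time rs trs) \<le> real C * real (num_updates rs) * (real d * real (max 1 hs) * lg ^ 2 / \<epsilon>)"
  proof -
    define m where "m = real (max 1 hs)"
    \<comment> \<open>First bound, with the height of the witnessing tree for \<open>H\<close>; two
      factors 13 come from \<open>L\<close>, and \<open>hs + 3\<close> is at most 4 times the
      maximum of 1 and \<open>hs\<close>.\<close>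
    have "real (update_time rs trs) \<le> real (num_updates rs) * KK L hs" using R(6)[of hs] shs pn[of hs] by auto
    also have "\<dots> \<le> real (num_updates rs) * (600000000 * (real d * ((13 * lg) * (13 * lg) * (4 * m)) / \<epsilon>))"
      by (intro mult_left_mono KK_le L) (auto simp: m_def)
    also have "\<dots> = (600000000 * 676) * (real (num_updates rs) * (real d * m * lg ^ 2 / \<epsilon>))" by (simp add: power2_eq_square)
    also have "\<dots> \<le> real C * (real (num_updates rs) * (real d * m * lg ^ 2 / \<epsilon>))"
      using C eps0 by (intro mult_right_mono mult_nonneg_nonneg divide_nonneg_nonneg) (auto simp: m_def)
    finally show ?thesis by (simp add: m_def mult.assoc)
  qed
  have t2: "real (update_time rs trs) \<le> real C * real (num_updates rs) * (real d * lg ^ 3 / \<epsilon> ^ 2)"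
  proof -
    define y where "y = (real L + 1) / \<epsilon>"
    \<comment> \<open>Second bound: (L+1)/\<epsilon> bounds the height of the stored tree at all
      times by \<open>sh_bound\<close>, and it exceeds 3, so adding 3 at most doubles it.\<close>
    define H where "H = nat \<lfloor>y\<rfloor>"
    have y3: "3 \<le> y" unfolding y_def using eps0 eps2 by (simp add: pos_le_divide_eq)
    have "sh (Tof (?st i)) \<le> H" if "i \<le> length rs" for i
    proof -
      have "real (sh (Tof (?st i))) \<le> y" using fs[OF that] eps0 by (simp add: y_def pos_le_divide_eq mult.commute)
      then show ?thesis unfolding H_def by linarith
    qed
    then have "real (update_time rs trs) \<le> real (num_updates rs) * KK L H" using R(6)[of H] pn[of H] by auto
    also have "\<dots> \<le> real (num_updates rs) * (600000000 * (real d * ((13 * lg) * (13 * lg) * (2 * (13 * lg / \<epsilon>))) / \<epsilon>))"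
    proof (intro mult_left_mono KK_le L)
      have "real H + 3 \<le> 2 * y" using y3 unfolding H_def by linarith
      also have "y \<le> 13 * lg / \<epsilon>" unfolding y_def using L(2) eps0 by (intro divide_right_mono) auto
      finally show "real H + 3 \<le> 2 * (13 * lg / \<epsilon>)" by simp
    qed simp
    also have "\<dots> = (600000000 * 4394) * (real (num_updates rs) * (real d * lg ^ 3 / \<epsilon> ^ 2))"
      by (simp add: power2_eq_square power3_eq_cube)
    also have "\<dots> \<le> real C * (real (num_updates rs) * (real d * lg ^ 3 / \<epsilon> ^ 2))"
      using C eps0 lg1 by (intro mult_right_mono mult_nonneg_nonneg divide_nonneg_nonneg) auto
    finally show ?thesis by (simp add: mult.assoc)
  qed
  show ?thesis using R(1) coh fs[of "length rs"] hsh q sp wb t1 t2 by auto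
qed

end

theorem theorem3p2:
  shows "\<exists>C :: nat. \<forall>(d :: nat) (k :: nat) (h :: nat) (\<alpha> :: real) (\<beta> :: real) (\<epsilon> :: real).
    d \<ge> 1 \<and> k \<ge> 1 \<and> h \<ge> 1 \<and> 0 < \<alpha> \<and> \<alpha> \<le> 1 \<and> 0 < \<beta> \<and> \<beta> \<le> 1 \<and>
    0 < \<epsilon> \<and> \<epsilon> < Min {1 / (real k + 1), \<alpha> / 5, \<beta> / 12.5} \<longrightarrow>
    (\<exists>(A :: algorithm) (tree :: request list \<Rightarrow> dtree).
       feasible_algorithm d \<alpha> \<beta> k h (start d k h \<alpha> \<beta> \<epsilon>) A tree \<and>
       (\<forall>rs trs s. valid_requests d rs \<and> run A (start d k h \<alpha> \<beta> \<epsilon>) rs trs s \<longrightarrow>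
         (let n = peak_size rs;
              hs = peak_height tree rs;
              lg = log 2 (real (max 2 n))
          in hs \<le> h \<and>
             (\<forall>i < length rs. \<not> is_update (rs ! i) \<longrightarrow> length (trs ! i) \<le> C * max 1 hs) \<and>
             space_used (concat trs) \<le> C * (max 1 n * d) \<and>
             words_bounded ((n + d + k + h + 2) ^ C) (concat trs) \<and>
             real (update_time rs trs) \<le>
               real C * real (num_updates rs) * (real d * real (max 1 hs) * lg ^ 2 / \<epsilon>) \<and>
             real (update_time rs trs) \<le>
               real C * real (num_updates rs) * (real d * lg ^ 3 / \<epsilon> ^ 2))))"
proof -
  \<comment> \<open>Large enough for 600000000 * 4394, the greatest of the constants in
    \<open>correct\<close>.\<close>
  define C :: nat where "C = 10000000000000"
  show ?thesis
  proof (rule exI[of _ C], intro allI impI)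
    fix d k h :: nat and \<alpha> \<beta> \<epsilon> :: real
    assume H: "d \<ge> 1 \<and> k \<ge> 1 \<and> h \<ge> 1 \<and> 0 < \<alpha> \<and> \<alpha> \<le> 1 \<and> 0 < \<beta> \<and> \<beta> \<le> 1 \<and>
      0 < \<epsilon> \<and> \<epsilon> < Min {1 / (real k + 1), \<alpha> / 5, \<beta> / 12.5}"
    then have e: "\<epsilon> < 1 / (real k + 1)" "\<epsilon> < \<beta> / 12.5" by simp_all
    have "\<epsilon> < 1 / 12" using e(2) H by simp
    then interpret params d k h \<epsilon> using H e(1) by unfold_locales auto
    define s0 where "s0 = start d k h \<alpha> \<beta> \<epsilon>"
    have CC: "10000000000000 \<le> C" by (simp add: C_def)
    note cor = correct[OF _ e(2) CC, where \<alpha> = \<alpha>, folded s0_def]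
    have "feasible_algorithm d \<alpha> \<beta> k h s0 alg (tree \<alpha> s0)"
      unfolding feasible_algorithm_def using cor by blast
    moreover have "let n = peak_size rs;
              hs = peak_height (tree \<alpha> s0) rs;
              lg = log 2 (real (max 2 n))
          in hs \<le> h \<and>
             (\<forall>i < length rs. \<not> is_update (rs ! i) \<longrightarrow> length (trs ! i) \<le> C * max 1 hs) \<and>
             space_used (concat trs) \<le> C * (max 1 n * d) \<and>
             words_bounded ((n + d + k + h + 2) ^ C) (concat trs) \<and>
             real (update_time rs trs) \<le>
               real C * real (num_updates rs) * (real d * real (max 1 hs) * lg ^ 2 / \<epsilon>) \<and>
             real (update_time rs trs) \<le>
               real C * real (num_updates rs) * (real d * lg ^ 3 / \<epsilon> ^ 2)"
      if r: "valid_requests d rs \<and> run alg s0 rs trs s" for rs trs s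
    proof -
      from cor[of rs] r obtain trs' s' where c: "run alg s0 rs trs' s'" and
        c': "peak_height (tree \<alpha> s0) rs \<le> h \<and>
             (\<forall>i < length rs. \<not> is_update (rs ! i) \<longrightarrow> length (trs' ! i) \<le> C * max 1 (peak_height (tree \<alpha> s0) rs)) \<and>
             space_used (concat trs') \<le> C * (max 1 (peak_size rs) * d) \<and>
             words_bounded ((peak_size rs + d + k + h + 2) ^ C) (concat trs') \<and>
             real (update_time rs trs') \<le>
               real C * real (num_updates rs) * (real d * real (max 1 (peak_height (tree \<alpha> s0) rs)) * log 2 (real (max 2 (peak_size rs))) ^ 2 / \<epsilon>) \<and>
             real (update_time rs trs') \<le>
               real C * real (num_updates rs) * (real d * log 2 (real (max 2 (peak_size rs))) ^ 3 / \<epsilon> ^ 2)" by blast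
      \<comment> \<open>The bounds were shown for one existing run; determinism transfers them to
        every run.\<close>
      have "trs' = trs" using run_deterministic[OF c] r by blast
      with c' show ?thesis unfolding Let_def by blast
    qed
    ultimately show "\<exists>(A :: algorithm) (tree :: request list \<Rightarrow> dtree).
       feasible_algorithm d \<alpha> \<beta> k h (start d k h \<alpha> \<beta> \<epsilon>) A tree \<and>
       (\<forall>rs trs s. valid_requests d rs \<and> run A (start d k h \<alpha> \<beta> \<epsilon>) rs trs s \<longrightarrow>
         (let n = peak_size rs;
              hs = peak_height tree rs;
              lg = log 2 (real (max 2 n))
          in hs \<le> h \<and>
             (\<forall>i < length rs. \<not> is_update (rs ! i) \<longrightarrow> length (trs ! i) \<le> C * max 1 hs) \<and>
             space_used (concat trs) \<le> C * (max 1 n * d) \<and>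
             words_bounded ((n + d + k + h + 2) ^ C) (concat trs) \<and>
             real (update_time rs trs) \<le>
               real C * real (num_updates rs) * (real d * real (max 1 hs) * lg ^ 2 / \<epsilon>) \<and>
             real (update_time rs trs) \<le>
               real C * real (num_updates rs) * (real d * lg ^ 3 / \<epsilon> ^ 2)))"
      unfolding s0_def[symmetric] by blast
  qed
qed

end
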